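(* Let $\mathcal O\subset\mathbb R^n$ be an open set with $|\mathcal O|<+\infty$, let $\{\Omega_k\}_{k\ge0}$ be measurable subsets of $\mathcal O$, and let $\Omega\subset\mathcal O$ be measurable. For $1\le i\le N$ and $k\ge0$ let $f_{i,k}\ge0$ and $g_{i,k}$ be bounded measurable functions on $\mathcal O$. Assume: (1) there is $C_0$ such that $\|f_{i,k}\|_\infty\le C_0$ and $\|g_{i,k}\|_\infty\le C_0$ for all $i,k$, and there are functions $f_i,g_i$ on $\mathcal O$ such that $\lim_{k\to\infty}\int f_{i,k}\varphi=\int f_i\varphi$ and $\lim_{k\to\infty}\int g_{i,k}\varphi=\int g_i\varphi$ for every continuous function $\varphi$ with compact support in $\mathcal O$; (2) $F_k(W_1,\dots,W_N)=\widetilde F_k(|W_1|,\dots,|W_N|)$ for $\mathbf W\in\mathcal W(\Omega_k)$, where each $\widetilde F_k:[0,|\mathcal O|]^N\to\mathbb R$ is continuous and the $\widetilde F_k$ converge uniformly to a limit $\widetilde F$; set $F(W_1,\dots,W_N)=\widetilde F(|W_1|,\dots,|W_N|)$ for $\mathbf W\in\mathcal W(\Omega)$; (3) $\lim_{k\to\infty}\mathbf 1_{\Omega_k}=\mathbf 1_\Omega$ in $L^1(\mathcal O)$; for each compact set $K\subset\mathcal O$ there are $r_K>0$ and $c_K>0$ such that $|B(x,r)\setminus\Omega|\ge c_Kr^n$ for $x\in K\cap\partial\Omega$ and $0<r\le r_K$; and for each compact set $K\subset\mathcal O$, $\lim_{k\to\infty}\delta(K,k)=0$, where $\delta(K,k)=\sup\{\operatorname{dist}(x,\mathcal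 O\setminus\Omega): x\in K\setminus\Omega_k\}$ (with $\delta(K,k)=0$ if $K\setminus\Omega_k=\emptyset$); (4) for each $k$, $(\mathbf u_k,\mathbf W_k)\in\mathcal F(\mathcal O,\Omega_k)$ is a local minimizer for $J_k$ in $\mathcal O$, relative to $\Omega_k$, where $J_k$ is the functional associated with the data $f_{i,k}$, $g_{i,k}$, $F_k$; (5) for each compact ball $B\subset\mathcal O$ there is a constant $C(B)$ such that all the $\mathbf u_k$ are $C(B)$-Lipschitz in $B$, and there is a function $\mathbf u\in W^{1,2}(\mathcal O)$ such that $\mathbf u(x)=\lim_{k\to\infty}\mathbf u_k(x)$ for $x\in\mathcal O$. Then we can find $\mathbf W\in\mathcal W(\Omega)$ such that $(\mathbf u,\mathbf W)\in\mathcal F(\mathcal O,\Omega)$ and $(\mathbf u,\mathbf W)$ is a local minimizer in $\mathcal O$, relative to $\Omega$, for the functional $J$ associated with the data $f_i,g_i,F$. In addition, $$\lim_{k\to+\infty}\mathbf u_k=\mathbf u\quad\text{in }W^{1,2}(B)\text{ for every ball }B\text{ such that }\overline B\subset\mathcal O.$$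
   Context: $n\ge2$ and $N\ge1$ are integers; $|A|$ is the Lebesgue measure of $A$; $B(x,r)$ is the open ball. For a measurable set $\Omega\subset\mathcal O$, $\mathcal W(\Omega)$ is the set of $N$-tuples of pairwise disjoint measurable subsets of $\Omega$. $\mathcal F(\mathcal O,\Omega)$ is the set of pairs $(\mathbf u,\mathbf W)$ such that $\mathbf u=(u_1,\dots,u_N)$ with real-valued $u_i\in W^{1,2}_{loc}(\mathcal O)$ (i.e. $u_i\in W^{1,2}(B)$ for every ball $B$ with $\overline B\subset\mathcal O$), $\mathbf W\in\mathcal W(\Omega)$, and $u_i=0$ almost everywhere on $\mathcal O\setminus W_i$. A pair $(\mathbf u^*,\mathbf W^* )\in\mathcal F(\mathcal O,\Omega)$ is a competitor for $(\mathbf u,\mathbf W)\in\mathcal F(\mathcal O,\Omega)$ in $\mathcal O$, relative to $\Omega$, if there is a compact set $K\subset\mathcal O$ such that $(\mathbf u^*,\mathbf W^* )$ coincides with $(\mathbf u,\mathbf W)$ in $\mathcal O\setminus K$. Given bounded measurable $f_i,g_i$ on $\mathcal O$ and $F:\mathcal W(\Omega)\to\mathbb R$ (the data of a functional $J$), $(\mathbf u,\mathbf W)\in\mathcal F(\mathcal O,\Omega)$ is a local minimizer for $J$ in $\mathcal O$, relative to $\Omega$, if $$\int_K|\nabla\mathbf u|^2+\sum_i\int_K[u_i^2f_i-u_ig_i]+F(\mathbf W)\le\int_K|\nabla\mathbf u^*|^2+\sum_i\int_K[(u_i^* )^2f_i-u_i^*g_i]+F(\mathbf W^* )$$ whenever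 $(\mathbf u^*,\mathbf W^* )$ is a competitor for $(\mathbf u,\mathbf W)$ in $\mathcal O$, relative to $\Omega$, and $K\subset\mathcal O$ is a compact set such that $(\mathbf u^*,\mathbf W^* )$ coincides with $(\mathbf u,\mathbf W)$ in $\mathcal O\setminus K$. Here $|\nabla\mathbf u|^2=\sum_i|\nabla u_i|^2$. *)

theory Defs
  imports "HOL-Analysis.Analysis"
begin

section \<open>Sobolev spaces\<close>

text \<open>Real functions of class \<open>C\<^sup>k\<close> on the whole space: one derivative is taken at a time,
  through the directional derivatives along the standard basis.\<close>

primrec C_k :: "nat \<Rightarrow> ('a::euclidean_space \<Rightarrow> real) \<Rightarrow> bool" where
  "C_k 0 f \<longleftrightarrow> continuous_on UNIV f"
| "C_k (Suc k) f \<longleftrightarrow>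
     (\<forall>x. f differentiable (at x)) \<and>
     (\<forall>b\<in>Basis. C_k k (\<lambda>x. frechet_derivative f (at x) b))"

definition supp_compact_in :: "'a::euclidean_space set \<Rightarrow> ('a \<Rightarrow> real) \<Rightarrow> bool" where
  "supp_compact_in S \<phi> \<longleftrightarrow>
     compact (closure {x. \<phi> x \<noteq> 0}) \<and> closure {x. \<phi> x \<noteq> 0} \<subseteq> S"

definition test_function :: "'a::euclidean_space set \<Rightarrow> ('a \<Rightarrow> real) \<Rightarrow> bool" where
  "test_function S \<phi> \<longleftrightarrow> (\<forall>k. C_k k \<phi>) \<and> supp_compact_in S \<phi>"

definition locally_integrable ::
  "'a::euclidean_space set \<Rightarrow> ('a \<Rightarrow> 'b::euclidean_space) \<Rightarrow> bool" where
  "locally_integrable S f \<longleftrightarrow> (\<forall>K. compact K \<longrightarrow> K \<subseteq> S \<longrightarrow> set_integrable lebesgue K f)"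

definition square_integrable ::
  "'a::euclidean_space set \<Rightarrow> ('a \<Rightarrow> 'b::euclidean_space) \<Rightarrow> bool" where
  "square_integrable S f \<longleftrightarrow>
     f \<in> borel_measurable (lebesgue_on S) \<and> set_integrable lebesgue S (\<lambda>x. (norm (f x))\<^sup>2)"

definition has_weak_gradient ::
  "'a::euclidean_space set \<Rightarrow> ('a \<Rightarrow> real) \<Rightarrow> ('a \<Rightarrow> 'a) \<Rightarrow> bool" where
  "has_weak_gradient S u G \<longleftrightarrow>
     locally_integrable S u \<and> locally_integrable S G \<and>
     (\<forall>\<phi>. test_function S \<phi> \<longrightarrow>
       (\<forall>b\<in>Basis. (LINT x:S|lebesgue. u x * frechet_derivative \<phi> (at x) b)
                   = - (LINT x:S|lebesgue. (G x \<bullet> b) * \<phi> x)))"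

text \<open>On an open set the weak gradient is unique up to a null set; a representative is chosen.
  Only its values on \<open>S\<close> are meaningful.\<close>

definition weak_grad :: "'a::euclidean_space set \<Rightarrow> ('a \<Rightarrow> real) \<Rightarrow> 'a \<Rightarrow> 'a" where
  "weak_grad S u = (SOME G. has_weak_gradient S u G)"

definition W12 :: "'a::euclidean_space set \<Rightarrow> ('a \<Rightarrow> real) \<Rightarrow> bool" where
  "W12 S u \<longleftrightarrow>
     square_integrable S u \<and> (\<exists>G. has_weak_gradient S u G \<and> square_integrable S G)"

definition W12_loc :: "'a::euclidean_space set \<Rightarrow> ('a \<Rightarrow> real) \<Rightarrow> bool" where
  "W12_loc S u \<longleftrightarrow> (\<forall>x r. 0 < r \<longrightarrow> cball x r \<subseteq> S \<longrightarrow> W12 (ball x r) u)"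

definition W12_norm :: "'a::euclidean_space set \<Rightarrow> ('a \<Rightarrow> real) \<Rightarrow> real" where
  "W12_norm S u =
     sqrt ((LINT x:S|lebesgue. (u x)\<^sup>2) + (LINT x:S|lebesgue. (norm (weak_grad S u x))\<^sup>2))"

definition W12_tendsto ::
  "'a::euclidean_space set \<Rightarrow> (nat \<Rightarrow> 'a \<Rightarrow> real) \<Rightarrow> ('a \<Rightarrow> real) \<Rightarrow> bool" where
  "W12_tendsto S v u \<longleftrightarrow>
     (\<forall>k. W12 S (v k)) \<and> W12 S u \<and> (\<lambda>k. W12_norm S (\<lambda>x. v k x - u x)) \<longlonglongrightarrow> 0"

definition bounded_measurable :: "'a::euclidean_space set \<Rightarrow> ('a \<Rightarrow> real) \<Rightarrow> bool" where
  "bounded_measurable S f \<longleftrightarrow>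
     f \<in> borel_measurable (lebesgue_on S) \<and> (\<exists>C. AE x in lebesgue_on S. \<bar>f x\<bar> \<le> C)"


section \<open>Admissible pairs, competitors, local minimizers\<close>

text \<open>The components are indexed by a finite type \<open>'m\<close> with \<open>N = CARD('m)\<close>;
  \<open>Om\<close> is the ambient open set.\<close>

definition set_tuples :: "'a::euclidean_space set \<Rightarrow> ('m::finite \<Rightarrow> 'a set) set" where
  "set_tuples \<Omega> = {W. (\<forall>i. W i \<in> sets lebesgue \<and> W i \<subseteq> \<Omega>) \<and> disjoint_family W}"

definition volumes :: "('m::finite \<Rightarrow> 'a::euclidean_space set) \<Rightarrow> real ^ 'm" where
  "volumes W = (\<chi> i. measure lebesgue (W i))"

definition admissible ::
  "'a::euclidean_space set \<Rightarrow> 'a set \<Rightarrow> (('a \<Rightarrow> real ^ 'm::finite) \<times> ('m \<Rightarrow> 'a set)) set" where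
  "admissible Om \<Omega> =
     {(u, W). (\<forall>i. W12_loc Om (\<lambda>x. u x $ i)) \<and> W \<in> set_tuples \<Omega> \<and>
              (\<forall>i. AE x in lebesgue. x \<in> Om - W i \<longrightarrow> u x $ i = 0)}"

text \<open>Functions are compared almost everywhere, as Sobolev functions, and sets as sets.\<close>

definition coincide_off ::
  "'a::euclidean_space set \<Rightarrow> 'a set \<Rightarrow> ('a \<Rightarrow> real ^ 'm::finite) \<times> ('m \<Rightarrow> 'a set) \<Rightarrow>
   ('a \<Rightarrow> real ^ 'm) \<times> ('m \<Rightarrow> 'a set) \<Rightarrow> bool" where
  "coincide_off Om K p q \<longleftrightarrow>
     (AE x in lebesgue. x \<in> Om - K \<longrightarrow> fst p x = fst q x) \<and>
     (\<forall>i. snd p i \<inter> (Om - K) = snd q i \<inter> (Om - K))"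

definition competitor ::
  "'a::euclidean_space set \<Rightarrow> 'a set \<Rightarrow> ('a \<Rightarrow> real ^ 'm::finite) \<times> ('m \<Rightarrow> 'a set) \<Rightarrow>
   ('a \<Rightarrow> real ^ 'm) \<times> ('m \<Rightarrow> 'a set) \<Rightarrow> bool" where
  "competitor Om \<Omega> p q \<longleftrightarrow>
     p \<in> admissible Om \<Omega> \<and> q \<in> admissible Om \<Omega> \<and>
     (\<exists>K. compact K \<and> K \<subseteq> Om \<and> coincide_off Om K p q)"

definition energy ::
  "'a::euclidean_space set \<Rightarrow> ('m::finite \<Rightarrow> 'a \<Rightarrow> real) \<Rightarrow> ('m \<Rightarrow> 'a \<Rightarrow> real) \<Rightarrow>
   (('m \<Rightarrow> 'a set) \<Rightarrow> real) \<Rightarrow> 'a set \<Rightarrow> ('a \<Rightarrow> real ^ 'm) \<times> ('m \<Rightarrow> 'a set) \<Rightarrow> real" where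
  "energy Om f g F K = (\<lambda>(u, W).
     (LINT x:K|lebesgue. (\<Sum>i\<in>UNIV. (norm (weak_grad Om (\<lambda>y. u y $ i) x))\<^sup>2))
     + (\<Sum>i\<in>UNIV. LINT x:K|lebesgue. (u x $ i)\<^sup>2 * f i x - u x $ i * g i x)
     + F W)"

text \<open>In \<open>competitor Om \<Omega> p q\<close> the pair \<open>p\<close> is the competitor for \<open>q\<close>.\<close>

definition local_minimizer ::
  "'a::euclidean_space set \<Rightarrow> 'a set \<Rightarrow> ('m::finite \<Rightarrow> 'a \<Rightarrow> real) \<Rightarrow> ('m \<Rightarrow> 'a \<Rightarrow> real) \<Rightarrow>
   (('m \<Rightarrow> 'a set) \<Rightarrow> real) \<Rightarrow> ('a \<Rightarrow> real ^ 'm) \<times> ('m \<Rightarrow> 'a set) \<Rightarrow> bool" where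
  "local_minimizer Om \<Omega> f g F q \<longleftrightarrow>
     q \<in> admissible Om \<Omega> \<and>
     (\<forall>p K. competitor Om \<Omega> p q \<longrightarrow> compact K \<longrightarrow> K \<subseteq> Om \<longrightarrow> coincide_off Om K p q \<longrightarrow>
        energy Om f g F K q \<le> energy Om f g F K p)"


section \<open>One-sided distance between complements\<close>

text \<open>The value is taken in \<open>[0,\<infinity>]\<close>, where \<open>Sup {} = 0\<close> and \<open>Inf {} = \<infinity>\<close>: the value is
  \<open>0\<close> if \<open>K \<subseteq> \<Omega>k\<close>, and the distance to an empty set is infinite (unlike with \<open>infdist\<close>).\<close>

definition excess_dist ::
  "'a::euclidean_space set \<Rightarrow> 'a set \<Rightarrow> 'a set \<Rightarrow> 'a set \<Rightarrow> ennreal" where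
  "excess_dist Om \<Omega> \<Omega>k K = (SUP x\<in>K - \<Omega>k. INF y\<in>Om - \<Omega>. ennreal (dist x y))"

end

theory Submission
 imports Defs "HOL-Library.Diagonal_Subsequence"
begin

text \<open>
 The minimizers \<open>u\<^sub>k\<close> converge uniformly on compact sets, but the sets \<open>W\<^sub>k\<close> need not converge at all. The proof
 rests on four ideas.

 Strong convergence of gradients. Near a compact set, \<open>u\<^sub>k\<close> is compared with an interpolation between \<open>u\<^sub>k\<close> and
 the soft thresholding of \<open>u\<close> at a small level \<open>e\<close>. The latter vanishes unless \<open>\<bar>u\<bar> > e\<close>, where \<open>u\<^sub>k\<close> does not vanish
 for large \<open>k\<close>, so the sets \<open>W\<^sub>k\<close> may be kept and the volume terms cancel. Minimality bounds the upper limit of the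
 Dirichlet integrals by that of \<open>u\<close> (\<open>limsup_gradients\<close>). Since the gradients converge weakly
 (\<open>gradients_weakly_convergent\<close>), they converge strongly (\<open>gradients_L2_tendsto\<close>), which is the last claim of the
 theorem.

 Choice of the limit sets. Along a subsequence the volumes of the sets \<open>W\<^sub>k\<close> converge in each shell of a compact
 exhaustion. The positivity sets of \<open>u\<close> have at most these volumes by Fatou's lemma, and Lebesgue measure has no atoms,
 so they can be enlarged inside \<open>\<Omega>\<close> to disjoint sets with exactly the limit volumes (\<open>limit_partition\<close>). The energy
 depends on the sets only through their volumes, so nothing else about them has to converge.

 Transplanting competitors. A competitor for the limit is not admissible for problem \<open>k\<close>, since \<open>\<Omega>\<^sub>k\<close> may miss points
 of \<open>\<Omega>\<close>. The missed points in a compact set are close to the complement of \<open>\<Omega>\<close>. The density condition yields a Hardy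
 inequality there (\<open>Hardy_near_complement\<close>), so functions that vanish outside \<open>\<Omega>\<close> can be cut off near the complement
 with arbitrarily small error in the energy (\<open>cutoff_near_complement\<close>). Soft thresholding makes the competitor compatible
 with \<open>W\<^sub>k\<close> in the transition zone. After these changes the competitor can be compared with \<open>u\<^sub>k\<close>
 (\<open>limit_comparison\<close>), and the changes are removed in the limit (\<open>comparison_on_large_compact\<close>).

 Passage to the limit. The coefficients converge weakly and are bounded, the functions converge strongly in \<open>L\<^sup>2\<close>
 together with their gradients, and the volume functions converge uniformly, so all terms of the comparison converge.

 The analysis starts from mollification with a smooth kernel: weak gradients are unique, local, obey product and chain
 rules, and vanish almost everywhere on the zero set of the function.
\<close>

abbreviation (input) "leb \<equiv> lebesgue"
abbreviation (input) "leb_on \<equiv> lebesgue_on"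

abbreviation (input) converges_to :: "(nat => 'a::topological_space) => 'a => bool" (infix "\<leadsto>" 60)
  where "f \<leadsto> l \<equiv> f \<longlonglongrightarrow> l"

text \<open>Bochner and Henstock-Kurzweil integration share many fact names; these refer to the former.\<close>

lemmas LINT_cong = Bochner_Integration.integral_cong
  and LINT_nonneg = Bochner_Integration.integral_nonneg
  and LINT_diff = Bochner_Integration.integral_diff
  and LINT_sum = Bochner_Integration.integral_sum
  and intgb_bound = Bochner_Integration.integrable_bound
  and intgb_diff = Bochner_Integration.integrable_diff
  and intgb_add = Bochner_Integration.integrable_add
  and intgb_cong = Bochner_Integration.integrable_cong


section \<open>Smooth functions and a smoothing kernel\<close>

lemma C_k_mono_Suc: "C_k (Suc k) f ==> C_k k f"
proof (induction k arbitrary: f)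
 case 0
 then show ?case
 by (simp add: continuous_at_imp_continuous_on differentiable_imp_continuous_within)
next
 case (Suc k)
 then show ?case by (metis C_k.simps(2))
qed

lemma frechet_derivativeI: "(f has_derivative f') (at x) ==> frechet_derivative f (at x) = f'"
 using frechet_derivative_at by metis

lemma C_k_SucI:
 assumes "!!x. (f has_derivative f' x) (at x)" "!!b. b : Basis ==> C_k k (%x. f' x b)"
 shows "C_k (Suc k) f"
 using assms by (auto simp: differentiable_def frechet_derivativeI[OF assms(1)])

lemma C_k_SucD:
 assumes "C_k (Suc k) f"
 shows "(f has_derivative frechet_derivative f (at x)) (at x)"
 "b : Basis ==> C_k k (%x. frechet_derivative f (at x) b)"
 using assms by (auto simp: frechet_derivative_works)

lemma C_k_const: "C_k k (%x. c)"
 by (induction k arbitrary: c) (auto intro!: C_k_SucI[where f'="%_ _. 0"] simp del: C_k.simps(2))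

lemma C_k_add: "C_k k f ==> C_k k g ==> C_k k (%x. f x + g x)"
proof (induction k arbitrary: f g)
 case 0 then show ?case by (auto intro: continuous_intros)
next
 case (Suc k)
 show ?case
 by (rule C_k_SucI[OF has_derivative_add[OF C_k_SucD(1)[OF Suc.prems(1)] C_k_SucD(1)[OF Suc.prems(2)]]])
  (intro Suc.IH C_k_SucD(2) Suc.prems)
qed

lemma C_k_mult: "C_k k f ==> C_k k g ==> C_k k (%x. f x * g x)"
proof (induction k arbitrary: f g)
 case 0 then show ?case by (auto intro: continuous_intros)
next
 case (Suc k)
 show ?case
 by (rule C_k_SucI[OF has_derivative_mult[OF C_k_SucD(1)[OF Suc.prems(1)] C_k_SucD(1)[OF Suc.prems(2)]]])
  (intro Suc.IH C_k_add C_k_SucD(2) Suc.prems C_k_mono_Suc[OF Suc.prems(1)] C_k_mono_Suc[OF Suc.prems(2)])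
qed

lemma C_k_diff: "C_k k f ==> C_k k g ==> C_k k (%x. f x - g x)"
 using C_k_add[OF _ C_k_mult[OF C_k_const[where c="-1"]], of k f g] by simp

lemma C_k_inner: "C_k k (%x. x \<bullet> c)"
proof (cases k)
 case 0 then show ?thesis by (auto intro: continuous_intros)
next
 case (Suc j)
 show ?thesis unfolding Suc
 by (rule C_k_SucI[where f'="%_ h. h \<bullet> c"], auto intro!: derivative_eq_intros)
  (rule C_k_const)
qed

lemma C_k_inner_self: "C_k k (%x. x \<bullet> x)"
proof (cases k)
 case 0 then show ?thesis by (auto intro: continuous_intros)
next
 case (Suc j)
 show ?thesis unfolding Suc
 proof (rule C_k_SucI)
 show "((%x. x \<bullet> x) has_derivative (%h. 2 * (x \<bullet> h))) (at x)" for x :: 'a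
  by (auto intro!: derivative_eq_intros simp: inner_commute)
 qed (intro C_k_mult C_k_const C_k_inner)
qed

lemma C_k_reflect: "C_k k f ==> C_k k (%x. f (z - x))"
proof (induction k arbitrary: f)
 case 0
 then show ?case by (auto intro!: continuous_on_compose2[of UNIV f] continuous_intros)
next
 case (Suc k)
 have d: "((%x. f (z - x)) has_derivative (%h. - 1 * frechet_derivative f (at (z - x)) h)) (at x)" for x
 proof -
 have "((%x. f (z - x)) has_derivative (%h. frechet_derivative f (at (z - x)) (- h))) (at x)"
  by (rule has_derivative_compose[OF _ C_k_SucD(1)[OF Suc.prems]]) (auto intro!: derivative_eq_intros)
 moreover have "frechet_derivative f (at (z - x)) (- h) = - 1 * frechet_derivative f (at (z - x)) h" for h
  using linear_neg[OF has_derivative_linear[OF C_k_SucD(1)[OF Suc.prems, of "z-x"]]] by simp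
 ultimately show ?thesis by simp
 qed
 show ?case
 by (rule C_k_SucI[OF d]) (intro C_k_mult C_k_const Suc.IH C_k_SucD(2) Suc.prems)
qed

lemma power_le_fact_exp: "0 <= (x::real) ==> x ^ n <= fact n * exp x"
proof -
 assume x: "0 <= x"
 have "(\<Sum>k\<in>{n}. x ^ k /\<^sub>R fact k) <= (\<Sum>k. x ^ k /\<^sub>R fact k)"
 by (rule sum_le_suminf[OF summable_exp_generic]) (use x in auto)
 then show ?thesis by (simp add: exp_def divide_simps mult.commute)
qed

text \<open>The classical function \<open>exp (-1/t)\<close>, extended by \<open>0\<close>, and its quotients by powers of \<open>t\<close>:
 differentiation maps this family to its linear span, which makes all its members smooth.\<close>

definition flat :: "nat => real => real" where
 "flat m t = (if t > 0 then exp (- (1 / t)) / t ^ m else 0)"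

lemma flat_nonneg: "0 <= flat m t" by (simp add: flat_def)

lemma flat_bound: "flat m t <= fact (m + j) * \<bar>t\<bar> ^ j"
proof (cases "t > 0")
 case True
 have "(1 / t) ^ (m + j) <= fact (m + j) * exp (1 / t)" using True by (intro power_le_fact_exp) auto
 then show ?thesis using True
 by (simp add: flat_def exp_minus field_simps power_add)
qed (auto simp: flat_def)

lemma flat_has_derivative:
 "(flat m has_real_derivative flat (m + 2) t - real m * flat (m + 1) t) (at t)"
proof -
 consider "t > 0" | "t < 0" | "t = 0" by linarith
 then show ?thesis
 proof cases
 case 1
 have "((%t. exp (- (1 / t)) / t ^ m) has_real_derivative flat (m + 2) t - real m * flat (m + 1) t) (at t)"
 proof (cases m)
  case 0
  then show ?thesis using 1
  by (auto intro!: derivative_eq_intros simp: flat_def field_simps power2_eq_square)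
 next
  case (Suc j)
  have i: "(inverse has_real_derivative - (1 / t^2)) (at t)"
  using 1 by (auto intro!: derivative_eq_intros simp: power2_eq_square field_simps)
  have e: "((%t. exp (- (1 / t))) has_real_derivative exp (- (1 / t)) * (1 / t^2)) (at t)"
  using 1 by (auto intro!: derivative_eq_intros simp: power2_eq_square field_simps)
  have "inverse t ^ (m - 1) * (1 / t^2) = inverse t ^ (m + 1)"
  using 1 by (simp add: Suc power2_eq_square field_simps)
  then have eq: "exp (- (1 / t)) * (1 / t^2) * inverse t ^ m
   + real m * (- (1 / t^2) * inverse t ^ (m - Suc 0)) * exp (- (1 / t))
  = exp (- (1 / t)) * (1 / t^2 * inverse t ^ m) - real m * (exp (- (1 / t)) * inverse t ^ (m + 1))"
  by (simp add: algebra_simps)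
  have fl: "exp (- (1 / t)) * (1 / t^2 * inverse t ^ m) = flat (m + 2) t"
   "exp (- (1 / t)) * inverse t ^ (m + 1) = flat (m + 1) t"
  using 1 by (simp_all add: flat_def power_inverse divide_inverse power2_eq_square mult_ac)
  have "(%t::real. exp (- (1 / t)) * inverse t ^ m) = (%t. exp (- (1 / t)) / t ^ m)"
  by (rule ext) (simp add: field_simps)
  with DERIV_mult[OF e DERIV_power[OF i, of m]] show ?thesis
  unfolding eq fl by simp
 qed
 then show ?thesis
  by (rule DERIV_cong_ev[THEN iffD1, rotated 3])
   (use 1 in \<open>auto simp: flat_def intro!: eventually_mono[OF eventually_gt_at_top] 
   eventually_nhds_in_open[of "{0<..}" t, THEN eventually_mono]\<close>)
 next
 case 2
 have "((%t. 0) has_real_derivative flat (m + 2) t - real m * flat (m + 1) t) (at t)"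
  using 2 by (auto simp: flat_def)
 then show ?thesis
  by (rule DERIV_cong_ev[THEN iffD1, rotated 3])
   (use 2 in \<open>auto simp: flat_def 
   intro!: eventually_nhds_in_open[of "{..<0}" t, THEN eventually_mono]\<close>)
 next
 case 3
 have "((%h. flat m h / h) \<longlongrightarrow> 0) (at 0)"
 proof (rule Lim_null_comparison)
  show "\<forall>\<^sub>F h in at 0. norm (flat m h / h) <= fact (m + 2) * \<bar>h\<bar>"
  proof (rule eventually_at_ball[of 1, THEN eventually_mono])
  fix h :: real
  show "norm (flat m h / h) <= fact (m + 2) * \<bar>h\<bar>"
   using flat_bound[of m h 2] flat_nonneg[of m h]
   by (cases "h = 0") (auto simp: divide_simps power2_eq_square mult.assoc abs_mult_self_eq)
  qed simp
  show "((%h. fact (m + 2) * \<bar>h\<bar>) \<longlongrightarrow> 0) (at (0::real))"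
  by (auto intro!: tendsto_eq_intros)
 qed
 then show ?thesis using 3 by (simp add: DERIV_def flat_def)
 qed
qed

lemma C_k_flat: "C_k k f ==> C_k k (%x. flat m (f x))"
proof (induction k arbitrary: m)
 case 0
 have "continuous_on UNIV (flat m)"
 by (rule continuous_at_imp_continuous_on) (blast intro: DERIV_isCont flat_has_derivative)
 from continuous_on_compose2[OF this] 0 show ?case by simp
next
 case (Suc k)
 note F = C_k_mono_Suc[OF Suc.prems]
 have d: "((%x. flat m (f x)) has_derivative
  (%h. (flat (m + 2) (f x) - real m * flat (m + 1) (f x)) * frechet_derivative f (at x) h)) (at x)" for x
 using has_derivative_compose[OF C_k_SucD(1)[OF Suc.prems] flat_has_derivative[unfolded has_field_derivative_def]]
 by simp
 show ?case
 by (rule C_k_SucI[OF d]) (intro C_k_mult C_k_diff C_k_const Suc.IH F C_k_SucD(2)[OF Suc.prems])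
qed

lemma integrable_continuous_compact_support:
 fixes f :: "'a::euclidean_space => 'b::{banach, second_countable_topology}"
 assumes "continuous_on UNIV f" "compact K" "!!x. x \<notin> K ==> f x = 0"
 shows "integrable lborel f" "integrable leb f"
proof -
 have "integrable lborel (%x. indicator K x *\<^sub>R f x)"
 by (rule borel_integrable_compact[OF assms(2) continuous_on_subset[OF assms(1)]]) auto
 also have "(%x. indicator K x *\<^sub>R f x) = f" using assms(3) by (auto simp: indicator_def fun_eq_iff)
 finally show "integrable lborel f" .
 then show "integrable leb f"
 by (rule integrable_completion[OF borel_measurable_integrable, THEN iffD2, rotated])
  (fact \<open>integrable lborel f\<close>)
qed

definition bump :: "real => 'a::euclidean_space => real" where
 "bump r x = flat 0 (1 - (x \<bullet> x) / r^2)"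

definition kernel :: "real => 'a::euclidean_space => real" where
 "kernel r x = bump r x / (LINT y|leb. bump r (y::'a))"

lemma C_k_bump: "C_k k (bump r)"
 unfolding bump_def[abs_def]
 by (intro C_k_flat C_k_diff C_k_const) (use C_k_mult[OF C_k_inner_self C_k_const, of k "1 / r^2"] in simp)

lemma bump_eq_0: "0 < r ==> x \<notin> ball 0 r ==> bump r x = 0"
proof -
 assume "0 < r" "x \<notin> ball 0 r"
 then have "r^2 <= x \<bullet> x" using power_mono[of r "norm x" 2] by (simp add: power2_norm_eq_inner)
 then show ?thesis using \<open>0 < r\<close> by (simp add: bump_def flat_def field_simps)
qed

lemma bump_nonneg: "0 <= bump r x" by (simp add: bump_def flat_nonneg)

lemma bump_integrable: "0 < r ==> integrable leb (bump r)"
 by (rule integrable_continuous_compact_support(2)[of _ "cball 0 r"])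
  (use C_k_bump[of 0 r] in \<open>auto intro!: bump_eq_0[of r]\<close>)

lemma bump_integral_ge:
 assumes r: "0 < r"
 shows "exp (- 2) * measure leb (ball (0::'a::euclidean_space) (r/2)) <= (LINT y|leb. bump r (y::'a))"
proof -
 have "exp (- 2) * measure leb (ball (0::'a) (r/2)) = (LINT y|leb. exp (-2) * indicator (ball (0::'a) (r/2)) y)"
 by simp
 also have "... <= (LINT y|leb. bump r (y::'a))"
 proof (rule integral_mono[OF _ bump_integrable[OF r]])
 show "integrable leb (%y. exp (- 2) * indicat_real (ball (0::'a) (r/2)) y)"
  by (intro integrable_mult_right integrable_real_indicator)
   (use emeasure_lborel_ball_finite[of "0::'a" "r/2"] in auto)
 fix y :: 'a
 show "exp (-2) * indicat_real (ball 0 (r/2)) y <= bump r y"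
 proof (cases "y : ball 0 (r/2)")
  case True
  then have "norm y ^ 2 <= (r/2)^2" by (intro power_mono) auto
  then have "(y \<bullet> y) / r^2 <= 1/4" using r by (simp add: power2_norm_eq_inner field_simps)
  then have *: "1/2 <= 1 - (y \<bullet> y) / r^2" by linarith
  have "1 / (1 - (y \<bullet> y) / r^2) <= 1 / (1/2)" 
  by (rule divide_left_mono[OF *]) (simp, rule mult_pos_pos, use * in linarith, simp)
  then have "exp (- 2) <= exp (- (1 / (1 - (y \<bullet> y) / r^2)))" by simp
  moreover have "0 < 1 - (y \<bullet> y) / r^2" using * by linarith
  ultimately show ?thesis using True unfolding bump_def flat_def by simp
 qed (simp add: bump_nonneg)
 qed
 finally show ?thesis .
qed

lemma bump_integral_pos: "0 < r ==> 0 < (LINT y|leb. bump r (y::'a::euclidean_space))"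
 using bump_integral_ge[of r, where 'a='a]
 by (rule less_le_trans[rotated]) auto

lemma C_k_kernel: "C_k k (kernel r)"
 using C_k_mult[OF C_k_bump C_k_const, of k r "1 / (LINT y|leb. bump r y)"]
 by (simp add: kernel_def[abs_def])

lemma kernel_eq_0: "0 < r ==> x \<notin> ball 0 r ==> kernel r x = 0"
 by (simp add: kernel_def bump_eq_0)

lemma kernel_nonneg: "0 < r ==> 0 <= kernel r x"
 by (simp add: kernel_def bump_nonneg bump_integral_pos less_imp_le)

lemma kernel_even: "kernel r (x - y) = kernel r (y - x)"
 by (simp add: kernel_def bump_def inner_diff algebra_simps)

lemma kernel_integrable: "0 < r ==> integrable leb (kernel r)"
 unfolding kernel_def[abs_def] by (intro integrable_divide_zero bump_integrable)

lemma kernel_integral: "0 < r ==> (LINT y|leb. kernel r (y::'a::euclidean_space)) = 1"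
 unfolding kernel_def[abs_def] using bump_integral_pos[of r, where 'a='a] by simp

lemma kernel_continuous: "continuous_on A (kernel r)"
 using C_k_kernel[of 0 r] by (auto intro: continuous_on_subset)

lemma kernel_has_derivative:
 fixes x :: "'a::euclidean_space"
 shows "(kernel r has_derivative (%h. flat 2 (1 - (x \<bullet> x) / r^2) * (- 2 / r^2 * (x \<bullet> h))
  / (LINT y|leb. bump r (y::'a)))) (at x)"
proof -
 have i: "((%x. 1 - (x \<bullet> x) / r^2) has_derivative (%h. - 2 / r^2 * (x \<bullet> h))) (at x)"
 by (auto intro!: derivative_eq_intros simp: inner_commute divide_inverse)
 have "((%x. flat 0 (1 - (x \<bullet> x) / r^2)) has_derivative
  (%h. flat 2 (1 - (x \<bullet> x) / r^2) * (- 2 / r^2 * (x \<bullet> h)))) (at x)"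
 using has_derivative_compose[OF i flat_has_derivative[of 0, unfolded has_field_derivative_def]]
 by (simp add: numeral_2_eq_2)
 from has_derivative_mult_left[OF this, of "1 / (LINT y|leb. bump r (y::'a))"] show ?thesis
 unfolding kernel_def[abs_def] bump_def[abs_def] by (simp add: divide_inverse)
qed

text \<open>The gradient of \<open>bump r\<close> is at most a constant times \<open>1/r\<close> on the support, and \<open>bump r\<close> is at
 least a constant on the ball of radius \<open>r/2\<close>, whose volume is comparable with that of the support.\<close>

lemma kernel_gradient_L1:
 assumes r: "0 < r" and b: "b : Basis"
 shows "(LINT x|leb. \<bar>frechet_derivative (kernel r) (at (x::'a::euclidean_space)) b\<bar>)
 <= 4 * exp 2 * 2 ^ DIM('a) / r"
proof -
 define c where "c = (LINT y|leb. bump r (y::'a))"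
 define V where "V = measure leb (ball (0::'a) r)"
 have c: "0 < c" using bump_integral_pos[OF r] by (simp add: c_def)
 have V2: "measure leb (ball (0::'a) (r/2)) = V / 2 ^ DIM('a)"
 using content_ball[of "r/2" "0::'a"] content_ball[of r "0::'a"] r
 by (simp add: V_def power_divide)
 have Vc: "V <= exp 2 * 2 ^ DIM('a) * c"
 using bump_integral_ge[OF r, where 'a='a] unfolding V2 c_def[symmetric]
 by (simp add: exp_minus field_simps)
 have le: "\<bar>frechet_derivative (kernel r) (at x) b\<bar> <= 4 / (r * c) * indicator (ball 0 r) x" for x :: 'a
 proof (cases "x : ball 0 r")
 case True
 have "\<bar>flat 2 (1 - (x \<bullet> x) / r^2) * (- 2 / r^2 * (x \<bullet> b)) / c\<bar>
  <= 2 * (2 / r^2 * r) / c"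
 proof -
  have f: "\<bar>flat 2 (1 - (x \<bullet> x) / r^2)\<bar> <= 2"
  using flat_bound[of 2 _ 0] flat_nonneg[of 2] by (simp add: fact_numeral)
  have x: "\<bar>x \<bullet> b\<bar> <= r" using True Basis_le_norm[OF b, of x] by auto
  have "\<bar>- 2 / r^2 * (x \<bullet> b)\<bar> <= 2 / r^2 * r"
  using mult_left_mono[OF x, of "2 / r^2"] by (simp add: abs_mult)
  then have "\<bar>flat 2 (1 - (x \<bullet> x) / r^2)\<bar> * \<bar>- 2 / r^2 * (x \<bullet> b)\<bar> <= 2 * (2 / r^2 * r)"
  by (intro mult_mono[OF f]) auto
  then have "\<bar>flat 2 (1 - (x \<bullet> x) / r^2) * (- 2 / r^2 * (x \<bullet> b))\<bar> <= 2 * (2 / r^2 * r)"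
  by (simp only: abs_mult)
  then show ?thesis
  unfolding abs_divide abs_of_pos[OF c] using c by (intro divide_right_mono) auto
 qed
 then show ?thesis
  using True r unfolding frechet_derivativeI[OF kernel_has_derivative] c_def[symmetric]
  by (simp add: power2_eq_square field_simps)
 next
 case False
 then have "r^2 <= x \<bullet> x"
  using r power_mono[of r "norm x" 2] by (simp add: power2_norm_eq_inner)
 then have "1 - (x \<bullet> x) / r^2 <= 0" using r by simp
 then show ?thesis
  using False by (simp add: frechet_derivativeI[OF kernel_has_derivative] flat_def)
 qed
 have "(LINT x|leb. \<bar>frechet_derivative (kernel r) (at (x::'a)) b\<bar>)
  <= (LINT x|leb. 4 / (r * c) * indicator (ball (0::'a) r) x)"
 by (rule integral_mono'[OF _ le])
  (use c r emeasure_lborel_ball_finite[of "0::'a" r] in \<open>auto simp: less_top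
   intro!: integrable_mult_right integrable_divide_zero integrable_real_indicator\<close>)
 also have "... = 4 / (r * c) * V" by (simp add: V_def)
 also have "... <= 4 / (r * c) * (exp 2 * 2 ^ DIM('a) * c)"
 using Vc c r by (intro mult_left_mono) auto
 also have "... = 4 * exp 2 * 2 ^ DIM('a) / r" using c by (simp add: field_simps)
 finally show ?thesis .
qed



section \<open>Mollification of integrable functions\<close>

text \<open>Translations and Fubini are available for Borel functions, so integrands are replaced by Borel
 representatives that agree with them almost everywhere.\<close>

lemma integrable_lebesgue_borel_ex:
 fixes f :: "'a::euclidean_space => 'b::euclidean_space"
 assumes "integrable leb f"
 shows "\<exists>g. integrable lborel g & (AE x in leb. f x = g x)"
proof -
 have m: "f : borel_measurable leb" using assms by simp
 have "\<forall>b. \<exists>h\<in>borel_measurable lborel. AE x in lborel. f x \<bullet> b = h x"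
 using m by (intro allI completion_ex_borel_measurable_real) (rule borel_measurable_inner, auto)
 then obtain h where h: "!!b. h b : borel_measurable lborel" "!!b. AE x in lborel. f x \<bullet> b = h b x"
 by metis
 define g where "g x = (\<Sum>b\<in>Basis. h b x *\<^sub>R b)" for x
 have gm: "g : borel_measurable lborel" unfolding g_def using h(1) by measurable
 have "AE x in lborel. \<forall>b\<in>Basis. f x \<bullet> b = h b x" using h(2) by (simp add: AE_finite_all)
 then have eq: "AE x in lborel. f x = g x"
 proof eventually_elim
 case (elim x)
 then have "g x = (\<Sum>b\<in>Basis. (f x \<bullet> b) *\<^sub>R b)" unfolding g_def by (intro sum.cong) auto
 then show ?case by (simp add: euclidean_representation)
 qed
 have "integrable leb g"
 using gm by (intro integrable_cong_AE_imp[OF assms]) (auto intro: measurable_completion simp: AE_completion[OF eq])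
 then have "integrable lborel g" using integrable_completion[OF gm] by simp
 then show ?thesis using AE_completion[OF eq] by blast
qed

lemma continuous_imp_lebesgue_measurable:
 fixes h :: "'a::euclidean_space => 'b::topological_space"
 assumes "continuous_on UNIV h"
 shows "h : borel_measurable leb"
 by (rule measurable_completion) (simp add: borel_measurable_continuous_onI[OF assms])

lemma integral_lborel_translate:
 fixes f :: "'a::euclidean_space => 'b::euclidean_space"
 assumes "f : borel_measurable lborel"
 shows "(LINT x|lborel. f (c + x)) = (LINT x|lborel. f x)"
proof -
 have "(LINT x|distr lborel borel ((+) c). f x) = (LINT x|lborel. f (c + x))"
 using assms by (intro integral_distr) auto
 then show ?thesis by (simp add: lborel_distr_plus)
qed

lemma integrable_lborel_translate:
 fixes f :: "'a::euclidean_space => 'b::euclidean_space"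
 assumes "integrable lborel f"
 shows "integrable lborel (%x. f (c + x))"
proof -
 have "integrable (distr lborel borel ((+) c)) f" using assms by (simp add: lborel_distr_plus)
 then show ?thesis using assms by (subst (asm) integrable_distr_eq) auto
qed

text \<open>By density of simple functions it suffices to treat the indicator of a set of finite measure. A continuous
 function that is one on a closed subset and zero off an open superset approximates it, and is then truncated.\<close>

lemma continuous_compact_support_L1_dense:
 fixes f :: "'a::euclidean_space => 'b::euclidean_space"
 assumes "integrable leb f" "0 < e"
 shows "\<exists>g R. continuous_on UNIV g & (\<forall>x. x \<notin> cball 0 R --> g x = 0) &
 (LINT x|leb. norm (f x - g x)) < e"
proof -
 define P where "P f \<longleftrightarrow> (\<forall>e>0. \<exists>g R. continuous_on UNIV g & (\<forall>x. x \<notin> cball 0 R --> g x = 0) &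
 (LINT x|leb. norm (f x - g x)) < e)" for f :: "'a => 'b"
 have int: "integrable leb g" if "continuous_on UNIV g" "\<forall>x. x \<notin> cball 0 R --> g x = 0" for g :: "'a => 'b" and R
 using integrable_continuous_compact_support(2)[OF that(1) compact_cball] that(2) by blast
 have "P f" using assms(1)
 proof (induction rule: integrable_induct)
 case (base A c)
 show ?case unfolding P_def
 proof (intro allI impI)
  fix e :: real assume e: "0 < e"
  define q where "q = e / (norm c + 1)"
  define d where "d = q / 4"
  have d: "0 < d" unfolding d_def q_def using e by (intro divide_pos_pos) (auto intro: add_nonneg_pos)
  have "norm c / (norm c + 1) < 1" by (simp add: divide_less_eq add_nonneg_pos)
  from mult_strict_left_mono[OF this e] have "q * norm c < e" by (simp add: q_def)
  then have dc: "4 * (d * norm c) < e" by (simp add: d_def)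
  obtain U where U: "open U" "A <= U" "U - A : lmeasurable" "emeasure leb (U - A) < ennreal d"
  using sets_lebesgue_outer_open[OF base(1) d] by auto
  obtain C where C: "closed C" "C <= A" "A - C : lmeasurable" "emeasure leb (A - C) < ennreal d"
  using sets_lebesgue_inner_closed[OF base(1) d] by auto
  have A: "A : lmeasurable" using base by (simp add: fmeasurable_def)
  have Um: "U : lmeasurable"
  using fmeasurable.Un[OF A U(3)] U(2) by (simp add: Un_absorb1)
  obtain h where h: "continuous_on UNIV h" "!!x. h x : closed_segment (1::real) 0"
   "!!x. x : C ==> h x = 1" "!!x. x : - U ==> h x = 0"
  using Urysohn[OF C(1), of "- U" "1::real" 0] U(1,2) C(2) by (metis closed_Compl disjoint_eq_subset_Compl double_compl subset_trans)
  have h01: "0 <= h x" "h x <= 1" for x using h(2)[of x] by (auto simp: closed_segment_eq_real_ivl)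
  define t where "t n x = h x * max 0 (min 1 (1 + real n - norm x))" for n x
  have tc: "continuous_on UNIV (t n)" for n unfolding t_def by (intro continuous_intros h)
  have t0: "x \<notin> cball 0 (1 + real n) ==> t n x = 0" for x n by (simp add: t_def)
  have hm: "h : borel_measurable leb"
  by (rule continuous_imp_lebesgue_measurable[OF h(1)])
  have hU: "integrable leb h"
  by (rule intgb_bound[OF integrable_real_indicator[of U leb]])
   (use Um hm h01 h(4) in \<open>auto simp: fmeasurable_def indicator_def abs_le_iff\<close>)
  have ti: "integrable leb (t n)" for n
  using integrable_continuous_compact_support(2)[OF tc compact_cball] t0 by blast
  have "(%n. LINT x|leb. \<bar>h x - t n x\<bar>) \<leadsto> (LINT x|(leb::'a measure). 0)"
  proof (rule integral_dominated_convergence[where w = h])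
  show "AE x in leb. (%n. \<bar>h x - t n x\<bar>) \<leadsto> 0"
  proof (intro AE_I2 tendsto_eventually)
   fix x :: 'a
   obtain N where "norm x <= real N" using real_arch_simple by blast
   then show "\<forall>\<^sub>F n in sequentially. \<bar>h x - t n x\<bar> = 0"
   by (intro eventually_sequentiallyI[of N]) (auto simp: t_def)
  qed
  show "AE x in leb. norm \<bar>h x - t n x\<bar> <= h x" for n
  proof (intro AE_I2)
   fix x
   have "0 <= t n x" "t n x <= h x" using h01[of x] by (auto simp: t_def intro: mult_left_le)
   then show "norm \<bar>h x - t n x\<bar> <= h x" by auto
  qed
  qed (use hU hm borel_measurable_integrable[OF ti] in auto)
  then have "\<forall>\<^sub>F n in sequentially. (LINT x|leb. \<bar>h x - t n x\<bar>) < d"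
  using d by (auto intro: order_tendstoD)
  then obtain n where n: "(LINT x|leb. \<bar>h x - t n x\<bar>) < d"
  by (auto simp: eventually_sequentially)
  have dm: "measure leb (U - A) < d" "measure leb (A - C) < d"
  using U(4) C(4) unfolding emeasure_eq_measure2[OF U(3)] emeasure_eq_measure2[OF C(3)]
  by (simp_all add: ennreal_less_iff)
  have ib: "integrable leb (indicat_real B)" if "B : lmeasurable" for B :: "'a set"
  using that by (auto simp: fmeasurable_def)
  have "(LINT x|leb. \<bar>indicat_real A x - t n x\<bar>)
   <= (LINT x|leb. indicat_real (U - A) x + indicat_real (A - C) x + \<bar>h x - t n x\<bar>)"
  proof (rule integral_mono)
  show "integrable leb (%x. \<bar>indicat_real A x - t n x\<bar>)"
   using ib[OF A] ti by auto
  show "integrable leb (%x. indicat_real (U - A) x + indicat_real (A - C) x + \<bar>h x - t n x\<bar>)"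
   using ib[OF U(3)] ib[OF C(3)] ti hU by auto
  fix x
  have "\<bar>indicat_real A x - h x\<bar> <= indicat_real (U - A) x + indicat_real (A - C) x"
   using h01[of x] h(3,4)[of x] U(2) C(2) by (auto simp: indicator_def)
  then show "\<bar>indicat_real A x - t n x\<bar> <= indicat_real (U - A) x + indicat_real (A - C) x + \<bar>h x - t n x\<bar>"
   by linarith
  qed
  also have "... = measure leb (U - A) + measure leb (A - C) + (LINT x|leb. \<bar>h x - t n x\<bar>)"
  using ib[OF U(3)] ib[OF C(3)] ti hU by simp
  also have "... < 3 * d" using n dm by simp
  finally have "(LINT x|leb. \<bar>indicat_real A x - t n x\<bar>) * norm c <= 3 * d * norm c"
  by (intro mult_right_mono) auto
  also have "... <= 4 * (d * norm c)" using d by simp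
  also note dc
  finally have "(LINT x|leb. norm (indicator A x *\<^sub>R c - t n x *\<^sub>R c)) < e"
  by (simp flip: scaleR_diff_left integral_mult_left_zero)
  moreover have "continuous_on UNIV (%x. t n x *\<^sub>R c)" by (intro continuous_intros tc)
  ultimately show "\<exists>g R. continuous_on UNIV g & (\<forall>x. x \<notin> cball 0 R --> g x = 0) &
   (LINT x|leb. norm (indicat_real A x *\<^sub>R c - g x)) < e"
  using t0[of _ n] by (intro exI[of _ "%x. t n x *\<^sub>R c"] exI[of _ "1 + real n"]) auto
 qed
 next
 case (add f g)
 show ?case unfolding P_def
 proof (intro allI impI)
  fix e :: real assume "0 < e"
  then have e2: "0 < e / 2" by simp
  obtain f' R where f': "continuous_on UNIV f'" "\<forall>x. x \<notin> cball 0 R --> f' x = 0" "(LINT x|leb. norm (f x - f' x)) < e/2"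
  using add.IH(1) e2 unfolding P_def by blast
  obtain g' R' where g': "continuous_on UNIV g'" "\<forall>x. x \<notin> cball 0 R' --> g' x = 0" "(LINT x|leb. norm (g x - g' x)) < e/2"
  using add.IH(2) e2 unfolding P_def by blast
  have "(LINT x|leb. norm (f x + g x - (f' x + g' x))) <= (LINT x|leb. norm (f x - f' x) + norm (g x - g' x))"
  using add.hyps int[OF f'(1,2)] int[OF g'(1,2)]
  by (intro integral_mono) (auto simp: add_diff_add intro: norm_triangle_ineq)
  also have "... < e" using add.hyps int[OF f'(1,2)] int[OF g'(1,2)] f'(3) g'(3) by simp
  finally show "\<exists>g' R. continuous_on UNIV g' & (\<forall>x. x \<notin> cball 0 R --> g' x = 0) &
   (LINT x|leb. norm (f x + g x - g' x)) < e"
  using f'(1,2) g'(1,2)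
  by (intro exI[of _ "%x. f' x + g' x"] exI[of _ "max R R'"]) (auto intro!: continuous_intros)
 qed
 next
 case (lim f s)
 show ?case unfolding P_def
 proof (intro allI impI)
  fix e :: real assume "0 < e"
  then have e2: "0 < e / 2" by simp
  have "(%i. LINT x|leb. norm (f x - s i x)) \<leadsto> (LINT x|(leb::'a measure). 0)"
  proof (rule integral_dominated_convergence[where w = "%x. 3 * norm (f x)"])
  show "AE x in leb. (%i. norm (f x - s i x)) \<leadsto> 0"
   using lim.hyps(2) by (intro AE_I2 tendsto_norm_zero) (auto intro!: tendsto_eq_intros)
  show "AE x in leb. norm (norm (f x - s i x)) <= 3 * norm (f x)" for i
  proof (intro AE_I2)
   fix x show "norm (norm (f x - s i x)) <= 3 * norm (f x)"
   using lim.hyps(3)[of x i] norm_triangle_ineq4[of "f x" "s i x"] by simp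
  qed
  qed (use lim.hyps in auto)
  then have "\<forall>\<^sub>F i in sequentially. (LINT x|leb. norm (f x - s i x)) < e/2"
  using order_tendstoD(2) e2 by fastforce
  then obtain i where i: "(LINT x|leb. norm (f x - s i x)) < e/2" by (auto simp: eventually_sequentially)
  obtain g R where g: "continuous_on UNIV g" "\<forall>x. x \<notin> cball 0 R --> g x = 0" "(LINT x|leb. norm (s i x - g x)) < e/2"
  using lim.IH e2 unfolding P_def by blast
  have "(LINT x|leb. norm (f x - g x)) <= (LINT x|leb. norm (f x - s i x) + norm (s i x - g x))"
  proof (intro integral_mono)
  show "norm (f x - g x) <= norm (f x - s i x) + norm (s i x - g x)" for x
   using norm_triangle_ineq[of "f x - s i x" "s i x - g x"] by simp
  qed (use lim.hyps(1,4) int[OF g(1,2)] in auto)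
  also have "... < e" using lim.hyps(1,4) int[OF g(1,2)] g(3) i by simp
  finally show "\<exists>g R. continuous_on UNIV g & (\<forall>x. x \<notin> cball 0 R --> g x = 0) & (LINT x|leb. norm (f x - g x)) < e"
  using g(1,2) by blast
 qed
 qed
 then show ?thesis using assms(2) unfolding P_def by blast
qed

definition mollify :: "real => ('a::euclidean_space => 'b::euclidean_space) => 'a => 'b" where
 "mollify r f x = (LINT y|leb. kernel r (x - y) *\<^sub>R f y)"

lemma kernel_measurable [measurable]: "kernel r : borel_measurable borel"
 by (rule borel_measurable_continuous_onI[OF kernel_continuous])

lemma kernel_bounded:
 assumes "0 < r"
 obtains M where "!!x::'a::euclidean_space. kernel r x <= M"
proof -
 have "kernel r x <= 1 / (LINT y|leb. bump r (y::'a))" for x :: 'a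
 using flat_bound[of 0 _ 0] bump_integral_pos[OF assms, where 'a='a]
 by (auto simp: kernel_def bump_def intro!: divide_right_mono)
 then show ?thesis using that by blast
qed

lemma kernel_shift_integral:
 fixes x :: "'a::euclidean_space"
 assumes "0 < r"
 shows "integrable lborel (%y. kernel r (x - y))" "(LINT y|lborel. kernel r (x - y)) = 1"
 "integrable lborel (%z. kernel r (z - x))" "(LINT z|lborel. kernel r (z - x)) = 1"
proof -
 have i: "integrable lborel (kernel r :: 'a => real)"
 using kernel_integrable[OF assms, where 'a='a] integrable_completion[of "kernel r :: 'a => real" lborel] by simp
 have v: "(LINT y|lborel. kernel r (y::'a)) = 1"
 using kernel_integral[OF assms, where 'a='a] integral_completion[of "kernel r" "lborel :: 'a measure"] by simp
 show "integrable lborel (%z. kernel r (z - x))" using integrable_lborel_translate[OF i, of "-x"] by simp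
 then show "integrable lborel (%y. kernel r (x - y))" by (simp add: kernel_even[of r x])
 show "(LINT z|lborel. kernel r (z - x)) = 1" 
 using integral_lborel_translate[of "kernel r" "-x"] v by simp
 then show "(LINT y|lborel. kernel r (x - y)) = 1" by (simp add: kernel_even[of r x])
qed

lemma kernel_shift_integral_lebesgue:
 fixes x :: "'a::euclidean_space"
 assumes "0 < r"
 shows "integrable leb (%y. kernel r (x - y))" "(LINT y|leb. kernel r (x - y)) = 1"
 using kernel_shift_integral[OF assms] integrable_completion[of "%y. kernel r (x - y)" lborel]
 integral_completion[of "%y. kernel r (x - y)" lborel] by simp_all

lemma kernel_shift_measurable: "(%y. kernel r (x - y)) : borel_measurable leb"
 by (rule measurable_completion) measurable

lemma kernel_mult_integrable:
 fixes f :: "'a::euclidean_space => 'b::euclidean_space"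
 assumes "0 < r" "integrable leb f"
 shows "integrable leb (%y. kernel r (x - y) *\<^sub>R f y)"
proof -
 obtain M where M: "!!x::'a. kernel r x <= M" using kernel_bounded[OF assms(1)] by blast
 show ?thesis
 proof (rule intgb_bound)
 show "integrable leb (%y. M * norm (f y))" using assms(2) by simp
 show "(%y. kernel r (x - y) *\<^sub>R f y) : borel_measurable leb"
  using assms(2) by (intro borel_measurable_scaleR kernel_shift_measurable) auto
 show "AE y in leb. norm (kernel r (x - y) *\<^sub>R f y) <= norm (M * norm (f y))"
 proof (intro AE_I2)
  fix y
  have "kernel r (x - y) * norm (f y) <= M * norm (f y)" by (intro mult_right_mono M) auto
  then show "norm (kernel r (x - y) *\<^sub>R f y) <= norm (M * norm (f y))"
  using kernel_nonneg[OF assms(1), of "x - y"] by (simp add: abs_le_iff)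
 qed
 qed
qed

lemma mollify_cong_AE:
 assumes "AE y in leb. f y = g y" "f : borel_measurable leb" "g : borel_measurable leb"
 shows "mollify r f = mollify r g"
 unfolding mollify_def
 by (intro ext integral_cong_AE borel_measurable_scaleR kernel_shift_measurable assms)
  (use assms(1) in eventually_elim, simp)

text \<open>Fubini: the kernel has integral one in each variable.\<close>

lemma mollify_L1_bound:
 fixes f :: "'a::euclidean_space => 'b::euclidean_space"
 assumes r: "0 < r" and f: "integrable leb f"
 shows "integrable leb (mollify r f)"
 "(LINT x|leb. norm (mollify r f x)) <= (LINT x|leb. norm (f x))"
proof -
 obtain g where g: "integrable lborel g" "AE x in leb. f x = g x"
 using integrable_lebesgue_borel_ex[OF f] by blast
 have gm[measurable]: "g : borel_measurable lborel" using g(1) by simp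
 have gl: "integrable leb g" using integrable_completion[OF gm] g(1) by simp
 have fg: "mollify r f = mollify r g"
 using f gl by (intro mollify_cong_AE g) auto
 have mg: "mollify r g x = (LINT y|lborel. kernel r (x - y) *\<^sub>R g y)" for x
 unfolding mollify_def by (rule integral_completion) measurable
 define H where "H x y = kernel r (x - y) *\<^sub>R g y" for x y
 have Hm[measurable]: "case_prod H : borel_measurable (lborel \<Otimes>\<^sub>M lborel)"
 unfolding H_def case_prod_beta by measurable
 have nH: "(LINT x|lborel. norm (H x y)) = norm (g y)" for y
 using kernel_shift_integral(4)[OF r, of y] by (simp add: H_def kernel_nonneg[OF r])
 have "integrable (lborel \<Otimes>\<^sub>M lborel) (%(y,x). H x y)"
 proof (rule lborel_pair.Fubini_integrable)
 show "integrable lborel (%y. LINT x|lborel. norm ((%(y,x). H x y) (y, x)))"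
  using g(1) by (simp add: nH)
 show "AE y in lborel. integrable lborel (%x. (%(y,x). H x y) (y, x))"
  using kernel_shift_integral(3)[OF r] by (intro AE_I2) (simp add: H_def, intro integrable_scaleR_left)
 qed measurable
 then have Hi: "integrable (lborel \<Otimes>\<^sub>M lborel) (case_prod H)"
 using lborel_pair.integrable_product_swap_iff[of "case_prod H"] by simp
 have "integrable lborel (%x. LINT y|lborel. H x y)"
 using lborel_pair.integrable_fst[OF Hi] .
 moreover have mgH: "mollify r g = (%x. LINT y|lborel. H x y)" by (simp add: fun_eq_iff mg H_def)
 ultimately have mi: "integrable lborel (mollify r g)" by simp
 then show "integrable leb (mollify r f)"
 unfolding fg using integrable_completion[of "mollify r g" lborel] by simp
 have Hn: "integrable (lborel \<Otimes>\<^sub>M lborel) (%(x,y). norm (H x y))"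
 using integrable_norm[OF Hi] by (simp add: split_def)
 have "(LINT x|leb. norm (mollify r f x)) = (LINT x|lborel. norm (mollify r g x))"
 unfolding fg using mi by (intro integral_completion) auto
 also have "... <= (LINT x|lborel. LINT y|lborel. norm (H x y))"
 using mi lborel_pair.integrable_fst[OF Hn]
 by (intro integral_mono) (auto simp: mgH integral_norm_bound)
 also have "... = (LINT y|lborel. LINT x|lborel. norm (H x y))"
 using lborel_pair.Fubini_integral[OF Hn] by simp
 also have "... = (LINT y|lborel. norm (g y))" by (simp add: nH)
 also have "... = (LINT y|leb. norm (g y))" by (rule integral_completion[symmetric]) measurable
 also have "... = (LINT x|leb. norm (f x))"
 using f gl g(2) by (intro integral_cong_AE) auto
 finally show "(LINT x|leb. norm (mollify r f x)) <= (LINT x|leb. norm (f x))" .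
qed

lemma mollify_diff:
 assumes "0 < r" "integrable leb f" "integrable leb g"
 shows "mollify r (%x. f x - g x) x = mollify r f x - mollify r g x"
 unfolding mollify_def scaleR_diff_right
 by (rule LINT_diff) (intro kernel_mult_integrable assms)+

lemma mollify_inner:
 assumes "0 < r" "integrable leb f"
 shows "mollify r f x \<bullet> b = mollify r (%y. f y \<bullet> b) x"
proof -
 have "(LINT y|leb. (kernel r (x - y) *\<^sub>R f y) \<bullet> b) = mollify r f x \<bullet> b"
 unfolding mollify_def by (rule integral_inner_left) (auto intro: kernel_mult_integrable assms)
 then show ?thesis by (simp add: mollify_def)
qed

lemma kernel_shift_eq_0: "0 < r ==> y \<notin> ball x r ==> kernel r (x - y) = 0"
 by (rule kernel_eq_0) (auto simp: dist_norm[of x y])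

lemma mollify_eq_0:
 assumes "0 < r" "!!y. y : S ==> f y = 0" "ball x r <= S"
 shows "mollify r f x = 0"
proof -
 have "kernel r (x - y) *\<^sub>R f y = 0" for y
 proof (cases "y : ball x r")
 case False
 then show ?thesis by (simp add: kernel_shift_eq_0[OF assms(1) False])
 qed (use assms in auto)
 then show ?thesis by (simp only: mollify_def) simp
qed

lemma mollify_minus_const:
 fixes f :: "'a::euclidean_space => 'b::euclidean_space"
 assumes "0 < r" "integrable leb f"
 shows "mollify r f x - c = (LINT y|leb. kernel r (x - y) *\<^sub>R (f y - c))"
proof -
 have "(LINT y|leb. kernel r (x - y) *\<^sub>R (f y - c))
  = (LINT y|leb. kernel r (x - y) *\<^sub>R f y) - (LINT y|leb. kernel r (x - y) *\<^sub>R c)"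
 unfolding scaleR_diff_right
 using kernel_mult_integrable[OF assms, of x] kernel_shift_integral_lebesgue(1)[OF assms(1), of x]
 by (intro LINT_diff) auto
 also have "(LINT y|leb. kernel r (x - y) *\<^sub>R c) = c"
 using kernel_shift_integral_lebesgue[OF assms(1), of x] by simp
 finally show ?thesis by (simp add: mollify_def)
qed

text \<open>For continuous functions with compact support the averages converge uniformly.  The general
 case follows by density, because averaging does not increase the \<open>L\<^sup>1\<close> norm.\<close>

theorem mollify_tendsto_L1:
 fixes f :: "'a::euclidean_space => 'b::euclidean_space"
 assumes f: "integrable leb f" and r: "!!n. 0 < r n" "r \<leadsto> 0"
 shows "(%n. LINT x|leb. norm (mollify (r n) f x - f x)) \<leadsto> 0"
proof (rule LIMSEQ_I)
 fix e :: real assume e: "0 < e"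
 then have e4: "0 < e / 4" by simp
 obtain g R where g: "continuous_on UNIV g" "!!x. x \<notin> cball 0 R ==> g x = 0"
  "(LINT x|leb. norm (f x - g x)) < e / 4"
 using continuous_compact_support_L1_dense[OF f e4] by blast
 have gi: "integrable leb g"
 using integrable_continuous_compact_support(2)[OF g(1) compact_cball] g(2) by blast
 define V where "V = measure leb (cball (0::'a) (R + 1))"
 have Vi: "integrable leb (indicat_real (cball (0::'a) (R + 1)))"
 using emeasure_lborel_cball_finite[of "0::'a" "R + 1"] by auto
 define d where "d = e / 4 / (V + 1)"
 have V0: "0 <= V" by (simp add: V_def)
 have d: "0 < d" unfolding d_def using e V0 by (intro divide_pos_pos) auto
 have dV: "d * V < e / 4"
 proof -
 have "V / (V + 1) < 1" using V0 by (simp add: divide_less_eq)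
 from mult_strict_left_mono[OF this e4] show ?thesis by (simp add: d_def)
 qed
 have "uniformly_continuous_on (cball 0 (R + 2)) g"
 by (rule compact_uniformly_continuous[OF continuous_on_subset[OF g(1)]]) auto
 then obtain s where s: "0 < s" "!!x y. x : cball 0 (R+2) ==> y : cball 0 (R+2) ==> dist y x < s ==> dist (g y) (g x) < d"
 using d unfolding uniformly_continuous_on_def by metis
 have unif: "norm (mollify q g x - g x) <= d * indicat_real (cball 0 (R + 1)) x"
 if q: "0 < q" "q < s" "q < 1" for q x
 proof (cases "x : cball 0 (R + 1)")
 case True
 have "norm (mollify q g x - g x) <= (LINT y|leb. norm (kernel q (x - y) *\<^sub>R (g y - g x)))"
  unfolding mollify_minus_const[OF q(1) gi] by (rule integral_norm_bound)
 also have "... <= (LINT y|leb. kernel q (x - y) * d)"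
 proof (rule integral_mono')
  show "integrable leb (%y. kernel q (x - y) * d)"
  using kernel_shift_integral_lebesgue(1)[OF q(1), of x] by simp
  show "0 <= kernel q (x - y) * d" for y using kernel_nonneg[OF q(1), of "x-y"] d by simp
  show "norm (kernel q (x - y) *\<^sub>R (g y - g x)) <= kernel q (x - y) * d" for y
  proof (cases "y : ball x q")
  case yT: True
  have "norm y <= R + 2" using True yT norm_triangle_sub[of y x] q by (simp add: dist_norm norm_minus_commute)
  then have "dist (g y) (g x) < d" using True yT q by (intro s) (auto simp: dist_commute)
  then show ?thesis using kernel_nonneg[OF q(1), of "x-y"]
   by (auto simp: dist_norm intro!: mult_left_mono)
  next
  case False
  then have "kernel q (x - y) = 0" by (rule kernel_shift_eq_0[OF q(1)])
  then show ?thesis by simp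
  qed
 qed
 also have "... = d" using kernel_shift_integral_lebesgue[OF q(1), of x] by simp
 finally show ?thesis using True by simp
 next
 case False
 have "mollify q g x = 0"
 proof (rule mollify_eq_0[OF q(1), of "- cball 0 R"])
  show "ball x q <= - cball 0 R"
  proof
  fix y assume "y : ball x q"
  then have "norm x - norm y < 1" using norm_triangle_ineq2[of x y] q by (simp add: dist_norm)
  then show "y : - cball 0 R" using False by auto
  qed
 qed (use g(2) in auto)
 moreover have "g x = 0" using False by (intro g(2)) auto
 ultimately show ?thesis using d by simp
 qed
 obtain N where N: "!!n. n >= N ==> r n < min s 1"
 using order_tendstoD(2)[OF r(2), of "min s 1"] s(1) unfolding eventually_sequentially by fastforce
 show "\<exists>N. \<forall>n\<ge>N. norm ((LINT x|leb. norm (mollify (r n) f x - f x)) - 0) < e"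
 proof (intro exI allI impI)
 fix n assume "n >= N"
 then have q: "0 < r n" "r n < s" "r n < 1" using N r(1) by auto
 let ?m = "mollify (r n)"
 have fg: "integrable leb (%x. f x - g x)" using f gi by simp
 note mi = mollify_L1_bound(1)[OF q(1) f] mollify_L1_bound(1)[OF q(1) gi] mollify_L1_bound(1)[OF q(1) fg]
 have "(LINT x|leb. norm (?m f x - f x))
  <= (LINT x|leb. norm (?m (%x. f x - g x) x) + (norm (?m g x - g x) + norm (f x - g x)))"
 proof (rule integral_mono)
  fix x
  have eq: "?m f x - f x = ?m (%x. f x - g x) x + ((?m g x - g x) + - (f x - g x))"
  by (simp add: mollify_diff[OF q(1) f gi])
  have tri: "norm (a + (b + - c)) <= norm a + (norm b + norm c)" for a b c :: 'b
  using norm_triangle_ineq[of a "b + - c"] norm_triangle_ineq[of b "- c"] by simp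
  show "norm (?m f x - f x) <= norm (?m (%x. f x - g x) x) + (norm (?m g x - g x) + norm (f x - g x))"
  unfolding eq by (rule tri)
 qed (use mi f gi fg in simp_all)
 also have "... = (LINT x|leb. norm (?m (%x. f x - g x) x)) + ((LINT x|leb. norm (?m g x - g x)) + (LINT x|leb. norm (f x - g x)))"
  using mi f gi fg by simp
 finally have "(LINT x|leb. norm (?m f x - f x)) <= (LINT x|leb. norm (?m (%x. f x - g x) x))
  + ((LINT x|leb. norm (?m g x - g x)) + (LINT x|leb. norm (f x - g x)))" .
 moreover have "(LINT x|leb. norm (?m (%x. f x - g x) x)) < e / 4"
  using mollify_L1_bound(2)[OF q(1) fg] g(3) by simp
 moreover have "(LINT x|leb. norm (?m g x - g x)) <= (LINT x|leb. d * indicat_real (cball (0::'a) (R + 1)) x)"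
  by (rule integral_mono) (use unif[OF q] mi gi Vi in simp_all)
 moreover have "(LINT x|leb. d * indicat_real (cball (0::'a) (R + 1)) x) = d * V" by (simp add: V_def)
 moreover have "0 <= (LINT x|leb. norm (?m f x - f x))" by simp
 ultimately have "\<bar>LINT x|leb. norm (?m f x - f x)\<bar> < e" using dV g(3) by linarith
 then show "norm ((LINT x|leb. norm (?m f x - f x)) - 0) < e" by simp
 qed
qed



definition convol :: "('a::euclidean_space => real) => ('a => real) => 'a => real" where
 "convol phi f x = (LINT y|leb. phi (x - y) * f y)"

lemma mollify_eq_convol: "mollify r f = convol (kernel r) f"
 by (simp add: mollify_def convol_def fun_eq_iff)

lemma frechet_derivative_eq_0_outside:
 assumes "closed S" "!!x. x \<notin> S ==> phi x = (0::real)" "x \<notin> S"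
 shows "frechet_derivative phi (at x) = (%h. 0)"
proof -
 have "(phi has_derivative (%h. 0)) (at x)"
 by (rule has_derivative_transform_within_open[of "%_. 0" _ _ _ "- S"])
  (use assms in \<open>auto simp: open_Compl\<close>)
 then show ?thesis by (rule frechet_derivativeI)
qed

lemma frechet_derivative_basis_sum:
 assumes "phi differentiable (at x)"
 shows "frechet_derivative phi (at x) h = (\<Sum>b\<in>Basis. (h \<bullet> b) * frechet_derivative phi (at x) b)"
proof -
 interpret linear "frechet_derivative phi (at x)" using assms by (rule linear_frechet_derivative)
 have "frechet_derivative phi (at x) (\<Sum>b\<in>Basis. (h \<bullet> b) *\<^sub>R b) = (\<Sum>b\<in>Basis. (h \<bullet> b) *\<^sub>R frechet_derivative phi (at x) b)"
 by (simp add: sum scaleR)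
 then show ?thesis by (simp add: euclidean_representation)
qed

lemma continuous_compact_support_bounded:
 fixes phi :: "'a::euclidean_space => real"
 assumes "continuous_on UNIV phi" "compact K" "!!x. x \<notin> K ==> phi x = 0"
 obtains M where "0 <= M" "!!x. \<bar>phi x\<bar> <= M"
proof -
 have "bounded (phi ` K)" by (intro compact_imp_bounded compact_continuous_image continuous_on_subset[OF assms(1)] assms) auto
 then obtain B where B: "!!x. x : K ==> \<bar>phi x\<bar> <= B" by (auto simp: bounded_iff)
 show ?thesis by (rule that[of "max B 0"]) (use B assms(3) in \<open>force simp: max_def\<close>)+
qed

lemma C1_compact_support_Lipschitz:
 fixes phi :: "'a::euclidean_space => real"
 assumes phi: "C_k (Suc 0) phi" and K: "compact K" "!!x. x \<notin> K ==> phi x = 0"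
 obtains M where "0 <= M" "!!x h. \<bar>frechet_derivative phi (at x) h\<bar> <= M * norm h"
 "!!x y. \<bar>phi y - phi x\<bar> <= M * norm (y - x)"
proof -
 have "\<exists>M. 0 <= M & (\<forall>x. \<bar>frechet_derivative phi (at x) b\<bar> <= M)" if "b : Basis" for b
 proof -
 have "continuous_on UNIV (%x. frechet_derivative phi (at x) b)" using C_k_SucD(2)[OF phi that] by simp
 from continuous_compact_support_bounded[OF this K(1)] obtain M
  where "0 <= M" "!!x. \<bar>frechet_derivative phi (at x) b\<bar> <= M"
  using frechet_derivative_eq_0_outside[OF compact_imp_closed[OF K(1)] K(2)] by auto
 then show ?thesis by blast
 qed
 then obtain m where m: "!!b. b : Basis ==> 0 <= m b" "!!b x. b : Basis ==> \<bar>frechet_derivative phi (at x) b\<bar> <= m b"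
 by metis
 define M where "M = (\<Sum>b\<in>Basis. m (b::'a))"
 have M0: "0 <= M" unfolding M_def by (intro sum_nonneg m)
 have D: "\<bar>frechet_derivative phi (at x) h\<bar> <= M * norm h" for x h
 proof -
 have "phi differentiable (at x)" using phi by simp
 then have "\<bar>frechet_derivative phi (at x) h\<bar> <= (\<Sum>b\<in>Basis. \<bar>(h \<bullet> b) * frechet_derivative phi (at x) b\<bar>)"
  by (subst frechet_derivative_basis_sum) (auto intro: sum_abs)
 also have "... <= (\<Sum>b\<in>Basis. norm h * m b)"
  unfolding abs_mult by (intro sum_mono mult_mono Basis_le_norm m) auto
 finally show ?thesis by (simp add: M_def sum_distrib_left sum_distrib_right mult.commute)
 qed
 have "\<bar>phi y - phi x\<bar> <= M * norm (y - x)" for x y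
 proof -
 have "norm (phi y - phi x) <= M * norm (y - x)"
 proof (rule differentiable_bound[of UNIV])
  show "(phi has_derivative frechet_derivative phi (at z)) (at z within UNIV)" for z using C_k_SucD(1)[OF phi] by simp
  show "onorm (frechet_derivative phi (at z)) <= M" for z by (rule onorm_bound[OF M0]) (use D in auto)
 qed auto
 then show ?thesis by simp
 qed
 with M0 D that show ?thesis by blast
qed

lemma convol_integrable:
 fixes phi f :: "'a::euclidean_space => real"
 assumes "continuous_on UNIV phi" "!!x. \<bar>phi x\<bar> <= M" "integrable leb f"
 shows "integrable leb (%y. phi (x - y) * f y)"
proof (rule intgb_bound)
 show "integrable leb (%y. M * norm (f y))" using assms(3) by simp
 have "(%y. phi (x - y)) : borel_measurable leb"
 by (rule continuous_imp_lebesgue_measurable) (intro continuous_on_compose2[OF assms(1)] continuous_intros, auto)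
 then show "(%y. phi (x - y) * f y) : borel_measurable leb"
 using assms(3) by (intro borel_measurable_times) auto
 show "AE y in leb. norm (phi (x - y) * f y) <= norm (M * norm (f y))"
 proof (intro AE_I2)
 fix y
 have "\<bar>phi (x - y)\<bar> * \<bar>f y\<bar> <= M * \<bar>f y\<bar>" by (intro mult_right_mono assms) auto
 also have "... <= \<bar>M * \<bar>f y\<bar>\<bar>" by simp
 finally show "norm (phi (x - y) * f y) <= norm (M * norm (f y))" by (simp add: abs_mult)
 qed
qed

text \<open>The difference quotients of \<open>phi\<close> are bounded by its Lipschitz constant, so that the derivative may
 be taken under the integral sign by dominated convergence.\<close>

lemma convol_has_derivative:
 fixes f :: "'a::euclidean_space => real"
 assumes phi: "C_k (Suc 0) phi" and K: "compact K" "!!x. x \<notin> K ==> phi x = 0" and f: "integrable leb f"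
 shows "(convol phi f has_derivative
 (%h. \<Sum>b\<in>Basis. (h \<bullet> b) * convol (%z. frechet_derivative phi (at z) b) f x)) (at x)"
proof -
 obtain M where M: "0 <= M" "!!x h. \<bar>frechet_derivative phi (at x) h\<bar> <= M * norm h"
 "!!x y. \<bar>phi y - phi x\<bar> <= M * norm (y - x)"
 using C1_compact_support_Lipschitz[OF phi K] by blast
 have c: "continuous_on UNIV phi" using C_k_mono_Suc[OF phi] by simp
 obtain M0 where M0: "!!x. \<bar>phi x\<bar> <= M0" using continuous_compact_support_bounded[OF c K] by blast
 let ?D = "%z. frechet_derivative phi (at z)"
 let ?L = "%h. \<Sum>b\<in>Basis. (h \<bullet> b) * convol (%z. ?D z b) f x"
 have iD: "integrable leb (%y. ?D (x - y) b * f y)" if "b : Basis" for b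
 by (rule convol_integrable[where M = "M * norm b", OF _ M(2) f]) (use C_k_SucD(2)[OF phi that] in simp)
 have df: "phi differentiable (at z)" for z using phi by simp
 have DL: "(%y. ?D (x - y) h * f y) = (%y. \<Sum>b\<in>Basis. (h \<bullet> b) * (?D (x - y) b * f y))" for h
 by (rule ext, subst frechet_derivative_basis_sum[OF df]) (simp add: sum_distrib_right mult.assoc)
 have iL: "integrable leb (%y. ?D (x - y) h * f y)" "?L h = (LINT y|leb. ?D (x - y) h * f y)" for h
 by (subst DL, use iD in \<open>auto intro!: Bochner_Integration.integrable_sum\<close>)
  (subst DL, use iD in \<open>simp add: LINT_sum convol_def\<close>)
 have iphi: "integrable leb (%y. phi (z - y) * f y)" for z by (rule convol_integrable[OF c M0 f])
 show ?thesis
 unfolding has_derivative_at tendsto_at_iff_sequentially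
 proof (intro conjI allI impI)
 show "bounded_linear ?L"
  by (intro bounded_linear_sum bounded_linear_mult_left[THEN bounded_linear_compose] bounded_linear_inner_left)
 next
 fix X assume X: "\<forall>i. X i : UNIV - {0}" "X \<leadsto> (0::'a)"
 define q where "q n y = (phi (x + X n - y) - phi (x - y) - ?D (x - y) (X n)) / norm (X n)" for n y
 have eq: "(convol phi f (x + X n) - convol phi f x - ?L (X n)) / norm (X n) = (LINT y|leb. q n y * f y)" for n
 proof -
  have "(LINT y|leb. q n y * f y) = (LINT y|leb. (phi (x + X n - y) * f y - phi (x - y) * f y - ?D (x - y) (X n) * f y) / norm (X n))"
  by (rule LINT_cong) (auto simp: q_def algebra_simps)
  also have "... = (convol phi f (x + X n) - convol phi f x - ?L (X n)) / norm (X n)"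
  unfolding iL(2) using iphi iL(1) by (simp add: convol_def)
  finally show ?thesis by simp
 qed
 have "(%n. LINT y|leb. q n y * f y) \<leadsto> (LINT y|(leb::'a measure). 0)"
 proof (rule integral_dominated_convergence[where w = "%y. 2 * M * norm (f y)"])
  have "(%y. q n y * f y) = (%y. (phi (x + X n - y) * f y - phi (x - y) * f y - ?D (x - y) (X n) * f y) / norm (X n))" for n
  by (auto simp: q_def algebra_simps fun_eq_iff)
  then have "integrable leb (%y. q n y * f y)" for n
  using iphi[of "x + X n"] iphi[of x] iL(1)[of "X n"] by simp
  then show "(%y. q n y * f y) : borel_measurable leb" for n by (rule borel_measurable_integrable)
  show "AE y in leb. (%n. q n y * f y) \<leadsto> 0"
  proof (intro AE_I2 tendsto_mult_left_zero)
  fix y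
  have "((%h. norm (phi (x - y + h) - phi (x - y) - ?D (x - y) h) / norm h) \<longlongrightarrow> 0) (at 0)"
   using C_k_SucD(1)[OF phi, of "x - y"] unfolding has_derivative_at by blast
  then have "(%n. norm (phi (x - y + X n) - phi (x - y) - ?D (x - y) (X n)) / norm (X n)) \<leadsto> 0"
   unfolding tendsto_at_iff_sequentially using X by (auto simp: o_def)
  then have "(%n. norm (q n y)) \<leadsto> 0" by (simp add: q_def algebra_simps)
  then show "(%n. q n y) \<leadsto> 0" by (rule tendsto_norm_zero_cancel)
  qed
  show "AE y in leb. norm (q n y * f y) <= 2 * M * norm (f y)" for n
  proof (intro AE_I2)
  fix y
  have "\<bar>phi (x + X n - y) - phi (x - y) - ?D (x - y) (X n)\<bar> <= 2 * M * norm (X n)"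
   using M(3)[of "x + X n - y" "x - y"] M(2)[of "x - y" "X n"] by simp
  then have "\<bar>q n y\<bar> <= 2 * M" using X(1) by (simp add: q_def divide_le_eq)
  then have "\<bar>q n y\<bar> * \<bar>f y\<bar> <= 2 * M * \<bar>f y\<bar>" by (intro mult_right_mono) auto
  then show "norm (q n y * f y) <= 2 * M * norm (f y)" by (simp add: abs_mult)
  qed
 qed (use f in auto)
 then have "(%n. LINT y|leb. q n y * f y) \<leadsto> 0" by simp
 then have "(%n. norm ((convol phi f (x + X n) - convol phi f x - ?L (X n)) / norm (X n))) \<leadsto> 0"
  unfolding eq real_norm_def by (rule tendsto_rabs_zero)
 then show "((%h. norm (convol phi f (x + h) - convol phi f x - ?L h) / norm h) \<circ> X) \<leadsto> 0"
  by (simp add: o_def)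
 qed
qed

lemma C_k_convol:
 fixes f :: "'a::euclidean_space => real"
 assumes "!!k. C_k k phi" and K: "compact K" "!!x. x \<notin> K ==> phi x = 0" and f: "integrable leb f"
 shows "C_k k (convol phi f)"
 using assms(1) K(2)
proof (induction k arbitrary: phi)
 case 0
 have "isCont (convol phi f) x" for x
 using has_derivative_continuous[OF convol_has_derivative[OF 0(1) K(1) 0(2) f]] .
 then show ?case by (simp add: continuous_at_imp_continuous_on)
next
 case (Suc k)
 show ?case
 proof (rule C_k_SucI[OF convol_has_derivative[OF Suc.prems(1) K(1) Suc.prems(2) f]])
 fix b :: 'a assume b: "b : Basis"
 have "(%x. \<Sum>c\<in>Basis. (b \<bullet> c) * convol (%z. frechet_derivative phi (at z) c) f x)
  = convol (%z. frechet_derivative phi (at z) b) f"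
 proof (rule ext)
  fix x
  have "(\<Sum>c\<in>Basis. (b \<bullet> c) * convol (%z. frechet_derivative phi (at z) c) f x)
  = (\<Sum>c\<in>Basis. if c = b then convol (%z. frechet_derivative phi (at z) c) f x else 0)"
  using b by (intro sum.cong) (auto simp: inner_Basis)
  then show "(\<Sum>c\<in>Basis. (b \<bullet> c) * convol (%z. frechet_derivative phi (at z) c) f x)
  = convol (%z. frechet_derivative phi (at z) b) f x" using b by simp
 qed
 moreover have "C_k k (convol (%z. frechet_derivative phi (at z) b) f)"
 proof (rule Suc.IH)
  show "C_k j (%z. frechet_derivative phi (at z) b)" for j
  using C_k_SucD(2)[OF Suc.prems(1)[of "Suc j"] b] .
  show "frechet_derivative phi (at z) b = 0" if "z \<notin> K" for z
  using frechet_derivative_eq_0_outside[OF compact_imp_closed[OF K(1)] Suc.prems(2) that] by simp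
 qed
 ultimately show "C_k k (%x. \<Sum>c\<in>Basis. (b \<bullet> c) * convol (%z. frechet_derivative phi (at z) c) f x)" by simp
 qed
qed

lemma kernel_eq_0_cball: "0 < r ==> x \<notin> cball 0 r ==> kernel r x = 0"
 by (rule kernel_eq_0) auto

lemma C_k_mollify:
 fixes f :: "'a::euclidean_space => real"
 assumes "0 < r" "integrable leb f"
 shows "C_k k (mollify r f)"
 unfolding mollify_eq_convol
 by (rule C_k_convol[OF C_k_kernel compact_cball[of 0 r] kernel_eq_0_cball assms(2)]) (use assms in auto)

lemma mollify_frechet_derivative:
 fixes f :: "'a::euclidean_space => real"
 assumes "0 < r" "integrable leb f" "b : Basis"
 shows "frechet_derivative (mollify r f) (at x) b = convol (%z. frechet_derivative (kernel r) (at z) b) f x"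
proof -
 have "frechet_derivative (mollify r f) (at x) b
 = (\<Sum>c\<in>Basis. (b \<bullet> c) * convol (%z. frechet_derivative (kernel r) (at z) c) f x)"
 unfolding mollify_eq_convol
 by (subst frechet_derivativeI[OF convol_has_derivative[OF C_k_kernel compact_cball[of 0 r]
   kernel_eq_0_cball[OF assms(1)] assms(2)]]) auto
 also have "... = (\<Sum>c\<in>Basis. if c = b then convol (%z. frechet_derivative (kernel r) (at z) c) f x else 0)"
 using assms(3) by (intro sum.cong) (auto simp: inner_Basis)
 finally show ?thesis using assms(3) by simp
qed

subsection \<open>Mollification in \<open>L^2\<close>\<close>

lemma mollify_norm_square_le:
 fixes f :: "'a::euclidean_space => 'b::euclidean_space"
 assumes r: "0 < r" and f: "integrable leb f" "integrable leb (%y. (norm (f y))^2)"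
 shows "(norm (mollify r f x))^2 <= mollify r (%y. (norm (f y))^2) x"
proof -
 let ?k = "%y. kernel r (x - y)" and ?c = "mollify r f x"
 note k = kernel_shift_integral_lebesgue[OF r, of x]
 have i1: "integrable leb (%y. ?k y * (norm (f y))^2)" using kernel_mult_integrable[OF r f(2), of x] by simp
 have i2: "integrable leb (%y. (?k y *\<^sub>R f y) \<bullet> ?c)"
 using kernel_mult_integrable[OF r f(1), of x] by (intro integrable_inner_left) auto
 have "0 <= (LINT y|leb. ?k y * (norm (f y - ?c))^2)"
 by (intro LINT_nonneg mult_nonneg_nonneg kernel_nonneg[OF r]) auto
 also have "... = (LINT y|leb. ?k y * (norm (f y))^2 - 2 * ((?k y *\<^sub>R f y) \<bullet> ?c) + ?k y * (norm ?c)^2)"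
 by (rule LINT_cong)
  (auto simp: power2_norm_eq_inner inner_diff inner_commute algebra_simps)
 also have "... = (LINT y|leb. ?k y * (norm (f y))^2) - 2 * (LINT y|leb. (?k y *\<^sub>R f y) \<bullet> ?c) + (LINT y|leb. ?k y * (norm ?c)^2)"
 using i1 i2 k(1) by simp
 also have "(LINT y|leb. (?k y *\<^sub>R f y) \<bullet> ?c) = (norm ?c)^2"
 using integral_inner_left[OF kernel_mult_integrable[OF r f(1), of x], of ?c]
 by (simp add: mollify_def power2_norm_eq_inner)
 finally show ?thesis using k by (simp add: mollify_def)
qed

lemma mollify_L2_bound:
 fixes f :: "'a::euclidean_space => 'b::euclidean_space"
 assumes r: "0 < r" and f: "integrable leb f" "integrable leb (%y. (norm (f y))^2)"
 shows "integrable leb (%x. (norm (mollify r f x))^2)"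
 "(LINT x|leb. (norm (mollify r f x))^2) <= (LINT x|leb. (norm (f x))^2)"
proof -
 note m = mollify_L1_bound[OF r f(2)]
 have p: "0 <= mollify r (%y. (norm (f y))^2) x" for x
 using mollify_norm_square_le[OF r f, of x] zero_le_power2 order_trans by blast
 show i: "integrable leb (%x. (norm (mollify r f x))^2)"
 by (rule intgb_bound[OF m(1)])
  (use mollify_norm_square_le[OF r f] p mollify_L1_bound(1)[OF r f(1)] in auto)
 have "(LINT x|leb. (norm (mollify r f x))^2) <= (LINT x|leb. norm (mollify r (%y. (norm (f y))^2) x))"
 using i m(1) p mollify_norm_square_le[OF r f] by (intro integral_mono) auto
 also have "... <= (LINT x|leb. (norm (f x))^2)" using m(2) by simp
 finally show "(LINT x|leb. (norm (mollify r f x))^2) <= (LINT x|leb. (norm (f x))^2)" .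
qed

lemma norm_add_square_le: "(norm (a + b :: 'b::real_normed_vector))^2 <= 2 * (norm a)^2 + 2 * (norm b)^2"
proof -
 have "(norm (a + b))^2 <= (norm a + norm b)^2" by (intro power_mono norm_triangle_ineq) auto
 also have "... <= 2 * (norm a)^2 + 2 * (norm b)^2"
 using zero_le_power2[of "norm a - norm b"] by (simp add: power2_eq_square algebra_simps)
 finally show ?thesis .
qed

text \<open>For a bounded function \<open>L^2\<close> convergence follows from \<open>L\<^sup>1\<close> convergence; the part where the function is large
 has a small \<open>L^2\<close> norm, which averaging does not increase.\<close>

theorem mollify_tendsto_L2:
 fixes f :: "'a::euclidean_space => 'b::euclidean_space"
 assumes f: "integrable leb f" "integrable leb (%y. (norm (f y))^2)"
 and r: "!!n. 0 < r n" "r \<leadsto> 0"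
 shows "(%n. LINT x|leb. (norm (mollify (r n) f x - f x))^2) \<leadsto> 0"
proof (rule LIMSEQ_I)
 fix e :: real assume e: "0 < e"
 define g where "g k x = (if norm (f x) <= real k then f x else 0)" for k x
 define h where "h k x = (if norm (f x) <= real k then 0 else f x)" for k x
 have fm[measurable]: "f : borel_measurable leb" using f by auto
 have gm[measurable]: "g k : borel_measurable leb" "h k : borel_measurable leb" for k
 unfolding g_def h_def by measurable
 have gi: "integrable leb (g k)" "integrable leb (h k)"
  "integrable leb (%x. (norm (g k x))^2)" "integrable leb (%x. (norm (h k x))^2)" for k
 by (rule intgb_bound[OF f(1)], measurable, simp add: g_def,
  rule intgb_bound[OF f(1)], measurable, simp add: h_def,
  rule intgb_bound[OF f(2)], measurable, simp add: g_def,
  rule intgb_bound[OF f(2)], measurable, simp add: h_def)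
 have "(%k. LINT x|leb. (norm (h k x))^2) \<leadsto> (LINT x|(leb::'a measure). 0)"
 proof (rule integral_dominated_convergence[where w = "%x. (norm (f x))^2"])
 show "AE x in leb. (%k. (norm (h k x))^2) \<leadsto> 0"
 proof (intro AE_I2 tendsto_eventually)
  fix x
  obtain N where "norm (f x) <= real N" using real_arch_simple by blast
  then show "\<forall>\<^sub>F k in sequentially. (norm (h k x))^2 = 0"
  by (intro eventually_sequentiallyI[of N]) (auto simp: h_def)
 qed
 qed (use f gi in \<open>auto simp: h_def\<close>)
 then have "\<forall>\<^sub>F k in sequentially. (LINT x|leb. (norm (h k x))^2) < e / 16"
 using e order_tendstoD(2)[of _ 0 sequentially "e/16"] by simp
 then obtain k where k: "(LINT x|leb. (norm (h k x))^2) < e / 16"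
 by (auto simp: eventually_sequentially)
 have lim0: "(%n. 4 * real k * (LINT x|leb. norm (mollify (r n) (g k) x - g k x))) \<leadsto> 0"
 by (intro tendsto_mult_right_zero mollify_tendsto_L1 gi r)
 have "\<forall>\<^sub>F n in sequentially. 4 * real k * (LINT x|leb. norm (mollify (r n) (g k) x - g k x)) < e / 2"
 by (rule order_tendstoD(2)[OF lim0]) (use e in simp)
 then obtain N where N: "!!n. n >= N ==> 4 * real k * (LINT x|leb. norm (mollify (r n) (g k) x - g k x)) < e / 2"
 by (auto simp: eventually_sequentially)
 show "\<exists>N. \<forall>n\<ge>N. norm ((LINT x|leb. (norm (mollify (r n) f x - f x))^2) - 0) < e"
 proof (intro exI allI impI)
 fix n assume n: "n >= N"
 let ?m = "mollify (r n)"
 have gb: "norm (?m (g k) x) <= real k" for x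
 proof -
  have "norm (?m (g k) x) <= (LINT y|leb. norm (kernel (r n) (x - y) *\<^sub>R g k y))"
  unfolding mollify_def by (rule integral_norm_bound)
  also have "... <= (LINT y|leb. kernel (r n) (x - y) * real k)"
  using kernel_shift_integral_lebesgue(1)[OF r(1), of n x]
  by (intro integral_mono') (auto simp: g_def kernel_nonneg[OF r(1)] intro!: mult_left_mono)
  finally show ?thesis using kernel_shift_integral_lebesgue[OF r(1), of n x] by simp
 qed
 have fgh: "f = (%x. g k x - (- h k x))" by (auto simp: g_def h_def)
 have hn: "integrable leb (%x. - h k x)" using gi by simp
 have mh: "?m (%x. - h k x) x = - ?m (h k) x" for x by (simp add: mollify_def)
 have mf: "?m f x = ?m (g k) x + ?m (h k) x" for x
  by (subst fgh, subst mollify_diff[OF r(1) gi(1) hn]) (simp add: mh)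
 note mi = mollify_L1_bound(1)[OF r(1) gi(1), of n k] mollify_L2_bound[OF r(1) gi(2) gi(4), of n k]
 have pt: "(norm (?m f x - f x))^2 <= 4 * real k * norm (?m (g k) x - g k x) + (4 * (norm (?m (h k) x))^2 + 4 * (norm (h k x))^2)" for x
 proof -
  have "?m f x - f x = (?m (g k) x - g k x) + (?m (h k) x + - h k x)"
  unfolding mf by (simp add: g_def h_def)
  then have "(norm (?m f x - f x))^2 <= 2 * (norm (?m (g k) x - g k x))^2 + 2 * (norm (?m (h k) x + - h k x))^2"
  by (simp only: norm_add_square_le)
  moreover have "(norm (?m (h k) x + - h k x))^2 <= 2 * (norm (?m (h k) x))^2 + 2 * (norm (h k x))^2"
  using norm_add_square_le[of "?m (h k) x" "- h k x"] by simp
  moreover have "(norm (?m (g k) x - g k x))^2 <= 2 * real k * norm (?m (g k) x - g k x)"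
  proof -
  have "norm (g k x) <= real k" by (simp add: g_def)
  then have "norm (?m (g k) x - g k x) <= 2 * real k"
   using gb[of x] norm_triangle_ineq4[of "?m (g k) x" "g k x"] by linarith
  then show ?thesis unfolding power2_eq_square by (intro mult_right_mono) auto
  qed
  ultimately show ?thesis by linarith
 qed
 have "(LINT x|leb. (norm (?m f x - f x))^2)
  <= (LINT x|leb. 4 * real k * norm (?m (g k) x - g k x) + (4 * (norm (?m (h k) x))^2 + 4 * (norm (h k x))^2))"
  by (rule integral_mono'[OF _ pt]) (use mi(1,2) gi in auto)
 also have "... = 4 * real k * (LINT x|leb. norm (?m (g k) x - g k x))
  + (4 * (LINT x|leb. (norm (?m (h k) x))^2) + 4 * (LINT x|leb. (norm (h k x))^2))"
  using mi(1,2) gi by simp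
 finally have "(LINT x|leb. (norm (?m f x - f x))^2) < e"
  using N[OF n] mi(3) k by linarith
 then show "norm ((LINT x|leb. (norm (?m f x - f x))^2) - 0) < e" by simp
 qed
qed



section \<open>Calculus of weak gradients\<close>

definition grad :: "('a::euclidean_space => real) => 'a => 'a" where
 "grad phi x = (\<Sum>b\<in>Basis. frechet_derivative phi (at x) b *\<^sub>R b)"

lemma grad_inner_Basis: "b : Basis ==> grad phi x \<bullet> b = frechet_derivative phi (at x) b"
 by (simp add: grad_def inner_sum_left inner_Basis if_distrib cong: if_cong)

lemma grad_eq_0_outside:
 assumes "closed S" "!!x. x \<notin> S ==> phi x = (0::real)" "x \<notin> S"
 shows "grad phi x = 0"
 by (simp add: grad_def frechet_derivative_eq_0_outside[OF assms])

lemma grad_const_on_open: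
 assumes "open U" "!!x. x : U ==> phi x = (c::real)" "x : U"
 shows "grad phi x = 0"
proof -
 have "(phi has_derivative (%h. 0)) (at x)"
 by (rule has_derivative_transform_within_open[of "%_. c" _ _ _ U]) (use assms in auto)
 then show ?thesis by (simp add: grad_def frechet_derivativeI)
qed

definition smooth :: "('a::euclidean_space => real) => bool" where
 "smooth psi \<longleftrightarrow> (\<forall>k. C_k k psi)"

lemma smooth_differentiable: "smooth psi ==> psi differentiable (at x)"
 unfolding smooth_def by (metis C_k.simps(2))

lemma smooth_continuous: "smooth psi ==> continuous_on A psi"
 unfolding smooth_def by (metis C_k.simps(1) continuous_on_subset subset_UNIV)

lemma smooth_partial: "smooth psi ==> b : Basis ==> smooth (%x. frechet_derivative psi (at x) b)"
 unfolding smooth_def by (metis C_k.simps(2))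

lemma smooth_grad_continuous: "smooth psi ==> continuous_on A (grad psi)"
 unfolding grad_def by (intro continuous_intros smooth_continuous smooth_partial)

lemma smooth_mult: "smooth f ==> smooth g ==> smooth (%x. f x * g x)"
 unfolding smooth_def by (simp add: C_k_mult)

lemma smooth_diff: "smooth f ==> smooth g ==> smooth (%x. f x - g x)"
 unfolding smooth_def by (simp add: C_k_diff)

lemma smooth_const: "smooth (%x. c)" unfolding smooth_def by (simp add: C_k_const)

lemma frechet_derivative_mult:
 fixes f g :: "'a::euclidean_space => real"
 assumes "f differentiable (at x)" "g differentiable (at x)"
 shows "frechet_derivative (%x. f x * g x) (at x) b
 = f x * frechet_derivative g (at x) b + frechet_derivative f (at x) b * g x"
 using frechet_derivativeI[OF has_derivative_mult[OF assms[unfolded frechet_derivative_works]]] by simp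

lemma grad_mult:
 assumes "smooth f" "smooth g"
 shows "grad (%x. f x * g x) x = f x *\<^sub>R grad g x + g x *\<^sub>R grad f x"
 by (rule euclidean_eqI)
  (simp add: grad_inner_Basis inner_add_left frechet_derivative_mult[OF assms[THEN smooth_differentiable]])

lemma test_function_smooth: "test_function S phi ==> smooth phi"
 by (simp add: test_function_def smooth_def)

lemma test_functionI:
 assumes "smooth phi" "compact K" "K <= S" "!!x. x \<notin> K ==> phi x = 0"
 shows "test_function S phi"
proof -
 have "{x. phi x ~= 0} <= K" using assms(4) by auto
 then have c: "closure {x. phi x ~= 0} <= K" using assms(2) by (simp add: closure_minimal compact_imp_closed)
 then have "compact (closure {x. phi x ~= 0})" 
 using compact_Int_closed[OF assms(2) closed_closure[of "{x. phi x ~= 0}"]] by (simp add: Int_absorb1)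
 then show ?thesis using c assms by (auto simp: test_function_def supp_compact_in_def smooth_def)
qed

lemma test_functionE:
 assumes "test_function S phi"
 obtains K where "smooth phi" "compact K" "K <= S" "!!x. x \<notin> K ==> phi x = 0"
 using assms closure_subset[of "{x. phi x ~= 0}"]
 by (intro that[of "closure {x. phi x ~= 0}"]) (auto simp: test_function_def supp_compact_in_def smooth_def)

lemma test_function_mult:
 assumes "smooth psi" "test_function S phi"
 shows "test_function S (%x. psi x * phi x)"
 using assms(2) by (rule test_functionE) (rule test_functionI[OF smooth_mult[OF assms(1)]], auto)

lemma test_function_mono: "test_function S phi ==> S <= T ==> test_function T phi"
 by (auto simp: test_function_def supp_compact_in_def)

lemma test_function_kernel:
 assumes "0 < r" "cball z r <= S"
 shows "test_function S (%y. kernel r (z - y))"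
proof (rule test_functionI)
 show "smooth (%y. kernel r (z - y))" unfolding smooth_def by (intro allI C_k_reflect C_k_kernel)
 show "compact (cball z r)" by simp
 show "kernel r (z - y) = 0" if "y \<notin> cball z r" for y
 using that by (intro kernel_shift_eq_0[OF assms(1)]) auto
qed (fact assms(2))

text \<open>Mollified indicators serve as cutoff functions; their values are averages of \<open>0\<close> and \<open>1\<close>.\<close>

lemma cutoff_exists:
 fixes S :: "'a::euclidean_space set"
 assumes S: "bounded S" "S : sets leb" and r: "0 < r"
 shows "smooth (mollify r (indicat_real S))"
 "!!x. 0 <= mollify r (indicat_real S) x" "!!x. mollify r (indicat_real S) x <= 1"
 "!!x. ball x r <= S ==> mollify r (indicat_real S) x = 1"
 "!!x. ball x r \<inter> S = {} ==> mollify r (indicat_real S) x = 0"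
proof -
 have i: "integrable leb (indicat_real S)"
 using bounded_set_imp_lmeasurable[OF S] by (auto simp: fmeasurable_def)
 note k = kernel_shift_integral_lebesgue[OF r]
 have ki: "integrable leb (%y. kernel r (x - y) *\<^sub>R indicat_real S y)" for x by (rule kernel_mult_integrable[OF r i])
 show "smooth (mollify r (indicat_real S))" unfolding smooth_def by (intro allI C_k_mollify r i)
 show "0 <= mollify r (indicat_real S) x" for x
 unfolding mollify_def by (intro LINT_nonneg) (simp add: kernel_nonneg[OF r])
 show "mollify r (indicat_real S) x <= 1" for x
 unfolding mollify_def k(2)[of x, symmetric] using ki k(1) 
 by (intro integral_mono) (auto simp: indicator_def kernel_nonneg[OF r])
 show "mollify r (indicat_real S) x = 1" if "ball x r <= S" for x
 proof -
 have "kernel r (x - y) *\<^sub>R indicat_real S y = kernel r (x - y)" for y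
  using kernel_shift_eq_0[OF r, of y x] that by (cases "y : ball x r") auto
 then show ?thesis unfolding mollify_def by (simp only: k)
 qed
 show "mollify r (indicat_real S) x = 0" if "ball x r \<inter> S = {}" for x
 by (rule mollify_eq_0[OF r, of "- S"]) (use that in auto)
qed

lemma cutoff_ball:
 fixes x :: "'a::euclidean_space"
 assumes "0 < e"
 obtains psi where "smooth psi" "!!y. 0 <= psi y" "!!y. psi y <= 1" "!!y. y : ball x (e/2) ==> psi y = 1"
 "!!y. y \<notin> cball x (3*e/4) ==> psi y = 0"
proof
 let ?S = "ball x (5*e/8)" and ?r = "e/8"
 have S: "bounded ?S" "?S : sets leb" and r: "0 < ?r" using assms by auto
 note c = cutoff_exists[OF S r]
 show "smooth (mollify ?r (indicat_real ?S))" "!!y. 0 <= mollify ?r (indicat_real ?S) y" "!!y. mollify ?r (indicat_real ?S) y <= 1"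
 by (fact c)+
 show "mollify ?r (indicat_real ?S) y = 1" if "y : ball x (e/2)" for y
 proof (rule c(4), rule subsetI)
 fix z assume "z : ball y ?r"
 then show "z : ?S" using that dist_triangle[of x z y] by (simp add: dist_commute)
 qed
 show "mollify ?r (indicat_real ?S) y = 0" if "y \<notin> cball x (3*e/4)" for y
 proof (rule c(5), rule ccontr)
 assume "ball y ?r \<inter> ?S ~= {}"
 then obtain z where "dist y z < e/8" "dist x z < 5*e/8" by auto
 then have "dist x y < 3*e/4" using dist_triangle[of x y z] by (simp add: dist_commute)
 then show False using that by simp
 qed
qed

lemma locally_integrable_mult_bounded:
 fixes u psi :: "'a::euclidean_space => real"
 assumes u: "locally_integrable S u" and K: "compact K" "K <= S"
 and psi: "psi : borel_measurable leb" "!!x. \<bar>psi x\<bar> <= M" "!!x. x \<notin> K ==> psi x = 0"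
 shows "set_integrable leb S (%x. u x * psi x)"
 "(LINT x:S|leb. u x * psi x) = (LINT x:K|leb. u x * psi x)"
proof -
 have i: "integrable leb (%x. indicator K x *\<^sub>R u x)"
 using u K by (auto simp: locally_integrable_def set_integrable_def)
 have eq: "indicator S x *\<^sub>R (u x * psi x) = (indicator K x *\<^sub>R u x) * psi x"
 "indicator K x *\<^sub>R (u x * psi x) = (indicator K x *\<^sub>R u x) * psi x" for x
 using K(2) psi(3)[of x] by (auto simp: indicator_def)
 show "set_integrable leb S (%x. u x * psi x)"
 unfolding set_integrable_def eq
 proof (rule intgb_bound)
 show "integrable leb (%x. M * norm (indicator K x *\<^sub>R u x))" using i by (intro integrable_mult_right integrable_norm)
 show "(%x. indicat_real K x *\<^sub>R u x * psi x) : borel_measurable leb"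
  using i psi(1) by (intro borel_measurable_times) auto
 show "AE x in leb. norm (indicat_real K x *\<^sub>R u x * psi x) <= norm (M * norm (indicat_real K x *\<^sub>R u x))"
 proof (intro AE_I2)
  fix x
  have "\<bar>indicat_real K x *\<^sub>R u x\<bar> * \<bar>psi x\<bar> <= \<bar>indicat_real K x *\<^sub>R u x\<bar> * M" by (intro mult_left_mono psi) auto
  also have "... <= \<bar>M * \<bar>indicat_real K x *\<^sub>R u x\<bar>\<bar>" by (simp add: mult.commute)
  finally show "norm (indicat_real K x *\<^sub>R u x * psi x) <= norm (M * norm (indicat_real K x *\<^sub>R u x))"
  by (simp add: abs_mult)
 qed
 qed
 show "(LINT x:S|leb. u x * psi x) = (LINT x:K|leb. u x * psi x)"
 unfolding set_lebesgue_integral_def eq ..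
qed

lemma locally_integrable_mult_continuous:
 fixes u psi :: "'a::euclidean_space => real"
 assumes u: "locally_integrable S u" and K: "compact K" "K <= S"
 and psi: "continuous_on UNIV psi" "!!x. x \<notin> K ==> psi x = 0"
 shows "set_integrable leb S (%x. u x * psi x)"
 "(LINT x:S|leb. u x * psi x) = (LINT x:K|leb. u x * psi x)"
proof -
 obtain M where M: "!!x. \<bar>psi x\<bar> <= M" using continuous_compact_support_bounded[OF psi(1) K(1) psi(2)] by blast
 note l = locally_integrable_mult_bounded[OF u K continuous_imp_lebesgue_measurable[OF psi(1)] M psi(2)]
 show "set_integrable leb S (%x. u x * psi x)"
 "(LINT x:S|leb. u x * psi x) = (LINT x:K|leb. u x * psi x)" using l by blast+
qed

lemma locally_integrable_inner:
 "locally_integrable S G ==> locally_integrable S (%x. G x \<bullet> b)"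
 unfolding locally_integrable_def set_integrable_def
 using integrable_inner_left[of b leb] by fastforce

lemma locally_integrable_mono: "locally_integrable S f ==> T <= S ==> locally_integrable T f"
 unfolding locally_integrable_def by (meson order_trans)

lemma locally_integrable_cong: "(!!x. x : S ==> f x = g x) ==> locally_integrable S f ==> locally_integrable S g"
 unfolding locally_integrable_def by (metis (no_types, lifting) set_integrable_cong subsetD)

lemma locally_integrable_add: "locally_integrable S f ==> locally_integrable S g ==> locally_integrable S (%x. f x + g x)"
 unfolding locally_integrable_def by (simp add: set_integral_add)

lemma locally_integrable_scaleR_left:
 fixes f :: "'a::euclidean_space => 'b::euclidean_space"
 assumes "locally_integrable S f" shows "locally_integrable S (%x. c *\<^sub>R f x)"
 unfolding locally_integrable_def set_integrable_def
proof (intro allI impI)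
 fix K assume "compact K" "K <= S"
 then have "integrable leb (%x. indicator K x *\<^sub>R f x)"
 using assms by (auto simp: locally_integrable_def set_integrable_def)
 from integrable_scaleR_right[OF this, of c]
 show "integrable leb (%x. indicat_real K x *\<^sub>R c *\<^sub>R f x)" by (simp add: mult.commute)
qed

lemma locally_integrable_continuous_scaleR:
 fixes f :: "'a::euclidean_space => 'b::euclidean_space"
 assumes f: "locally_integrable S f" and psi: "continuous_on UNIV psi"
 shows "locally_integrable S (%x. psi x *\<^sub>R f x)"
 unfolding locally_integrable_def
proof (intro allI impI)
 fix K assume K: "compact K" "K <= S"
 have i: "integrable leb (%x. indicator K x *\<^sub>R f x)" using f K by (auto simp: locally_integrable_def set_integrable_def)
 have "bounded (psi ` K)" by (intro compact_imp_bounded compact_continuous_image continuous_on_subset[OF psi] K) auto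
 then obtain M where M: "!!x. x : K ==> \<bar>psi x\<bar> <= M" by (auto simp: bounded_iff)
 have "integrable leb (%x. psi x *\<^sub>R (indicator K x *\<^sub>R f x))"
 proof (rule intgb_bound)
 show "integrable leb (%x. M * norm (indicator K x *\<^sub>R f x))" using i by (intro integrable_mult_right integrable_norm)
 show "(%x. psi x *\<^sub>R indicat_real K x *\<^sub>R f x) : borel_measurable leb"
  using continuous_imp_lebesgue_measurable[OF psi] borel_measurable_integrable[OF i]
  by (rule borel_measurable_scaleR)
 show "AE x in leb. norm (psi x *\<^sub>R indicat_real K x *\<^sub>R f x) <= norm (M * norm (indicat_real K x *\<^sub>R f x))"
 proof (intro AE_I2)
  fix x show "norm (psi x *\<^sub>R indicat_real K x *\<^sub>R f x) <= norm (M * norm (indicat_real K x *\<^sub>R f x))"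
  using M[of x] by (cases "x : K") (auto intro!: mult_right_mono)
 qed
 qed
 then show "set_integrable leb K (%x. psi x *\<^sub>R f x)" by (simp add: set_integrable_def mult.commute)
qed

lemma locally_integrable_scaleR_continuous:
 fixes f :: "'a::euclidean_space => real" and psi :: "'a => 'b::euclidean_space"
 assumes f: "locally_integrable S f" and psi: "continuous_on UNIV psi"
 shows "locally_integrable S (%x. f x *\<^sub>R psi x)"
proof -
 have "locally_integrable S (%x. \<Sum>b\<in>B. ((psi x \<bullet> b) *\<^sub>R f x) *\<^sub>R b)" if "finite B" for B :: "'b set"
 using that
 proof induction
 case empty then show ?case by (simp add: locally_integrable_def set_integrable_def)
 next
 case (insert b B)
 have "locally_integrable S (%x. (psi x \<bullet> b) *\<^sub>R f x)"
  by (rule locally_integrable_continuous_scaleR[OF f]) (intro continuous_intros psi)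
 then have "locally_integrable S (%x. ((psi x \<bullet> b) *\<^sub>R f x) *\<^sub>R b)"
  unfolding locally_integrable_def set_integrable_def
  using integrable_scaleR_left[of b leb] by fastforce
 from locally_integrable_add[OF this insert.IH] show ?case using insert.hyps by simp
 qed
 from this[OF finite_Basis] have *: "locally_integrable S (%x. \<Sum>b\<in>Basis. ((psi x \<bullet> b) *\<^sub>R f x) *\<^sub>R b)" .
 have "(\<Sum>b\<in>Basis. ((psi x \<bullet> b) *\<^sub>R f x) *\<^sub>R b) = f x *\<^sub>R psi x" for x
 proof -
 have "(\<Sum>b\<in>Basis. ((psi x \<bullet> b) *\<^sub>R f x) *\<^sub>R b) = f x *\<^sub>R (\<Sum>b\<in>Basis. (psi x \<bullet> b) *\<^sub>R b)"
  unfolding scaleR_sum_right by (intro sum.cong) (auto simp: mult.commute)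
 then show ?thesis by (simp add: euclidean_representation)
 qed
 with * show ?thesis by simp
qed

lemma AE_open_local:
 fixes S :: "'a::euclidean_space set"
 assumes "!!x. x : S ==> \<exists>e>0. AE y in leb. y : ball x e --> P y"
 shows "AE y in leb. y : S --> P y"
proof -
 obtain e where e: "!!x. x : S ==> 0 < e x" "!!x. x : S ==> AE y in leb. y : ball x (e x) --> P y"
 using assms by metis
 obtain \<F> where F: "\<F> <= (%x. ball x (e x)) ` S" "countable \<F>" "\<Union>\<F> = (\<Union>x\<in>S. ball x (e x))"
 using Lindelof[of "(%x. ball x (e x)) ` S"] by auto
 have "AE y in leb. \<forall>B\<in>\<F>. y : B --> P y"
 by (subst AE_ball_countable[OF F(2)]) (use F(1) e(2) in auto)
 then show ?thesis
 proof eventually_elim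
 case (elim y)
 show ?case
 proof
  assume "y : S"
  then have "y : \<Union>\<F>" unfolding F(3) using e(1) by force
  then show "P y" using elim by blast
 qed
 qed
qed

text \<open>Averages of \<open>h\<close> near a point are integrals of \<open>h\<close> against test functions.\<close>

lemma fundamental_lemma_calculus_of_variations:
 fixes h :: "'a::euclidean_space => real"
 assumes S: "open S" and h: "locally_integrable S h"
 and 0: "!!phi. test_function S phi ==> (LINT x:S|leb. h x * phi x) = 0"
 shows "AE x in leb. x : S --> h x = 0"
proof (rule AE_open_local)
 fix z assume "z : S"
 then obtain e0 where e0: "0 < e0" "cball z e0 <= S" using S open_contains_cball by metis
 define e where "e = e0 / 2"
 have e: "0 < e" "cball z (2 * e) <= S" using e0 by (auto simp: e_def)
 define g where "g x = indicator (cball z (2 * e)) x *\<^sub>R h x" for x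
 have g: "integrable leb g"
 using h e(2) unfolding g_def locally_integrable_def set_integrable_def by auto
 define r where "r n = e / real (n + 2)" for n
 have r: "0 < r n" "r n < e" for n using e by (auto simp: r_def divide_less_eq)
 have rlim: "r \<leadsto> 0" unfolding r_def
 using LIMSEQ_ignore_initial_segment[OF lim_const_over_n[of e], of 2] by simp
 have m0: "mollify (r n) g x = 0" if x: "x : ball z e" for n x
 proof -
 have sub: "cball x (r n) <= cball z (2 * e)"
 proof
  fix y assume "y : cball x (r n)"
  then show "y : cball z (2 * e)" using x r(2)[of n] dist_triangle[of z y x] by simp
 qed
 then have "test_function S (%y. kernel (r n) (x - y))" using e(2) by (intro test_function_kernel r) auto
 from 0[OF this] have "(LINT y|leb. indicator S y *\<^sub>R (h y * kernel (r n) (x - y))) = 0"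
  by (simp add: set_lebesgue_integral_def)
 moreover have "indicator S y *\<^sub>R (h y * kernel (r n) (x - y)) = kernel (r n) (x - y) *\<^sub>R g y" for y
 proof (cases "y : ball x (r n)")
  case True
  then have "y : cball z (2 * e)" using sub ball_subset_cball by blast
  moreover then have "y : S" using e(2) by auto
  ultimately show ?thesis by (simp add: g_def)
 qed (simp add: kernel_shift_eq_0[OF r(1)])
 ultimately show ?thesis by (simp only: mollify_def)
 qed
 have "(LINT x|leb. norm (indicator (ball z e) x *\<^sub>R g x)) <= (LINT x|leb. norm (mollify (r n) g x - g x))" for n
 proof (rule integral_mono')
 show "integrable leb (%x. norm (mollify (r n) g x - g x))"
  using g mollify_L1_bound(1)[OF r(1) g, of n] by simp
 qed (auto simp: indicator_def m0)
 moreover have "(%n. LINT x|leb. norm (mollify (r n) g x - g x)) \<leadsto> 0"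
 by (rule mollify_tendsto_L1[OF g r(1) rlim])
 ultimately have "(LINT x|leb. norm (indicator (ball z e) x *\<^sub>R g x)) <= 0"
 by (intro LIMSEQ_le_const) auto
 moreover have gi: "integrable leb (%x. indicator (ball z e) x *\<^sub>R g x)" using g by (intro integrable_mult_indicator) auto
 ultimately have "(LINT x|leb. norm (indicator (ball z e) x *\<^sub>R g x)) = 0"
 by (intro antisym LINT_nonneg) auto
 then have "AE x in leb. norm (indicator (ball z e) x *\<^sub>R g x) = 0"
 using integral_nonneg_eq_0_iff_AE[OF integrable_norm[OF gi]] by simp
 then have "AE y in leb. y : ball z e --> h y = 0"
 by eventually_elim (use e in \<open>auto simp: g_def\<close>)
 then show "\<exists>e>0. AE y in leb. y : ball z e --> h y = 0" using e(1) by blast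
qed



lemma has_weak_gradientD:
 assumes "has_weak_gradient S u G"
 shows "locally_integrable S u" "locally_integrable S G"
 "!!phi b. test_function S phi ==> b : Basis ==>
  (LINT x:S|leb. u x * (grad phi x \<bullet> b)) = - (LINT x:S|leb. (G x \<bullet> b) * phi x)"
 using assms by (auto simp: has_weak_gradient_def grad_inner_Basis)

lemma has_weak_gradientI:
 assumes "locally_integrable S u" "locally_integrable S G"
 "!!phi b. test_function S phi ==> b : Basis ==>
  (LINT x:S|leb. u x * (grad phi x \<bullet> b)) = - (LINT x:S|leb. (G x \<bullet> b) * phi x)"
 shows "has_weak_gradient S u G"
 using assms by (auto simp: has_weak_gradient_def grad_inner_Basis)

lemma test_function_integrable:
 assumes "locally_integrable S u" "test_function S phi"
 shows "set_integrable leb S (%x. u x * phi x)"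
 "set_integrable leb S (%x. u x * (grad phi x \<bullet> b))"
proof -
 obtain K where K: "smooth phi" "compact K" "K <= S" "!!x. x \<notin> K ==> phi x = 0" using assms(2) by (rule test_functionE) blast
 show "set_integrable leb S (%x. u x * phi x)"
 by (rule locally_integrable_mult_continuous[OF assms(1) K(2,3) smooth_continuous[OF K(1)] K(4)])
 show "set_integrable leb S (%x. u x * (grad phi x \<bullet> b))"
 by (rule locally_integrable_mult_continuous[OF assms(1) K(2,3)])
  (auto intro!: continuous_intros smooth_grad_continuous K(1) simp: grad_eq_0_outside[OF compact_imp_closed[OF K(2)] K(4)])
qed

lemma integrable_imp_locally_integrable: "integrable leb f ==> locally_integrable S f"
 by (auto simp: locally_integrable_def set_integrable_def intro!: integrable_mult_indicator
  dest: lmeasurable_compact)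

lemma locally_integrable_cong_AE:
 assumes "locally_integrable S f" "AE x in leb. x : S --> f x = g x"
 shows "locally_integrable S g"
 unfolding locally_integrable_def set_integrable_def
proof (intro allI impI)
 fix K assume "compact K" "K <= S"
 then have i: "integrable leb (%x. indicator K x *\<^sub>R f x)"
 using assms(1) by (auto simp: locally_integrable_def set_integrable_def)
 have eq: "AE x in leb. indicator K x *\<^sub>R f x = indicator K x *\<^sub>R g x"
 using assms(2) by eventually_elim (use \<open>K <= S\<close> in \<open>auto simp: indicator_def\<close>)
 have "(%x. indicator K x *\<^sub>R g x) : borel_measurable leb"
 using borel_measurable_AE[OF borel_measurable_integrable[OF i] eq] .
 then show "integrable leb (%x. indicator K x *\<^sub>R g x)"
 by (rule integrable_cong_AE_imp[OF i]) (use eq in eventually_elim, simp)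
qed

lemma has_weak_gradient_cong_AE:
 assumes G: "has_weak_gradient S u G"
 and eq: "AE x in leb. x : S --> u x = u' x" "AE x in leb. x : S --> G x = G' x"
 shows "has_weak_gradient S u' G'"
proof (rule has_weak_gradientI)
 note D = has_weak_gradientD[OF G]
 show u': "locally_integrable S u'" by (rule locally_integrable_cong_AE[OF D(1) eq(1)])
 show G': "locally_integrable S G'" by (rule locally_integrable_cong_AE[OF D(2) eq(2)])
 fix phi :: "'a => real" and b :: 'a assume phi: "test_function S phi" and b: "b : Basis"
 have "(LINT x:S|leb. u x * (grad phi x \<bullet> b)) = (LINT x:S|leb. u' x * (grad phi x \<bullet> b))"
 unfolding set_lebesgue_integral_def
 proof (rule integral_cong_AE)
 show "AE x in leb. indicat_real S x *\<^sub>R (u x * (grad phi x \<bullet> b)) = indicat_real S x *\<^sub>R (u' x * (grad phi x \<bullet> b))"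
  using eq(1) by eventually_elim (auto simp: indicator_def)
 qed (use test_function_integrable(2)[OF D(1) phi, of b] test_function_integrable(2)[OF u' phi, of b] in
  \<open>auto simp: set_integrable_def dest: borel_measurable_integrable\<close>)
 moreover have "(LINT x:S|leb. (G x \<bullet> b) * phi x) = (LINT x:S|leb. (G' x \<bullet> b) * phi x)"
 unfolding set_lebesgue_integral_def
 proof (rule integral_cong_AE)
 show "AE x in leb. indicat_real S x *\<^sub>R (G x \<bullet> b * phi x) = indicat_real S x *\<^sub>R (G' x \<bullet> b * phi x)"
  using eq(2) by eventually_elim (auto simp: indicator_def)
 qed (use test_function_integrable(1)[OF locally_integrable_inner[OF D(2)] phi, of b]
   test_function_integrable(1)[OF locally_integrable_inner[OF G'] phi, of b] in
  \<open>auto simp: set_integrable_def dest: borel_measurable_integrable\<close>)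
 ultimately show "(LINT x:S|leb. u' x * (grad phi x \<bullet> b)) = - (LINT x:S|leb. (G' x \<bullet> b) * phi x)"
 using D(3)[OF phi b] by simp
qed

lemma has_weak_gradient_cong:
 assumes "has_weak_gradient S u G" "!!x. x : S ==> u x = u' x" "!!x. x : S ==> G x = G' x"
 shows "has_weak_gradient S u' G'"
 by (rule has_weak_gradient_cong_AE[OF assms(1)]) (use assms(2,3) in auto)

lemma weak_gradient_unique:
 assumes S: "open S" and G: "has_weak_gradient S u G" "has_weak_gradient S u G'"
 shows "AE x in leb. x : S --> G x = G' x"
proof -
 note D = has_weak_gradientD[OF G(1)] and D' = has_weak_gradientD[OF G(2)]
 have "AE x in leb. x : S --> (G x - G' x) \<bullet> b = 0" if b: "b : Basis" for b
 proof (rule fundamental_lemma_calculus_of_variations[OF S])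
 have "locally_integrable S (%x. G x + (- 1) *\<^sub>R G' x)"
  by (intro locally_integrable_add locally_integrable_scaleR_left D(2) D'(2))
 then show "locally_integrable S (%x. (G x - G' x) \<bullet> b)" by (intro locally_integrable_inner) simp
 fix phi :: "'a => real" assume phi: "test_function S phi"
 have "(LINT x:S|leb. (G x - G' x) \<bullet> b * phi x)
  = (LINT x:S|leb. (G x \<bullet> b) * phi x - (G' x \<bullet> b) * phi x)" by (simp add: inner_diff_left left_diff_distrib)
 also have "... = (LINT x:S|leb. (G x \<bullet> b) * phi x) - (LINT x:S|leb. (G' x \<bullet> b) * phi x)"
  by (rule set_integral_diff(2)) (intro test_function_integrable(1)[OF locally_integrable_inner phi] D(2) D'(2))+
 finally show "(LINT x:S|leb. (G x - G' x) \<bullet> b * phi x) = 0" using D(3)[OF phi b] D'(3)[OF phi b] by simp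
 qed
 then have "AE x in leb. \<forall>b\<in>Basis. x : S --> (G x - G' x) \<bullet> b = 0"
 by (intro AE_finite_allI finite_Basis)
 then show ?thesis by eventually_elim (auto simp: inner_diff_left intro: euclidean_eqI)
qed

lemma set_integral_subset_support:
 fixes f :: "'a::euclidean_space => 'b::euclidean_space"
 assumes "T <= S" "!!x. x : S - T ==> f x = 0"
 shows "(LINT x:S|leb. f x) = (LINT x:T|leb. f x)"
 unfolding set_lebesgue_integral_def
 by (rule LINT_cong) (use assms in \<open>auto simp: indicator_def\<close>)

lemma has_weak_gradient_mono:
 assumes G: "has_weak_gradient S u G" and T: "T <= S"
 shows "has_weak_gradient T u G"
proof (rule has_weak_gradientI)
 note D = has_weak_gradientD[OF G]
 show "locally_integrable T u" "locally_integrable T G" using D(1,2) T by (auto intro: locally_integrable_mono)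
 fix phi :: "'a => real" and b :: 'a assume phi: "test_function T phi" and b: "b : Basis"
 obtain K where K: "smooth phi" "compact K" "K <= T" "!!x. x \<notin> K ==> phi x = 0" using phi by (rule test_functionE) blast
 have "(LINT x:T|leb. u x * (grad phi x \<bullet> b)) = (LINT x:S|leb. u x * (grad phi x \<bullet> b))"
 proof (rule set_integral_subset_support[OF T, symmetric])
 fix x assume "x : S - T"
 then have "grad phi x = 0"
  using grad_eq_0_outside[OF compact_imp_closed[OF K(2)], of phi x] K(3,4) by blast
 then show "u x * (grad phi x \<bullet> b) = 0" by simp
 qed
 moreover have "(LINT x:T|leb. (G x \<bullet> b) * phi x) = (LINT x:S|leb. (G x \<bullet> b) * phi x)"
 using K by (intro set_integral_subset_support[OF T, symmetric]) auto
 ultimately show "(LINT x:T|leb. u x * (grad phi x \<bullet> b)) = - (LINT x:T|leb. (G x \<bullet> b) * phi x)"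
 using D(3)[OF test_function_mono[OF phi T] b] by simp
qed

lemma has_weak_gradient_add:
 assumes "has_weak_gradient S u G" "has_weak_gradient S v H"
 shows "has_weak_gradient S (%x. u x + v x) (%x. G x + H x)"
proof (rule has_weak_gradientI)
 note D = has_weak_gradientD[OF assms(1)] and D' = has_weak_gradientD[OF assms(2)]
 show "locally_integrable S (%x. u x + v x)" "locally_integrable S (%x. G x + H x)"
 by (intro locally_integrable_add D(1,2) D'(1,2))+
 fix phi :: "'a => real" and b :: 'a assume phi: "test_function S phi" and b: "b : Basis"
 have "(LINT x:S|leb. (u x + v x) * (grad phi x \<bullet> b)) = (LINT x:S|leb. u x * (grad phi x \<bullet> b)) + (LINT x:S|leb. v x * (grad phi x \<bullet> b))"
 unfolding distrib_right by (intro set_integral_add(2) test_function_integrable phi D D')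
 moreover have "(LINT x:S|leb. (G x + H x) \<bullet> b * phi x) = (LINT x:S|leb. (G x \<bullet> b) * phi x) + (LINT x:S|leb. (H x \<bullet> b) * phi x)"
 unfolding inner_add_left distrib_right
 by (intro set_integral_add(2) test_function_integrable(1) locally_integrable_inner phi D D')
 ultimately show "(LINT x:S|leb. (u x + v x) * (grad phi x \<bullet> b)) = - (LINT x:S|leb. (G x + H x) \<bullet> b * phi x)"
 using D(3)[OF phi b] D'(3)[OF phi b] by simp
qed

lemma has_weak_gradient_mult_smooth_extension:
 assumes G: "has_weak_gradient S u G" and eta: "smooth eta" and ST: "S <= T"
 and K: "!!phi. test_function T phi ==> \<exists>K. compact K & K <= S & (\<forall>x. x \<notin> K --> eta x * phi x = 0 & phi x *\<^sub>R grad eta x = 0)"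
 and loc: "locally_integrable T (%x. if x : S then eta x * u x else 0)"
  "locally_integrable T (%x. if x : S then eta x *\<^sub>R G x + u x *\<^sub>R grad eta x else 0)"
 shows "has_weak_gradient T (%x. if x : S then eta x * u x else 0)
 (%x. if x : S then eta x *\<^sub>R G x + u x *\<^sub>R grad eta x else 0)"
proof (rule has_weak_gradientI[OF loc])
 note D = has_weak_gradientD[OF G]
 let ?v = "%x. if x : S then eta x * u x else 0"
 let ?H = "%x. if x : S then eta x *\<^sub>R G x + u x *\<^sub>R grad eta x else 0"
 fix phi :: "'a => real" and b :: 'a assume phi: "test_function T phi" and b: "b : Basis"
 note s = test_function_smooth[OF phi]
 obtain K where K: "compact K" "K <= S" "!!x. x \<notin> K ==> eta x * phi x = 0" "!!x. x \<notin> K ==> phi x *\<^sub>R grad eta x = 0"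
 using K[OF phi] by blast
 have t: "test_function S (%x. eta x * phi x)" by (rule test_functionI[OF smooth_mult[OF eta s] K(1,2,3)])
 have i1: "set_integrable leb S (%x. u x * (grad (%x. eta x * phi x) x \<bullet> b))"
 by (rule test_function_integrable(2)[OF D(1) t])
 have i2: "set_integrable leb S (%x. u x * (phi x *\<^sub>R grad eta x \<bullet> b))"
 proof (rule locally_integrable_mult_continuous(1)[OF D(1) K(1,2)])
 show "continuous_on UNIV (%x. phi x *\<^sub>R grad eta x \<bullet> b)"
  by (intro continuous_intros smooth_continuous[OF s] smooth_grad_continuous[OF eta])
 show "phi x *\<^sub>R grad eta x \<bullet> b = 0" if "x \<notin> K" for x using K(4)[OF that] by (simp only: inner_zero_left)
 qed
 have i3: "set_integrable leb S (%x. (G x \<bullet> b) * (eta x * phi x))"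
 by (rule test_function_integrable(1)[OF locally_integrable_inner[OF D(2)] t])
 have "(LINT x:T|leb. ?v x * (grad phi x \<bullet> b)) = (LINT x:S|leb. ?v x * (grad phi x \<bullet> b))"
 by (rule set_integral_subset_support[OF ST]) auto
 also have "... = (LINT x:S|leb. u x * (grad (%x. eta x * phi x) x \<bullet> b) - u x * (phi x *\<^sub>R grad eta x \<bullet> b))"
 unfolding set_lebesgue_integral_def
 by (rule LINT_cong) (auto simp: indicator_def grad_mult[OF eta s] inner_add_left algebra_simps)
 also have "... = (LINT x:S|leb. u x * (grad (%x. eta x * phi x) x \<bullet> b)) - (LINT x:S|leb. u x * (phi x *\<^sub>R grad eta x \<bullet> b))"
 by (rule set_integral_diff(2)[OF i1 i2])
 also have "... = - ((LINT x:S|leb. (G x \<bullet> b) * (eta x * phi x)) + (LINT x:S|leb. u x * (phi x *\<^sub>R grad eta x \<bullet> b)))"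
 by (simp add: D(3)[OF t b])
 also have "... = - (LINT x:S|leb. (G x \<bullet> b) * (eta x * phi x) + u x * (phi x *\<^sub>R grad eta x \<bullet> b))"
 by (simp only: set_integral_add(2)[OF i3 i2])
 also have "(LINT x:S|leb. (G x \<bullet> b) * (eta x * phi x) + u x * (phi x *\<^sub>R grad eta x \<bullet> b)) = (LINT x:S|leb. (?H x \<bullet> b) * phi x)"
 unfolding set_lebesgue_integral_def
 by (rule LINT_cong) (auto simp: indicator_def inner_add_left algebra_simps)
 also have "... = (LINT x:T|leb. (?H x \<bullet> b) * phi x)"
 by (rule set_integral_subset_support[OF ST, symmetric]) auto
 finally show "(LINT x:T|leb. ?v x * (grad phi x \<bullet> b)) = - (LINT x:T|leb. (?H x \<bullet> b) * phi x)" .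
qed

lemma locally_integrable_product_rule:
 fixes u :: "'a::euclidean_space => real"
 assumes "locally_integrable S u" "locally_integrable S G" "smooth eta"
 shows "locally_integrable S (%x. eta x * u x)" "locally_integrable S (%x. eta x *\<^sub>R G x + u x *\<^sub>R grad eta x)"
 using locally_integrable_continuous_scaleR[OF assms(1) smooth_continuous[OF assms(3)]]
 locally_integrable_add[OF locally_integrable_continuous_scaleR[OF assms(2) smooth_continuous[OF assms(3)]]
  locally_integrable_scaleR_continuous[OF assms(1) smooth_grad_continuous[OF assms(3)]]]
 by simp_all

lemma has_weak_gradient_mult_smooth:
 assumes G: "has_weak_gradient S u G" and eta: "smooth eta"
 shows "has_weak_gradient S (%x. eta x * u x) (%x. eta x *\<^sub>R G x + u x *\<^sub>R grad eta x)"
proof -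
 note D = has_weak_gradientD[OF G]
 have "has_weak_gradient S (%x. if x : S then eta x * u x else 0)
 (%x. if x : S then eta x *\<^sub>R G x + u x *\<^sub>R grad eta x else 0)"
 proof (rule has_weak_gradient_mult_smooth_extension[OF G eta subset_refl])
 fix phi :: "'a => real" assume "test_function S phi"
 then show "\<exists>K. compact K & K <= S & (\<forall>x. x \<notin> K --> eta x * phi x = 0 & phi x *\<^sub>R grad eta x = 0)"
  by (rule test_functionE) auto
 qed (rule locally_integrable_cong[rotated, OF locally_integrable_product_rule(1)[OF D(1,2) eta]], simp,
  rule locally_integrable_cong[rotated, OF locally_integrable_product_rule(2)[OF D(1,2) eta]], simp)
 then show ?thesis by (rule has_weak_gradient_cong) auto
qed

text \<open>Multiplying by a cutoff with compact support in \<open>S\<close> turns a local Sobolev function into one on the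
 whole space, for which mollification is defined everywhere.\<close>

lemma has_weak_gradient_cutoff_extension:
 assumes G: "has_weak_gradient S u G" and eta: "smooth eta" and K: "compact K" "K <= S" "!!x. x \<notin> K ==> eta x = 0"
 defines "v == %x. if x : S then eta x * u x else 0"
 and "H == %x. if x : S then eta x *\<^sub>R G x + u x *\<^sub>R grad eta x else 0"
 shows "has_weak_gradient UNIV v H" "integrable leb v" "integrable leb H"
proof -
 note D = has_weak_gradientD[OF G]
 have g0: "grad eta x = 0" if "x \<notin> K" for x
 using grad_eq_0_outside[OF compact_imp_closed[OF K(1)], of eta x] K(3) that by blast
 have "v = (%x. indicator K x *\<^sub>R (eta x * u x))" using K by (auto simp: v_def indicator_def fun_eq_iff)
 then show v: "integrable leb v"
 using locally_integrable_product_rule(1)[OF D(1,2) eta] K(1,2) by (auto simp: locally_integrable_def set_integrable_def)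
 have "H = (%x. indicator K x *\<^sub>R (eta x *\<^sub>R G x + u x *\<^sub>R grad eta x))"
 using K g0 by (auto simp: H_def indicator_def fun_eq_iff)
 then show H: "integrable leb H"
 using locally_integrable_product_rule(2)[OF D(1,2) eta] K(1,2) by (auto simp: locally_integrable_def set_integrable_def)
 show "has_weak_gradient UNIV v H"
 unfolding v_def H_def
 proof (rule has_weak_gradient_mult_smooth_extension[OF G eta subset_UNIV])
 show "\<exists>K. compact K & K <= S & (\<forall>x. x \<notin> K --> eta x * phi x = 0 & phi x *\<^sub>R grad eta x = 0)" for phi :: "'a => real"
  by (rule exI[of _ K]) (simp add: K g0)
 qed (use integrable_imp_locally_integrable[OF v] integrable_imp_locally_integrable[OF H] in \<open>simp_all only: v_def H_def\<close>)
qed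

lemma has_weak_gradient_scale:
 assumes "has_weak_gradient S u G"
 shows "has_weak_gradient S (%x. c * u x) (%x. c *\<^sub>R G x)"
proof -
 have "grad (%x. c) x = 0" for x :: 'a by (rule grad_const_on_open[of UNIV _ c]) auto
 then show ?thesis using has_weak_gradient_mult_smooth[OF assms smooth_const[of c]] by simp
qed

lemma has_weak_gradient_diff:
 assumes "has_weak_gradient S u G" "has_weak_gradient S v H"
 shows "has_weak_gradient S (%x. u x - v x) (%x. G x - H x)"
 using has_weak_gradient_add[OF assms(1) has_weak_gradient_scale[OF assms(2), of "-1"]] by simp

text \<open>Being a weak gradient is a local property: a test function is split, one ball of a finite cover of
 its support at a time, into a part that lives in the ball and a part that vanishes near its centre.\<close>

lemma has_weak_gradient_local:
 fixes S :: "'a::euclidean_space set"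
 assumes loc: "!!x. x : S ==> \<exists>e>0. ball x e <= S & has_weak_gradient (ball x e) u G"
 shows "has_weak_gradient S u G"
proof -
 obtain e where e: "!!x. x : S ==> 0 < e x" "!!x. x : S ==> ball x (e x) <= S"
  "!!x. x : S ==> has_weak_gradient (ball x (e x)) u G" using loc by metis
 have cover: "\<exists>I. finite I & I <= S & K <= (\<Union>x\<in>I. ball x (e x / 2))" if cK: "compact K" and "K <= S" for K
 proof -
 have "K <= (\<Union>x\<in>S. ball x (e x / 2))" using \<open>K <= S\<close> e(1) by force
 then obtain I where "I <= S" "finite I" "K <= (\<Union>x\<in>I. ball x (e x / 2))"
  by (rule compactE_image[OF cK open_ball])
 then show ?thesis by (intro exI[of _ I]) simp
 qed
 have li: "locally_integrable S f" if f: "!!x. x : S ==> locally_integrable (ball x (e x)) f" for f :: "'a => 'b::euclidean_space"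
 unfolding locally_integrable_def
 proof (intro allI impI)
 fix K assume K: "compact K" "K <= S"
 obtain I where I: "finite I" "I <= S" "K <= (\<Union>x\<in>I. ball x (e x / 2))"
  using cover[OF K] by (elim exE conjE)
 have "set_integrable leb (\<Union>x\<in>I. cball x (e x / 2)) f"
 proof (rule set_integrable_UN[OF I(1)])
  fix x assume x: "x : I"
  then have xS: "x : S" using I(2) by blast
  have "cball x (e x / 2) <= ball x (e x)" 
  proof
  fix y assume "y : cball x (e x / 2)"
  then have "dist x y <= e x / 2" by simp
  then have "dist x y < e x" using e(1)[OF xS] by linarith
  then show "y : ball x (e x)" by simp
  qed
  then show "set_integrable leb (cball x (e x / 2)) f"
  using f[OF xS, unfolded locally_integrable_def, rule_format, OF compact_cball] by simp
 qed auto
 from this show "set_integrable leb K f"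
 proof (rule set_integrable_subset)
  show "K : sets leb" using K(1) lmeasurable_compact by blast
  show "K <= (\<Union>x\<in>I. cball x (e x / 2))"
  by (rule order_trans[OF I(3)]) (intro UN_mono subset_refl ball_subset_cball)
 qed
 qed
 have Lu: "locally_integrable S u" and LG: "locally_integrable S G"
 by (rule li, erule has_weak_gradientD(1)[OF e(3)], rule li, erule has_weak_gradientD(2)[OF e(3)])
 have key: "(LINT x:S|leb. u x * (grad phi x \<bullet> b)) = - (LINT x:S|leb. (G x \<bullet> b) * phi x)"
 if "finite I" "I <= S" "smooth phi" "compact K" "K <= S" "K <= (\<Union>x\<in>I. ball x (e x / 2))" "!!x. x \<notin> K ==> phi x = 0"
  "b : Basis" for I phi K b
 using that(1-7)
 proof (induction I arbitrary: phi K)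
 case empty
 then have "phi = (%x. 0)" by auto
 moreover have "grad (%x. 0) x = 0" for x :: 'a by (rule grad_const_on_open[of UNIV _ 0]) auto
 ultimately show ?case by simp
 next
 case (insert z I)
 have z: "z : S" using insert.prems by auto
 obtain psi where psi: "smooth psi" "!!y. y : ball z (e z/2) ==> psi y = 1" "!!y. y \<notin> cball z (3*e z/4) ==> psi y = 0"
  using cutoff_ball[OF e(1)[OF z], of z] by metis
 let ?f = "%x. psi x * phi x" and ?g = "%x. (1 - psi x) * phi x"
 have sg: "smooth (%x. 1 - psi x)" by (intro smooth_diff smooth_const psi)
 have tphi: "test_function S phi" by (rule test_functionI) (fact insert.prems)+
 have tf: "test_function (ball z (e z)) ?f"
  by (rule test_functionI[of _ "cball z (3*e z/4)"]) (use psi insert.prems smooth_mult e(1)[OF z] in auto)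
 have tf': "test_function S ?f" by (rule test_function_mono[OF tf e(2)[OF z]])
 have tg: "test_function S ?g" by (rule test_function_mult[OF sg tphi])
 have F: "(LINT x:S|leb. u x * (grad ?f x \<bullet> b)) = - (LINT x:S|leb. (G x \<bullet> b) * ?f x)"
 proof -
  obtain K' where K': "compact K'" "K' <= ball z (e z)" "!!x. x \<notin> K' ==> ?f x = 0" using tf by (rule test_functionE) blast
  have "(LINT x:S|leb. u x * (grad ?f x \<bullet> b)) = (LINT x:ball z (e z)|leb. u x * (grad ?f x \<bullet> b))"
  proof (rule set_integral_subset_support[OF e(2)[OF z]])
  fix x assume "x : S - ball z (e z)"
  then have "x \<notin> K'" using K'(2) by auto
  then have "grad ?f x = 0" using grad_eq_0_outside[OF compact_imp_closed[OF K'(1)], of ?f x] K'(3) by blast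
  then show "u x * (grad ?f x \<bullet> b) = 0" by simp
  qed
  also have "... = - (LINT x:ball z (e z)|leb. (G x \<bullet> b) * ?f x)"
  using has_weak_gradientD(3)[OF e(3)[OF z] tf that(8)] .
  also have "(LINT x:ball z (e z)|leb. (G x \<bullet> b) * ?f x) = (LINT x:S|leb. (G x \<bullet> b) * ?f x)"
  proof (rule set_integral_subset_support[OF e(2)[OF z], symmetric])
  fix x assume "x : S - ball z (e z)"
  then have "?f x = 0" using K'(2,3) by blast
  then show "(G x \<bullet> b) * ?f x = 0" by simp
  qed
  finally show ?thesis .
 qed
 have G: "(LINT x:S|leb. u x * (grad ?g x \<bullet> b)) = - (LINT x:S|leb. (G x \<bullet> b) * ?g x)"
 proof (rule insert.IH)
  show "compact (K - ball z (e z / 2))" by (intro compact_diff insert.prems) auto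
  show "K - ball z (e z / 2) <= (\<Union>x\<in>I. ball x (e x / 2))" using insert.prems(5) by auto
  show "?g x = 0" if "x \<notin> K - ball z (e z / 2)" for x using that psi(2) insert.prems(6) by auto
 qed (use insert.prems smooth_mult[OF sg] in auto)
 have fg: "phi x = ?f x + ?g x" for x by (simp add: algebra_simps)
 have "grad phi x = grad ?f x + grad ?g x" for x
 proof -
  have "((%x. 1 - psi x) has_derivative (%h. 0 - frechet_derivative psi (at x) h)) (at x)"
  using smooth_differentiable[OF psi(1)] by (intro has_derivative_diff has_derivative_const) (simp add: frechet_derivative_works)
  then have g1: "grad (%x. 1 - psi x) x = - grad psi x"
  by (simp add: grad_def frechet_derivativeI sum_negf)
  show ?thesis unfolding grad_mult[OF psi(1) insert.prems(2)] grad_mult[OF sg insert.prems(2)] g1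
  by (simp add: algebra_simps)
 qed
 then have "(LINT x:S|leb. u x * (grad phi x \<bullet> b)) = (LINT x:S|leb. u x * (grad ?f x \<bullet> b) + u x * (grad ?g x \<bullet> b))"
  by (simp only: inner_add_left distrib_left)
 also have "... = (LINT x:S|leb. u x * (grad ?f x \<bullet> b)) + (LINT x:S|leb. u x * (grad ?g x \<bullet> b))"
  by (intro set_integral_add(2) test_function_integrable(2) Lu tf' tg)
 also have "... = - ((LINT x:S|leb. (G x \<bullet> b) * ?f x) + (LINT x:S|leb. (G x \<bullet> b) * ?g x))"
  unfolding F G by simp
 also have "(LINT x:S|leb. (G x \<bullet> b) * ?f x) + (LINT x:S|leb. (G x \<bullet> b) * ?g x) = (LINT x:S|leb. (G x \<bullet> b) * ?f x + (G x \<bullet> b) * ?g x)"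
  by (intro set_integral_add(2)[symmetric] test_function_integrable(1) locally_integrable_inner LG tf' tg)
 also have "(%x. (G x \<bullet> b) * ?f x + (G x \<bullet> b) * ?g x) = (%x. (G x \<bullet> b) * phi x)"
  by (rule ext) (subst distrib_left[symmetric], simp only: fg[symmetric])
 finally show ?case .
 qed
 show ?thesis
 proof (rule has_weak_gradientI[OF Lu LG])
 fix phi :: "'a => real" and b :: 'a assume phi: "test_function S phi" and b: "b : Basis"
 obtain K where K: "smooth phi" "compact K" "K <= S" "!!x. x \<notin> K ==> phi x = 0" using phi by (rule test_functionE) blast
 obtain I where "finite I" "I <= S" "K <= (\<Union>x\<in>I. ball x (e x / 2))"
  using cover[OF K(2,3)] by (elim exE conjE)
 from key[OF this(1,2) K(1,2,3) this(3) K(4) b]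
 show "(LINT x:S|leb. u x * (grad phi x \<bullet> b)) = - (LINT x:S|leb. (G x \<bullet> b) * phi x)" .
 qed
qed



lemma compact_sets_lebesgue [simp]: "compact (K :: 'a::euclidean_space set) ==> K : sets leb"
 using lmeasurable_compact by blast

lemma locally_integrable_continuous:
 fixes f :: "'a::euclidean_space => 'b::euclidean_space"
 assumes "continuous_on UNIV f"
 shows "locally_integrable S f"
 unfolding locally_integrable_def set_integrable_def
proof (intro allI impI)
 fix K :: "'a set" assume "compact K"
 then have i: "integrable lborel (%x. indicator K x *\<^sub>R f x)"
 by (rule borel_integrable_compact[OF _ continuous_on_subset[OF assms]]) auto
 show "integrable leb (%x. indicator K x *\<^sub>R f x)"
 using integrable_completion[OF borel_measurable_integrable[OF i]] i by simp
qed

lemma locally_integrable_set_integrable: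
 "locally_integrable S f ==> compact K ==> K <= S ==> set_integrable leb K f"
 by (simp add: locally_integrable_def)

text \<open>Sets \<open>C n\<close> that eventually contain each compact subset reduce countably many local statements to one
 sequence.\<close>

lemma compact_exhaustion:
 fixes S :: "'a::euclidean_space set"
 assumes "open S"
 shows "\<exists>C. (\<forall>n. compact (C n)) & (\<forall>n. C n <= S) & (\<forall>n. C n <= C (Suc n)) &
 (\<forall>K. compact K --> K <= S --> (\<exists>N. \<forall>n\<ge>N. K <= C n))"
proof (rule open_Union_compact_subsets[OF assms])
 fix C assume C: "!!n. compact (C n)" "!!n. C n <= S" "!!n. C n <= interior (C (Suc n))"
 "!!K. compact K ==> K <= S ==> \<exists>N. \<forall>n\<ge>N. K <= C n"
 have "C n <= C (Suc n)" for n using C(3)[of n] interior_subset by (rule order_trans)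
 then show ?thesis using C(1,2,4) by (intro exI[of _ C]) simp
qed

lemma locally_integrable_measurable:
 fixes f :: "'a::euclidean_space => 'b::euclidean_space"
 assumes S: "open S" and f: "locally_integrable S f"
 shows "(%x. indicator S x *\<^sub>R f x) : borel_measurable leb"
proof -
 obtain C where C: "!!n. compact (C n)" "!!n. C n <= S" "!!n. C n <= C (Suc n)"
  "!!K. compact K ==> K <= S ==> \<exists>N. \<forall>n\<ge>N. K <= C n"
 using compact_exhaustion[OF S] by (elim exE conjE) blast
 show ?thesis
 proof (rule borel_measurable_LIMSEQ_metric)
 show "(%x. indicator (C n) x *\<^sub>R f x) : borel_measurable leb" for n
  using locally_integrable_set_integrable[OF f C(1,2), of n] unfolding set_integrable_def
  by (rule borel_measurable_integrable)
 fix x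
 show "(%n. indicator (C n) x *\<^sub>R f x) \<leadsto> indicator S x *\<^sub>R f x"
 proof (cases "x : S")
  case True
  then obtain N where "\<forall>n\<ge>N. {x} <= C n" using C(4)[of "{x}"] by auto
  then show ?thesis using True
  by (intro tendsto_eventually eventually_sequentiallyI[of N]) auto
 next
  case False
  then have "x \<notin> C n" for n using C(2)[of n] by blast
  then show ?thesis using False by simp
 qed
 qed
qed

text \<open>The derivative is the limit of difference quotients, whose integrals vanish by translation
 invariance.\<close>

lemma integral_partial_eq_0:
 fixes w :: "'a::euclidean_space => real"
 assumes w: "C_k (Suc 0) w" and K: "compact K" "!!x. x \<notin> K ==> w x = 0" and b: "b : Basis"
 shows "(LINT x|leb. frechet_derivative w (at x) b) = 0"
proof -
 obtain M where M: "0 <= M" "!!x y. \<bar>w y - w x\<bar> <= M * norm (y - x)"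
 using C1_compact_support_Lipschitz[OF w K] by metis
 obtain R where R: "K <= cball 0 R" 
 using bounded_subset_ballD[OF compact_imp_bounded[OF K(1)], of 0] ball_subset_cball by fast
 have c: "continuous_on UNIV w" using C_k_mono_Suc[OF w] by simp
 have i: "integrable lborel w" using integrable_continuous_compact_support(1)[OF c K] .
 define X where "X n = (1 / real (Suc n)) *\<^sub>R b" for n
 define q where "q n x = real (Suc n) * (w (x + X n) - w x)" for n x
 have nX: "norm (X n) = 1 / real (Suc n)" for n using b by (simp add: X_def)
 have iX: "integrable lborel (%x. w (x + X n))" for n
 using integrable_lborel_translate[OF i, of "X n"] by (simp add: add.commute)
 have qi: "integrable lborel (q n)" for n unfolding q_def using i iX by simp
 have q0: "(LINT x|lborel. q n x) = 0" for n
 proof -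
 have "(LINT x|lborel. w (x + X n)) = (LINT x|lborel. w x)"
  using integral_lborel_translate[of w "X n"] borel_measurable_integrable[OF i] by (simp add: add.commute)
 then show ?thesis unfolding q_def using i iX by simp
 qed
 have "(%n. LINT x|lborel. q n x) \<leadsto> (LINT x|lborel. frechet_derivative w (at x) b)"
 proof (rule integral_dominated_convergence[where w = "%x. M * indicator (cball 0 (R + 1)) x"])
 show "(%x. frechet_derivative w (at x) b) : borel_measurable lborel"
  using C_k_SucD(2)[OF w b] by (simp add: borel_measurable_continuous_onI)
 show "q n : borel_measurable lborel" for n using qi by (rule borel_measurable_integrable)
 show "integrable lborel (%x. M * indicat_real (cball (0::'a) (R + 1)) x)"
  using emeasure_lborel_cball_finite[of "0::'a" "R + 1"] by (intro integrable_mult_right integrable_real_indicator) auto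
 show "AE x in lborel. (%n. q n x) \<leadsto> frechet_derivative w (at x) b"
 proof (intro AE_I2)
  fix x
  let ?D = "frechet_derivative w (at x)"
  have "((%h. norm (w (x + h) - w x - ?D h) / norm h) \<longlongrightarrow> 0) (at 0)"
  using C_k_SucD(1)[OF w, of x] unfolding has_derivative_at by blast
  moreover have "\<forall>n. X n : UNIV - {0}" using b by (auto simp: X_def)
  moreover have "X \<leadsto> 0"
  unfolding X_def using tendsto_scaleR[OF LIMSEQ_inverse_real_of_nat tendsto_const[of b]] by (simp add: inverse_eq_divide)
  ultimately have lim: "(%n. norm (w (x + X n) - w x - ?D (X n)) / norm (X n)) \<leadsto> 0"
  unfolding tendsto_at_iff_sequentially o_def by blast
  have eq: "norm (w (x + X n) - w x - ?D (X n)) / norm (X n) = norm (q n x - ?D b)" for n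
  proof -
  have "?D (X n) = (1 / real (Suc n)) * ?D b"
   using linear_scale[OF has_derivative_linear[OF C_k_SucD(1)[OF w, of x]]] by (simp add: X_def)
  then have "q n x - ?D b = real (Suc n) * (w (x + X n) - w x - ?D (X n))"
   unfolding q_def right_diff_distrib by (simp del: of_nat_Suc)
  then show ?thesis unfolding nX by (simp only: norm_mult) (simp del: of_nat_Suc)
  qed
  from lim show "(%n. q n x) \<leadsto> ?D b"
  unfolding eq by (rule LIM_zero_cancel[OF tendsto_norm_zero_cancel])
 qed
 show "AE x in lborel. norm (q n x) <= M * indicat_real (cball 0 (R + 1)) x" for n
 proof (intro AE_I2)
  fix x
  show "norm (q n x) <= M * indicat_real (cball 0 (R + 1)) x"
  proof (cases "x : cball 0 (R + 1)")
  case True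
  have "\<bar>w (x + X n) - w x\<bar> <= M * (1 / real (Suc n))" using M(2)[of "x + X n" x] nX[of n] by simp
  then have "real (Suc n) * \<bar>w (x + X n) - w x\<bar> <= real (Suc n) * (M * (1 / real (Suc n)))" by (intro mult_left_mono) auto
  then show ?thesis using True by (simp add: q_def abs_mult del: of_nat_Suc)
  next
  case False
  have "norm (X n) <= 1" by (simp add: nX)
  then have "R < norm (x + X n)" "R < norm x" using False norm_diff_ineq[of x "X n"] by auto
  then have "x + X n \<notin> K" "x \<notin> K" using R by auto
  then show ?thesis using K(2) False by (simp add: q_def)
  qed
 qed
 qed
 then have "(LINT x|lborel. frechet_derivative w (at x) b) = 0" by (simp add: q0 LIMSEQ_const_iff)
 moreover have "(LINT x|leb. frechet_derivative w (at x) b) = (LINT x|lborel. frechet_derivative w (at x) b)"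
 using C_k_SucD(2)[OF w b] by (intro integral_completion) (simp add: borel_measurable_continuous_onI)
 ultimately show ?thesis by simp
qed

lemma C1_grad_continuous: "C_k (Suc 0) v ==> continuous_on A (grad v)"
 unfolding grad_def
 by (rule continuous_on_subset[OF _ subset_UNIV], rule continuous_on_sum, rule continuous_on_scaleR)
  (simp_all add: continuous_on_const)

lemma C1_has_weak_gradient:
 assumes v: "C_k (Suc 0) v"
 shows "has_weak_gradient S v (grad v)"
proof (rule has_weak_gradientI)
 have vc: "continuous_on UNIV v" using C_k_mono_Suc[OF v] by simp
 show L: "locally_integrable S v" "locally_integrable S (grad v)"
 by (intro locally_integrable_continuous vc C1_grad_continuous v)+
 fix phi :: "'a => real" and b :: 'a assume phi: "test_function S phi" and b: "b : Basis"
 obtain K where K: "smooth phi" "compact K" "K <= S" "!!x. x \<notin> K ==> phi x = 0" using phi by (rule test_functionE) blast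
 have phi1: "C_k (Suc 0) phi" using K(1) unfolding smooth_def by blast
 have w: "C_k (Suc 0) (%x. v x * phi x)" by (rule C_k_mult[OF v phi1])
 have fd: "frechet_derivative (%x. v x * phi x) (at x) b = v x * (grad phi x \<bullet> b) + (grad v x \<bullet> b) * phi x" for x
 using frechet_derivative_mult[of v x phi b] v phi1 b by (simp add: grad_inner_Basis)
 have 0: "v x * (grad phi x \<bullet> b) + (grad v x \<bullet> b) * phi x = 0" if "x \<notin> K" for x
 proof -
 have "grad phi x = 0" using grad_eq_0_outside[OF compact_imp_closed[OF K(2)], of phi x] K(4) that by blast
 then show ?thesis using K(4)[OF that] by simp
 qed
 have "(LINT x:S|leb. v x * (grad phi x \<bullet> b)) + (LINT x:S|leb. (grad v x \<bullet> b) * phi x)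
  = (LINT x:S|leb. v x * (grad phi x \<bullet> b) + (grad v x \<bullet> b) * phi x)"
 by (intro set_integral_add(2)[symmetric] test_function_integrable locally_integrable_inner L phi)
 also have "... = (LINT x:UNIV|leb. v x * (grad phi x \<bullet> b) + (grad v x \<bullet> b) * phi x)"
 proof (rule set_integral_subset_support[symmetric])
 fix x assume "x : UNIV - S"
 then show "v x * (grad phi x \<bullet> b) + (grad v x \<bullet> b) * phi x = 0" using K(3) by (intro 0) auto
 qed simp
 also have "... = 0"
 using integral_partial_eq_0[OF w K(2) _ b] K(4) by (simp add: set_lebesgue_integral_def fd)
 finally show "(LINT x:S|leb. v x * (grad phi x \<bullet> b)) = - (LINT x:S|leb. (grad v x \<bullet> b) * phi x)" by simp
qed

text \<open>The kernel centred at \<open>x\<close> is a test function, so a derivative that falls on it may be moved to \<open>u\<close>.\<close>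

lemma grad_mollify:
 assumes G: "has_weak_gradient UNIV u G" "integrable leb u" "integrable leb G" and r: "0 < r"
 shows "grad (mollify r u) x = mollify r G x"
proof (rule euclidean_eqI)
 fix b :: 'a assume b: "b : Basis"
 let ?phi = "%y. kernel r (x - y)"
 have t: "test_function UNIV ?phi" by (rule test_function_kernel[OF r subset_UNIV])
 have "grad ?phi y \<bullet> b = - frechet_derivative (kernel r) (at (x - y)) b" for y
 proof -
 have k: "C_k (Suc 0) (kernel r :: 'a => real)" by (rule C_k_kernel)
 have "(?phi has_derivative (%h. frechet_derivative (kernel r) (at (x - y)) (- h))) (at y)"
  by (rule has_derivative_compose[OF _ C_k_SucD(1)[OF k]]) (auto intro!: derivative_eq_intros)
 then have "grad ?phi y \<bullet> b = frechet_derivative (kernel r) (at (x - y)) (- b)"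
  using b by (simp add: grad_inner_Basis frechet_derivativeI)
 then show ?thesis using linear_neg[OF has_derivative_linear[OF C_k_SucD(1)[OF k, of "x - y"]]] by simp
 qed
 then have "- (LINT y|leb. u y * frechet_derivative (kernel r) (at (x - y)) b) = - (LINT y|leb. (G y \<bullet> b) * ?phi y)"
 using has_weak_gradientD(3)[OF G(1) t b] by (simp add: set_lebesgue_integral_def)
 then have "convol (%z. frechet_derivative (kernel r) (at z) b) u x = mollify r (%y. G y \<bullet> b) x"
 by (simp add: convol_def mollify_def mult.commute)
 then show "grad (mollify r u) x \<bullet> b = mollify r G x \<bullet> b"
 using b mollify_frechet_derivative[OF r G(2) b] mollify_inner[OF r G(3)] by (simp add: grad_inner_Basis)
qed

definition L1_loc_tendsto :: "'a::euclidean_space set => (nat => 'a => 'b::euclidean_space) => ('a => 'b) => bool" where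
 "L1_loc_tendsto S v u \<longleftrightarrow>
 (\<forall>K. compact K --> K <= S --> (%n. LINT x:K|leb. norm (v n x - u x)) \<leadsto> 0)"

lemma L1_loc_tendsto_integral:
 fixes u psi :: "'a::euclidean_space => real"
 assumes v: "!!n. locally_integrable S (v n)" "locally_integrable S u" "L1_loc_tendsto S v u"
 and K: "compact K" "K <= S" and psi: "continuous_on UNIV psi" "!!x. x \<notin> K ==> psi x = 0"
 shows "(%n. LINT x:S|leb. v n x * psi x) \<leadsto> (LINT x:S|leb. u x * psi x)"
proof -
 obtain M where M: "0 <= M" "!!x. \<bar>psi x\<bar> <= M" using continuous_compact_support_bounded[OF psi(1) K(1) psi(2)] by blast
 note i = locally_integrable_mult_continuous(1)[OF v(1) K psi] locally_integrable_mult_continuous(1)[OF v(2) K psi]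
 have d: "set_integrable leb K (%x. norm (v n x - u x))" for n
 by (rule set_integrable_norm, rule set_integral_diff(1)[OF locally_integrable_set_integrable[OF v(1) K]
   locally_integrable_set_integrable[OF v(2) K]])
 have le: "norm ((LINT x:S|leb. v n x * psi x) - (LINT x:S|leb. u x * psi x)) <= M * (LINT x:K|leb. norm (v n x - u x))" for n
 proof -
 have "(LINT x:S|leb. v n x * psi x) - (LINT x:S|leb. u x * psi x) = (LINT x:S|leb. v n x * psi x - u x * psi x)"
  by (rule set_integral_diff(2)[OF i, symmetric])
 also have "... = (LINT x|leb. indicator S x *\<^sub>R (v n x * psi x - u x * psi x))" by (simp add: set_lebesgue_integral_def)
 also have "norm ... <= (LINT x|leb. norm (indicator S x *\<^sub>R (v n x * psi x - u x * psi x)))" by (rule integral_norm_bound)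
 also have "... <= (LINT x|leb. M * (indicator K x *\<^sub>R norm (v n x - u x)))"
 proof (rule integral_mono')
  show "integrable leb (%x. M * (indicator K x *\<^sub>R norm (v n x - u x)))"
  using d[of n] unfolding set_integrable_def by (rule integrable_mult_right)
  fix x
  show "norm (indicator S x *\<^sub>R (v n x * psi x - u x * psi x)) <= M * (indicator K x *\<^sub>R norm (v n x - u x))"
  proof (cases "x : K")
  case True
  have "\<bar>psi x\<bar> * \<bar>v n x - u x\<bar> <= M * \<bar>v n x - u x\<bar>" by (intro mult_right_mono M) auto
  moreover have "v n x * psi x - u x * psi x = psi x * (v n x - u x)" by (simp add: algebra_simps)
  moreover have "x : S" using True K(2) by blast
  ultimately show ?thesis using True by (simp add: abs_mult)
  qed (simp add: psi(2))
  show "0 <= M * (indicator K x *\<^sub>R norm (v n x - u x))" using M(1) by simp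
 qed
 also have "... = M * (LINT x:K|leb. norm (v n x - u x))" by (simp add: set_lebesgue_integral_def)
 finally show ?thesis .
 qed
 have "(%n. M * (LINT x:K|leb. norm (v n x - u x))) \<leadsto> 0"
 by (intro tendsto_mult_right_zero v(3)[unfolded L1_loc_tendsto_def, rule_format] K)
 then have "(%n. (LINT x:S|leb. v n x * psi x) - (LINT x:S|leb. u x * psi x)) \<leadsto> 0"
 by (rule Lim_null_comparison[OF always_eventually[OF allI[OF le]]])
 then show ?thesis by (rule LIM_zero_cancel)
qed

lemma L1_loc_tendsto_inner:
 assumes H: "!!n. locally_integrable S (H n)" "locally_integrable S G" "L1_loc_tendsto S H G"
 shows "L1_loc_tendsto S (%n x. H n x \<bullet> b) (%x. G x \<bullet> b)"
 unfolding L1_loc_tendsto_def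
proof (intro allI impI)
 fix K assume K: "compact K" "K <= S"
 have d: "set_integrable leb K (%x. norm (H n x - G x))" for n
 by (rule set_integrable_norm, rule set_integral_diff(1)[OF locally_integrable_set_integrable[OF H(1) K]
   locally_integrable_set_integrable[OF H(2) K]])
 have le: "norm (LINT x:K|leb. norm (H n x \<bullet> b - G x \<bullet> b)) <= norm b * (LINT x:K|leb. norm (H n x - G x))" for n
 proof -
 have "(LINT x:K|leb. norm (H n x \<bullet> b - G x \<bullet> b)) <= (LINT x|leb. norm b * (indicator K x *\<^sub>R norm (H n x - G x)))"
  unfolding set_lebesgue_integral_def
 proof (rule integral_mono')
  show "integrable leb (%x. norm b * (indicator K x *\<^sub>R norm (H n x - G x)))"
  using d[of n] unfolding set_integrable_def by (rule integrable_mult_right)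
  show "indicat_real K x *\<^sub>R norm (H n x \<bullet> b - G x \<bullet> b) <= norm b * (indicat_real K x *\<^sub>R norm (H n x - G x))" for x
  using Cauchy_Schwarz_ineq2[of "H n x - G x" b] by (auto simp: indicator_def inner_diff_left mult.commute)
 qed simp
 moreover have "0 <= (LINT x:K|leb. norm (H n x \<bullet> b - G x \<bullet> b))"
  unfolding set_lebesgue_integral_def by (intro LINT_nonneg) auto
 ultimately show ?thesis by (simp add: set_lebesgue_integral_def)
 qed
 show "(%n. LINT x:K|leb. norm (H n x \<bullet> b - G x \<bullet> b)) \<leadsto> 0"
 by (rule Lim_null_comparison[OF always_eventually[OF allI[OF le]]])
  (intro tendsto_mult_right_zero H(3)[unfolded L1_loc_tendsto_def, rule_format] K)
qed

text \<open>The defining identity passes to limits in local \<open>L\<^sup>1\<close>, because test functions and their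
 derivatives are bounded with compact support.\<close>

lemma has_weak_gradient_limit:
 assumes v: "!!n. has_weak_gradient S (v n) (H n)" "L1_loc_tendsto S v u" "L1_loc_tendsto S H G"
 and L: "locally_integrable S u" "locally_integrable S G"
 shows "has_weak_gradient S u G"
proof (rule has_weak_gradientI[OF L])
 note D = has_weak_gradientD[OF v(1)]
 fix phi :: "'a => real" and b :: 'a assume phi: "test_function S phi" and b: "b : Basis"
 obtain K where K: "smooth phi" "compact K" "K <= S" "!!x. x \<notin> K ==> phi x = 0" using phi by (rule test_functionE) blast
 have g0: "grad phi x \<bullet> b = 0" if "x \<notin> K" for x
 using grad_eq_0_outside[OF compact_imp_closed[OF K(2)], of phi x] K(4) that by simp
 have "(%n. LINT x:S|leb. v n x * (grad phi x \<bullet> b)) \<leadsto> (LINT x:S|leb. u x * (grad phi x \<bullet> b))"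
 by (rule L1_loc_tendsto_integral[OF D(1) L(1) v(2) K(2,3) _ g0])
  (intro continuous_intros smooth_grad_continuous[OF K(1)])
 moreover have "(%n. LINT x:S|leb. (H n x \<bullet> b) * phi x) \<leadsto> (LINT x:S|leb. (G x \<bullet> b) * phi x)"
 by (rule L1_loc_tendsto_integral[OF locally_integrable_inner[OF D(2)] locally_integrable_inner[OF L(2)]
  L1_loc_tendsto_inner[OF D(2) L(2) v(3)] K(2,3) smooth_continuous[OF K(1)] K(4)])
 ultimately have "(%n. LINT x:S|leb. v n x * (grad phi x \<bullet> b)) \<leadsto> - (LINT x:S|leb. (G x \<bullet> b) * phi x)"
 unfolding D(3)[OF phi b] by (intro tendsto_minus)
 with \<open>(%n. LINT x:S|leb. v n x * (grad phi x \<bullet> b)) \<leadsto> (LINT x:S|leb. u x * (grad phi x \<bullet> b))\<close>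
 show "(LINT x:S|leb. u x * (grad phi x \<bullet> b)) = - (LINT x:S|leb. (G x \<bullet> b) * phi x)"
 by (rule LIMSEQ_unique)
qed



subsection \<open>Chain rule and level sets\<close>

lemma L1_loc_tendstoI:
 assumes "!!n K. compact K ==> K <= S ==> (LINT x:K|leb. norm (v n x - u x)) <= e K n"
 "!!K. compact K ==> K <= S ==> e K \<leadsto> (0::real)"
 shows "L1_loc_tendsto S v u"
 unfolding L1_loc_tendsto_def
proof (intro allI impI)
 fix K assume K: "compact K" "K <= S"
 have le: "norm (LINT x:K|leb. norm (v n x - u x)) <= e K n" for n
 proof -
 have "0 <= (LINT x:K|leb. norm (v n x - u x))"
  unfolding set_lebesgue_integral_def by (rule LINT_nonneg) simp
 then show ?thesis using assms(1)[OF K, of n] by simp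
 qed
 show "(%n. LINT x:K|leb. norm (v n x - u x)) \<leadsto> 0"
 by (rule Lim_null_comparison[OF always_eventually[OF allI[OF le]] assms(2)[OF K]])
qed

lemma set_integral_le_integral:
 fixes f :: "'a::euclidean_space => real"
 assumes "integrable leb g" "!!x. x : K ==> f x <= g x" "!!x. 0 <= g x"
 shows "(LINT x:K|leb. f x) <= (LINT x|leb. g x)"
 unfolding set_lebesgue_integral_def
 by (rule integral_mono') (use assms in \<open>auto simp: indicator_def\<close>)

text \<open>The composition is differentiated for smooth approximations of \<open>u\<close>; dominated convergence gives the
 general case.\<close>

lemma has_weak_gradient_chain_UNIV:
 fixes u :: "'a::euclidean_space => real"
 assumes G: "has_weak_gradient UNIV u G" "integrable leb u" "integrable leb G"
 and psi: "!!t. (psi has_real_derivative psi' t) (at t)" "continuous_on UNIV psi'" "!!t. \<bar>psi' t\<bar> <= M"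
 shows "has_weak_gradient UNIV (%x. psi (u x)) (%x. psi' (u x) *\<^sub>R G x)"
proof -
 define r where "r n = 1 / real (Suc n)" for n
 have r: "0 < r n" for n by (simp add: r_def)
 have rlim: "r \<leadsto> 0" unfolding r_def using LIMSEQ_inverse_real_of_nat by (simp add: inverse_eq_divide)
 have psic: "continuous_on UNIV psi" using psi(1) DERIV_isCont continuous_at_imp_continuous_on by blast
 have psim: "psi : borel_measurable borel" "psi' : borel_measurable borel"
 using psic psi(2) by (auto intro: borel_measurable_continuous_onI)
 have M0: "0 <= M" using psi(3)[of 0] by linarith
 have psilip: "\<bar>psi a - psi b\<bar> <= M * \<bar>a - b\<bar>" for a b
 proof -
 have "norm (psi a - psi b) <= M * norm (a - b)"
  by (rule field_differentiable_bound[of UNIV psi psi' M])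
   (use psi(1,3) in \<open>auto simp: has_field_derivative_at_within\<close>)
 then show ?thesis by simp
 qed
 let ?mu = "%n. mollify (r n) u" and ?mG = "%n. mollify (r n) G"
 have i: "integrable leb (?mu n)" "integrable leb (?mG n)" for n
 using mollify_L1_bound(1)[OF r G(2)] mollify_L1_bound(1)[OF r G(3)] by auto
 have di: "integrable leb (%x. ?mu n x - u x)" for n using i G by simp
 have lu: "(%n. LINT x|leb. norm (?mu n x - u x)) \<leadsto> 0" by (rule mollify_tendsto_L1[OF G(2) r rlim])
 obtain s where s: "strict_mono s" "AE x in leb. (%n. ?mu (s n) x - u x) \<leadsto> 0"
 using tendsto_L1_AE_subseq[OF di lu] by blast
 have lu': "(%n. LINT x|leb. norm (?mu (s n) x - u x)) \<leadsto> 0"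
 using LIMSEQ_subseq_LIMSEQ[OF lu s(1)] by (simp add: o_def)
 have lG': "(%n. LINT x|leb. norm (?mG (s n) x - G x)) \<leadsto> 0"
 using LIMSEQ_subseq_LIMSEQ[OF mollify_tendsto_L1[OF G(3) r rlim] s(1)] by (simp add: o_def)
 have um: "u : borel_measurable leb" "G : borel_measurable leb" "?mu n : borel_measurable leb" for n
 using G i(1) by (auto dest: borel_measurable_integrable)
 have cm: "(%x. psi' (u x)) : borel_measurable leb" "(%x. psi' (?mu n x)) : borel_measurable leb" for n
 using measurable_compose[OF um(1) psim(2)] measurable_compose[OF um(3) psim(2)] by auto
 have w: "has_weak_gradient UNIV (%x. psi (?mu n x)) (%x. psi' (?mu n x) *\<^sub>R ?mG n x)" for n
 proof -
 have C: "C_k k (?mu n)" for k by (rule C_k_mollify[OF r G(2)])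
 have D: "((%x. psi (?mu n x)) has_derivative (%h. psi' (?mu n x) * frechet_derivative (?mu n) (at x) h)) (at x)" for x
  using has_derivative_compose[OF C_k_SucD(1)[OF C] psi(1)[unfolded has_field_derivative_def]] by simp
 have C1: "C_k (Suc 0) (%x. psi (?mu n x))"
 proof (rule C_k_SucI[OF D])
  fix b :: 'a assume "b : Basis"
  then have "continuous_on UNIV (%x. frechet_derivative (?mu n) (at x) b)"
  using C_k_SucD(2)[OF C[of "Suc 0"]] by simp
  moreover have "continuous_on UNIV (%x. psi' (?mu n x))"
  using C[of 0] by (intro continuous_on_compose2[OF psi(2)]) auto
  ultimately show "C_k 0 (%x. psi' (?mu n x) * frechet_derivative (?mu n) (at x) b)"
  by (simp add: continuous_on_mult)
 qed
 have "grad (%x. psi (?mu n x)) x = psi' (?mu n x) *\<^sub>R grad (?mu n) x" for x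
  by (simp add: grad_def frechet_derivativeI[OF D] scaleR_sum_right)
 then have "grad (%x. psi (?mu n x)) = (%x. psi' (?mu n x) *\<^sub>R ?mG n x)"
  by (simp add: grad_mollify[OF G r] fun_eq_iff)
 with C1_has_weak_gradient[OF C1, of UNIV] show ?thesis by simp
 qed
 show ?thesis
 proof (rule has_weak_gradient_limit[of UNIV "%n x. psi (?mu (s n) x)" "%n x. psi' (?mu (s n) x) *\<^sub>R ?mG (s n) x"])
 show "has_weak_gradient UNIV (%x. psi (?mu (s n) x)) (%x. psi' (?mu (s n) x) *\<^sub>R ?mG (s n) x)" for n by (rule w)
 show "L1_loc_tendsto UNIV (%n x. psi (?mu (s n) x)) (%x. psi (u x))"
 proof (rule L1_loc_tendstoI)
  show "(LINT x:K|leb. norm (psi (?mu (s n) x) - psi (u x))) <= (LINT x|leb. M * norm (?mu (s n) x - u x))" for n K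
  by (rule set_integral_le_integral) (use di psilip M0 in auto)
  show "(%n. LINT x|leb. M * norm (?mu (s n) x - u x)) \<leadsto> 0"
  using tendsto_mult_right_zero[OF lu', of M] by simp
 qed
 define e where "e n = M * (LINT x|leb. norm (?mG (s n) x - G x)) + (LINT x|leb. \<bar>psi' (?mu (s n) x) - psi' (u x)\<bar> * norm (G x))" for n
 have i2: "integrable leb (%x. \<bar>psi' (?mu n x) - psi' (u x)\<bar> * norm (G x))" for n
 proof (rule intgb_bound[of _ "%x. 2 * M * norm (G x)"])
  show "integrable leb (%x. 2 * M * norm (G x))" using G(3) by simp
  show "(%x. \<bar>psi' (?mu n x) - psi' (u x)\<bar> * norm (G x)) : borel_measurable leb" using cm um by simp
  show "AE x in leb. norm (\<bar>psi' (?mu n x) - psi' (u x)\<bar> * norm (G x)) <= norm (2 * M * norm (G x))"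
  proof (intro AE_I2)
  fix x
  have "\<bar>psi' (?mu n x) - psi' (u x)\<bar> <= 2 * M" using psi(3)[of "?mu n x"] psi(3)[of "u x"] by linarith
  then show "norm (\<bar>psi' (?mu n x) - psi' (u x)\<bar> * norm (G x)) <= norm (2 * M * norm (G x))"
   using M0 by (simp add: abs_mult mult_right_mono)
  qed
 qed
 have "(%n. LINT x|leb. \<bar>psi' (?mu (s n) x) - psi' (u x)\<bar> * norm (G x)) \<leadsto> (LINT x|(leb::'a measure). 0)"
 proof (rule integral_dominated_convergence[where w = "%x. 2 * M * norm (G x)"])
  show "integrable leb (%x. 2 * M * norm (G x))" using G(3) by simp
  show "(%x. \<bar>psi' (?mu (s n) x) - psi' (u x)\<bar> * norm (G x)) : borel_measurable leb" for n
  using i2 by (rule borel_measurable_integrable)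
  show "AE x in leb. (%n. \<bar>psi' (?mu (s n) x) - psi' (u x)\<bar> * norm (G x)) \<leadsto> 0"
  using s(2)
  proof eventually_elim
  case (elim x)
  have "(%n. ?mu (s n) x) \<leadsto> u x" using elim by (rule LIM_zero_cancel)
  moreover have "isCont psi' (u x)" using psi(2) by (simp add: continuous_on_eq_continuous_at)
  ultimately have "(%n. psi' (?mu (s n) x)) \<leadsto> psi' (u x)" by (rule isCont_tendsto_compose[rotated])
  then have "(%n. psi' (?mu (s n) x) - psi' (u x)) \<leadsto> 0" by (rule LIM_zero)
  then show ?case by (intro tendsto_mult_left_zero tendsto_rabs_zero)
  qed
  show "AE x in leb. norm (\<bar>psi' (?mu (s n) x) - psi' (u x)\<bar> * norm (G x)) <= 2 * M * norm (G x)" for n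
  proof (intro AE_I2)
  fix x
  have "\<bar>psi' (?mu (s n) x) - psi' (u x)\<bar> <= 2 * M" using psi(3)[of "?mu (s n) x"] psi(3)[of "u x"] by linarith
  then show "norm (\<bar>psi' (?mu (s n) x) - psi' (u x)\<bar> * norm (G x)) <= 2 * M * norm (G x)"
   by (simp add: mult_right_mono)
  qed
 qed simp
 then have "(%n. LINT x|leb. \<bar>psi' (?mu (s n) x) - psi' (u x)\<bar> * norm (G x)) \<leadsto> 0" by simp
 from tendsto_add[OF tendsto_mult_right_zero[OF lG', of M] this] have e0: "e \<leadsto> 0" by (simp add: e_def[abs_def])
 show "L1_loc_tendsto UNIV (%n x. psi' (?mu (s n) x) *\<^sub>R ?mG (s n) x) (%x. psi' (u x) *\<^sub>R G x)"
 proof (rule L1_loc_tendstoI[of _ _ _ "%_. e"])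
  fix n K
  have "(LINT x:K|leb. norm (psi' (?mu (s n) x) *\<^sub>R ?mG (s n) x - psi' (u x) *\<^sub>R G x))
  <= (LINT x|leb. M * norm (?mG (s n) x - G x) + \<bar>psi' (?mu (s n) x) - psi' (u x)\<bar> * norm (G x))"
  proof (rule set_integral_le_integral)
  show "integrable leb (%x. M * norm (?mG (s n) x - G x) + \<bar>psi' (?mu (s n) x) - psi' (u x)\<bar> * norm (G x))"
   using i2[of "s n"] i(2)[of "s n"] G(3) by simp
  show "norm (psi' (?mu (s n) x) *\<^sub>R ?mG (s n) x - psi' (u x) *\<^sub>R G x)
   <= M * norm (?mG (s n) x - G x) + \<bar>psi' (?mu (s n) x) - psi' (u x)\<bar> * norm (G x)" for x
  proof -
   have "psi' (?mu (s n) x) *\<^sub>R ?mG (s n) x - psi' (u x) *\<^sub>R G x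
   = psi' (?mu (s n) x) *\<^sub>R (?mG (s n) x - G x) + (psi' (?mu (s n) x) - psi' (u x)) *\<^sub>R G x"
   by (simp add: algebra_simps)
   also have "norm ... <= \<bar>psi' (?mu (s n) x)\<bar> * norm (?mG (s n) x - G x) + \<bar>psi' (?mu (s n) x) - psi' (u x)\<bar> * norm (G x)"
   by (rule order_trans[OF norm_triangle_ineq]) simp
   also have "... <= M * norm (?mG (s n) x - G x) + \<bar>psi' (?mu (s n) x) - psi' (u x)\<bar> * norm (G x)"
   by (intro add_right_mono mult_right_mono psi(3)) simp
   finally show ?thesis .
  qed
  show "0 <= M * norm (?mG (s n) x - G x) + \<bar>psi' (?mu (s n) x) - psi' (u x)\<bar> * norm (G x)" for x using M0 by simp
  qed
  also have "... = e n" using i2[of "s n"] i(2)[of "s n"] G(3) by (simp add: e_def)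
  finally show "(LINT x:K|leb. norm (psi' (?mu (s n) x) *\<^sub>R ?mG (s n) x - psi' (u x) *\<^sub>R G x)) <= e n" .
 qed (rule e0)
 have "integrable leb (%x. psi (u x) - psi 0)"
 proof (rule intgb_bound[of _ "%x. M * norm (u x)"])
  show "(%x. psi (u x) - psi 0) : borel_measurable leb" using measurable_compose[OF um(1) psim(1)] by simp
  show "AE x in leb. norm (psi (u x) - psi 0) <= norm (M * norm (u x))"
  using psilip[of _ 0] M0 by (intro AE_I2) simp
 qed (use G(2) in simp)
 then have "locally_integrable UNIV (%x. (psi (u x) - psi 0) + psi 0)"
  by (intro locally_integrable_add integrable_imp_locally_integrable locally_integrable_continuous continuous_on_const)
 then show "locally_integrable UNIV (%x. psi (u x))" by simp
 show "locally_integrable UNIV (%x. psi' (u x) *\<^sub>R G x)"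
 proof (rule integrable_imp_locally_integrable, rule intgb_bound[of _ "%x. M * norm (G x)"])
  show "(%x. psi' (u x) *\<^sub>R G x) : borel_measurable leb" using cm um by simp
  show "AE x in leb. norm (psi' (u x) *\<^sub>R G x) <= norm (M * norm (G x))"
  using psi(3) M0 by (intro AE_I2) (simp add: mult_right_mono)
 qed (use G(3) in simp)
 qed
qed

theorem has_weak_gradient_chain:
 fixes u :: "'a::euclidean_space => real"
 assumes S: "open S" and G: "has_weak_gradient S u G"
 and psi: "!!t. (psi has_real_derivative psi' t) (at t)" "continuous_on UNIV psi'" "!!t. \<bar>psi' t\<bar> <= M"
 shows "has_weak_gradient S (%x. psi (u x)) (%x. psi' (u x) *\<^sub>R G x)"
proof (rule has_weak_gradient_local)
 fix x assume "x : S"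
 then obtain e where e: "0 < e" "cball x e <= S" using S open_contains_cball by metis
 obtain eta where eta: "smooth eta" "!!y. y : ball x (e/2) ==> eta y = 1" "!!y. y \<notin> cball x (3*e/4) ==> eta y = 0"
 using cutoff_ball[OF e(1), of x] by metis
 have K: "cball x (3*e/4) <= S" using e by (intro order_trans[OF _ e(2)]) auto
 note E = has_weak_gradient_cutoff_extension[OF G eta(1) compact_cball K eta(3)]
 note C = has_weak_gradient_mono[OF has_weak_gradient_chain_UNIV[OF E psi] subset_UNIV, of "ball x (e/2)"]
 have sub: "ball x (e/2) <= S" using e by (intro order_trans[OF _ e(2)]) auto
 have "has_weak_gradient (ball x (e/2)) (%x. psi (u x)) (%x. psi' (u x) *\<^sub>R G x)"
 proof (rule has_weak_gradient_cong[OF C])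
 fix y assume y: "y : ball x (e/2)"
 have g: "grad eta y = 0" using eta(2) y by (intro grad_const_on_open[of "ball x (e/2)" eta 1]) auto
 have yS: "y : S" using y sub by blast
 show "psi (if y : S then eta y * u y else 0) = psi (u y)" using yS eta(2)[OF y] by simp
 show "psi' (if y : S then eta y * u y else 0) *\<^sub>R (if y : S then eta y *\<^sub>R G y + u y *\<^sub>R grad eta y else 0) = psi' (u y) *\<^sub>R G y"
  using yS eta(2)[OF y] g by simp
 qed
 with sub e(1) show "\<exists>e>0. ball x e <= S & has_weak_gradient (ball x e) (%x. psi (u x)) (%x. psi' (u x) *\<^sub>R G x)"
 by (intro exI[of _ "e/2"]) simp
qed

text \<open>A continuously differentiable version of soft thresholding: \<open>soft e t\<close> vanishes for \<open>\<bar>t\<bar> <= e\<close> and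
 equals \<open>t - 2 e sgn t + e^2 / t\<close> otherwise.\<close>

definition soft :: "real => real => real" where
 "soft e t = (max 0 (\<bar>t\<bar> - e))^2 / t"

definition soft' :: "real => real => real" where
 "soft' e t = 1 - (e / max \<bar>t\<bar> e)^2"

lemma soft_eq_0: "\<bar>t\<bar> <= e ==> soft e t = 0" by (simp add: soft_def)

lemma soft'_bounds: "0 < e ==> 0 <= soft' e t" "0 < e ==> soft' e t <= 1"
proof -
 assume e: "0 < e"
 have "\<bar>e / max \<bar>t\<bar> e\<bar> <= 1" using e by (simp add: divide_le_eq)
 then have "(e / max \<bar>t\<bar> e)^2 <= 1" by (simp add: abs_square_le_1)
 then show "0 <= soft' e t" "soft' e t <= 1" by (simp_all add: soft'_def)
qed

lemma soft'_continuous: "0 < e ==> continuous_on UNIV (soft' e)"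
 unfolding soft'_def by (intro continuous_intros) (auto simp: max_def)

lemma max_square_derivative: "((%s. (max 0 s)^2) has_real_derivative 2 * max 0 s) (at s)"
proof -
 consider "s > 0" | "s < 0" | "s = 0" by linarith
 then show ?thesis
 proof cases
 case 1
 have "((%s. s^2) has_real_derivative 2 * max 0 s) (at s)" using 1 by (auto intro!: derivative_eq_intros)
 then show ?thesis by (rule has_field_derivative_transform_within_open[of _ _ _ "{0<..}"]) (use 1 in auto)
 next
 case 2
 have "((%s. 0) has_real_derivative 2 * max 0 s) (at s)" using 2 by auto
 then show ?thesis by (rule has_field_derivative_transform_within_open[of _ _ _ "{..<0}"]) (use 2 in auto)
 next
 case 3
 have "((%h. (max 0 h)^2 / h) \<longlongrightarrow> 0) (at (0::real))"
 proof (rule Lim_null_comparison)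
  show "\<forall>\<^sub>F h in at 0. norm ((max 0 h)^2 / h) <= \<bar>h :: real\<bar>"
  by (rule always_eventually) (auto simp: max_def power2_eq_square)
  show "((%h. \<bar>h\<bar>) \<longlongrightarrow> 0) (at (0::real))" by (auto intro!: tendsto_eq_intros)
 qed
 then show ?thesis using 3 by (simp add: DERIV_def)
 qed
qed

lemma soft_derivative:
 assumes e: "0 < e"
 shows "(soft e has_real_derivative soft' e t) (at t)"
proof (cases "t = 0")
 case True
 have "((%s. 0) has_real_derivative soft' e t) (at t)" using True e by (simp add: soft'_def max_def)
 then show ?thesis
 by (rule has_field_derivative_transform_within_open[of _ _ _ "{- e<..<e}"]) (use True e in \<open>auto simp: soft_eq_0\<close>)
next
 case False
 have a: "((%t. \<bar>t\<bar> - e) has_real_derivative sgn t) (at t)"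
 proof -
 have "((%s. sgn t * s - e) has_real_derivative sgn t) (at t)" by (auto intro!: derivative_eq_intros)
 then show ?thesis
  by (rule has_field_derivative_transform_within_open[of _ _ _ "if t > 0 then {0<..} else {..<0}"])
   (use False in \<open>auto simp: sgn_if split: if_splits\<close>)
 qed
 define p where "p = max 0 (\<bar>t\<bar> - e)"
 have "((%t. (max 0 (\<bar>t\<bar> - e))^2) has_real_derivative 2 * p * sgn t) (at t)"
 using DERIV_chain2[OF max_square_derivative a] by (simp add: p_def)
 from DERIV_divide[OF this DERIV_ident False]
 have D: "(soft e has_real_derivative (2 * p * sgn t * t - p^2) / (t * t)) (at t)" by (simp add: soft_def[abs_def] p_def)
 have st: "sgn t * t = \<bar>t\<bar>" by (simp add: abs_sgn mult.commute)
 have "(2 * p * sgn t * t - p^2) / (t * t) = soft' e t"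
 proof (cases "\<bar>t\<bar> <= e")
 case True
 then show ?thesis using e by (simp add: p_def soft'_def max_def)
 next
 case F: False
 have "2 * p * sgn t * t = 2 * p * \<bar>t\<bar>" by (simp add: st mult.assoc)
 then have "2 * p * sgn t * t - p^2 = \<bar>t\<bar>^2 - e^2" using F by (simp add: p_def power2_eq_square algebra_simps)
 then show ?thesis using F False by (simp add: soft'_def max_def power_divide diff_divide_distrib power2_eq_square[of t, symmetric])
 qed
 with D show ?thesis by simp
qed

lemma soft_close: "0 < e ==> \<bar>soft e t - t\<bar> <= 2 * e"
proof -
 assume e: "0 < e"
 show ?thesis
 proof (cases "\<bar>t\<bar> <= e")
 case True then show ?thesis using e by (simp add: soft_eq_0)
 next
 case False
 then have t: "t ~= 0" using e by auto
 have "soft e t - t = (e^2 - 2 * e * \<bar>t\<bar>) / t" using False t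
  by (simp add: soft_def field_simps power2_eq_square)
 moreover have "\<bar>e^2 - 2 * e * \<bar>t\<bar>\<bar> <= 2 * e * \<bar>t\<bar>"
 proof -
  have "e * e <= e * \<bar>t\<bar>" using False e by (intro mult_left_mono) auto
  then show ?thesis using e by (simp add: power2_eq_square abs_le_iff)
 qed
 ultimately show ?thesis using t by (simp add: divide_le_eq)
 qed
qed

lemma soft'_tendsto:
 "(%n. soft' (1 / real (Suc n)) t) \<leadsto> (if t = 0 then 0 else 1)"
proof (cases "t = 0")
 case True then show ?thesis by (simp add: soft'_def max_def)
next
 case False
 have l: "(%n. 1 / real (Suc n)) \<leadsto> 0" using LIMSEQ_inverse_real_of_nat by (simp add: inverse_eq_divide)
 have "(%n. 1 - (1 / real (Suc n) / max \<bar>t\<bar> (1 / real (Suc n)))^2) \<leadsto> 1 - (0 / max \<bar>t\<bar> 0)^2"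
 by (intro tendsto_diff tendsto_const tendsto_power tendsto_divide tendsto_max l) (use False in auto)
 then show ?thesis using False by (simp add: soft'_def)
qed

lemma has_weak_gradient_soft:
 assumes "open S" "has_weak_gradient S u G" "0 < e"
 shows "has_weak_gradient S (%x. soft e (u x)) (%x. soft' e (u x) *\<^sub>R G x)"
 by (rule has_weak_gradient_chain[OF assms(1,2) soft_derivative[OF assms(3)] soft'_continuous[OF assms(3)], of 1])
  (use soft'_bounds[OF assms(3)] in \<open>auto simp: abs_le_iff intro: order_trans[of _ 0]\<close>)

text \<open>The functions \<open>soft e u\<close> tend to \<open>u\<close> and their gradients \<open>soft' e u \<cdot> G\<close> tend to \<open>G\<close> off the zero set
 and to \<open>0\<close> on it. Since weak gradients are unique, \<open>G\<close> must vanish there.\<close>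

theorem weak_gradient_eq_0_on_zero_set:
 fixes u :: "'a::euclidean_space => real"
 assumes S: "open S" and G: "has_weak_gradient S u G"
 shows "AE x in leb. x : S --> u x = 0 --> G x = 0"
proof -
 note D = has_weak_gradientD[OF G]
 define e where "e n = 1 / real (Suc n)" for n
 have e: "0 < e n" for n by (simp add: e_def)
 have elim: "e \<leadsto> 0" unfolding e_def using LIMSEQ_inverse_real_of_nat by (simp add: inverse_eq_divide)
 define H where "H x = (if u x = 0 then 0 else G x)" for x
 have Ki: "integrable leb (%x. indicator K x *\<^sub>R G x)" "integrable leb (%x. indicator K x *\<^sub>R u x)"
 if "compact K" "K <= S" for K
 using locally_integrable_set_integrable[OF D(1) that] locally_integrable_set_integrable[OF D(2) that]
 by (auto simp: set_integrable_def)
 have Hi: "integrable leb (%x. indicator K x *\<^sub>R H x)" if "compact K" "K <= S" for K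
 proof (rule intgb_bound[OF Ki(1)[OF that]])
 have m: "(%x. indicator K x *\<^sub>R u x) : borel_measurable leb" "(%x. indicator K x *\<^sub>R G x) : borel_measurable leb"
  using Ki[OF that] by auto
 have "(%x. indicator K x *\<^sub>R H x) = (%x. if indicator K x *\<^sub>R u x = 0 then 0 else indicator K x *\<^sub>R G x)"
  by (auto simp: H_def indicator_def)
 also have "... : borel_measurable leb" using m by measurable
 finally show "(%x. indicator K x *\<^sub>R H x) : borel_measurable leb" .
 qed (auto simp: H_def)
 have "has_weak_gradient S u H"
 proof (rule has_weak_gradient_limit[OF has_weak_gradient_soft[OF S G e]])
 show "L1_loc_tendsto S (%n x. soft (e n) (u x)) u"
 proof (rule L1_loc_tendstoI)
  fix n and K :: "'a set" assume K: "compact K" "K <= S"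
  have "(LINT x:K|leb. norm (soft (e n) (u x) - u x)) <= (LINT x|leb. 2 * e n * indicator K x)"
  unfolding set_lebesgue_integral_def
  proof (rule integral_mono')
  show "integrable leb (%x. 2 * e n * indicator K x)"
   using lmeasurable_compact[OF K(1)] by (intro integrable_mult_right) (simp add: lmeasurable_iff_integrable)
  qed (use soft_close[OF e] e[of n] in \<open>auto simp: indicator_def less_imp_le\<close>)
  then show "(LINT x:K|leb. norm (soft (e n) (u x) - u x)) <= 2 * e n * measure leb K" using K by simp
 next
  show "(%n. 2 * e n * measure leb K) \<leadsto> 0" for K
  using tendsto_mult[OF tendsto_mult[OF tendsto_const[of 2] elim] tendsto_const[of "measure leb K"]] by simp
 qed
 show "L1_loc_tendsto S (%n x. soft' (e n) (u x) *\<^sub>R G x) H"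
  unfolding L1_loc_tendsto_def
 proof (intro allI impI)
  fix K :: "'a set" assume K: "compact K" "K <= S"
  have b: "norm (soft' (e n) (u x) *\<^sub>R G x - H x) <= norm (G x)" for n x
  proof -
  have "\<bar>soft' (e n) (u x)\<bar> <= 1" "\<bar>soft' (e n) (u x) - 1\<bar> <= 1" using soft'_bounds[OF e, of n "u x"] by auto
  moreover have "soft' (e n) (u x) *\<^sub>R G x - G x = (soft' (e n) (u x) - 1) *\<^sub>R G x" by (simp add: algebra_simps)
  moreover have "\<bar>soft' (e n) (u x)\<bar> * norm (G x) <= 1 * norm (G x)" "\<bar>soft' (e n) (u x) - 1\<bar> * norm (G x) <= 1 * norm (G x)"
   by (intro mult_right_mono calculation norm_ge_zero)+
  ultimately show ?thesis by (cases "u x = 0") (simp_all add: H_def)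
  qed
  have "(%n. LINT x|leb. indicator K x *\<^sub>R norm (soft' (e n) (u x) *\<^sub>R G x - H x)) \<leadsto> (LINT x|(leb::'a measure). 0)"
  proof (rule integral_dominated_convergence[where w = "%x. norm (indicator K x *\<^sub>R G x)"])
  show "(%x. indicator K x *\<^sub>R norm (soft' (e n) (u x) *\<^sub>R G x - H x)) : borel_measurable leb" for n
  proof -
   have "(%x. indicator K x *\<^sub>R (soft' (e n) (u x) *\<^sub>R G x)) : borel_measurable leb"
   using locally_integrable_set_integrable[OF has_weak_gradientD(2)[OF has_weak_gradient_soft[OF S G e[of n]]] K]
   unfolding set_integrable_def by (rule borel_measurable_integrable)
   from measurable_compose[OF borel_measurable_diff[OF this borel_measurable_integrable[OF Hi[OF K]]] borel_measurable_norm]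
   moreover have "(%x. norm (indicator K x *\<^sub>R soft' (e n) (u x) *\<^sub>R G x - indicator K x *\<^sub>R H x))
    = (%x. indicator K x *\<^sub>R norm (soft' (e n) (u x) *\<^sub>R G x - H x))"
   by (auto simp: indicator_def fun_eq_iff)
   ultimately show ?thesis by (simp only:)
  qed
  show "integrable leb (%x. norm (indicator K x *\<^sub>R G x))" using Ki[OF K] by (intro integrable_norm)
  show "AE x in leb. (%n. indicator K x *\<^sub>R norm (soft' (e n) (u x) *\<^sub>R G x - H x)) \<leadsto> 0"
  proof (intro AE_I2)
   fix x
   have "(%n. soft' (e n) (u x) *\<^sub>R G x) \<leadsto> (if u x = 0 then 0 else 1) *\<^sub>R G x"
   unfolding e_def by (intro tendsto_scaleR soft'_tendsto tendsto_const)
   also have "(if u x = 0 then 0 else 1) *\<^sub>R G x = H x" by (simp add: H_def)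
   finally have "(%n. norm (soft' (e n) (u x) *\<^sub>R G x - H x)) \<leadsto> 0"
   by (intro tendsto_norm_zero LIM_zero)
   from tendsto_mult_right_zero[OF this, of "indicator K x"]
   show "(%n. indicator K x *\<^sub>R norm (soft' (e n) (u x) *\<^sub>R G x - H x)) \<leadsto> 0" by simp
  qed
  show "AE x in leb. norm (indicator K x *\<^sub>R norm (soft' (e n) (u x) *\<^sub>R G x - H x)) <= norm (indicator K x *\<^sub>R G x)" for n
   using b by (intro AE_I2) (auto simp: indicator_def)
  qed simp
  then show "(%n. LINT x:K|leb. norm (soft' (e n) (u x) *\<^sub>R G x - H x)) \<leadsto> 0"
  by (simp add: set_lebesgue_integral_def)
 qed
 show "locally_integrable S u" by (rule D(1))
 show "locally_integrable S H" unfolding locally_integrable_def set_integrable_def using Hi by blast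
 qed
 from weak_gradient_unique[OF S G this] show ?thesis
 by eventually_elim (auto simp: H_def)
qed



section \<open>Difference estimates and vanishing near the complement\<close>

lemma frechet_derivative_eq_grad:
 assumes "v differentiable (at x)"
 shows "frechet_derivative v (at x) h = grad v x \<bullet> h"
 by (subst frechet_derivative_basis_sum[OF assms], simp only: grad_def inner_sum_left)
  (simp add: inner_commute mult.commute)

lemma nn_integral_lborel_translate:
 fixes f :: "'a::euclidean_space => ennreal"
 assumes "f : borel_measurable borel"
 shows "(\<integral>\<^sup>+x. f (c + x) \<partial>lborel) = (\<integral>\<^sup>+x. f x \<partial>lborel)"
proof -
 have "(\<integral>\<^sup>+x. f x \<partial>distr lborel borel ((+) c)) = (\<integral>\<^sup>+x. f (c + x) \<partial>lborel)"
 using assms by (intro nn_integral_distr) auto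
 then show ?thesis by (simp add: lborel_distr_plus)
qed

lemma AE_lebesgue_translate:
 fixes c :: "'a::euclidean_space"
 assumes "AE x in leb. P x"
 shows "AE x in leb. P (c + x)"
proof -
 have "AE x in distr lborel borel ((+) c). P x" using assms by (simp only: lborel_distr_plus AE_completion_iff)
 then have "AE x in lborel. P (c + x)" by (rule AE_distrD[rotated]) simp
 then show ?thesis by (rule AE_completion)
qed

lemma C1_difference_pointwise:
 fixes v :: "'a::euclidean_space => real"
 assumes v: "C_k (Suc 0) v"
 shows "ennreal ((v (x + h) - v x)^2)
 <= (\<integral>\<^sup>+t. ennreal ((norm h)^2 * (norm (grad v (x + t *\<^sub>R h)))^2) * indicator {0..1} t \<partial>(lborel :: real measure))"
proof -
 define f where "f t = grad v (x + t *\<^sub>R h) \<bullet> h" for t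
 define c where "c = v (x + h) - v x"
 have fc: "continuous_on A f" for A
 unfolding f_def
 by (intro continuous_intros continuous_on_compose2[OF C1_grad_continuous[OF v, of UNIV]]) auto
 have F: "((%t. v (x + t *\<^sub>R h)) has_vector_derivative f t) (at t within {0..1})" for t
 proof -
 have "((%t. v (x + t *\<^sub>R h)) has_derivative (%s. frechet_derivative v (at (x + t *\<^sub>R h)) (s *\<^sub>R h))) (at t)"
  by (rule has_derivative_compose[OF _ C_k_SucD(1)[OF v]]) (auto intro!: derivative_eq_intros)
 moreover have "frechet_derivative v (at (x + t *\<^sub>R h)) (s *\<^sub>R h) = s *\<^sub>R f t" for s
  using v by (simp add: frechet_derivative_eq_grad f_def)
 ultimately show ?thesis unfolding has_vector_derivative_def by (simp add: has_derivative_at_withinI)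
 qed
 have hb: "has_bochner_integral lborel (%t. indicator {0..1} t *\<^sub>R f t) (v (x + 1 *\<^sub>R h) - v (x + 0 *\<^sub>R h))"
 by (rule has_bochner_integral_FTC_Icc[OF _ F fc]) auto
 have i1: "integrable lborel (%t. indicator {0..1} t *\<^sub>R f t)" "(LINT t|lborel. indicator {0..1} t *\<^sub>R f t) = c"
 using hb unfolding has_bochner_integral_iff by (auto simp: c_def)
 have i2: "integrable lborel (%t. indicator {0..1} t *\<^sub>R (f t)^2)"
 by (rule borel_integrable_compact) (auto intro!: continuous_intros fc)
 have i3: "integrable lborel (%t::real. indicator {0..1} t *\<^sub>R c^2)"
 by (rule borel_integrable_compact) (auto intro!: continuous_intros)
 have lin: "(LINT t|lborel. f1 t - 2 * c * f2 t + f3 t) = (LINT t|lborel. f1 t) - 2 * c * (LINT t|lborel. f2 t) + (LINT t|lborel. f3 t)"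
 if "integrable lborel f1" "integrable lborel f2" "integrable lborel f3" for f1 f2 f3 :: "real => real"
 using that by simp
 have "0 <= (LINT t|lborel. indicator {0..1} t *\<^sub>R (f t - c)^2)"
 by (rule LINT_nonneg) auto
 also have "... = (LINT t|lborel. indicator {0..1} t *\<^sub>R (f t)^2 - 2 * c * (indicator {0..1} t *\<^sub>R f t) + indicator {0..1} t *\<^sub>R c^2)"
 by (rule LINT_cong) (auto simp: power2_eq_square algebra_simps)
 also have "... = (LINT t|lborel. indicator {0..1} t *\<^sub>R (f t)^2) - 2 * c * (LINT t|lborel. indicator {0..1} t *\<^sub>R f t) + (LINT t|lborel. indicator {0..1} (t::real) *\<^sub>R c^2)"
 by (rule lin[OF i2 i1(1) i3])
 also have "(LINT t|lborel. indicator {0..1} (t::real) *\<^sub>R c^2) = c^2" by simp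
 finally have "c^2 <= (LINT t|lborel. indicator {0..1} t *\<^sub>R (f t)^2)" unfolding i1(2) by (simp add: power2_eq_square)
 then have "ennreal (c^2) <= ennreal (LINT t|lborel. indicator {0..1} t *\<^sub>R (f t)^2)" by (rule ennreal_leI)
 also have "... = (\<integral>\<^sup>+t. ennreal (indicator {0..1} t *\<^sub>R (f t)^2) \<partial>lborel)"
 by (rule nn_integral_eq_integral[symmetric, OF i2]) auto
 also have "... <= (\<integral>\<^sup>+t. ennreal ((norm h)^2 * (norm (grad v (x + t *\<^sub>R h)))^2) * indicator {0..1} t \<partial>lborel)"
 proof (rule nn_integral_mono)
 fix t :: real
 have "\<bar>f t\<bar> <= norm (grad v (x + t *\<^sub>R h)) * norm h" unfolding f_def by (rule Cauchy_Schwarz_ineq2)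
 then have "\<bar>f t\<bar>^2 <= (norm (grad v (x + t *\<^sub>R h)) * norm h)^2" by (rule power_mono) simp
 then have "(f t)^2 <= (norm h)^2 * (norm (grad v (x + t *\<^sub>R h)))^2"
  by (simp add: power_mult_distrib mult.commute)
 then show "ennreal (indicator {0..1} t *\<^sub>R (f t)^2) <= ennreal ((norm h)^2 * (norm (grad v (x + t *\<^sub>R h)))^2) * indicator {0..1} t"
  by (auto simp: indicator_def intro: ennreal_leI)
 qed
 finally show ?thesis by (simp add: c_def)
qed

lemma C1_difference_bound:
 fixes v :: "'a::euclidean_space => real"
 assumes v: "C_k (Suc 0) v" and A[measurable]: "A : sets borel" and B[measurable]: "B : sets borel"
 and AB: "!!x t. x : A ==> 0 <= t ==> t <= 1 ==> x + t *\<^sub>R h : B"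
 shows "(\<integral>\<^sup>+x. ennreal ((v (x + h) - v x)^2) * indicator A x \<partial>lborel)
 <= (\<integral>\<^sup>+x. ennreal ((norm h)^2 * (norm (grad v x))^2) * indicator B x \<partial>lborel)"
proof -
 define g where "g x = ennreal ((norm h)^2 * (norm (grad v x))^2)" for x
 have gv[measurable]: "grad v : borel_measurable borel"
 by (rule borel_measurable_continuous_onI[OF C1_grad_continuous[OF v]])
 have [measurable]: "g : borel_measurable borel" unfolding g_def by measurable
 have "(\<integral>\<^sup>+x. ennreal ((v (x + h) - v x)^2) * indicator A x \<partial>lborel)
 <= (\<integral>\<^sup>+x. (\<integral>\<^sup>+t. g (x + t *\<^sub>R h) * indicator {0..1} t * indicator A x \<partial>(lborel::real measure)) \<partial>lborel)"
 proof (rule nn_integral_mono)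
 fix x
 have "ennreal ((v (x + h) - v x)^2) * indicator A x <= (\<integral>\<^sup>+t. g (x + t *\<^sub>R h) * indicator {0..1} t \<partial>(lborel::real measure)) * indicator A x"
  unfolding g_def by (intro mult_right_mono C1_difference_pointwise[OF v]) simp
 also have "... = (\<integral>\<^sup>+t. g (x + t *\<^sub>R h) * indicator {0..1} t * indicator A x \<partial>(lborel::real measure))"
  by (rule nn_integral_multc[symmetric]) measurable
 finally show "ennreal ((v (x + h) - v x)^2) * indicator A x <= ..." .
 qed
 also have "... = (\<integral>\<^sup>+t. (\<integral>\<^sup>+x. g (x + t *\<^sub>R h) * indicator {0..1} t * indicator A x \<partial>lborel) \<partial>(lborel::real measure))"
 by (rule lborel_pair.Fubini') measurable
 also have "... <= (\<integral>\<^sup>+t. (\<integral>\<^sup>+x. g x * indicator B x \<partial>lborel) * indicator {0..1} t \<partial>(lborel::real measure))"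
 proof (rule nn_integral_mono)
 fix t :: real
 have "(\<integral>\<^sup>+x. g (x + t *\<^sub>R h) * indicator {0..1} t * indicator A x \<partial>lborel)
  <= (\<integral>\<^sup>+x. g (t *\<^sub>R h + x) * indicator B (t *\<^sub>R h + x) * indicator {0..1} t \<partial>lborel)"
  by (rule nn_integral_mono) (use AB in \<open>auto simp: indicator_def add.commute\<close>)
 also have "... = (\<integral>\<^sup>+x. g (t *\<^sub>R h + x) * indicator B (t *\<^sub>R h + x) \<partial>lborel) * indicator {0..1} t"
  by (rule nn_integral_multc) measurable
 also have "(\<integral>\<^sup>+x. g (t *\<^sub>R h + x) * indicator B (t *\<^sub>R h + x) \<partial>lborel) = (\<integral>\<^sup>+x. g x * indicator B x \<partial>lborel)"
  by (rule nn_integral_lborel_translate[of "%x. g x * indicator B x"]) measurable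
 finally show "(\<integral>\<^sup>+x. g (x + t *\<^sub>R h) * indicator {0..1} t * indicator A x \<partial>lborel)
  <= (\<integral>\<^sup>+x. g x * indicator B x \<partial>lborel) * indicator {0..1} t" .
 qed
 also have "... = (\<integral>\<^sup>+x. g x * indicator B x \<partial>lborel)" by (simp add: nn_integral_cmult)
 finally show ?thesis by (simp add: g_def)
qed

text \<open>For smooth functions this is the fundamental theorem of calculus on the segment from \<open>x\<close> to \<open>x + h\<close>;
 mollification gives the general case.\<close>

lemma weak_gradient_difference_bound:
 fixes u :: "'a::euclidean_space => real"
 assumes G: "has_weak_gradient UNIV u G" "integrable leb u" "integrable leb G"
  "integrable leb (%x. (norm (G x))^2)"
 and A: "A : sets borel" and B: "B : sets borel"
 and AB: "!!x t. x : A ==> 0 <= t ==> t <= 1 ==> x + t *\<^sub>R h : B"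
 shows "(\<integral>\<^sup>+x. ennreal ((u (x + h) - u x)^2) * indicator A x \<partial>lborel)
 <= ennreal (2 * (norm h)^2 * (LINT x:B|leb. (norm (G x))^2))"
proof -
 define r where "r n = 1 / real (Suc n)" for n
 have r: "0 < r n" for n by (simp add: r_def)
 have rlim: "r \<leadsto> 0" unfolding r_def using LIMSEQ_inverse_real_of_nat by (simp add: inverse_eq_divide)
 let ?mu = "%n. mollify (r n) u" and ?mG = "%n. mollify (r n) G"
 have i: "integrable leb (?mu n)" "integrable leb (?mG n)" for n
 using mollify_L1_bound(1)[OF r G(2)] mollify_L1_bound(1)[OF r G(3)] by auto
 have di: "integrable leb (%x. ?mu n x - u x)" for n using i G by simp
 obtain s where s: "strict_mono s" "AE x in leb. (%n. ?mu (s n) x - u x) \<leadsto> 0"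
 using tendsto_L1_AE_subseq[OF di mollify_tendsto_L1[OF G(2) r rlim]] by blast
 define d where "d n = (LINT x|leb. (norm (?mG (s n) x - G x))^2)" for n
 have dlim: "d \<leadsto> 0"
 using LIMSEQ_subseq_LIMSEQ[OF mollify_tendsto_L2[OF G(3,4) r rlim] s(1)] by (simp add: o_def d_def[abs_def])
 define I where "I = (LINT x:B|leb. (norm (G x))^2)"
 have C: "C_k k (?mu n)" for k n by (rule C_k_mollify[OF r G(2)])
 have gm: "grad (?mu n) = ?mG n" for n by (rule ext) (rule grad_mollify[OF G(1-3) r])
 have i2: "integrable leb (%x. (norm (?mG n x))^2)" for n by (rule mollify_L2_bound(1)[OF r G(3,4)])
 have Bl: "B : sets leb" using B by simp
 have id: "integrable leb (%x. (norm (?mG n x - G x))^2)" for n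
 proof (rule intgb_bound[of _ "%x. 2 * (norm (?mG n x))^2 + 2 * (norm (G x))^2"])
 show "AE x in leb. norm ((norm (?mG n x - G x))^2) <= norm (2 * (norm (?mG n x))^2 + 2 * (norm (G x))^2)"
  using norm_add_square_le[of "?mG n _" "- G _"] by (intro AE_I2) simp
 qed (use i2 G(4) i(2) G(3) in auto)
 have bnd: "(\<integral>\<^sup>+x. ennreal ((?mu (s n) (x + h) - ?mu (s n) x)^2) * indicator A x \<partial>lborel) <= ennreal ((norm h)^2 * (2 * I + 2 * d n))" for n
 proof -
 have "(\<integral>\<^sup>+x. ennreal ((?mu (s n) (x + h) - ?mu (s n) x)^2) * indicator A x \<partial>lborel)
  <= (\<integral>\<^sup>+x. ennreal ((norm h)^2 * (norm (?mG (s n) x))^2) * indicator B x \<partial>lborel)"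
  using C1_difference_bound[OF C A B AB] unfolding gm by blast
 also have "... = (\<integral>\<^sup>+x. ennreal ((norm h)^2 * (indicator B x *\<^sub>R (norm (?mG (s n) x))^2)) \<partial>leb)"
  unfolding nn_integral_completion by (rule nn_integral_cong) (auto simp: indicator_def)
 also have "... = ennreal (LINT x|leb. (norm h)^2 * (indicator B x *\<^sub>R (norm (?mG (s n) x))^2))"
  by (rule nn_integral_eq_integral)
   (use integrable_mult_indicator[OF Bl i2[of "s n"]] in \<open>auto intro!: integrable_mult_right\<close>)
 also have "... <= ennreal ((norm h)^2 * (2 * I + 2 * d n))"
 proof (rule ennreal_leI)
  have "(LINT x|leb. indicator B x *\<^sub>R (norm (?mG (s n) x))^2)
  <= (LINT x|leb. 2 * (indicator B x *\<^sub>R (norm (G x))^2) + 2 * (norm (?mG (s n) x - G x))^2)"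
  proof (rule integral_mono[OF integrable_mult_indicator[OF Bl i2]])
  show "integrable leb (%x. 2 * (indicator B x *\<^sub>R (norm (G x))^2) + 2 * (norm (?mG (s n) x - G x))^2)"
   by (intro intgb_add integrable_mult_right integrable_mult_indicator[OF Bl G(4)] id)
  fix x
  show "indicator B x *\<^sub>R (norm (?mG (s n) x))^2 <= 2 * (indicator B x *\<^sub>R (norm (G x))^2) + 2 * (norm (?mG (s n) x - G x))^2"
   using norm_add_square_le[of "G x" "?mG (s n) x - G x"] by (simp add: indicator_def)
  qed
  also have "... = 2 * I + 2 * d n"
  using integrable_mult_indicator[OF Bl G(4)] id[of "s n"] by (simp add: I_def d_def set_lebesgue_integral_def)
  finally show "(LINT x|leb. (norm h)^2 * (indicator B x *\<^sub>R (norm (?mG (s n) x))^2)) <= (norm h)^2 * (2 * I + 2 * d n)"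
  by (simp add: mult_left_mono)
 qed
 finally show ?thesis .
 qed
 have lim: "(%n. ennreal ((norm h)^2 * (2 * I + 2 * d n))) \<leadsto> ennreal ((norm h)^2 * (2 * I + 2 * 0))"
 by (intro tendsto_ennrealI tendsto_mult tendsto_add tendsto_const dlim)
 have "(\<integral>\<^sup>+x. ennreal ((u (x + h) - u x)^2) * indicator A x \<partial>lborel)
 = (\<integral>\<^sup>+x. ennreal ((u (x + h) - u x)^2) * indicator A x \<partial>leb)" by (simp add: nn_integral_completion)
 also have "... = (\<integral>\<^sup>+x. liminf (%n. ennreal ((?mu (s n) (x + h) - ?mu (s n) x)^2) * indicator A x) \<partial>leb)"
 proof (rule nn_integral_cong_AE)
 have "AE x in leb. (%n. ?mu (s n) (h + x) - u (h + x)) \<leadsto> 0" by (rule AE_lebesgue_translate[OF s(2)])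
 then show "AE x in leb. ennreal ((u (x + h) - u x)^2) * indicator A x
  = liminf (%n. ennreal ((?mu (s n) (x + h) - ?mu (s n) x)^2) * indicator A x)"
  using s(2)
 proof eventually_elim
  case (elim x)
  have "(%n. ennreal ((?mu (s n) (x + h) - ?mu (s n) x)^2)) \<leadsto> ennreal ((u (x + h) - u x)^2)"
  using LIM_zero_cancel[OF elim(1)] LIM_zero_cancel[OF elim(2)]
  by (intro tendsto_ennrealI tendsto_power tendsto_diff) (simp_all add: add.commute)
  then have "(%n. ennreal ((?mu (s n) (x + h) - ?mu (s n) x)^2) * indicator A x) \<leadsto> ennreal ((u (x + h) - u x)^2) * indicator A x"
  by (cases "x : A") simp_all
  then show ?case by (rule lim_imp_Liminf[OF sequentially_bot, symmetric])
 qed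
 qed
 also have "... = (\<integral>\<^sup>+x. liminf (%n. ennreal ((?mu (s n) (x + h) - ?mu (s n) x)^2) * indicator A x) \<partial>lborel)"
 by (simp add: nn_integral_completion)
 also have "... <= liminf (%n. \<integral>\<^sup>+x. ennreal ((?mu (s n) (x + h) - ?mu (s n) x)^2) * indicator A x \<partial>lborel)"
 proof (rule nn_integral_liminf)
 fix n
 have [measurable]: "?mu (s n) : borel_measurable borel" using C[of 0] by (intro borel_measurable_continuous_onI) simp
 have [measurable]: "A : sets borel" by (rule A)
 show "(%x. ennreal ((?mu (s n) (x + h) - ?mu (s n) x)^2) * indicator A x) : borel_measurable lborel" by measurable
 qed
 also have "... <= liminf (%n. ennreal ((norm h)^2 * (2 * I + 2 * d n)))"
 by (rule Liminf_mono[OF always_eventually]) (use bnd in blast)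
 also have "... = ennreal ((norm h)^2 * (2 * I + 2 * 0))" by (rule lim_imp_Liminf[OF sequentially_bot lim])
 finally show ?thesis by (simp add: I_def mult_ac)
qed

text \<open>If \<open>u\<close> vanishes on a fixed portion of a ball of radius \<open>d\<close> around each point of \<open>A\<close>, then \<open>u(x)^2\<close> is at most an
 average of \<open>(u(x + h) - u(x))^2\<close> over \<open>h\<close> in that ball.\<close>

lemma Poincare_zero_portion:
 fixes u :: "'a::euclidean_space => real"
 assumes G: "has_weak_gradient UNIV u G" "integrable leb u" "integrable leb G"
  "integrable leb (%x. (norm (G x))^2)"
 and A[measurable]: "A : sets borel" and B: "B : sets borel" and d: "0 < d"
 and AB: "!!x h. x : A ==> norm h < d ==> x + h : B"
 and Z: "Z : sets leb" "AE x in leb. x : Z --> u x = 0"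
 and kappa: "0 <= kappa" "AE x in leb. x : A --> u x = 0 \<or> kappa <= measure leb (ball x d \<inter> Z)"
 shows "kappa * (LINT x:A|leb. (u x)^2)
 <= measure leb (ball (0::'a) d) * (2 * d^2 * (LINT x:B|leb. (norm (G x))^2))"
proof -
 define I where "I = (LINT x:B|leb. (norm (G x))^2)"
 define V where "V = measure leb (ball (0::'a) d)"
 have I0: "0 <= I" unfolding I_def set_lebesgue_integral_def by (rule LINT_nonneg) auto
 obtain w where w: "integrable lborel w" "AE x in leb. u x = w x"
 using integrable_lebesgue_borel_ex[OF G(2)] by blast
 have [measurable]: "w : borel_measurable borel" using w(1) by auto
 have wl: "integrable leb w" using w(1) integrable_completion[of w lborel] by simp
 have Gw: "has_weak_gradient UNIV w G" by (rule has_weak_gradient_cong_AE[OF G(1)]) (use w(2) in auto)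
 define Y where "Y = {y. w y = 0}"
 have Yb[measurable]: "Y : sets borel" unfolding Y_def by measurable
 have [measurable]: "ball x e : sets borel" for x :: 'a and e by simp
 have ZY: "AE x in leb. x : Z --> x : Y" using Z(2) w(2) by eventually_elim (auto simp: Y_def)
 have msr: "kappa <= measure leb (ball x d \<inter> Z) ==> ennreal kappa <= emeasure lborel (ball x d \<inter> Y)" for x
 proof -
 assume *: "kappa <= measure leb (ball x d \<inter> Z)"
 have "ball x d \<inter> Z : lmeasurable" using Z(1) by (intro bounded_set_imp_lmeasurable) auto
 then have "ennreal kappa <= emeasure leb (ball x d \<inter> Z)" using * by (simp add: emeasure_eq_measure2 ennreal_leI)
 also have "... <= emeasure leb (ball x d \<inter> Y)"
 proof (rule emeasure_mono_AE)
  show "AE y in leb. y : ball x d \<inter> Z --> y : ball x d \<inter> Y" using ZY by eventually_elim auto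
  show "ball x d \<inter> Y : sets leb" using Yb by simp
 qed
 finally show ?thesis by (simp add: emeasure_completion)
 qed
 have pt: "AE x in lborel. ennreal (kappa * (w x)^2) * indicator A x
  <= (\<integral>\<^sup>+h. ennreal ((w (x + h) - w x)^2) * indicator A x * indicator (ball 0 d) h \<partial>lborel)"
 proof -
 have "AE x in leb. x : A --> w x = 0 \<or> kappa <= measure leb (ball x d \<inter> Z)"
  using kappa(2) w(2) by eventually_elim auto
 then have "AE x in lborel. x : A --> w x = 0 \<or> kappa <= measure leb (ball x d \<inter> Z)" by (simp add: AE_completion_iff)
 then show ?thesis
 proof eventually_elim
  case (elim x)
  show ?case
  proof (cases "x : A & w x ~= 0")
  case True
  then have "ennreal kappa <= emeasure lborel (ball x d \<inter> Y)" using elim msr by blast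
  also have "... = (\<integral>\<^sup>+y. indicator (ball x d \<inter> Y) y \<partial>lborel)" by simp
  also have "... = (\<integral>\<^sup>+h. indicator (ball x d \<inter> Y) (x + h) \<partial>lborel)"
   by (rule nn_integral_lborel_translate[symmetric]) measurable
  finally have "ennreal ((w x)^2) * ennreal kappa <= ennreal ((w x)^2) * (\<integral>\<^sup>+h. indicator (ball x d \<inter> Y) (x + h) \<partial>lborel)"
   by (intro mult_left_mono) auto
  also have "... = (\<integral>\<^sup>+h. ennreal ((w x)^2) * indicator (ball x d \<inter> Y) (x + h) \<partial>lborel)"
   by (rule nn_integral_cmult[symmetric]) measurable
  also have "... <= (\<integral>\<^sup>+h. ennreal ((w (x + h) - w x)^2) * indicator A x * indicator (ball 0 d) h \<partial>lborel)"
   by (rule nn_integral_mono) (use True in \<open>auto simp: indicator_def Y_def dist_norm\<close>)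
  finally show ?thesis using True kappa(1) by (simp add: ennreal_mult mult.commute)
  qed (auto simp: indicator_def)
 qed
 qed
 have "(\<integral>\<^sup>+x. ennreal (kappa * (w x)^2) * indicator A x \<partial>lborel)
 <= (\<integral>\<^sup>+x. (\<integral>\<^sup>+h. ennreal ((w (x + h) - w x)^2) * indicator A x * indicator (ball 0 d) h \<partial>lborel) \<partial>lborel)"
 by (rule nn_integral_mono_AE[OF pt])
 also have "... = (\<integral>\<^sup>+h. (\<integral>\<^sup>+x. ennreal ((w (x + h) - w x)^2) * indicator A x * indicator (ball 0 d) h \<partial>lborel) \<partial>lborel)"
 by (rule lborel_pair.Fubini') measurable
 also have "... <= (\<integral>\<^sup>+h. ennreal (2 * d^2 * I) * indicator (ball (0::'a) d) h \<partial>lborel)"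
 proof (rule nn_integral_mono)
 fix h :: 'a
 show "(\<integral>\<^sup>+x. ennreal ((w (x + h) - w x)^2) * indicator A x * indicator (ball 0 d) h \<partial>lborel) <= ennreal (2 * d^2 * I) * indicator (ball (0::'a) d) h"
 proof (cases "h : ball 0 d")
  case True
  have "(\<integral>\<^sup>+x. ennreal ((w (x + h) - w x)^2) * indicator A x \<partial>lborel) <= ennreal (2 * (norm h)^2 * I)"
  unfolding I_def
  proof (rule weak_gradient_difference_bound[OF Gw wl G(3,4) A B])
  fix x t assume x: "x : A" "0 <= t" "t <= (1::real)"
  have "t * norm h <= 1 * norm h" using x by (intro mult_right_mono) auto
  then have "norm (t *\<^sub>R h) < d" using True x by simp
  then show "x + t *\<^sub>R h : B" using AB x by blast
  qed
  also have "... <= ennreal (2 * d^2 * I)"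
  using True I0 by (intro ennreal_leI mult_right_mono mult_left_mono power_mono) auto
  finally show ?thesis using True by simp
 qed simp
 qed
 also have "... = ennreal (2 * d^2 * I) * ennreal V"
 using emeasure_lborel_ball_finite[of "0::'a" d] by (simp add: nn_integral_cmult V_def emeasure_eq_ennreal_measure)
 also have "... = ennreal (V * (2 * d^2 * I))" using I0 by (simp add: ennreal_mult[symmetric] V_def mult.commute)
 finally have le: "(\<integral>\<^sup>+x. ennreal (kappa * (w x)^2) * indicator A x \<partial>lborel) <= ennreal (V * (2 * d^2 * I))" .
 have "kappa * (LINT x:A|leb. (u x)^2) = (LINT x|leb. kappa * (indicator A x *\<^sub>R (w x)^2))"
 proof -
 have "(LINT x|leb. indicator A x *\<^sub>R (u x)^2) = (LINT x|leb. indicator A x *\<^sub>R (w x)^2)"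
 proof (rule integral_cong_AE)
  show "AE x in leb. indicator A x *\<^sub>R (u x)^2 = indicator A x *\<^sub>R (w x)^2" using w(2) by eventually_elim simp
  have [measurable]: "u : borel_measurable leb" "w : borel_measurable leb" "A : sets leb"
  using G(2) wl A by auto
  show "(%x. indicator A x *\<^sub>R (u x)^2) : borel_measurable leb" "(%x. indicator A x *\<^sub>R (w x)^2) : borel_measurable leb"
  by measurable
 qed
 then show ?thesis by (simp add: set_lebesgue_integral_def)
 qed
 also have "... = enn2real (\<integral>\<^sup>+x. ennreal (kappa * (indicator A x *\<^sub>R (w x)^2)) \<partial>leb)"
 proof (rule integral_eq_nn_integral)
 have [measurable]: "w : borel_measurable leb" "A : sets leb" using wl A by auto
 show "(%x. kappa * (indicator A x *\<^sub>R (w x)^2)) : borel_measurable leb" by measurable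
 qed (use kappa(1) in auto)
 also have "(\<integral>\<^sup>+x. ennreal (kappa * (indicator A x *\<^sub>R (w x)^2)) \<partial>leb) = (\<integral>\<^sup>+x. ennreal (kappa * (w x)^2) * indicator A x \<partial>lborel)"
 unfolding nn_integral_completion by (rule nn_integral_cong) (auto simp: indicator_def)
 also have "enn2real ... <= enn2real (ennreal (V * (2 * d^2 * I)))" using le by (intro enn2real_mono) auto
 also have "... = V * (2 * d^2 * I)" using I0 by (simp add: V_def)
 finally show ?thesis by (simp add: I_def V_def)
qed



section \<open>Square integrable functions\<close>

text \<open>Functions rather than classes are used, so that values on null sets can be compared directly with the
 given sets.\<close>

definition L2 :: "'a measure => ('a => 'b::euclidean_space) => bool" where
 "L2 M f \<longleftrightarrow> f : borel_measurable M & integrable M (%x. (norm (f x))^2)"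

definition L2_tendsto :: "'a measure => (nat => 'a => 'b::euclidean_space) => ('a => 'b) => bool" where
 "L2_tendsto M f g \<longleftrightarrow> (%n. LINT x|M. (norm (f n x - g x))^2) \<leadsto> 0"

lemma L2D: "L2 M f ==> f : borel_measurable M" "L2 M f ==> integrable M (%x. (norm (f x))^2)"
 by (auto simp: L2_def)

lemma L2_bound:
 assumes "f : borel_measurable M" "integrable M h" "!!x. x : space M ==> (norm (f x))^2 <= h x"
 shows "L2 M f"
 unfolding L2_def
proof
 show "integrable M (%x. (norm (f x))^2)"
 proof (rule intgb_bound[OF assms(2)])
 show "(%x. (norm (f x))^2) : borel_measurable M" using assms(1) by measurable
 show "AE x in M. norm ((norm (f x))^2) <= norm (h x)"
  by (rule AE_I2) (use assms(3) in \<open>force intro: order_trans[OF _ abs_ge_self]\<close>)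
 qed
qed (fact assms(1))

lemma L2_add: "L2 M f ==> L2 M g ==> L2 M (%x. f x + g x)"
 by (rule L2_bound[where h = "%x. 2 * (norm (f x))^2 + 2 * (norm (g x))^2"])
  (auto simp: L2_def norm_add_square_le intro!: borel_measurable_add)

lemma L2_mult_bounded:
 assumes f: "L2 M f" and eta: "eta : borel_measurable M" "!!x. x : space M ==> \<bar>eta x\<bar> <= C"
 shows "L2 M (%x. eta x *\<^sub>R f x)"
proof (rule L2_bound[where h = "%x. C^2 * (norm (f x))^2"])
 fix x assume "x : space M"
 then have "\<bar>eta x\<bar>^2 <= C^2" by (intro power_mono eta) auto
 then show "(norm (eta x *\<^sub>R f x))^2 <= C^2 * (norm (f x))^2"
 by (simp add: power_mult_distrib mult_right_mono)
qed (use f eta(1) in \<open>auto simp: L2_def\<close>)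

lemma L2_scaleR_bounded:
 fixes f :: "'a => real" and V :: "'a => 'b::euclidean_space"
 assumes f: "L2 M f" and V: "V : borel_measurable M" "!!x. x : space M ==> norm (V x) <= C"
 shows "L2 M (%x. f x *\<^sub>R V x)"
proof (rule L2_bound[where h = "%x. C^2 * (norm (f x))^2"])
 fix x assume "x : space M"
 then have "(norm (V x))^2 <= C^2" by (intro power_mono V) auto
 then have "(f x)^2 * (norm (V x))^2 <= (f x)^2 * C^2" by (intro mult_left_mono) auto
 then show "(norm (f x *\<^sub>R V x))^2 <= C^2 * (norm (f x))^2"
 by (simp add: power_mult_distrib mult.commute)
qed (use f V(1) in \<open>auto simp: L2_def\<close>)

lemma L2_scale: "L2 M f ==> L2 M (%x. c *\<^sub>R f x)"
 by (rule L2_mult_bounded[where C = "\<bar>c\<bar>"]) auto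

lemma L2_diff: "L2 M f ==> L2 M g ==> L2 M (%x. f x - g x)"
 using L2_add[OF _ L2_scale[of M g "-1"], of f] by simp

lemma L2_mult_integrable:
 fixes f g :: "'a => real"
 assumes "L2 M f" "L2 M g"
 shows "integrable M (%x. f x * g x)"
proof (rule intgb_bound[of _ "%x. (norm (f x))^2 + (norm (g x))^2"])
 show "AE x in M. norm (f x * g x) <= norm ((norm (f x))^2 + (norm (g x))^2)"
 proof (rule AE_I2)
 fix x
 have "2 * (\<bar>f x\<bar> * \<bar>g x\<bar>) <= (f x)^2 + (g x)^2"
  using zero_le_power2[of "\<bar>f x\<bar> - \<bar>g x\<bar>"] by (simp add: power2_diff)
 moreover have "0 <= \<bar>f x\<bar> * \<bar>g x\<bar>" by simp
 ultimately have "\<bar>f x\<bar> * \<bar>g x\<bar> <= (f x)^2 + (g x)^2" by linarith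
 then show "norm (f x * g x) <= norm ((norm (f x))^2 + (norm (g x))^2)" by (simp add: abs_mult)
 qed
qed (use assms in \<open>auto simp: L2_def\<close>)

lemma L2_inner_integrable:
 assumes "L2 M f" "L2 M g"
 shows "integrable M (%x. f x \<bullet> g x)"
proof -
 have "L2 M (%x. norm (f x))" "L2 M (%x. norm (g x))" using assms by (auto simp: L2_def)
 from L2_mult_integrable[OF this] show ?thesis
 by (rule intgb_bound)
  (use assms in \<open>auto simp: L2_def intro!: borel_measurable_inner Cauchy_Schwarz_ineq2\<close>)
qed

lemma (in finite_measure) L2_integrable:
 assumes "L2 M f" shows "integrable M f"
proof (rule intgb_bound[of _ "%x. 1 + (norm (f x))^2"])
 show "AE x in M. norm (f x) <= norm (1 + (norm (f x))^2)"
 proof (rule AE_I2)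
 fix x
 have "2 * norm (f x) <= 1 + (norm (f x))^2" using zero_le_power2[of "norm (f x) - 1"] by (simp add: power2_diff)
 then have "norm (f x) <= 1 + (norm (f x))^2" using norm_ge_zero[of "f x"] by linarith
 then show "norm (f x) <= norm (1 + (norm (f x))^2)" by simp
 qed
qed (use assms in \<open>auto simp: L2_def\<close>)

lemma L2_tendsto_bound:
 assumes "!!n. (LINT x|M. (norm (f n x - g x))^2) <= e n" "e \<leadsto> (0::real)"
 shows "L2_tendsto M f g"
 unfolding L2_tendsto_def
proof -
 have "norm (LINT x|M. (norm (f n x - g x))^2) <= e n" for n using assms(1)[of n] by simp
 then show "(%n. LINT x|M. (norm (f n x - g x))^2) \<leadsto> 0"
 by (intro Lim_null_comparison[OF always_eventually assms(2)]) blast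
qed

lemma L2_tendsto_add:
 assumes f: "L2_tendsto M f f'" "L2_tendsto M g g'" and L: "!!n. L2 M (f n)" "L2 M f'" "!!n. L2 M (g n)" "L2 M g'"
 shows "L2_tendsto M (%n x. f n x + g n x) (%x. f' x + g' x)"
proof (rule L2_tendsto_bound)
 fix n
 note i = L2D(2)[OF L2_diff[OF L(1)[of n] L(2)]] L2D(2)[OF L2_diff[OF L(3)[of n] L(4)]]
 have "(LINT x|M. (norm (f n x + g n x - (f' x + g' x)))^2) <= (LINT x|M. 2 * (norm (f n x - f' x))^2 + 2 * (norm (g n x - g' x))^2)"
 proof (rule integral_mono')
 show "integrable M (%x. 2 * (norm (f n x - f' x))^2 + 2 * (norm (g n x - g' x))^2)" using i by simp
 show "(norm (f n x + g n x - (f' x + g' x)))^2 <= 2 * (norm (f n x - f' x))^2 + 2 * (norm (g n x - g' x))^2" for x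
  using norm_add_square_le[of "f n x - f' x" "g n x - g' x"] by (simp add: algebra_simps)
 qed simp
 also have "... = 2 * (LINT x|M. (norm (f n x - f' x))^2) + 2 * (LINT x|M. (norm (g n x - g' x))^2)" using i by simp
 finally show "(LINT x|M. (norm (f n x + g n x - (f' x + g' x)))^2)
 <= 2 * (LINT x|M. (norm (f n x - f' x))^2) + 2 * (LINT x|M. (norm (g n x - g' x))^2)" .
next
 show "(%n. 2 * (LINT x|M. (norm (f n x - f' x))^2) + 2 * (LINT x|M. (norm (g n x - g' x))^2)) \<leadsto> 0"
 using tendsto_add[OF tendsto_mult[OF tendsto_const[of 2] f(1)[unfolded L2_tendsto_def]]
  tendsto_mult[OF tendsto_const[of 2] f(2)[unfolded L2_tendsto_def]]] by simp
qed

lemma L2_tendsto_const: "L2_tendsto M (%n. f) f"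
 by (simp add: L2_tendsto_def)

lemma L2_tendsto_pointwise_bound:
 assumes f: "L2_tendsto M f f'" and L: "!!n. L2 M (f n)" "L2 M f'"
 and le: "!!n x. x : space M ==> norm (g n x - g' x) <= C * norm (f n x - f' x)"
 shows "L2_tendsto M g g'"
proof (rule L2_tendsto_bound)
 fix n
 have "(LINT x|M. (norm (g n x - g' x))^2) <= (LINT x|M. C^2 * (norm (f n x - f' x))^2)"
 proof (rule integral_mono')
 show "integrable M (%x. C^2 * (norm (f n x - f' x))^2)" using L2D(2)[OF L2_diff[OF L(1)[of n] L(2)]] by simp
 fix x assume "x : space M"
 then have "(norm (g n x - g' x))^2 <= (C * norm (f n x - f' x))^2" by (intro power_mono le) auto
 then show "(norm (g n x - g' x))^2 <= C^2 * (norm (f n x - f' x))^2" by (simp add: power_mult_distrib)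
 qed simp
 also have "... = C^2 * (LINT x|M. (norm (f n x - f' x))^2)" by simp
 finally show "(LINT x|M. (norm (g n x - g' x))^2) <= C^2 * (LINT x|M. (norm (f n x - f' x))^2)" .
next
 show "(%n. C^2 * (LINT x|M. (norm (f n x - f' x))^2)) \<leadsto> 0"
 using f unfolding L2_tendsto_def by (rule tendsto_mult_right_zero)
qed

lemma L2_tendsto_dominated:
 assumes m: "!!n. f n : borel_measurable M" "g : borel_measurable M"
 and lim: "AE x in M. (%n. f n x) \<leadsto> g x"
 and h: "L2 M h" "!!n x. x : space M ==> norm (f n x - g x) <= norm (h x)"
 shows "L2_tendsto M f g"
proof -
 have "(%n. LINT x|M. (norm (f n x - g x))^2) \<leadsto> (LINT x|M. 0)"
 proof (rule integral_dominated_convergence[where w = "%x. (norm (h x))^2"])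
 show "AE x in M. (%n. (norm (f n x - g x))^2) \<leadsto> 0"
  using lim
 proof eventually_elim
  case (elim x)
  have "(%n. norm (f n x - g x)) \<leadsto> 0" using elim by (intro tendsto_norm_zero LIM_zero)
  from tendsto_power[OF this, of 2] show ?case by simp
 qed
 show "AE x in M. norm ((norm (f n x - g x))^2) <= (norm (h x))^2" for n
  by (rule AE_I2) (auto intro!: power_mono h(2))
 show "(%x. (norm (f n x - g x))^2) : borel_measurable M" for n using m by measurable
 qed (use h L2D(2) in auto)
 then show ?thesis by (simp add: L2_tendsto_def)
qed

lemma (in finite_measure) L2_tendsto_uniform:
 assumes "!!e. 0 < e ==> \<forall>\<^sub>F n in sequentially. \<forall>x\<in>space M. norm (f n x - g x) <= e"
 shows "L2_tendsto M f g"
 unfolding L2_tendsto_def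
proof (rule LIMSEQ_I)
 fix eps :: real assume eps: "0 < eps"
 define V where "V = measure M (space M)"
 have V: "0 <= V" by (simp add: V_def)
 define e where "e = sqrt (eps / (2 * (V + 1)))"
 have e: "0 < e" using eps V by (simp add: e_def)
 have e2: "e^2 * V < eps"
 proof -
 have "e^2 = eps / (2 * (V + 1))" using eps V by (simp add: e_def)
 then have "e^2 * V = eps * (V / (2 * (V + 1)))" by simp
 also have "V / (2 * (V + 1)) < 1" using V by (simp add: divide_less_eq)
 finally show ?thesis using eps by simp
 qed
 obtain N where N: "!!n x. n >= N ==> x : space M ==> norm (f n x - g x) <= e"
 using assms[OF e] unfolding eventually_sequentially by metis
 show "\<exists>N. \<forall>n\<ge>N. norm ((LINT x|M. (norm (f n x - g x))^2) - 0) < eps"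
 proof (intro exI[of _ N] allI impI)
 fix n assume n: "n >= N"
 have "(LINT x|M. (norm (f n x - g x))^2) <= (LINT x|M. e^2)"
  by (rule integral_mono') (auto intro!: power_mono N n)
 also have "... = e^2 * V" by (simp add: V_def)
 finally show "norm ((LINT x|M. (norm (f n x - g x))^2) - 0) < eps" using e2 by simp
 qed
qed

text \<open>\<open>|a|^2 - |b|^2\<close> is at most \<open>|a - b|^2 + 2 |b| |a - b|\<close>, and the mixed term is split with a small
 weight.\<close>

lemma L2_tendsto_square_L1:
 fixes f :: "nat => 'a => 'b::euclidean_space"
 assumes f: "L2_tendsto M f g" and L: "!!n. L2 M (f n)" "L2 M g"
 shows "(%n. LINT x|M. \<bar>(norm (f n x))^2 - (norm (g x))^2\<bar>) \<leadsto> 0"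
proof (rule LIMSEQ_I)
 fix eps :: real assume eps: "0 < eps"
 define I where "I = (LINT x|M. (norm (g x))^2)"
 have I: "0 <= I" by (simp add: I_def)
 define s where "s = eps / (2 * (I + 1))"
 have s: "0 < s" using eps I by (simp add: s_def)
 have sI: "s * I < eps / 2"
 proof -
 have "s * I = (eps / 2) * (I / (I + 1))" by (simp add: s_def)
 also have "... < eps / 2 * 1" using I eps by (intro mult_strict_left_mono) (auto simp: divide_less_eq)
 finally show ?thesis by simp
 qed
 have "(%n. (1 + 1 / s) * (LINT x|M. (norm (f n x - g x))^2)) \<leadsto> 0"
 using f unfolding L2_tendsto_def by (rule tendsto_mult_right_zero)
 then have "\<forall>\<^sub>F n in sequentially. (1 + 1 / s) * (LINT x|M. (norm (f n x - g x))^2) < eps / 2"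
 by (rule order_tendstoD(2)) (use eps in simp)
 then obtain N where N: "!!n. n >= N ==> (1 + 1 / s) * (LINT x|M. (norm (f n x - g x))^2) < eps / 2"
 unfolding eventually_sequentially by metis
 show "\<exists>N. \<forall>n\<ge>N. norm ((LINT x|M. \<bar>(norm (f n x))^2 - (norm (g x))^2\<bar>) - 0) < eps"
 proof (intro exI[of _ N] allI impI)
 fix n assume n: "n >= N"
 note i = L2D(2)[OF L2_diff[OF L(1)[of n] L(2)]] L2D(2)[OF L(2)]
 have pt: "\<bar>(norm a)^2 - (norm b)^2\<bar> <= (1 + 1 / s) * (norm (a - b))^2 + s * (norm b)^2" for a b :: 'b
 proof -
  define A where "A = norm (a - b)"
  define B where "B = norm b"
  have AB: "0 <= A" "0 <= B" by (auto simp: A_def B_def)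
  have 1: "norm a <= B + A" "B <= norm a + A"
  using norm_triangle_ineq[of b "a - b"] norm_triangle_ineq4[of a "a - b"] by (auto simp: A_def B_def)
  have "(norm a)^2 <= (B + A)^2" using 1 by (intro power_mono) auto
  moreover have "B^2 - 2 * A * B <= (norm a)^2"
  proof (cases "A <= B")
  case True
  then have "(B - A)^2 <= (norm a)^2" using 1 by (intro power_mono) auto
  moreover have "B^2 - 2 * A * B <= (B - A)^2" by (simp add: power2_diff mult_ac)
  ultimately show ?thesis by linarith
  next
  case False
  then have "B * B <= A * B" using AB by (intro mult_right_mono) auto
  moreover have "0 <= A * B" using AB by simp
  ultimately have "B^2 - 2 * A * B <= 0" by (simp add: power2_eq_square)
  then show ?thesis by (rule order_trans) simp
  qed
  moreover have "(B + A)^2 = B^2 + A^2 + 2 * A * B" by (simp add: power2_sum mult_ac)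
  moreover have "0 <= A^2" by simp
  ultimately have "\<bar>(norm a)^2 - B^2\<bar> <= A^2 + 2 * A * B" by linarith
  moreover have "2 * A * B <= (1 / s) * A^2 + s * B^2"
  proof -
  have "0 <= (A - s * B)^2 / s" using s by simp
  also have "... = (1 / s) * A^2 + s * B^2 - 2 * A * B" using s by (simp add: power2_eq_square field_simps)
  finally show ?thesis by simp
  qed
  ultimately show ?thesis by (simp add: A_def B_def distrib_right)
 qed
 have "(LINT x|M. \<bar>(norm (f n x))^2 - (norm (g x))^2\<bar>) <= (LINT x|M. (1 + 1 / s) * (norm (f n x - g x))^2 + s * (norm (g x))^2)"
  by (rule integral_mono') (use i pt s in auto)
 also have "... = (1 + 1 / s) * (LINT x|M. (norm (f n x - g x))^2) + s * I" using i by (simp add: I_def)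
 also have "... < eps" using N[OF n] sI by linarith
 finally show "norm ((LINT x|M. \<bar>(norm (f n x))^2 - (norm (g x))^2\<bar>) - 0) < eps" by simp
 qed
qed

lemma integral_tendsto_of_L1:
 fixes f :: "nat => 'a => real"
 assumes "!!n. integrable M (f n)" "integrable M g" "(%n. LINT x|M. \<bar>f n x - g x\<bar>) \<leadsto> 0"
 shows "(%n. LINT x|M. f n x) \<leadsto> (LINT x|M. g x)"
proof -
 have le: "norm ((LINT x|M. f n x) - (LINT x|M. g x)) <= (LINT x|M. \<bar>f n x - g x\<bar>)" for n
 using integral_norm_bound[of M "%x. f n x - g x"] assms(1)[of n] assms(2) by simp
 show ?thesis
 by (rule LIM_zero_cancel, rule Lim_null_comparison[OF always_eventually[OF allI[OF le]] assms(3)])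
qed

lemma L2_tendsto_norm_square:
 assumes "L2_tendsto M f g" "!!n. L2 M (f n)" "L2 M g"
 shows "(%n. LINT x|M. (norm (f n x))^2) \<leadsto> (LINT x|M. (norm (g x))^2)"
 by (rule integral_tendsto_of_L1[OF L2D(2)[OF assms(2)] L2D(2)[OF assms(3)] L2_tendsto_square_L1[OF assms]])

section \<open>Local Sobolev functions\<close>

lemma lebesgue_on_integral:
 fixes f :: "'a::euclidean_space => 'b::euclidean_space"
 assumes "K : sets leb"
 shows "(LINT x:K|leb. f x) = (LINT x|leb_on K. f x)"
 "set_integrable leb K f \<longleftrightarrow> integrable (leb_on K) f"
 using assms by (simp_all add: set_lebesgue_integral_def set_integrable_def integral_restrict_space integrable_restrict_space)

lemma finite_measure_compact: "compact K ==> finite_measure (leb_on (K :: 'a::euclidean_space set))"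
 by (rule finite_measure_lebesgue_on) (rule lmeasurable_compact)

lemma square_integrable_iff_L2: "S : sets leb ==> square_integrable S f \<longleftrightarrow> L2 (leb_on S) f"
 by (simp add: square_integrable_def L2_def lebesgue_on_integral)

lemma lebesgue_on_measurable_mono:
 fixes f :: "'a::euclidean_space => 'b::euclidean_space"
 assumes "f : borel_measurable (leb_on S)" "T <= S" "S : sets leb" "T : sets leb"
 shows "f : borel_measurable (leb_on T)"
proof -
 have m: "(%x. indicator S x *\<^sub>R f x) : borel_measurable leb"
 using assms by (simp add: borel_measurable_restrict_space_iff)
 have "(%x. indicator T x *\<^sub>R (indicator S x *\<^sub>R f x)) : borel_measurable leb"
 by (rule borel_measurable_scaleR[OF borel_measurable_indicator[OF assms(4)] m])
 also have "(%x. indicator T x *\<^sub>R (indicator S x *\<^sub>R f x)) = (%x. indicator T x *\<^sub>R f x)"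
 using assms(2) by (auto simp: indicator_def fun_eq_iff)
 finally show ?thesis using assms(4) by (simp add: borel_measurable_restrict_space_iff)
qed

lemma L2_mono_set:
 assumes "L2 (leb_on S) f" "T <= S" "S : sets leb" "T : sets leb"
 shows "L2 (leb_on T) f"
 unfolding L2_def
proof
 show "f : borel_measurable (leb_on T)" by (rule lebesgue_on_measurable_mono[OF L2D(1)[OF assms(1)] assms(2-4)])
 have "set_integrable leb S (%x. (norm (f x))^2)" using assms(1,3) by (simp add: L2_def lebesgue_on_integral)
 then have "set_integrable leb T (%x. (norm (f x))^2)" by (rule set_integrable_subset[OF _ assms(4,2)])
 then show "integrable (leb_on T) (%x. (norm (f x))^2)" by (simp add: lebesgue_on_integral(2)[OF assms(4)])
qed

lemma L2_cong_AE_on: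
 fixes f g :: "'a::euclidean_space => 'b::euclidean_space"
 assumes "L2 (leb_on S) f" "S : sets leb" "AE x in leb. x : S --> f x = g x"
 shows "L2 (leb_on S) g"
proof -
 have m: "(%x. indicator S x *\<^sub>R f x) : borel_measurable leb"
 using assms L2D(1)[OF assms(1)] by (simp add: borel_measurable_restrict_space_iff)
 have "AE x in leb. indicator S x *\<^sub>R f x = indicator S x *\<^sub>R g x"
 using assms(3) by eventually_elim (auto simp: indicator_def)
 from borel_measurable_AE[OF m this] have gm: "g : borel_measurable (leb_on S)"
 using assms(2) by (simp add: borel_measurable_restrict_space_iff)
 have ae: "AE x in leb_on S. (norm (f x))^2 = (norm (g x))^2"
 using assms(2,3) by (auto simp: AE_restrict_space_iff elim: eventually_mono)
 have "integrable (leb_on S) (%x. (norm (g x))^2)"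
 by (rule integrable_cong_AE_imp[OF L2D(2)[OF assms(1)] _ ae]) (use gm in measurable)
 with gm show ?thesis by (simp add: L2_def)
qed

text \<open>The gradient is carried as an explicit function, so that the sum, product and chain rules are formulas
 for it.\<close>

definition loc_sobolev :: "'a::euclidean_space set => ('a => real) => ('a => 'a) => bool" where
 "loc_sobolev S u G \<longleftrightarrow> has_weak_gradient S u G &
 (\<forall>K. compact K --> K <= S --> L2 (leb_on K) u & L2 (leb_on K) G)"

lemma loc_sobolevD:
 assumes "loc_sobolev S u G"
 shows "has_weak_gradient S u G" "compact K ==> K <= S ==> L2 (leb_on K) u"
 "compact K ==> K <= S ==> L2 (leb_on K) G"
 using assms by (auto simp: loc_sobolev_def)

lemma loc_sobolev_add: "loc_sobolev S u G ==> loc_sobolev S v H ==> loc_sobolev S (%x. u x + v x) (%x. G x + H x)"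
 by (simp add: loc_sobolev_def has_weak_gradient_add L2_add)

lemma loc_sobolev_diff: "loc_sobolev S u G ==> loc_sobolev S v H ==> loc_sobolev S (%x. u x - v x) (%x. G x - H x)"
 by (simp add: loc_sobolev_def has_weak_gradient_diff L2_diff)

lemma continuous_on_compact_bounded:
 fixes f :: "'a::euclidean_space => 'b::euclidean_space"
 assumes "compact K" "continuous_on UNIV f"
 obtains C where "!!x. x : K ==> norm (f x) <= C"
proof -
 have "compact (f ` K)" by (rule compact_continuous_image[OF continuous_on_subset[OF assms(2) subset_UNIV] assms(1)])
 then have "bounded (f ` K)" by (rule compact_imp_bounded)
 then show ?thesis using that unfolding bounded_iff by blast
qed

lemma continuous_measurable_lebesgue_on:
 fixes f :: "'a::euclidean_space => 'b::euclidean_space"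
 shows "continuous_on UNIV f ==> f : borel_measurable (leb_on K)"
 by (rule measurable_restrict_space1) (rule continuous_imp_lebesgue_measurable)

lemma loc_sobolev_mult_smooth:
 assumes "loc_sobolev S u G" "smooth eta"
 shows "loc_sobolev S (%x. eta x * u x) (%x. eta x *\<^sub>R G x + u x *\<^sub>R grad eta x)"
 unfolding loc_sobolev_def
proof (intro conjI allI impI)
 show "has_weak_gradient S (%x. eta x * u x) (%x. eta x *\<^sub>R G x + u x *\<^sub>R grad eta x)"
 by (rule has_weak_gradient_mult_smooth[OF loc_sobolevD(1)[OF assms(1)] assms(2)])
 fix K assume K: "compact K" "K <= S"
 note c = smooth_continuous[OF assms(2), of UNIV] smooth_grad_continuous[OF assms(2), of UNIV]
 obtain C where C: "!!x. x : K ==> norm (eta x) <= C" by (rule continuous_on_compact_bounded[OF K(1) c(1)]) blast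
 obtain D where D: "!!x. x : K ==> norm (grad eta x) <= D" by (rule continuous_on_compact_bounded[OF K(1) c(2)]) blast
 have "L2 (leb_on K) (%x. eta x *\<^sub>R u x)"
 by (rule L2_mult_bounded[OF loc_sobolevD(2)[OF assms(1) K] continuous_measurable_lebesgue_on[OF c(1)]]) (use C in simp)
 then show "L2 (leb_on K) (%x. eta x * u x)" by simp
 show "L2 (leb_on K) (%x. eta x *\<^sub>R G x + u x *\<^sub>R grad eta x)"
 proof (rule L2_add)
 show "L2 (leb_on K) (%x. eta x *\<^sub>R G x)"
  by (rule L2_mult_bounded[OF loc_sobolevD(3)[OF assms(1) K] continuous_measurable_lebesgue_on[OF c(1)]]) (use C in simp)
 show "L2 (leb_on K) (%x. u x *\<^sub>R grad eta x)"
  by (rule L2_scaleR_bounded[OF loc_sobolevD(2)[OF assms(1) K] continuous_measurable_lebesgue_on[OF c(2)]]) (use D in simp)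
 qed
qed

lemma soft_abs_le: "0 < e ==> \<bar>soft e t\<bar> <= \<bar>t\<bar>"
proof (cases "t = 0")
 case False
 assume e: "0 < e"
 have "(max 0 (\<bar>t\<bar> - e))^2 <= \<bar>t\<bar>^2" using e by (intro power_mono) auto
 then have "(max 0 (\<bar>t\<bar> - e))^2 / \<bar>t\<bar> <= \<bar>t\<bar>" using False by (simp add: divide_le_eq power2_eq_square)
 then show ?thesis by (simp add: soft_def)
qed (simp add: soft_def)

lemma soft_measurable: "0 < e ==> soft e : borel_measurable borel" "0 < e ==> soft' e : borel_measurable borel"
 using soft_derivative[of e, THEN DERIV_isCont] soft'_continuous[of e]
 by (auto intro!: borel_measurable_continuous_onI continuous_at_imp_continuous_on)

lemma loc_sobolev_soft:
 assumes S: "open S" and u: "loc_sobolev S u G" and e: "0 < e"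
 shows "loc_sobolev S (%x. soft e (u x)) (%x. soft' e (u x) *\<^sub>R G x)"
 unfolding loc_sobolev_def
proof (intro conjI allI impI)
 show "has_weak_gradient S (%x. soft e (u x)) (%x. soft' e (u x) *\<^sub>R G x)"
 by (rule has_weak_gradient_soft[OF S loc_sobolevD(1)[OF u] e])
 fix K assume K: "compact K" "K <= S"
 note L = loc_sobolevD(2,3)[OF u K]
 show "L2 (leb_on K) (%x. soft e (u x))"
 proof (rule L2_bound[OF measurable_compose[OF L2D(1)[OF L(1)] soft_measurable(1)[OF e]] L2D(2)[OF L(1)]])
 show "(norm (soft e (u x)))^2 <= (norm (u x))^2" for x using soft_abs_le[OF e] by (intro power_mono) auto
 qed
 show "L2 (leb_on K) (%x. soft' e (u x) *\<^sub>R G x)"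
 by (rule L2_mult_bounded[OF L(2) measurable_compose[OF L2D(1)[OF L(1)] soft_measurable(2)[OF e]], of 1])
  (use soft'_bounds[OF e] in \<open>auto simp: abs_le_iff intro: order_trans[of _ 0]\<close>)
qed

lemma loc_sobolev_imp_W12_ball:
 assumes u: "loc_sobolev S u G" and r: "cball x r <= S"
 shows "W12 (ball x r) u" "has_weak_gradient (ball x r) u G" "L2 (leb_on (ball x r)) u" "L2 (leb_on (ball x r)) G"
proof -
 show h: "has_weak_gradient (ball x r) u G"
 by (rule has_weak_gradient_mono[OF loc_sobolevD(1)[OF u] order_trans[OF ball_subset_cball r]])
 show l: "L2 (leb_on (ball x r)) u" "L2 (leb_on (ball x r)) G"
 by (rule L2_mono_set[OF loc_sobolevD(2)[OF u compact_cball r] ball_subset_cball], simp, simp,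
  rule L2_mono_set[OF loc_sobolevD(3)[OF u compact_cball r] ball_subset_cball], simp, simp)
 show "W12 (ball x r) u" unfolding W12_def using h l by (auto simp: square_integrable_iff_L2)
qed

lemma loc_sobolev_imp_W12_loc: "loc_sobolev S u G ==> W12_loc S u"
 unfolding W12_loc_def using loc_sobolev_imp_W12_ball(1) by blast

lemma L2_finite_UN:
 fixes f :: "'a::euclidean_space => 'b::euclidean_space"
 assumes "finite I" "!!i. i : I ==> T i : sets leb" "!!i. i : I ==> L2 (leb_on (T i)) f"
 shows "L2 (leb_on (\<Union>i\<in>I. T i)) f"
proof -
 have U: "(\<Union>i\<in>I. T i) : sets leb" using assms(1,2) by auto
 have m: "(%x. indicator (\<Union>i\<in>I. T i) x *\<^sub>R f x) : borel_measurable leb"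
 using assms
 proof (induction I rule: finite_induct)
 case empty then show ?case by simp
 next
 case (insert i I)
 have a: "(%x. indicator (T i) x *\<^sub>R f x) : borel_measurable leb"
  using insert.prems L2D(1)[of "leb_on (T i)" f] by (simp add: borel_measurable_restrict_space_iff)
 have b: "(%x. indicator (\<Union>i\<in>I. T i) x *\<^sub>R f x) : borel_measurable leb" using insert by simp
 have "(%x. indicator (\<Union>i\<in>insert i I. T i) x *\<^sub>R f x)
  = (%x. if x : T i then indicator (T i) x *\<^sub>R f x else indicator (\<Union>i\<in>I. T i) x *\<^sub>R f x)"
  by (auto simp: indicator_def fun_eq_iff)
 also have "... : borel_measurable leb"
  using a b insert.prems by (intro measurable_If_set) auto
 finally show ?case .
 qed
 have "set_integrable leb (\<Union>i\<in>I. T i) (%x. (norm (f x))^2)"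
 by (rule set_integrable_UN[OF assms(1)]) (use assms(2,3) L2D(2) in \<open>auto simp: lebesgue_on_integral\<close>)
 then show ?thesis
 using m U by (simp add: L2_def lebesgue_on_integral borel_measurable_restrict_space_iff)
qed

text \<open>The weak gradients on the balls of a countable cover agree almost everywhere on overlaps, hence glue
 to a weak gradient on the whole set.\<close>

lemma W12_loc_imp_loc_sobolev:
 fixes u :: "'a::euclidean_space => real"
 assumes S: "open S" and u: "W12_loc S u"
 shows "\<exists>G. loc_sobolev S u G"
proof (cases "S = {}")
 case True
 have "has_weak_gradient {} u (%_. 0)"
 by (rule has_weak_gradientI) (auto simp: locally_integrable_def set_integrable_def set_lebesgue_integral_def)
 then show ?thesis using True
 by (intro exI[of _ "%_. 0"]) (auto simp: loc_sobolev_def L2_def space_restrict_space measurable_def sets_restrict_space integrable_restrict_space)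
next
 case False
 have "\<forall>x\<in>S. \<exists>e>0. cball x e <= S" using S open_contains_cball by blast
 then obtain e where e: "!!x. x : S ==> 0 < e x" "!!x. x : S ==> cball x (e x) <= S" by metis
 have "\<forall>x\<in>S. \<exists>G. has_weak_gradient (ball x (e x)) u G & square_integrable (ball x (e x)) G & square_integrable (ball x (e x)) u"
 using u e unfolding W12_loc_def W12_def by blast
 then obtain G where G: "!!x. x : S ==> has_weak_gradient (ball x (e x)) u (G x)"
  "!!x. x : S ==> L2 (leb_on (ball x (e x))) (G x)" "!!x. x : S ==> L2 (leb_on (ball x (e x))) u"
 by (auto simp: square_integrable_iff_L2) metis
 obtain \<F> where F: "\<F> <= (%x. ball x (e x)) ` S" "countable \<F>" "\<Union>\<F> = (\<Union>x\<in>S. ball x (e x))"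
 using Lindelof[of "(%x. ball x (e x)) ` S"] by auto
 obtain C where C: "C <= S" "countable C" "\<F> = (%x. ball x (e x)) ` C"
 using countable_subset_image[of \<F> "%x. ball x (e x)" S] F(1,2) by auto
 have cov: "S <= (\<Union>x\<in>C. ball x (e x))" using F(3) C(3) e(1) by force
 then have "C ~= {}" using False by auto
 define c where "c = from_nat_into C"
 have cC: "range c = C" unfolding c_def by (rule range_from_nat_into[OF \<open>C ~= {}\<close> C(2)])
 have cS: "c n : S" for n using cC C(1) by auto
 define B where "B n = ball (c n) (e (c n))" for n
 have covB: "\<exists>n. y : B n" if "y : S" for y using cov that cC unfolding B_def by force
 define H where "H y = G (c (LEAST n. y : B n)) y" for y
 have "AE y in leb. y : B m \<inter> B n --> G (c m) y = G (c n) y" for m n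
 by (rule weak_gradient_unique[of "B m \<inter> B n" u])
  (auto simp: B_def intro: has_weak_gradient_mono[OF G(1)[OF cS]])
 then have "AE y in leb. \<forall>m n. y : B m \<inter> B n --> G (c m) y = G (c n) y" by (simp add: AE_all_countable)
 then have HB: "AE y in leb. y : B m --> G (c m) y = H y" for m
 proof eventually_elim
 case (elim y)
 show ?case
 proof
  assume y: "y : B m"
  then have "y : B (LEAST n. y : B n)" by (rule LeastI)
  with y elim show "G (c m) y = H y" unfolding H_def by blast
 qed
 qed
 have hB: "has_weak_gradient (B m) u H" for m
 by (rule has_weak_gradient_cong_AE[OF G(1)[OF cS, folded B_def] _ HB]) simp
 have LB: "L2 (leb_on (B m)) H" for m
 by (rule L2_cong_AE_on[OF G(2)[OF cS, folded B_def] _ HB]) (simp add: B_def)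
 have "has_weak_gradient S u H"
 proof (rule has_weak_gradient_local)
 fix x assume x: "x : S"
 then obtain m where m: "x : B m" using covB by blast
 have "open (B m)" by (simp add: B_def)
 then obtain d where d: "0 < d" "ball x d <= B m" using m open_contains_ball by blast
 have "B m <= S" unfolding B_def using e(2)[OF cS] ball_subset_cball by (rule order_trans[rotated])
 with d show "\<exists>e>0. ball x e <= S & has_weak_gradient (ball x e) u H"
  using has_weak_gradient_mono[OF hB d(2)] by (intro exI[of _ d]) auto
 qed
 moreover have "L2 (leb_on K) u & L2 (leb_on K) H" if K: "compact K" "K <= S" for K
 proof -
 have "K <= (\<Union>n. B n)" using K(2) covB by blast
 then obtain I where I: "finite I" "K <= (\<Union>n\<in>I. B n)"
  using compactE_image[OF K(1), of UNIV B] by (auto simp: B_def)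
 have Bs: "B n : sets leb" for n by (simp add: B_def)
 have Us: "(\<Union>n\<in>I. B n) : sets leb" using I(1) Bs by auto
 have "L2 (leb_on (\<Union>n\<in>I. B n)) u" by (rule L2_finite_UN[OF I(1) Bs]) (simp add: B_def G(3)[OF cS])
 moreover have "L2 (leb_on (\<Union>n\<in>I. B n)) H" by (rule L2_finite_UN[OF I(1) Bs LB])
 ultimately show ?thesis using K(1) by (auto intro: L2_mono_set[OF _ I(2) Us])
 qed
 ultimately show ?thesis unfolding loc_sobolev_def by blast
qed

lemma weak_grad_eq_AE:
 assumes "open S" "has_weak_gradient S u G"
 shows "AE x in leb. x : S --> weak_grad S u x = G x"
proof -
 have "has_weak_gradient S u (weak_grad S u)" 
 unfolding weak_grad_def by (rule someI[of "has_weak_gradient S u", OF assms(2)])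
 from weak_gradient_unique[OF assms(1) this assms(2)] show ?thesis .
qed

lemma W12_imp_loc_sobolev:
 assumes "open S" "W12 S u"
 shows "\<exists>G. loc_sobolev S u G"
proof -
 obtain G where G: "has_weak_gradient S u G" "square_integrable S G" "square_integrable S u"
 using assms(2) by (auto simp: W12_def)
 have "S : sets leb" using assms(1) by simp
 then have "loc_sobolev S u G"
 unfolding loc_sobolev_def using G by (auto simp: square_integrable_iff_L2 intro: L2_mono_set[of S])
 then show ?thesis by blast
qed



section \<open>Strong convergence of the minimizers\<close>

lemma compact_neighbourhood:
 fixes K :: "'a::euclidean_space set"
 assumes K: "compact K" "K <= S" and S: "open S"
 obtains r K' where "0 < r" "compact K'" "K' <= S" "!!x. x : K ==> cball x r <= K'" "K' = (\<Union>x\<in>K. cball x r)"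
proof -
 have "\<exists>d>0. \<forall>x\<in>K. \<forall>y\<in>- S. d <= dist x y"
 by (rule separate_compact_closed) (use K S in auto)
 then obtain d where d: "0 < d" "!!x y. x : K ==> y \<notin> S ==> d <= dist x y" by auto
 define K' where "K' = {x + y | x y. x : K & y : cball 0 (d/2)}"
 have "compact K'" unfolding K'_def by (rule compact_sums[OF K(1) compact_cball])
 moreover have eq: "K' = (\<Union>x\<in>K. cball x (d/2))"
 proof (intro equalityI subsetI)
 fix z assume "z : K'"
 then obtain x y where "z = x + y" "x : K" "y : cball 0 (d/2)" unfolding K'_def by blast
 then have "x : K" "z : cball x (d/2)" by (auto simp: dist_norm)
 then show "z : (\<Union>x\<in>K. cball x (d/2))" by blast
 next
 fix z assume "z : (\<Union>x\<in>K. cball x (d/2))"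
 then obtain x where "x : K" "dist x z <= d/2" by auto
 then have "z = x + (z - x)" "x : K" "z - x : cball 0 (d/2)" by (auto simp: dist_norm norm_minus_commute)
 then show "z : K'" unfolding K'_def by blast
 qed
 moreover have "K' <= S"
 proof
 fix z assume "z : K'"
 then obtain x where "x : K" "dist x z <= d/2" unfolding eq by auto
 then show "z : S" using d(2)[of x z] d(1) by force
 qed
 ultimately show ?thesis using that[of "d/2" K'] d(1) by auto
qed

lemma cutoff_compact:
 fixes K :: "'a::euclidean_space set"
 assumes K: "compact K" "K <= S" and S: "open S"
 obtains zeta K' where "smooth zeta" "!!x. 0 <= zeta x" "!!x. zeta x <= 1" "!!x. x : K ==> zeta x = 1"
 "compact K'" "K' <= S" "K <= K'" "!!x. x \<notin> K' ==> zeta x = 0"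
proof -
 obtain r T where T: "0 < r" "compact T" "T <= S" "!!x. x : K ==> cball x r <= T" "T = (\<Union>x\<in>K. cball x r)"
 by (rule compact_neighbourhood[OF K S]) blast
 obtain q K' where K': "0 < q" "compact K'" "K' <= S" "!!x. x : T ==> cball x q <= K'" "K' = (\<Union>x\<in>T. cball x q)"
 by (rule compact_neighbourhood[OF T(2,3) S]) blast
 define p where "p = min r q"
 have p: "0 < p" "p <= r" "p <= q" using T(1) K'(1) by (auto simp: p_def)
 note c = cutoff_exists[OF compact_imp_bounded[OF T(2)] compact_sets_lebesgue[OF T(2)] p(1)]
 show ?thesis
 proof (rule that[OF c(1,2,3) _ K'(2,3)])
 show "mollify p (indicat_real T) x = 1" if "x : K" for x
 proof (rule c(4))
  have "ball x p <= cball x r" using p by auto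
  then show "ball x p <= T" using T(4)[OF that] by blast
 qed
 show "K <= K'"
 proof
  fix x assume "x : K"
  then have "x : T" using T(4)[of x] T(1) by force
  then show "x : K'" using K'(4)[of x] K'(1) by force
 qed
 show "mollify p (indicat_real T) x = 0" if "x \<notin> K'" for x
 proof (rule c(5), rule ccontr)
  assume "ball x p \<inter> T ~= {}"
  then obtain y where "y : T" "dist x y < p" by auto
  then have "x : cball y q" using p by (simp add: dist_commute)
  then show False using K'(4)[OF \<open>y : T\<close>] that by blast
 qed
 qed
qed

text \<open>Equicontinuity makes pointwise convergence uniform on compact sets: a compact set is covered by finitely
 many balls on which all the functions oscillate little.\<close>

lemma locally_equi_Lipschitz_uniform:
 fixes f :: "nat => 'a::euclidean_space => 'b::real_normed_vector"
 assumes S: "open S" and lip: "!!x r. 0 < r ==> cball x r <= S ==> \<exists>C. \<forall>n. C-lipschitz_on (cball x r) (f n)"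
 and lim: "!!x. x : S ==> (%n. f n x) \<leadsto> g x" and K: "compact K" "K <= S" and e: "0 < e"
 shows "\<forall>\<^sub>F n in sequentially. \<forall>x\<in>K. norm (f n x - g x) <= e"
proof -
 have "\<exists>s>0. \<forall>n. \<forall>y\<in>ball x s. norm (f n y - f n x) <= e/3 & norm (g y - g x) <= e/3" if x: "x : K" for x
 proof -
 obtain r where r: "0 < r" "cball x r <= S" using S K(2) x open_contains_cball by blast
 obtain C where C: "!!n. C-lipschitz_on (cball x r) (f n)" using lip[OF r] by blast
 have C0: "0 <= C" using lipschitz_on_nonneg[OF C] .
 define s where "s = min r (e / 3 / (C + 1))"
 have s: "0 < s" using r e C0 by (simp add: s_def)
 have Cs: "C * s <= e / 3"
 proof -
  have "C * s <= (C + 1) * (e / 3 / (C + 1))" using C0 e s by (intro mult_mono) (auto simp: s_def)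
  also have "... = e / 3"
  proof -
  have "(C + 1) * (t / (C + 1)) = t" for t :: real using C0 by simp
  then show ?thesis .
  qed
  finally show ?thesis .
 qed
 have f: "norm (f n y - f n x) <= e/3" if y: "y : ball x s" for n y
 proof -
  have "dist (f n y) (f n x) <= C * dist y x"
  using y r by (intro lipschitz_onD[OF C]) (auto simp: s_def)
  also have "... <= C * s" using y C0 by (intro mult_left_mono) (auto simp: dist_commute)
  finally show ?thesis using Cs by (simp add: dist_norm)
 qed
 have "norm (g y - g x) <= e/3" if y: "y : ball x s" for y
 proof -
  have "y : S" "x : S" using y r by (auto simp: s_def)
  then have "(%n. norm (f n y - f n x)) \<leadsto> norm (g y - g x)" by (intro tendsto_norm tendsto_diff lim)
  then show ?thesis by (rule LIMSEQ_le_const2) (use f[OF y] in auto)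
 qed
 with f s show ?thesis by blast
 qed
 then obtain s where s: "!!x. x : K ==> 0 < s x"
 "!!x n y. x : K ==> y : ball x (s x) ==> norm (f n y - f n x) <= e/3 & norm (g y - g x) <= e/3" by metis
 have "K <= (\<Union>x\<in>K. ball x (s x))" using s(1) by force
 then obtain I where I: "I <= K" "finite I" "K <= (\<Union>x\<in>I. ball x (s x))"
 by (rule compactE_image[OF K(1) open_ball])
 have "\<forall>\<^sub>F n in sequentially. \<forall>x\<in>I. norm (f n x - g x) < e/3"
 proof (rule eventually_ball_finite[OF I(2)], rule ballI)
 fix x assume "x : I"
 then have "(%n. f n x) \<leadsto> g x" using I(1) K(2) lim by blast
 then have "(%n. norm (f n x - g x)) \<leadsto> 0" by (intro tendsto_norm_zero LIM_zero)
 then show "\<forall>\<^sub>F n in sequentially. norm (f n x - g x) < e/3" by (rule order_tendstoD(2)) (use e in simp)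
 qed
 then show ?thesis
 proof eventually_elim
 case (elim n)
 show ?case
 proof
  fix y assume "y : K"
  then obtain x where x: "x : I" "y : ball x (s x)" using I(3) by blast
  have "x : K" using x I(1) by blast
  note b = s(2)[OF this x(2), of n]
  have "f n y - g y = (f n y - f n x) + ((f n x - g x) + (g x - g y))" by simp
  also have "norm ... <= norm (f n y - f n x) + (norm (f n x - g x) + norm (g x - g y))"
  by (intro order_trans[OF norm_triangle_ineq] add_left_mono norm_triangle_ineq)
  finally show "norm (f n y - g y) <= e"
  using b elim x(1) by (force simp: norm_minus_commute)
 qed
 qed
qed

text \<open>The quadratic form is convex; the term with the gradient of the cutoff \<open>zeta^2\<close> still carries one factor \<open>zeta\<close>,
 which lets it be absorbed by \<open>zeta^2 \<bar>a\<bar>^2\<close>.\<close>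

lemma interpolated_gradient_bound:
 fixes a b z :: "'b::real_inner"
 assumes zeta: "0 <= zeta" "zeta <= 1" and D: "\<bar>D\<bar> <= d" and L: "norm z <= L"
 shows "(norm ((1 - zeta^2) *\<^sub>R a + zeta^2 *\<^sub>R b + (2 * D * zeta) *\<^sub>R z))^2
 <= (1 - zeta^2) * (norm a)^2 + zeta^2 * (norm b)^2 + 2 * d * L * (zeta^2 * (norm a)^2 + zeta^2 * (norm b)^2 + 2) + 4 * d^2 * L^2"
proof -
 define X where "X = (1 - zeta^2) *\<^sub>R a + zeta^2 *\<^sub>R b"
 define Y where "Y = (2 * D * zeta) *\<^sub>R z"
 have z1: "zeta^2 <= 1" using zeta by (simp add: power_le_one)
 have d0: "0 <= d" using D by linarith
 have L0: "0 <= L" using L norm_ge_zero[of z] by linarith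
 have X2: "(norm X)^2 <= (1 - zeta^2) * (norm a)^2 + zeta^2 * (norm b)^2"
 proof -
 have "(1 - zeta^2) * (norm a)^2 + zeta^2 * (norm b)^2 - (norm X)^2 = zeta^2 * (1 - zeta^2) * (norm (a - b))^2"
  unfolding X_def power2_norm_eq_inner by (simp add: inner_diff inner_add inner_commute algebra_simps)
 moreover have "0 <= zeta^2 * (1 - zeta^2) * (norm (a - b))^2" using z1 by simp
 ultimately show ?thesis by linarith
 qed
 have Yn: "norm Y <= 2 * d * zeta * L"
 proof -
 have "\<bar>D\<bar> * zeta * norm z <= d * zeta * L" using D L zeta d0 by (intro mult_mono) auto
 then show ?thesis unfolding Y_def using zeta by (simp add: abs_mult)
 qed
 have Y2: "(norm Y)^2 <= 4 * d^2 * L^2"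
 proof -
 have "2 * d * zeta * L <= 2 * d * 1 * L" using zeta d0 L0 by (intro mult_right_mono mult_left_mono) auto
 then have "(norm Y)^2 <= (2 * d * L)^2" using Yn by (intro power_mono) auto
 then show ?thesis by (simp add: power_mult_distrib)
 qed
 have Xn: "norm X <= norm a + norm b"
 proof -
 have "norm X <= (1 - zeta^2) * norm a + zeta^2 * norm b"
  unfolding X_def by (rule order_trans[OF norm_triangle_ineq]) (use z1 in simp)
 also have "... <= 1 * norm a + 1 * norm b" using z1 by (intro add_mono mult_right_mono) auto
 finally show ?thesis by simp
 qed
 have XY: "2 * (X \<bullet> Y) <= 2 * d * L * (zeta^2 * (norm a)^2 + zeta^2 * (norm b)^2 + 2)"
 proof -
 have "X \<bullet> Y <= norm X * norm Y" by (rule norm_cauchy_schwarz)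
 also have "... <= (norm a + norm b) * (2 * d * zeta * L)" by (intro mult_mono Xn Yn) auto
 finally have "2 * (X \<bullet> Y) <= 2 * d * L * (2 * (zeta * norm a) + 2 * (zeta * norm b))" by (simp add: algebra_simps)
 also have "... <= 2 * d * L * (zeta^2 * (norm a)^2 + zeta^2 * (norm b)^2 + 2)"
 proof (rule mult_left_mono)
  have "2 * t <= t^2 + 1" for t :: real using zero_le_power2[of "t - 1"] by (simp add: power2_diff)
  from this[of "zeta * norm a"] this[of "zeta * norm b"]
  show "2 * (zeta * norm a) + 2 * (zeta * norm b) <= zeta^2 * (norm a)^2 + zeta^2 * (norm b)^2 + 2" by (simp add: power_mult_distrib)
 qed (use d0 L0 in simp)
 finally show ?thesis .
 qed
 have "(norm (X + Y))^2 = (norm X)^2 + 2 * (X \<bullet> Y) + (norm Y)^2"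
 by (simp add: power2_norm_eq_inner inner_add inner_commute)
 then show ?thesis using X2 Y2 XY unfolding X_def Y_def by linarith
qed

definition dirichlet :: "'a::euclidean_space set => ('m::finite => 'a => 'a) => real" where
 "dirichlet K G = (\<Sum>i\<in>UNIV. LINT x|leb_on K. (norm (G i x))^2)"

definition lower_terms :: "'a::euclidean_space set => ('m::finite => 'a => real) => ('m => 'a => real) => ('a => real ^ 'm) => real" where
 "lower_terms K f g v = (\<Sum>i\<in>UNIV. LINT x|leb_on K. (v x $ i)^2 * f i x - v x $ i * g i x)"

lemma AE_lebesgue_on_iff:
 "S : sets leb ==> (AE x in leb_on S. P x) \<longleftrightarrow> (AE x in leb. x : S --> P x)"
 by (subst AE_restrict_space_iff) auto

lemma energy_eq:
 fixes v :: "'a::euclidean_space => real ^ 'm::finite"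
 assumes Om: "open Om" and v: "!!i. loc_sobolev Om (%x. v x $ i) (H i)" and K: "compact K" "K <= Om"
 shows "energy Om f g F K (v, W) = dirichlet K H + lower_terms K f g v + F W"
proof -
 note Ks = compact_sets_lebesgue[OF K(1)]
 have ae: "AE x in leb_on K. (norm (weak_grad Om (%y. v y $ i) x))^2 = (norm (H i x))^2" for i
 unfolding AE_lebesgue_on_iff[OF Ks]
 using weak_grad_eq_AE[OF Om loc_sobolevD(1)[OF v[of i]]] by eventually_elim (use K(2) in auto)
 have L: "L2 (leb_on K) (weak_grad Om (%y. v y $ i))" for i
 by (rule L2_cong_AE_on[OF loc_sobolevD(3)[OF v[of i] K] Ks])
  (use weak_grad_eq_AE[OF Om loc_sobolevD(1)[OF v[of i]]] in eventually_elim, use K(2) in auto)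
 have "(LINT x:K|leb. (\<Sum>i\<in>UNIV. (norm (weak_grad Om (%y. v y $ i) x))^2))
  = (\<Sum>i\<in>UNIV. LINT x|leb_on K. (norm (weak_grad Om (%y. v y $ i) x))^2)"
 unfolding lebesgue_on_integral(1)[OF Ks] by (rule LINT_sum) (rule L2D(2)[OF L])
 also have "... = dirichlet K H"
 unfolding dirichlet_def
 proof (rule sum.cong[OF refl], rule integral_cong_AE)
 fix i
 show "(%x. (norm (weak_grad Om (%y. v y $ i) x))^2) : borel_measurable (leb_on K)"
  by (rule borel_measurable_integrable[OF L2D(2)[OF L]])
 show "(%x. (norm (H i x))^2) : borel_measurable (leb_on K)"
  by (rule borel_measurable_integrable[OF L2D(2)[OF loc_sobolevD(3)[OF v[of i] K]]])
 qed (rule ae)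
 finally show ?thesis by (simp add: energy_def lower_terms_def lebesgue_on_integral(1)[OF Ks])
qed

lemma integrable_mult_bounded_AE:
 fixes phi f :: "'a => real"
 assumes "integrable M phi" "f : borel_measurable M" "AE x in M. \<bar>f x\<bar> <= C"
 shows "integrable M (%x. phi x * f x)" "\<bar>LINT x|M. phi x * f x\<bar> <= C * (LINT x|M. \<bar>phi x\<bar>)"
proof -
 have ae: "AE x in M. norm (phi x * f x) <= C * \<bar>phi x\<bar>"
 using assms(3)
 proof eventually_elim
 case (elim x)
 then have "\<bar>phi x\<bar> * \<bar>f x\<bar> <= \<bar>phi x\<bar> * C" by (intro mult_left_mono) auto
 then show ?case by (simp add: abs_mult mult.commute)
 qed
 have Ci: "integrable M (%x. C * \<bar>phi x\<bar>)" using assms(1) by simp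
 show i: "integrable M (%x. phi x * f x)"
 proof (rule intgb_bound[OF Ci])
 show "(%x. phi x * f x) : borel_measurable M" using assms(1,2) by (intro borel_measurable_times) auto
 show "AE x in M. norm (phi x * f x) <= norm (C * \<bar>phi x\<bar>)" using ae by eventually_elim (simp add: order_trans[OF _ abs_ge_self])
 qed
 have "\<bar>LINT x|M. phi x * f x\<bar> <= (LINT x|M. norm (phi x * f x))" using integral_norm_bound[of M "%x. phi x * f x"] by simp
 also have "... <= (LINT x|M. C * \<bar>phi x\<bar>)" by (rule integral_mono_AE[OF integrable_norm[OF i] Ci ae])
 finally show "\<bar>LINT x|M. phi x * f x\<bar> <= C * (LINT x|M. \<bar>phi x\<bar>)" by simp
qed

lemma lower_terms_diff_bound:
 fixes v w :: "'a::euclidean_space => real ^ 'm::finite"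
 assumes K: "compact K"
 and c: "!!i. f i : borel_measurable (leb_on K)" "!!i. g i : borel_measurable (leb_on K)"
  "!!i. AE x in leb_on K. \<bar>f i x\<bar> <= C0" "!!i. AE x in leb_on K. \<bar>g i x\<bar> <= C0"
 and v: "!!i. L2 (leb_on K) (%x. v x $ i)" "!!i. L2 (leb_on K) (%x. w x $ i)"
 shows "\<bar>lower_terms K f g v - lower_terms K f g w\<bar>
 <= C0 * (\<Sum>i\<in>UNIV. (LINT x|leb_on K. \<bar>(v x $ i)^2 - (w x $ i)^2\<bar>) + (LINT x|leb_on K. \<bar>v x $ i - w x $ i\<bar>))"
proof -
 interpret finite_measure "leb_on K" by (rule finite_measure_compact[OF K])
 have "\<bar>(LINT x|leb_on K. (v x $ i)^2 * f i x - v x $ i * g i x) - (LINT x|leb_on K. (w x $ i)^2 * f i x - w x $ i * g i x)\<bar>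
  <= C0 * ((LINT x|leb_on K. \<bar>(v x $ i)^2 - (w x $ i)^2\<bar>) + (LINT x|leb_on K. \<bar>v x $ i - w x $ i\<bar>))" for i
 proof -
 have i2: "integrable (leb_on K) (%x. (v x $ i)^2)" "integrable (leb_on K) (%x. (w x $ i)^2)"
  using L2D(2)[OF v(1)[of i]] L2D(2)[OF v(2)[of i]] by auto
 have i1: "integrable (leb_on K) (%x. v x $ i)" "integrable (leb_on K) (%x. w x $ i)"
  using L2_integrable[OF v(1)] L2_integrable[OF v(2)] by auto
 note p = integrable_mult_bounded_AE(1)[OF i2(1) c(1,3)] integrable_mult_bounded_AE(1)[OF i2(2) c(1,3)]
  integrable_mult_bounded_AE(1)[OF i1(1) c(2,4)] integrable_mult_bounded_AE(1)[OF i1(2) c(2,4)]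
 have "(LINT x|leb_on K. (v x $ i)^2 * f i x - v x $ i * g i x) - (LINT x|leb_on K. (w x $ i)^2 * f i x - w x $ i * g i x)
  = (LINT x|leb_on K. ((v x $ i)^2 - (w x $ i)^2) * f i x) - (LINT x|leb_on K. (v x $ i - w x $ i) * g i x)"
  using p by (simp add: left_diff_distrib)
 moreover have "\<bar>LINT x|leb_on K. ((v x $ i)^2 - (w x $ i)^2) * f i x\<bar> <= C0 * (LINT x|leb_on K. \<bar>(v x $ i)^2 - (w x $ i)^2\<bar>)"
  by (rule integrable_mult_bounded_AE(2)[OF intgb_diff[OF i2] c(1,3)])
 moreover have "\<bar>LINT x|leb_on K. (v x $ i - w x $ i) * g i x\<bar> <= C0 * (LINT x|leb_on K. \<bar>v x $ i - w x $ i\<bar>)"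
  by (rule integrable_mult_bounded_AE(2)[OF intgb_diff[OF i1] c(2,4)])
 ultimately show ?thesis unfolding distrib_left by linarith
 qed
 then show ?thesis
 unfolding lower_terms_def sum_subtractf[symmetric] sum_distrib_left
 by (intro order_trans[OF sum_abs] sum_mono) blast
qed

text \<open>What the strong convergence of the minimizers rests on: uniform convergence on compact sets, uniformly
 bounded coefficients and minimality.\<close>

locale convergent_minimizers =
 fixes Om :: "'a::euclidean_space set"
 and \<Omega>k :: "nat => 'a set"
 and fk gk :: "nat => 'm::finite => 'a => real"
 and Fk :: "nat => ('m => 'a set) => real"
 and uk :: "nat => 'a => real ^ 'm" and Gk :: "nat => 'm => 'a => 'a"
 and Wk :: "nat => 'm => 'a set"
 and u :: "'a => real ^ 'm" and G :: "'m => 'a => 'a" and C0 :: real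
 assumes Om: "open Om"
 and Gk: "!!k i. loc_sobolev Om (%x. uk k x $ i) (Gk k i)"
 and G: "!!i. loc_sobolev Om (%x. u x $ i) (G i)"
 and unif: "!!K e. compact K ==> K <= Om ==> 0 < e ==> \<forall>\<^sub>F k in sequentially. \<forall>x\<in>K. norm (uk k x - u x) <= e"
 and coeff_measurable: "!!k i. fk k i : borel_measurable (leb_on Om)" "!!k i. gk k i : borel_measurable (leb_on Om)"
 and coeff_bound: "!!k i. AE x in leb. x : Om --> \<bar>fk k i x\<bar> <= C0" "!!k i. AE x in leb. x : Om --> \<bar>gk k i x\<bar> <= C0"
 and minimizer: "!!k. local_minimizer Om (\<Omega>k k) (fk k) (gk k) (Fk k) (uk k, Wk k)"
begin

lemma Wk_tuple: "Wk k : set_tuples (\<Omega>k k)"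
 and uk_vanishes: "AE x in leb. x : Om - Wk k i --> uk k x $ i = 0"
 using minimizer[of k] by (auto simp: local_minimizer_def admissible_def)

text \<open>Since weak gradients are determined almost everywhere, minimality holds for any representative
 \<open>H\<close> of the gradient of the competitor.\<close>

lemma minimality:
 assumes v: "!!i. loc_sobolev Om (%x. v x $ i) (H i)" and W: "W : set_tuples (\<Omega>k k)"
 and 0: "!!i. AE x in leb. x : Om - W i --> v x $ i = 0" and K: "compact K" "K <= Om"
 and off: "AE x in leb. x : Om - K --> v x = uk k x" "!!i. W i \<inter> (Om - K) = Wk k i \<inter> (Om - K)"
 shows "dirichlet K (Gk k) + lower_terms K (fk k) (gk k) (uk k) + Fk k (Wk k)
 <= dirichlet K H + lower_terms K (fk k) (gk k) v + Fk k W"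
proof -
 have adm: "(v, W) : admissible Om (\<Omega>k k)" using v W 0 by (auto simp: admissible_def intro: loc_sobolev_imp_W12_loc)
 have adm': "(uk k, Wk k) : admissible Om (\<Omega>k k)" using minimizer[of k] by (simp add: local_minimizer_def)
 have co: "coincide_off Om K (v, W) (uk k, Wk k)" using off by (simp add: coincide_off_def)
 then have "competitor Om (\<Omega>k k) (v, W) (uk k, Wk k)" using adm adm' K by (auto simp: competitor_def)
 then have "energy Om (fk k) (gk k) (Fk k) K (uk k, Wk k) <= energy Om (fk k) (gk k) (Fk k) K (v, W)"
 using minimizer[of k] K co unfolding local_minimizer_def by blast
 then show ?thesis unfolding energy_eq[OF Om v K] energy_eq[OF Om Gk K] .
qed

lemma Om_sets: "Om : sets leb" using Om by simp

lemma coeff_on: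
 assumes "compact K" "K <= Om"
 shows "fk k i : borel_measurable (leb_on K)" "gk k i : borel_measurable (leb_on K)"
 "AE x in leb_on K. \<bar>fk k i x\<bar> <= C0" "AE x in leb_on K. \<bar>gk k i x\<bar> <= C0"
proof -
 note Ks = compact_sets_lebesgue[OF assms(1)]
 show "fk k i : borel_measurable (leb_on K)" "gk k i : borel_measurable (leb_on K)"
 by (rule lebesgue_on_measurable_mono[OF coeff_measurable(1) assms(2) Om_sets Ks],
  rule lebesgue_on_measurable_mono[OF coeff_measurable(2) assms(2) Om_sets Ks])
 show "AE x in leb_on K. \<bar>fk k i x\<bar> <= C0"
 unfolding AE_lebesgue_on_iff[OF Ks] using coeff_bound(1)[of k i] by eventually_elim (use assms(2) in auto)
 show "AE x in leb_on K. \<bar>gk k i x\<bar> <= C0"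
 unfolding AE_lebesgue_on_iff[OF Ks] using coeff_bound(2)[of k i] by eventually_elim (use assms(2) in auto)
qed

lemma lower_terms_diff:
 assumes K: "compact K" "K <= Om" and v: "!!i. L2 (leb_on K) (%x. v x $ i)" "!!i. L2 (leb_on K) (%x. w x $ i)"
 shows "\<bar>lower_terms K (fk k) (gk k) v - lower_terms K (fk k) (gk k) w\<bar>
 <= C0 * (\<Sum>i\<in>UNIV. (LINT x|leb_on K. \<bar>(v x $ i)^2 - (w x $ i)^2\<bar>) + (LINT x|leb_on K. \<bar>v x $ i - w x $ i\<bar>))"
 by (rule lower_terms_diff_bound[OF K(1) coeff_on[OF K] v])

lemma uk_L2_tendsto:
 assumes K: "compact K" "K <= Om"
 shows "L2_tendsto (leb_on K) (%k x. uk k x $ i) (%x. u x $ i)"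
proof -
 interpret finite_measure "leb_on K" by (rule finite_measure_compact[OF K(1)])
 show ?thesis
 proof (rule L2_tendsto_uniform)
 fix e :: real assume "0 < e"
 from unif[OF K this] show "\<forall>\<^sub>F n in sequentially. \<forall>x\<in>space (leb_on K). norm (uk n x $ i - u x $ i) <= e"
 proof eventually_elim
  case (elim k)
  show ?case
  proof
  fix x assume "x : space (leb_on K)"
  then have "norm (uk k x - u x) <= e" using elim by simp
  then show "norm (uk k x $ i - u x $ i) <= e" using component_le_norm_cart[of "uk k x - u x" i] by simp
  qed
 qed
 qed
qed

end



context convergent_minimizers
begin

text \<open>The competitor \<open>v = u\<^sub>k + zeta^2 (soft e u - u\<^sub>k)\<close> is admissible with the same sets, because \<open>soft e u\<close> vanishes
 unless \<open>\<bar>u\<bar> > e\<close>, where \<open>u\<^sub>k\<close> does not vanish for large \<open>k\<close>. So the volume term drops out.\<close>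

lemma comparison_with_limit:
 assumes zeta: "smooth zeta" "!!x. 0 <= zeta x" "!!x. zeta x <= 1" and K: "compact K" "K <= Om" "!!x. x \<notin> K ==> zeta x = 0"
 and L: "!!x. x : K ==> norm (grad zeta x) <= L" and e: "0 < e" and k: "\<forall>x\<in>K. norm (uk k x - u x) <= e"
 defines "d == 3 * e"
 and "a == \<Sum>i\<in>UNIV. LINT x|leb_on K. (zeta x)^2 * (norm (Gk k i x))^2"
 and "A == \<Sum>i\<in>UNIV. LINT x|leb_on K. (zeta x)^2 * (norm (G i x))^2"
 and "V == measure leb K"
 and "U == \<Sum>i\<in>UNIV. LINT x|leb_on K. \<bar>u x $ i\<bar>"
 shows "a <= A + 2 * d * L * (a + A) + real CARD('m) * V * (4 * d * L + 4 * d^2 * L^2)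
  + C0 * (2 * d * U + real CARD('m) * (2 * d^2 * V + d * V))"
proof -
 interpret finite_measure "leb_on K" by (rule finite_measure_compact[OF K(1)])
 note Ks = compact_sets_lebesgue[OF K(1)]
 have d0: "0 < d" using e by (simp add: d_def)
 have V: "measure (leb_on K) (space (leb_on K)) = V"
 using Ks by (simp add: V_def measure_restrict_space)
 have ki: "\<bar>uk k x $ i - u x $ i\<bar> <= e" if "x : K" for x i
 using k that component_le_norm_cart[of "uk k x - u x" i] by force
 define eta where "eta x = zeta x * zeta x" for x
 have etas: "smooth eta" unfolding eta_def by (intro smooth_mult zeta)
 have geta: "grad eta x = (2 * zeta x) *\<^sub>R grad zeta x" for x
 unfolding eta_def grad_mult[OF zeta(1) zeta(1)] by (simp flip: scaleR_add_left)
 define v where "v x = (\<chi> i. uk k x $ i + eta x * (soft e (u x $ i) - uk k x $ i))" for x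
 define H where "H i x = Gk k i x + (eta x *\<^sub>R (soft' e (u x $ i) *\<^sub>R G i x - Gk k i x)
  + (soft e (u x $ i) - uk k x $ i) *\<^sub>R grad eta x)" for i x
 have vH: "loc_sobolev Om (%x. v x $ i) (H i)" for i
 unfolding v_def H_def
 by (simp, intro loc_sobolev_add loc_sobolev_mult_smooth[OF loc_sobolev_diff] loc_sobolev_soft[OF Om] Gk G e etas)
 have van: "AE x in leb. x : Om - Wk k i --> v x $ i = 0" for i
 using uk_vanishes[of k i]
 proof eventually_elim
 case (elim x)
 show ?case
 proof
  assume x: "x : Om - Wk k i"
  then have 0: "uk k x $ i = 0" using elim by blast
  show "v x $ i = 0"
  proof (cases "x : K")
  case True
  then have "\<bar>u x $ i\<bar> <= e" using ki[OF True, of i] 0 by simp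
  then show ?thesis using 0 by (simp add: v_def soft_eq_0)
  qed (simp add: v_def 0 eta_def K(3))
 qed
 qed
 have off: "AE x in leb. x : Om - K --> v x = uk k x"
 by (rule AE_I2) (simp add: v_def eta_def K(3) vec_eq_iff)
 have min: "dirichlet K (Gk k) + lower_terms K (fk k) (gk k) (uk k) <= dirichlet K H + lower_terms K (fk k) (gk k) v"
 using minimality[OF vH Wk_tuple van K(1,2) off] by simp
 have Dd: "\<bar>soft e (u x $ i) - uk k x $ i\<bar> <= d" if "x : K" for x i
 using soft_close[OF e, of "u x $ i"] ki[OF that, of i] by (simp add: d_def)
 note LG = L2D(2)[OF loc_sobolevD(3)[OF G K(1,2)]] and LGk = L2D(2)[OF loc_sobolevD(3)[OF Gk K(1,2)]]
 have zeta1: "(zeta x)^2 <= 1" for x using zeta(2,3)[of x] by (simp add: power_le_one)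
 have zetam: "(%x. (zeta x)^2) : borel_measurable (leb_on K)"
 by (rule continuous_measurable_lebesgue_on) (intro continuous_intros smooth_continuous zeta(1))
 have iw: "integrable (leb_on K) (%x. (zeta x)^2 * (norm (F x))^2)" if "integrable (leb_on K) (%x. (norm (F x))^2)" for F :: "'a => 'a"
 using integrable_mult_bounded_AE(1)[OF that zetam, of 1] zeta1 by (simp add: mult.commute)
 have dirH: "dirichlet K H <= dirichlet K (Gk k) - a + A + 2 * d * L * (a + A) + real CARD('m) * V * (4 * d * L + 4 * d^2 * L^2)"
 proof -
 define R where "R i = (LINT x|leb_on K. (norm (Gk k i x))^2)
  - (LINT x|leb_on K. (zeta x)^2 * (norm (Gk k i x))^2) + (LINT x|leb_on K. (zeta x)^2 * (norm (G i x))^2)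
  + 2 * d * L * ((LINT x|leb_on K. (zeta x)^2 * (norm (Gk k i x))^2) + (LINT x|leb_on K. (zeta x)^2 * (norm (G i x))^2))
  + V * (4 * d * L + 4 * d^2 * L^2)" for i
 have "(LINT x|leb_on K. (norm (H i x))^2) <= R i" for i
 proof -
  note i1 = LGk[of k i] and i2 = iw[OF LGk[of k i]] and i3 = iw[OF LG[of i]]
  let ?B = "%x. (norm (Gk k i x))^2 - (zeta x)^2 * (norm (Gk k i x))^2 + (zeta x)^2 * (norm (G i x))^2
   + 2 * d * L * ((zeta x)^2 * (norm (Gk k i x))^2 + (zeta x)^2 * (norm (G i x))^2) + (4 * d * L + 4 * d^2 * L^2)"
  have iB: "integrable (leb_on K) ?B" using i1 i2 i3 by simp
  have pt: "(norm (H i x))^2 <= ?B x" if x: "x : space (leb_on K)" for x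
  proof -
  have xK: "x : K" using x by simp
  have L0: "0 <= L" using L[OF xK] norm_ge_zero[of "grad zeta x"] by linarith
  let ?b = "soft' e (u x $ i) *\<^sub>R G i x"
  have Heq: "H i x = (1 - (zeta x)^2) *\<^sub>R Gk k i x + (zeta x)^2 *\<^sub>R ?b + (2 * (soft e (u x $ i) - uk k x $ i) * zeta x) *\<^sub>R grad zeta x"
   by (simp add: H_def geta eta_def power2_eq_square algebra_simps)
  have "norm ?b <= norm (G i x)"
   using soft'_bounds[OF e, of "u x $ i"] by (simp add: mult_left_le_one_le)
  then have "(norm ?b)^2 <= (norm (G i x))^2" by (intro power_mono) auto
  then have b: "(zeta x)^2 * (norm ?b)^2 <= (zeta x)^2 * (norm (G i x))^2" by (intro mult_left_mono) auto
  have "(norm (H i x))^2 <= (1 - (zeta x)^2) * (norm (Gk k i x))^2 + (zeta x)^2 * (norm ?b)^2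
   + 2 * d * L * ((zeta x)^2 * (norm (Gk k i x))^2 + (zeta x)^2 * (norm ?b)^2 + 2) + 4 * d^2 * L^2"
   unfolding Heq by (rule interpolated_gradient_bound[OF zeta(2,3) Dd[OF xK] L[OF xK]])
  also have "... <= (1 - (zeta x)^2) * (norm (Gk k i x))^2 + (zeta x)^2 * (norm (G i x))^2
   + 2 * d * L * ((zeta x)^2 * (norm (Gk k i x))^2 + (zeta x)^2 * (norm (G i x))^2 + 2) + 4 * d^2 * L^2"
  proof -
   have "2 * d * L * ((zeta x)^2 * (norm (Gk k i x))^2 + (zeta x)^2 * (norm ?b)^2 + 2)
   <= 2 * d * L * ((zeta x)^2 * (norm (Gk k i x))^2 + (zeta x)^2 * (norm (G i x))^2 + 2)"
   by (intro mult_left_mono add_right_mono add_left_mono b) (use d0 L0 in simp)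
   with b show ?thesis by linarith
  qed
  also have "... = ?B x" by (simp add: algebra_simps)
  finally show ?thesis .
  qed
  have "(LINT x|leb_on K. (norm (H i x))^2) <= (LINT x|leb_on K. ?B x)"
  by (rule integral_mono[OF L2D(2)[OF loc_sobolevD(3)[OF vH K(1,2)]] iB pt])
  also have "... = (LINT x|leb_on K. (norm (Gk k i x))^2)
  - (LINT x|leb_on K. (zeta x)^2 * (norm (Gk k i x))^2) + (LINT x|leb_on K. (zeta x)^2 * (norm (G i x))^2)
  + 2 * d * L * ((LINT x|leb_on K. (zeta x)^2 * (norm (Gk k i x))^2) + (LINT x|leb_on K. (zeta x)^2 * (norm (G i x))^2))
  + V * (4 * d * L + 4 * d^2 * L^2)"
  using i1 i2 i3 V by simp
  finally show ?thesis unfolding R_def .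
 qed
 then have "dirichlet K H <= (\<Sum>i\<in>UNIV. R i)" unfolding dirichlet_def by (intro sum_mono)
 also have "(\<Sum>i\<in>UNIV. R i) = dirichlet K (Gk k) - a + A + 2 * d * L * (a + A) + real CARD('m) * (V * (4 * d * L + 4 * d^2 * L^2))"
 proof -
  have "(\<Sum>i\<in>(UNIV::'m set). p i - q i + r i + c * (q i + r i) + w)
  = (\<Sum>i\<in>UNIV. p i) - (\<Sum>i\<in>UNIV. q i) + (\<Sum>i\<in>UNIV. r i) + c * ((\<Sum>i\<in>UNIV. q i) + (\<Sum>i\<in>UNIV. r i)) + real CARD('m) * w"
  for p q r :: "'m => real" and c w
  by (simp add: sum.distrib sum_subtractf sum_distrib_left distrib_left)
  then show ?thesis unfolding R_def dirichlet_def a_def A_def .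
 qed
 finally show ?thesis by (simp only: mult.assoc)
 qed
 have low: "lower_terms K (fk k) (gk k) v - lower_terms K (fk k) (gk k) (uk k) <= C0 * (2 * d * U + real CARD('m) * (2 * d^2 * V + d * V))"
 proof (cases "K = {}")
 case True
 then have "lower_terms K (fk k) (gk k) v = 0" "lower_terms K (fk k) (gk k) (uk k) = 0"
  by (simp_all add: lower_terms_def lebesgue_on_integral(1)[OF Ks, symmetric] set_lebesgue_integral_def)
 moreover have "U = 0" "V = 0" using True by (simp_all add: U_def V_def lebesgue_on_integral(1)[OF Ks, symmetric] set_lebesgue_integral_def)
 ultimately show ?thesis by simp
 next
 case False
 note Lv = loc_sobolevD(2)[OF vH K(1,2)] and Luk = loc_sobolevD(2)[OF Gk[of k] K(1,2)] and Lu = loc_sobolevD(2)[OF G K(1,2)]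
 have C0: "0 <= C0 \<or> V = 0"
 proof (rule disjCI)
  assume "V ~= 0"
  then have "K \<notin> null_sets leb" by (auto simp: V_def measure_def dest: null_setsD1)
  then have "\<not> (AE x in leb. x \<notin> K)" using Ks by (simp add: AE_iff_null_sets)
  moreover have "AE x in leb. x \<notin> K" if "C0 < 0"
  using coeff_bound(1)[of k undefined] by eventually_elim (use K(2) that in force)
  ultimately show "0 <= C0" by force
 qed
 have ud: "\<bar>v x $ i - uk k x $ i\<bar> <= d" if "x : K" for x i
 proof -
  have "v x $ i - uk k x $ i = (zeta x)^2 * (soft e (u x $ i) - uk k x $ i)" by (simp add: v_def eta_def power2_eq_square)
  then have "\<bar>v x $ i - uk k x $ i\<bar> = (zeta x)^2 * \<bar>soft e (u x $ i) - uk k x $ i\<bar>" by (simp add: abs_mult)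
  also have "... <= 1 * d" using zeta1[of x] Dd[OF that, of i] by (intro mult_mono) auto
  finally show ?thesis by simp
 qed
 have iu: "integrable (leb_on K) (%x. \<bar>u x $ i\<bar>)" for i using L2_integrable[OF Lu[of i]] by simp
 have 1: "(LINT x|leb_on K. \<bar>v x $ i - uk k x $ i\<bar>) <= d * V" for i
 proof -
  have "(LINT x|leb_on K. \<bar>v x $ i - uk k x $ i\<bar>) <= (LINT x|leb_on K. d)"
  by (rule integral_mono') (use ud d0 in auto)
  then show ?thesis using V by (simp add: mult.commute)
 qed
 have 2: "(LINT x|leb_on K. \<bar>(v x $ i)^2 - (uk k x $ i)^2\<bar>) <= 2 * d * (LINT x|leb_on K. \<bar>u x $ i\<bar>) + 2 * d^2 * V" for i
 proof -
  have "(LINT x|leb_on K. \<bar>(v x $ i)^2 - (uk k x $ i)^2\<bar>) <= (LINT x|leb_on K. 2 * d * \<bar>u x $ i\<bar> + 2 * d^2)"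
  proof (rule integral_mono')
  show "integrable (leb_on K) (%x. 2 * d * \<bar>u x $ i\<bar> + 2 * d^2)" using iu by simp
  fix x assume "x : space (leb_on K)"
  then have x: "x : K" by simp
  have "\<bar>v x $ i + uk k x $ i\<bar> <= 2 * \<bar>u x $ i\<bar> + 2 * d"
   using ud[OF x, of i] ki[OF x, of i] e by (simp add: d_def)
  then have "\<bar>v x $ i - uk k x $ i\<bar> * \<bar>v x $ i + uk k x $ i\<bar> <= d * (2 * \<bar>u x $ i\<bar> + 2 * d)"
   using ud[OF x, of i] d0 by (intro mult_mono) auto
  moreover have "(v x $ i)^2 - (uk k x $ i)^2 = (v x $ i - uk k x $ i) * (v x $ i + uk k x $ i)"
   by (simp add: power2_eq_square algebra_simps)
  ultimately have "\<bar>(v x $ i)^2 - (uk k x $ i)^2\<bar> <= d * (2 * \<bar>u x $ i\<bar> + 2 * d)" by (simp only: abs_mult)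
  also have "... = 2 * d * \<bar>u x $ i\<bar> + 2 * d^2" by (simp add: algebra_simps power2_eq_square)
  finally show "\<bar>(v x $ i)^2 - (uk k x $ i)^2\<bar> <= 2 * d * \<bar>u x $ i\<bar> + 2 * d^2" .
  qed (use d0 in auto)
  also have "... = 2 * d * (LINT x|leb_on K. \<bar>u x $ i\<bar>) + 2 * d^2 * V" using iu V by simp
  finally show ?thesis .
 qed
 have S: "(\<Sum>i\<in>UNIV. (LINT x|leb_on K. \<bar>(v x $ i)^2 - (uk k x $ i)^2\<bar>) + (LINT x|leb_on K. \<bar>v x $ i - uk k x $ i\<bar>))
  <= 2 * d * U + real CARD('m) * (2 * d^2 * V + d * V)"
 proof -
  have "(\<Sum>i\<in>UNIV. (LINT x|leb_on K. \<bar>(v x $ i)^2 - (uk k x $ i)^2\<bar>) + (LINT x|leb_on K. \<bar>v x $ i - uk k x $ i\<bar>))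
  <= (\<Sum>i\<in>UNIV. (2 * d * (LINT x|leb_on K. \<bar>u x $ i\<bar>) + 2 * d^2 * V) + d * V)"
  by (intro sum_mono add_mono 1 2)
  then show ?thesis unfolding U_def
  by (simp only: sum.distrib sum_distrib_left[symmetric] sum_constant) (simp add: algebra_simps)
 qed
 note ld = lower_terms_diff[OF K(1,2) Lv Luk, of k]
 show ?thesis
 proof (cases "V = 0")
  case True
  have "AE x in leb_on K. False"
  proof -
  have "emeasure leb K = 0" using True lmeasurable_compact[OF K(1)] by (simp add: V_def emeasure_eq_measure2)
  then have "AE x in leb. x \<notin> K" by (intro AE_not_in null_setsI Ks)
  then show ?thesis unfolding AE_lebesgue_on_iff[OF Ks] by simp
  qed
  then have z: "(LINT x|leb_on K. h x) = 0" for h :: "'a => real"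
  by (intro integral_eq_zero_AE) (auto elim: eventually_mono)
  show ?thesis using True by (simp add: lower_terms_def U_def z)
 next
  case False
  then have "0 <= C0" using C0 by blast
  from ld mult_left_mono[OF S this] show ?thesis by linarith
 qed
 qed
 from min dirH low show ?thesis by linarith
qed

text \<open>In \<open>comparison_with_limit\<close> all terms other than the two Dirichlet integrals carry a factor that tends
 to zero with \<open>e\<close>; uniform convergence allows any \<open>e\<close> for large \<open>k\<close>.\<close>

lemma limsup_gradients:
 assumes zeta: "smooth zeta" "!!x. 0 <= zeta x" "!!x. zeta x <= 1" and K: "compact K" "K <= Om" "!!x. x \<notin> K ==> zeta x = 0"
 and eps: "0 < eps"
 shows "\<forall>\<^sub>F k in sequentially. (\<Sum>i\<in>UNIV. LINT x|leb_on K. (zeta x)^2 * (norm (Gk k i x))^2)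
 <= (\<Sum>i\<in>UNIV. LINT x|leb_on K. (zeta x)^2 * (norm (G i x))^2) + eps"
proof -
 define A where "A = (\<Sum>i\<in>UNIV. LINT x|leb_on K. (zeta x)^2 * (norm (G i x))^2)"
 define V where "V = measure leb K"
 define U where "U = (\<Sum>i\<in>UNIV. LINT x|leb_on K. \<bar>u x $ i\<bar>)"
 obtain L0 where L0: "!!x. x : K ==> norm (grad zeta x) <= L0"
 by (rule continuous_on_compact_bounded[OF K(1) smooth_grad_continuous[OF zeta(1)]]) blast
 define L where "L = max L0 0"
 have L: "!!x. x : K ==> norm (grad zeta x) <= L" "0 <= L" using L0 by (auto simp: L_def le_max_iff_disj)
 define N where "N = real CARD('m)"
 define Q where "Q = \<bar>N * V * (4 * L + 4 * L^2) + C0 * (2 * U + N * (3 * V))\<bar> + \<bar>N * V * 4 * L^2\<bar> + \<bar>C0 * (N * (2 * V))\<bar>"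
 have A0: "0 <= A" unfolding A_def by (intro sum_nonneg LINT_nonneg) auto
 have Q0: "0 <= Q" unfolding Q_def by simp
 define P where "P = 4 * L * A + Q"
 have P0: "0 <= P" unfolding P_def using A0 Q0 L(2) by simp
 define d where "d = min 1 (min (1 / (4 * L + 1)) (eps / (2 * P + 1)))"
 have d: "0 < d" "d <= 1" "d <= 1 / (4 * L + 1)" "d <= eps / (2 * P + 1)" using eps P0 L(2) by (auto simp: d_def)
 have dL: "2 * d * L <= 1/2"
 proof -
 have "d * (4 * L + 1) <= 1" using d(3) L(2) by (simp add: le_divide_eq)
 moreover have "d * (4 * L + 1) = 4 * (d * L) + d" by (simp add: algebra_simps)
 ultimately show ?thesis using d(1) by linarith
 qed
 have dP: "2 * (d * P) <= eps"
 proof -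
 have "d * (2 * P + 1) <= eps" using d(4) P0 by (simp add: le_divide_eq)
 moreover have "d * (2 * P + 1) = 2 * (d * P) + d" by (simp add: algebra_simps)
 ultimately show ?thesis using d(1) by linarith
 qed
 define e where "e = d / 3"
 have e: "0 < e" "3 * e = d" using d(1) by (auto simp: e_def)
 from unif[OF K(1,2) e(1)] show ?thesis
 proof eventually_elim
 case (elim k)
 define a where "a = (\<Sum>i\<in>UNIV. LINT x|leb_on K. (zeta x)^2 * (norm (Gk k i x))^2)"
 have main: "a <= A + 2 * d * L * (a + A) + N * V * (4 * d * L + 4 * d^2 * L^2) + C0 * (2 * d * U + N * (2 * d^2 * V + d * V))"
  using comparison_with_limit[OF zeta K L(1) e(1) elim] unfolding e(2) a_def A_def V_def U_def N_def .
 have "N * V * (4 * d * L + 4 * d^2 * L^2) + C0 * (2 * d * U + N * (2 * d^2 * V + d * V)) <= d * Q"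
 proof -
  have "N * V * (4 * d * L + 4 * d^2 * L^2) + C0 * (2 * d * U + N * (2 * d^2 * V + d * V))
  = d * ((N * V * (4 * L + 4 * L^2) + C0 * (2 * U + N * (3 * V))) + (- (1 - d)) * (N * V * 4 * L^2) + (- (1 - d)) * (C0 * (N * (2 * V))))"
  by (simp add: power2_eq_square algebra_simps)
  also have "... <= d * Q"
  proof (rule mult_left_mono)
  have "(- (1 - d)) * t <= \<bar>t\<bar>" for t
  proof -
   have "\<bar>(- (1 - d)) * t\<bar> <= 1 * \<bar>t\<bar>" unfolding abs_mult using d by (intro mult_right_mono) auto
   then show ?thesis by linarith
  qed
  from this[of "N * V * 4 * L^2"] this[of "C0 * (N * (2 * V))"]
  show "(N * V * (4 * L + 4 * L^2) + C0 * (2 * U + N * (3 * V))) + (- (1 - d)) * (N * V * 4 * L^2) + (- (1 - d)) * (C0 * (N * (2 * V))) <= Q"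
   unfolding Q_def by linarith
  qed (use d in simp)
  finally show ?thesis .
 qed
 with main have 1: "a - A <= 2 * d * L * (a - A) + d * P" unfolding P_def by (simp add: algebra_simps)
 have "a - A <= eps"
 proof (cases "a - A <= 0")
  case False
  then have "2 * d * L * (a - A) <= 1/2 * (a - A)" using dL by (intro mult_right_mono) auto
  moreover have "T <= E" if "T <= X + Y" "X <= 1/2 * T" "2 * Y <= E" for T X Y E :: real using that by linarith
  ultimately show ?thesis using 1 dP by blast
 qed (use eps in simp)
 then show ?case unfolding a_def A_def by linarith
 qed
qed

text \<open>The gradients of \<open>u\<^sub>k - u\<close> are bounded in \<open>L^2\<close> near \<open>K\<close> and their integrals against test functions tend to \<open>0\<close>;
 mollified functions \<open>h\<close> are test functions.\<close>

lemma gradients_weakly_convergent: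
 assumes K: "compact K" "K <= Om" and h: "integrable leb h" "integrable leb (%x. (norm (h x))^2)"
 "!!x. x \<notin> K ==> h x = (0::real)" and b: "b : Basis"
 shows "(%k. LINT x|leb. h x * ((Gk k i x - G i x) \<bullet> b)) \<leadsto> 0"
proof (rule LIMSEQ_I)
 fix eps :: real assume eps: "0 < eps"
 obtain r0 K' where K': "0 < r0" "compact K'" "K' <= Om" "!!x. x : K ==> cball x r0 <= K'" "K' = (\<Union>x\<in>K. cball x r0)"
 by (rule compact_neighbourhood[OF K Om]) blast
 obtain zeta K2 where zeta: "smooth zeta" "!!x. 0 <= zeta x" "!!x. zeta x <= 1" "!!x. x : K' ==> zeta x = 1"
 "compact K2" "K2 <= Om" "K' <= K2" "!!x. x \<notin> K2 ==> zeta x = 0"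
 by (rule cutoff_compact[OF K'(2,3) Om]) blast
 note K's = compact_sets_lebesgue[OF K'(2)] and K2s = compact_sets_lebesgue[OF zeta(5)]
 have KK': "K <= K'" using K'(1,4) by force
 define D where "D k x = Gk k i x - G i x" for k x
 have LD: "L2 (leb_on K') (D k)" for k
 unfolding D_def by (rule L2_diff[OF loc_sobolevD(3)[OF Gk K'(2,3)] loc_sobolevD(3)[OF G K'(2,3)]])
 define A where "A = (\<Sum>i\<in>UNIV. LINT x|leb_on K2. (zeta x)^2 * (norm (G i x))^2)"
 define B where "B = 2 * (A + 1) + 2 * (LINT x|leb_on K'. (norm (G i x))^2)"
 have A0: "0 <= A" unfolding A_def by (intro sum_nonneg LINT_nonneg) auto
 have B0: "0 <= B" unfolding B_def using A0 by simp
 have "\<forall>\<^sub>F k in sequentially. (\<Sum>i\<in>UNIV. LINT x|leb_on K2. (zeta x)^2 * (norm (Gk k i x))^2) <= A + 1"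
 unfolding A_def by (rule limsup_gradients[OF zeta(1-3,5,6,8)]) simp_all
 then have evB: "\<forall>\<^sub>F k in sequentially. (LINT x|leb_on K'. (norm (D k x))^2) <= B"
 proof eventually_elim
 case (elim k)
 note l1 = L2D(2)[OF loc_sobolevD(3)[OF Gk[of k i] zeta(5,6)]]
 have zetam: "(%x. (zeta x)^2) : borel_measurable (leb_on K2)"
  by (rule continuous_measurable_lebesgue_on) (intro continuous_intros smooth_continuous zeta(1))
 have zetai: "integrable (leb_on K2) (%x. (zeta x)^2 * (norm (Gk k i x))^2)"
  using integrable_mult_bounded_AE(1)[OF l1 zetam, of 1] zeta(2,3) by (simp add: power_le_one mult.commute)
 have "(LINT x|leb_on K'. (norm (Gk k i x))^2) <= (LINT x|leb_on K2. (zeta x)^2 * (norm (Gk k i x))^2)"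
  unfolding lebesgue_on_integral(1)[OF K's, symmetric] lebesgue_on_integral(1)[OF K2s, symmetric] set_lebesgue_integral_def
 proof (rule integral_mono')
  show "integrable leb (%x. indicat_real K2 x *\<^sub>R ((zeta x)^2 * (norm (Gk k i x))^2))"
  using zetai unfolding lebesgue_on_integral(2)[OF K2s, symmetric] set_integrable_def .
 qed (use zeta(4,7) in \<open>auto simp: indicator_def\<close>)
 also have "... <= (\<Sum>i\<in>UNIV. LINT x|leb_on K2. (zeta x)^2 * (norm (Gk k i x))^2)"
  by (rule member_le_sum) (auto intro!: LINT_nonneg)
 finally have 1: "(LINT x|leb_on K'. (norm (Gk k i x))^2) <= A + 1" using elim by linarith
 note l2 = L2D(2)[OF loc_sobolevD(3)[OF Gk[of k i] K'(2,3)]] L2D(2)[OF loc_sobolevD(3)[OF G[of i] K'(2,3)]]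
 have "(LINT x|leb_on K'. (norm (D k x))^2) <= (LINT x|leb_on K'. 2 * (norm (Gk k i x))^2 + 2 * (norm (G i x))^2)"
 proof (rule integral_mono')
  show "(norm (D k x))^2 <= 2 * (norm (Gk k i x))^2 + 2 * (norm (G i x))^2" for x
  using norm_add_square_le[of "Gk k i x" "- G i x"] by (simp add: D_def)
 qed (use l2 in auto)
 also have "... <= B" using l2 1 by (simp add: B_def)
 finally show ?case .
 qed
 define s where "s = eps / (2 * (B + 1))"
 have s: "0 < s" using eps B0 by (simp add: s_def)
 have sB: "s * B <= eps / 2"
 proof -
 have "s * B = (eps / 2) * (B / (B + 1))" by (simp add: s_def)
 also have "... <= (eps / 2) * 1" using eps B0 by (intro mult_left_mono) (auto simp: divide_le_eq)
 finally show ?thesis by simp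
 qed
 define r where "r n = r0 / real (n + 2)" for n
 have r: "0 < r n" "r n <= r0" for n using K'(1) by (auto simp: r_def divide_le_eq)
 have rlim: "r \<leadsto> 0" unfolding r_def using LIMSEQ_ignore_initial_segment[OF lim_const_over_n[of r0], of 2] by simp
 have "(%n. LINT x|leb. (norm (mollify (r n) h x - h x))^2) \<leadsto> 0" by (rule mollify_tendsto_L2[OF h(1,2) r(1) rlim])
 then have "\<forall>\<^sub>F n in sequentially. (LINT x|leb. (norm (mollify (r n) h x - h x))^2) < s * eps / 2"
 by (rule order_tendstoD(2)) (use s eps in simp)
 then obtain n where n: "(LINT x|leb. (norm (mollify (r n) h x - h x))^2) < s * eps / 2" by (auto simp: eventually_sequentially)
 define g where "g = mollify (r n) h"
 have gs: "smooth g" unfolding smooth_def g_def by (intro allI C_k_mollify r h)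
 have g0: "g x = 0" if "x \<notin> K'" for x
 unfolding g_def
 proof (rule mollify_eq_0[OF r(1), of "- K"])
 show "ball x (r n) <= - K"
 proof
  fix y assume y: "y : ball x (r n)"
  show "y : - K"
  proof
  assume "y : K"
  moreover have "x : cball y r0" using y r(2)[of n] by (simp add: dist_commute)
  ultimately show False using K'(4) that by blast
  qed
 qed
 qed (use h(3) in auto)
 have tg: "test_function Om g" by (rule test_functionI[OF gs K'(2,3) g0])
 have hw: "has_weak_gradient Om (%x. uk k x $ i - u x $ i) (D k)" for k
 unfolding D_def by (rule has_weak_gradient_diff[OF loc_sobolevD(1)[OF Gk] loc_sobolevD(1)[OF G]])
 have gg0: "grad g x \<bullet> b = 0" if "x \<notin> K'" for x
 using grad_eq_0_outside[OF compact_imp_closed[OF K'(2)], of g x] g0 that by simp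
 have gc: "continuous_on UNIV (%x. grad g x \<bullet> b)" by (intro continuous_intros smooth_grad_continuous[OF gs])
 have li: "(LINT x:Om|leb. (uk k x $ i - u x $ i) * (grad g x \<bullet> b)) = (LINT x:K'|leb. (uk k x $ i - u x $ i) * (grad g x \<bullet> b))" for k
 by (rule locally_integrable_mult_continuous(2)[OF has_weak_gradientD(1)[OF hw] K'(2,3) gc gg0])
 have ig: "integrable (leb_on K') (%x. \<bar>grad g x \<bullet> b\<bar>)"
 using locally_integrable_set_integrable[OF locally_integrable_continuous[OF continuous_on_rabs[OF gc], of Om] K'(2,3)]
 by (simp add: lebesgue_on_integral(2)[OF K's])
 define I where "I = (LINT x|leb_on K'. \<bar>grad g x \<bullet> b\<bar>)"
 have I0: "0 <= I" by (simp add: I_def)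
 define q where "q = eps / (4 * (I + 1))"
 have q: "0 < q" using eps I0 by (simp add: q_def)
 have qI: "q * I < eps / 4"
 proof -
 have "q * I = (eps / 4) * (I / (I + 1))" by (simp add: q_def)
 also have "... < (eps / 4) * 1" using eps I0 by (intro mult_strict_left_mono) (auto simp: divide_less_eq)
 finally show ?thesis by simp
 qed
 have "\<forall>\<^sub>F k in sequentially. norm (LINT x|leb. h x * (D k x \<bullet> b)) < eps"
 using evB unif[OF K'(2,3) q]
 proof eventually_elim
 case (elim k)
 have e1: "\<bar>LINT x:Om|leb. (D k x \<bullet> b) * g x\<bar> <= q * I"
 proof -
  have "\<bar>LINT x:Om|leb. (D k x \<bullet> b) * g x\<bar> = \<bar>LINT x:Om|leb. (uk k x $ i - u x $ i) * (grad g x \<bullet> b)\<bar>"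
  using has_weak_gradientD(3)[OF hw tg b, of k] by simp
  also have "... = \<bar>LINT x|leb_on K'. (uk k x $ i - u x $ i) * (grad g x \<bullet> b)\<bar>"
  unfolding li lebesgue_on_integral(1)[OF K's] by (rule refl)
  also have "... <= (LINT x|leb_on K'. norm ((uk k x $ i - u x $ i) * (grad g x \<bullet> b)))"
  using integral_norm_bound[of "leb_on K'" "%x. (uk k x $ i - u x $ i) * (grad g x \<bullet> b)"] by simp
  also have "... <= (LINT x|leb_on K'. q * \<bar>grad g x \<bullet> b\<bar>)"
  proof (rule integral_mono')
  show "integrable (leb_on K') (%x. q * \<bar>grad g x \<bullet> b\<bar>)" using ig by simp
  fix x assume "x : space (leb_on K')"
  then have "norm (uk k x - u x) <= q" using elim(2) by simp
  then have "\<bar>uk k x $ i - u x $ i\<bar> <= q" using component_le_norm_cart[of "uk k x - u x" i] by simp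
  then show "norm ((uk k x $ i - u x $ i) * (grad g x \<bullet> b)) <= q * \<bar>grad g x \<bullet> b\<bar>"
   by (simp add: abs_mult mult_right_mono)
  qed (use q in simp)
  finally show ?thesis by (simp add: I_def)
 qed
 have e2: "(LINT x:Om|leb. (D k x \<bullet> b) * g x) = (LINT x|leb_on K'. (D k x \<bullet> b) * g x)"
  unfolding lebesgue_on_integral(1)[OF K's, symmetric] by (rule set_integral_subset_support[OF K'(3)]) (use g0 in simp)
 have e3: "(LINT x|leb. h x * (D k x \<bullet> b)) = (LINT x|leb_on K'. h x * (D k x \<bullet> b))"
  unfolding lebesgue_on_integral(1)[OF K's, symmetric] set_lebesgue_integral_def
  by (rule LINT_cong) (use h(3) KK' in \<open>auto simp: indicator_def\<close>)
 have Lh: "L2 (leb_on K') h"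
  unfolding L2_def using h(1,2) K's
  by (auto simp: integrable_restrict_space intro!: integrable_mult_indicator[where 'b=real, simplified] measurable_restrict_space1)
 have Lg: "L2 (leb_on K') g"
  unfolding L2_def using mollify_L2_bound(1)[OF r(1) h(1,2), of n] mollify_L1_bound(1)[OF r(1) h(1), of n] K's
  by (auto simp: g_def integrable_restrict_space intro!: integrable_mult_indicator[where 'b=real, simplified] measurable_restrict_space1)
 have LDb: "L2 (leb_on K') (%x. D k x \<bullet> b)"
 proof (rule L2_bound[OF _ L2D(2)[OF LD[of k]]])
  show "(%x. D k x \<bullet> b) : borel_measurable (leb_on K')" using L2D(1)[OF LD[of k]] by (intro borel_measurable_inner) auto
  show "(norm (D k x \<bullet> b))^2 <= (norm (D k x))^2" for x using Basis_le_norm[OF b, of "D k x"] by (intro power_mono) auto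
 qed
 note j = L2_mult_integrable[OF Lh LDb] L2_mult_integrable[OF LDb Lg]
 have "(LINT x|leb_on K'. h x * (D k x \<bullet> b)) = (LINT x|leb_on K'. (D k x \<bullet> b) * g x) + (LINT x|leb_on K'. (h x - g x) * (D k x \<bullet> b))"
  using j by (simp add: left_diff_distrib mult.commute)
 moreover have "\<bar>LINT x|leb_on K'. (h x - g x) * (D k x \<bullet> b)\<bar> <= eps / 2"
 proof -
  note jd = L2D(2)[OF L2_diff[OF Lg Lh]] L2D(2)[OF LD[of k]]
  have "\<bar>LINT x|leb_on K'. (h x - g x) * (D k x \<bullet> b)\<bar> <= (LINT x|leb_on K'. norm ((h x - g x) * (D k x \<bullet> b)))"
  using integral_norm_bound[of "leb_on K'" "%x. (h x - g x) * (D k x \<bullet> b)"] by simp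
  also have "... <= (LINT x|leb_on K'. (1 / (2 * s)) * (norm (g x - h x))^2 + (s / 2) * (norm (D k x))^2)"
  proof (rule integral_mono')
  show "integrable (leb_on K') (%x. (1 / (2 * s)) * (norm (g x - h x))^2 + (s / 2) * (norm (D k x))^2)" using jd by simp
  fix x
  define X where "X = \<bar>g x - h x\<bar>"
  define Y where "Y = norm (D k x)"
  have "\<bar>D k x \<bullet> b\<bar> <= Y" unfolding Y_def by (rule Basis_le_norm[OF b])
  then have "\<bar>h x - g x\<bar> * \<bar>D k x \<bullet> b\<bar> <= X * Y" unfolding X_def by (intro mult_mono) auto
  also have "X * Y <= (1 / (2 * s)) * X^2 + (s / 2) * Y^2"
  proof -
   have "0 <= (X - s * Y)^2 / (2 * s)" using s by simp
   also have "... = (1 / (2 * s)) * X^2 + (s / 2) * Y^2 - X * Y" using s by (simp add: power2_eq_square field_simps)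
   finally show ?thesis by simp
  qed
  finally show "norm ((h x - g x) * (D k x \<bullet> b)) <= (1 / (2 * s)) * (norm (g x - h x))^2 + (s / 2) * (norm (D k x))^2"
   by (simp add: X_def Y_def abs_mult)
  qed (use s in simp)
  also have "... = (1 / (2 * s)) * (LINT x|leb_on K'. (norm (g x - h x))^2) + (s / 2) * (LINT x|leb_on K'. (norm (D k x))^2)"
  using jd by simp
  also have "... <= (1 / (2 * s)) * (s * eps / 2) + (s / 2) * B"
  proof (intro add_mono mult_left_mono)
  have im: "integrable leb (%x. (norm (g x - h x))^2)"
  proof (rule intgb_bound[of _ "%x. 2 * (norm (g x))^2 + 2 * (norm (h x))^2"])
   show "integrable leb (%x. 2 * (norm (g x))^2 + 2 * (norm (h x))^2)"
   using mollify_L2_bound(1)[OF r(1) h(1,2), of n] h(2) unfolding g_def by simp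
   show "(%x. (norm (g x - h x))^2) : borel_measurable leb"
   using mollify_L1_bound(1)[OF r(1) h(1), of n] h(1) unfolding g_def by simp
   show "AE x in leb. norm ((norm (g x - h x))^2) <= norm (2 * (norm (g x))^2 + 2 * (norm (h x))^2)"
   using norm_add_square_le[of "g _" "- h _"] by (intro AE_I2) simp
  qed
  have "(LINT x|leb_on K'. (norm (g x - h x))^2) <= (LINT x|leb. (norm (g x - h x))^2)"
   unfolding lebesgue_on_integral(1)[OF K's, symmetric] by (rule set_integral_le_integral[OF im]) auto
  then show "(LINT x|leb_on K'. (norm (g x - h x))^2) <= s * eps / 2" using n by (simp add: g_def)
  show "(LINT x|leb_on K'. (norm (D k x))^2) <= B" by (rule elim(1))
  qed (use s in simp_all)
  also have "... <= eps / 2" using s sB by simp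
  finally show ?thesis .
 qed
 ultimately have "\<bar>LINT x|leb. h x * (D k x \<bullet> b)\<bar> < eps"
  using e1 qI eps unfolding e2 e3 by linarith
 then show ?case by simp
 qed
 then show "\<exists>N. \<forall>k\<ge>N. norm ((LINT x|leb. h x * ((Gk k i x - G i x) \<bullet> b)) - 0) < eps"
 by (simp add: eventually_sequentially D_def)
qed

text \<open>Together with the bound from above, weak convergence of the gradients gives strong convergence.\<close>

theorem gradients_L2_tendsto:
 assumes K: "compact K" "K <= Om"
 shows "L2_tendsto (leb_on K) (%k. Gk k i) (G i)"
proof -
 obtain zeta K' where zeta: "smooth zeta" "!!x. 0 <= zeta x" "!!x. zeta x <= 1" "!!x. x : K ==> zeta x = 1"
 "compact K'" "K' <= Om" "K <= K'" "!!x. x \<notin> K' ==> zeta x = 0"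
 by (rule cutoff_compact[OF K Om]) blast
 note K's = compact_sets_lebesgue[OF zeta(5)] and Ks = compact_sets_lebesgue[OF K(1)]
 have zetam: "(%x. (zeta x)^2) : borel_measurable (leb_on K')"
 by (rule continuous_measurable_lebesgue_on) (intro continuous_intros smooth_continuous zeta(1))
 have zeta1: "\<bar>(zeta x)^2\<bar> <= 1" for x using zeta(2,3)[of x] by (simp add: power_le_one)
 note LG = loc_sobolevD(3)[OF G zeta(5,6)] and LGk = loc_sobolevD(3)[OF Gk zeta(5,6)]
 have iw: "integrable (leb_on K') (%x. (zeta x)^2 * f x)" if "integrable (leb_on K') f" for f :: "'a => real"
 using integrable_mult_bounded_AE(1)[OF that zetam, of 1] zeta1 by (simp add: mult.commute)
 define c where "c k j = (LINT x|leb_on K'. (zeta x)^2 * ((Gk k j x - G j x) \<bullet> G j x))" for k j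
 define a where "a k = (\<Sum>j\<in>UNIV. LINT x|leb_on K'. (zeta x)^2 * (norm (Gk k j x))^2)" for k
 define A where "A = (\<Sum>j\<in>UNIV. LINT x|leb_on K'. (zeta x)^2 * (norm (G j x))^2)"
 define t where "t k j = (LINT x|leb_on K'. (zeta x)^2 * (norm (Gk k j x - G j x))^2)" for k j
 have t0: "0 <= t k j" for k j unfolding t_def by (rule LINT_nonneg) simp
 have clim: "(%k. c k j) \<leadsto> 0" for j
 proof -
 define h where "h b x = indicator K' x *\<^sub>R ((zeta x)^2 * (G j x \<bullet> b))" for b x
 have Lb: "L2 (leb_on K') (%x. (zeta x)^2 * (G j x \<bullet> b))" if b: "b : Basis" for b
 proof -
  have "L2 (leb_on K') (%x. G j x \<bullet> b)"
  proof (rule L2_bound[OF _ L2D(2)[OF LG[of j]]])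
  show "(%x. G j x \<bullet> b) : borel_measurable (leb_on K')" using L2D(1)[OF LG[of j]] by (intro borel_measurable_inner) auto
  show "(norm (G j x \<bullet> b))^2 <= (norm (G j x))^2" for x using Basis_le_norm[OF b, of "G j x"] by (intro power_mono) auto
  qed
  from L2_mult_bounded[OF this zetam, of 1] zeta1 show ?thesis by simp
 qed
 have lim: "(%k. LINT x|leb. h b x * ((Gk k j x - G j x) \<bullet> b)) \<leadsto> 0" if b: "b : Basis" for b
 proof (rule gradients_weakly_convergent[OF zeta(5,6) _ _ _ b])
  interpret finite_measure "leb_on K'" by (rule finite_measure_compact[OF zeta(5)])
  show "integrable leb (h b)"
  using L2_integrable[OF Lb[OF b]] unfolding h_def lebesgue_on_integral(2)[OF K's, symmetric] set_integrable_def .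
  have "integrable leb (%x. indicator K' x *\<^sub>R (norm ((zeta x)^2 * (G j x \<bullet> b)))^2)"
  using L2D(2)[OF Lb[OF b]] unfolding lebesgue_on_integral(2)[OF K's, symmetric] set_integrable_def .
  then show "integrable leb (%x. (norm (h b x))^2)"
  by (rule intgb_cong[THEN iffD1, rotated 2]) (auto simp: h_def indicator_def)
 qed (auto simp: h_def)
 have "c k j = (\<Sum>b\<in>Basis. LINT x|leb. h b x * ((Gk k j x - G j x) \<bullet> b))" for k
 proof -
  have ii: "integrable leb (%x. h b x * ((Gk k j x - G j x) \<bullet> b))" if b: "b : Basis" for b
  proof -
  have "L2 (leb_on K') (%x. (Gk k j x - G j x) \<bullet> b)"
  proof (rule L2_bound[OF _ L2D(2)[OF L2_diff[OF LGk[of k j] LG[of j]]]])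
   show "(%x. (Gk k j x - G j x) \<bullet> b) : borel_measurable (leb_on K')"
   using L2D(1)[OF L2_diff[OF LGk[of k j] LG[of j]]] by (intro borel_measurable_inner) auto
   show "(norm ((Gk k j x - G j x) \<bullet> b))^2 <= (norm (Gk k j x - G j x))^2" for x
   using Basis_le_norm[OF b, of "Gk k j x - G j x"] by (intro power_mono) auto
  qed
  from L2_mult_integrable[OF Lb[OF b] this]
  have "integrable leb (%x. indicator K' x *\<^sub>R ((zeta x)^2 * (G j x \<bullet> b) * ((Gk k j x - G j x) \<bullet> b)))"
   unfolding lebesgue_on_integral(2)[OF K's, symmetric] set_integrable_def .
  then show ?thesis by (simp add: h_def mult.assoc)
  qed
  have "c k j = (LINT x|leb. indicator K' x *\<^sub>R ((zeta x)^2 * ((Gk k j x - G j x) \<bullet> G j x)))"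
  unfolding c_def lebesgue_on_integral(1)[OF K's, symmetric] set_lebesgue_integral_def ..
  also have "... = (LINT x|leb. (\<Sum>b\<in>Basis. h b x * ((Gk k j x - G j x) \<bullet> b)))"
  proof (rule LINT_cong[OF refl])
  fix x
  show "indicator K' x *\<^sub>R ((zeta x)^2 * ((Gk k j x - G j x) \<bullet> G j x)) = (\<Sum>b\<in>Basis. h b x * ((Gk k j x - G j x) \<bullet> b))"
   unfolding h_def euclidean_inner[of "Gk k j x - G j x" "G j x"] by (simp add: sum_distrib_left mult_ac)
  qed
  also have "... = (\<Sum>b\<in>Basis. LINT x|leb. h b x * ((Gk k j x - G j x) \<bullet> b))"
  by (rule LINT_sum) (rule ii)
  finally show ?thesis .
 qed
 moreover have "(%k. \<Sum>b\<in>Basis. LINT x|leb. h b x * ((Gk k j x - G j x) \<bullet> b)) \<leadsto> (\<Sum>b\<in>(Basis::'a set). 0)"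
  by (intro tendsto_sum lim)
 ultimately show ?thesis by simp
 qed
 have eq: "(\<Sum>j\<in>UNIV. t k j) = a k - A - 2 * (\<Sum>j\<in>UNIV. c k j)" for k
 proof -
 have "t k j = (LINT x|leb_on K'. (zeta x)^2 * (norm (Gk k j x))^2) - (LINT x|leb_on K'. (zeta x)^2 * (norm (G j x))^2) - 2 * c k j" for j
 proof -
  note i = iw[OF L2D(2)[OF LGk[of k j]]] iw[OF L2D(2)[OF LG[of j]]] iw[OF L2_inner_integrable[OF L2_diff[OF LGk[of k j] LG[of j]] LG[of j]]]
  have "t k j = (LINT x|leb_on K'. (zeta x)^2 * (norm (Gk k j x))^2 - (zeta x)^2 * (norm (G j x))^2 - 2 * ((zeta x)^2 * ((Gk k j x - G j x) \<bullet> G j x)))"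
  unfolding t_def
  by (rule LINT_cong) (auto simp: power2_norm_eq_inner inner_diff inner_commute algebra_simps)
  also have "... = (LINT x|leb_on K'. (zeta x)^2 * (norm (Gk k j x))^2) - (LINT x|leb_on K'. (zeta x)^2 * (norm (G j x))^2) - 2 * c k j"
  using i unfolding c_def by simp
  finally show ?thesis .
 qed
 then show ?thesis by (simp add: a_def A_def sum_subtractf sum_distrib_left)
 qed
 have tlim: "(%k. \<Sum>j\<in>UNIV. t k j) \<leadsto> 0"
 proof (rule LIMSEQ_I)
 fix eps :: real assume eps: "0 < eps"
 have e2: "0 < eps / 2" using eps by simp
 have cs: "(%k. 2 * (\<Sum>j\<in>UNIV. c k j)) \<leadsto> 2 * (\<Sum>j\<in>(UNIV::'m set). 0)" by (intro tendsto_mult tendsto_const tendsto_sum clim)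
 have ev1: "\<forall>\<^sub>F k in sequentially. - (eps / 2) < 2 * (\<Sum>j\<in>UNIV. c k j)" by (rule order_tendstoD(1)[OF cs]) (use eps in simp)
 have ev2: "\<forall>\<^sub>F k in sequentially. a k <= A + eps / 2" unfolding a_def A_def by (rule limsup_gradients[OF zeta(1-3,5,6,8) e2])
 from ev1 ev2 have "\<forall>\<^sub>F k in sequentially. norm ((\<Sum>j\<in>UNIV. t k j) - 0) < eps"
 proof eventually_elim
  case (elim k)
  have "0 <= (\<Sum>j\<in>UNIV. t k j)" by (intro sum_nonneg t0)
  then show ?case using elim unfolding eq by simp
 qed
 then show "\<exists>N. \<forall>k\<ge>N. norm ((\<Sum>j\<in>UNIV. t k j) - 0) < eps" by (simp add: eventually_sequentially)
 qed
 show ?thesis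
 proof (rule L2_tendsto_bound[OF _ tlim])
 fix k
 have i: "integrable leb (%x. indicator K' x *\<^sub>R ((zeta x)^2 * (norm (Gk k i x - G i x))^2))"
  using iw[OF L2D(2)[OF L2_diff[OF LGk[of k i] LG[of i]]]] unfolding lebesgue_on_integral(2)[OF K's, symmetric] set_integrable_def .
 have "(LINT x|leb_on K. (norm (Gk k i x - G i x))^2) <= t k i"
  unfolding t_def lebesgue_on_integral(1)[OF K's, symmetric] lebesgue_on_integral(1)[OF Ks, symmetric] set_lebesgue_integral_def
  by (rule integral_mono'[OF i]) (use zeta(4,7) in \<open>auto simp: indicator_def\<close>)
 also have "... <= (\<Sum>j\<in>UNIV. t k j)" by (rule member_le_sum) (auto simp: t0)
 finally show "(LINT x|leb_on K. (norm (Gk k i x - G i x))^2) <= (\<Sum>j\<in>UNIV. t k j)" .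
 qed
qed

theorem W12_tendsto_balls:
 assumes r: "cball x r <= Om"
 shows "W12_tendsto (ball x r) (%k y. uk k y $ i) (%y. u y $ i)"
 unfolding W12_tendsto_def
proof (intro conjI allI)
 show "W12 (ball x r) (%y. uk k y $ i)" for k by (rule loc_sobolev_imp_W12_ball(1)[OF Gk r])
 show "W12 (ball x r) (%y. u y $ i)" by (rule loc_sobolev_imp_W12_ball(1)[OF G r])
 let ?B = "ball x r" and ?C = "cball x r"
 have Bs: "?B : sets leb" by simp
 have Cs: "?C : sets leb" by (rule compact_sets_lebesgue[OF compact_cball])
 have mono: "(LINT y:?B|leb. (norm (f y))^2) <= (LINT y|leb_on ?C. (norm (f y))^2)" if "L2 (leb_on ?C) f" for f :: "'a => 'b::euclidean_space"
 proof -
 have "integrable leb (%y. indicator ?C y *\<^sub>R (norm (f y))^2)"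
  using L2D(2)[OF that] unfolding lebesgue_on_integral(2)[OF Cs, symmetric] set_integrable_def .
 then show ?thesis unfolding lebesgue_on_integral(1)[OF Cs, symmetric] set_lebesgue_integral_def
  by (rule integral_mono') (auto simp: indicator_def)
 qed
 have hw: "has_weak_gradient ?B (%y. uk k y $ i - u y $ i) (%y. Gk k i y - G i y)" for k
 by (rule has_weak_gradient_diff[OF loc_sobolev_imp_W12_ball(2)[OF Gk r] loc_sobolev_imp_W12_ball(2)[OF G r]])
 define e1 where "e1 k = (LINT y|leb_on ?C. (norm (uk k y $ i - u y $ i))^2)" for k
 define e2 where "e2 k = (LINT y|leb_on ?C. (norm (Gk k i y - G i y))^2)" for k
 have le: "norm (W12_norm ?B (%y. uk k y $ i - u y $ i)) <= sqrt (e1 k + e2 k)" for k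
 proof -
 have g: "(LINT y:?B|leb. (norm (weak_grad ?B (%y. uk k y $ i - u y $ i) y))^2) = (LINT y:?B|leb. (norm (Gk k i y - G i y))^2)"
 proof -
  note ae = weak_grad_eq_AE[OF open_ball hw[of k]]
  have LD: "L2 (leb_on ?B) (%y. Gk k i y - G i y)"
  by (rule L2_diff[OF loc_sobolev_imp_W12_ball(4)[OF Gk r] loc_sobolev_imp_W12_ball(4)[OF G r]])
  have LW: "L2 (leb_on ?B) (weak_grad ?B (%y. uk k y $ i - u y $ i))"
  by (rule L2_cong_AE_on[OF LD Bs]) (use ae in eventually_elim, simp)
  show ?thesis unfolding lebesgue_on_integral(1)[OF Bs]
  proof (rule integral_cong_AE)
  show "AE y in leb_on ?B. (norm (weak_grad ?B (%y. uk k y $ i - u y $ i) y))^2 = (norm (Gk k i y - G i y))^2"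
   unfolding AE_lebesgue_on_iff[OF Bs] using ae by eventually_elim simp
  qed (rule borel_measurable_integrable[OF L2D(2)[OF LW]], rule borel_measurable_integrable[OF L2D(2)[OF LD]])
 qed
 have "(LINT y:?B|leb. (norm (uk k y $ i - u y $ i))^2) <= e1 k"
  unfolding e1_def by (rule mono[OF L2_diff[OF loc_sobolevD(2)[OF Gk compact_cball r] loc_sobolevD(2)[OF G compact_cball r]]])
 moreover have "(LINT y:?B|leb. (norm (Gk k i y - G i y))^2) <= e2 k"
  unfolding e2_def by (rule mono[OF L2_diff[OF loc_sobolevD(3)[OF Gk compact_cball r] loc_sobolevD(3)[OF G compact_cball r]]])
 moreover have "0 <= (LINT y:?B|leb. (norm (uk k y $ i - u y $ i))^2)" "0 <= (LINT y:?B|leb. (norm (Gk k i y - G i y))^2)"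
  unfolding set_lebesgue_integral_def by (rule LINT_nonneg, simp)+
 ultimately show ?thesis unfolding W12_norm_def g by simp
 qed
 have "e1 \<leadsto> 0"
 using uk_L2_tendsto[OF compact_cball r, of i] unfolding L2_tendsto_def e1_def[abs_def] by blast
 moreover have "e2 \<leadsto> 0"
 using gradients_L2_tendsto[OF compact_cball r, of i] unfolding L2_tendsto_def e2_def[abs_def] by blast
 ultimately have "(%k. sqrt (e1 k + e2 k)) \<leadsto> sqrt (0 + 0)"
 by (intro tendsto_real_sqrt tendsto_add)
 then have "(%k. sqrt (e1 k + e2 k)) \<leadsto> 0" by simp
 then show "(%k. W12_norm ?B (%y. uk k y $ i - u y $ i)) \<leadsto> 0"
 by (rule Lim_null_comparison[OF always_eventually[OF allI[OF le]]])
qed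

end



section \<open>Convergence of the lower order terms\<close>

text \<open>A mollification of \<open>f\<close> at an interior point is the limit of averages of the \<open>fk k\<close>, hence bounded by
 \<open>C\<close>; the mollifications converge to \<open>f\<close> almost everywhere along a subsequence.\<close>

lemma weak_limit_bounded:
 fixes f :: "'a::euclidean_space => real"
 assumes S: "open S" and f: "locally_integrable S f"
 and fk: "!!k. fk k : borel_measurable (leb_on S)" "!!k. AE x in leb_on S. \<bar>fk k x\<bar> <= C"
 and lim: "!!phi. continuous_on UNIV phi ==> supp_compact_in S phi ==>
   (%k. LINT x:S|leb. fk k x * phi x) \<leadsto> (LINT x:S|leb. f x * phi x)"
 shows "AE x in leb. x : S --> \<bar>f x\<bar> <= C"
proof (rule AE_open_local)
 fix z assume "z : S"
 then obtain q where q: "0 < q" "cball z q <= S" using S open_contains_cball by blast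
 have Ss: "S : sets leb" using S by simp
 define rho where "rho = q / 2"
 have rho: "0 < rho" using q by (simp add: rho_def)
 define h where "h x = indicator (cball z q) x *\<^sub>R f x" for x
 have h: "integrable leb h"
 using locally_integrable_set_integrable[OF f compact_cball q(2)] by (simp add: set_integrable_def h_def[abs_def])
 have bd: "\<bar>mollify r h x\<bar> <= C" if r: "0 < r" "r <= rho" and x: "x : ball z rho" for r x
 proof -
 have cb: "cball x r <= cball z q"
 proof
  fix y assume "y : cball x r"
  then have "dist z y <= dist z x + dist x y" "dist x y <= r" by (auto intro: dist_triangle)
  then show "y : cball z q" using x r by (simp add: rho_def)
 qed
 have tf: "supp_compact_in S (%y. kernel r (x - y))"
  using test_function_kernel[OF r(1), of x S] cb q(2) by (simp add: test_function_def)
 have c: "continuous_on UNIV (%y. kernel r (x - y))"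
  by (intro continuous_on_compose2[OF kernel_continuous[of UNIV]] continuous_intros) auto
 have "norm (LINT y:S|leb. fk k y * kernel r (x - y)) <= C" for k
 proof -
  have ki: "integrable (leb_on S) (%y. kernel r (x - y))"
  unfolding lebesgue_on_integral(2)[OF Ss, symmetric] set_integrable_def
  by (rule integrable_mult_indicator[OF Ss kernel_shift_integral_lebesgue(1)[OF r(1)]])
  have "\<bar>LINT y|leb_on S. kernel r (x - y) * fk k y\<bar> <= C * (LINT y|leb_on S. \<bar>kernel r (x - y)\<bar>)"
  by (rule integrable_mult_bounded_AE(2)[OF ki fk])
  also have "(LINT y|leb_on S. \<bar>kernel r (x - y)\<bar>) = (LINT y|leb. kernel r (x - y))"
  unfolding lebesgue_on_integral(1)[OF Ss, symmetric] set_lebesgue_integral_def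
  proof (rule LINT_cong[OF refl])
  fix y
  have "y : S \<or> kernel r (x - y) = 0"
   using kernel_shift_eq_0[OF r(1), of y x] cb q(2) by (metis ball_subset_cball subset_eq)
  then show "indicator S y *\<^sub>R \<bar>kernel r (x - y)\<bar> = kernel r (x - y)"
   using kernel_nonneg[OF r(1), of "x - y"] by (auto simp: indicator_def)
  qed
  finally show ?thesis
  by (simp add: lebesgue_on_integral(1)[OF Ss] kernel_shift_integral_lebesgue(2)[OF r(1)] mult.commute)
 qed
 then have "norm (LINT y:S|leb. f y * kernel r (x - y)) <= C"
  by (intro LIMSEQ_le_const2[OF tendsto_norm[OF lim[OF c tf]]]) auto
 also have "(LINT y:S|leb. f y * kernel r (x - y)) = mollify r h x"
  unfolding mollify_def set_lebesgue_integral_def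
 proof (rule LINT_cong[OF refl])
  fix y
  show "indicator S y *\<^sub>R (f y * kernel r (x - y)) = kernel r (x - y) *\<^sub>R h y"
  proof (cases "y : ball x r")
  case True
  then have "y : cball z q" "y : S" using cb q(2) by (meson ball_subset_cball subsetD)+
  then show ?thesis by (simp add: h_def)
  next
  case False
  show ?thesis using kernel_shift_eq_0[OF r(1) False] by simp
  qed
 qed
 finally show ?thesis by simp
 qed
 define r where "r n = rho / real (Suc n)" for n
 have r: "0 < r n" "r n <= rho" for n using rho by (auto simp: r_def field_simps)
 have r0: "r \<leadsto> 0" unfolding r_def[abs_def] by (rule LIMSEQ_Suc[OF lim_const_over_n])
 have L1: "(%n. LINT x|leb. norm (mollify (r n) h x - h x)) \<leadsto> 0"
 by (rule mollify_tendsto_L1[OF h r(1) r0])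
 have "\<exists>s. strict_mono s & (AE x in leb. (%n. mollify (r (s n)) h x - h x) \<leadsto> 0)"
 by (rule tendsto_L1_AE_subseq[OF _ L1]) (intro intgb_diff mollify_L1_bound(1)[OF r(1) h] h)
 then obtain s where s: "AE x in leb. (%n. mollify (r (s n)) h x - h x) \<leadsto> 0" by blast
 have "AE y in leb. y : ball z rho --> \<bar>f y\<bar> <= C"
 using s
 proof eventually_elim
 case (elim y)
 show ?case
 proof
  assume y: "y : ball z rho"
  have "(%n. mollify (r (s n)) h y) \<leadsto> h y" using elim by (rule LIM_zero_cancel)
  from LIMSEQ_le_const2[OF tendsto_rabs[OF this]] have "\<bar>h y\<bar> <= C" using bd[OF r y] by blast
  then show "\<bar>f y\<bar> <= C" using y q by (auto simp: h_def rho_def)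
 qed
 qed
 then show "\<exists>e>0. AE y in leb. y : ball z e --> \<bar>f y\<bar> <= C" using rho by blast
qed

text \<open>Continuous functions with compact support are dense in \<open>L\<^sup>1\<close>, and the coefficients are uniformly
 bounded, so the weak convergence extends to integrable multipliers.\<close>

lemma weak_limit_L1:
 fixes f :: "'a::euclidean_space => real"
 assumes S: "open S" and f: "locally_integrable S f"
 and fk: "!!k. fk k : borel_measurable (leb_on S)" "!!k. AE x in leb_on S. \<bar>fk k x\<bar> <= C"
 and lim: "!!phi. continuous_on UNIV phi ==> supp_compact_in S phi ==>
   (%k. LINT x:S|leb. fk k x * phi x) \<leadsto> (LINT x:S|leb. f x * phi x)"
 and K: "compact K" "K <= S" and h: "integrable (leb_on K) h"
 shows "(%k. LINT x|leb_on K. h x * fk k x) \<leadsto> (LINT x|leb_on K. h x * f x)"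
proof (rule LIMSEQ_I)
 fix eps :: real assume eps: "0 < eps"
 have Ss: "S : sets leb" using S by simp
 note Ks = compact_sets_lebesgue[OF K(1)]
 have fb: "AE x in leb_on S. \<bar>f x\<bar> <= C"
 unfolding AE_lebesgue_on_iff[OF Ss] by (rule weak_limit_bounded[OF S f fk lim])
 have fm: "f : borel_measurable (leb_on S)"
 using locally_integrable_measurable[OF S f] borel_measurable_restrict_space_iff[of S leb f] Ss by simp
 define H where "H x = indicator K x *\<^sub>R h x" for x
 have H: "integrable leb H" using h unfolding lebesgue_on_integral(2)[OF Ks, symmetric] by (simp add: set_integrable_def H_def[abs_def])
 obtain r0 K' where K': "0 < r0" "compact K'" "K' <= S" "!!x. x : K ==> cball x r0 <= K'" "K' = (\<Union>x\<in>K. cball x r0)"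
 by (rule compact_neighbourhood[OF K S]) blast
 define r where "r n = r0 / real (Suc n)" for n
 have r: "0 < r n" "r n <= r0" for n using K'(1) by (auto simp: r_def field_simps)
 have r0: "r \<leadsto> 0" unfolding r_def[abs_def] by (rule LIMSEQ_Suc[OF lim_const_over_n])
 have L1: "(%n. LINT x|leb. norm (mollify (r n) H x - H x)) \<leadsto> 0"
 by (rule mollify_tendsto_L1[OF H r(1) r0])
 define c where "c = \<bar>C\<bar> + 1"
 have c: "0 < c" "C <= c" by (auto simp: c_def)
 obtain n where n: "(LINT x|leb. norm (mollify (r n) H x - H x)) < eps / (3 * c)"
 using eventually_happens[OF order_tendstoD(2)[OF L1, of "eps / (3 * c)"]] eps c by auto
 define phi where "phi = mollify (r n) H"
 have phii: "integrable leb phi" unfolding phi_def by (rule mollify_L1_bound(1)[OF r(1) H])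
 have phic: "continuous_on UNIV phi" using C_k_mollify[OF r(1) H, of 0] by (simp add: phi_def)
 have phi0: "phi x = 0" if "x \<notin> K'" for x
 unfolding phi_def
 proof (rule mollify_eq_0[OF r(1)])
 show "ball x (r n) <= - K"
 proof
  fix y assume y: "y : ball x (r n)"
  show "y : - K"
  proof
  assume "y : K"
  then have "x : K'" using K'(4)[of y] y r(2)[of n] by (auto simp: dist_commute)
  with that show False by blast
  qed
 qed
 qed (simp add: H_def)
 have phis: "supp_compact_in S phi"
 proof -
 have "closure {x. phi x ~= 0} <= K'" using phi0 by (intro closure_minimal compact_imp_closed K') auto
 then show ?thesis unfolding supp_compact_in_def using K'(2,3) compact_Int_closed[OF K'(2) closed_closure, of "{x. phi x ~= 0}"]
  by (auto simp: Int_absorb1)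
 qed
 have on: "integrable (leb_on S) p" if "integrable leb p" for p :: "'a => real"
 using integrable_mult_indicator[OF Ss that] unfolding lebesgue_on_integral(2)[OF Ss, symmetric] set_integrable_def .
 have eq: "(LINT x|leb_on K. h x * p x) = (LINT x|leb_on S. H x * p x)" for p
 unfolding lebesgue_on_integral(1)[OF Ks, symmetric] lebesgue_on_integral(1)[OF Ss, symmetric] set_lebesgue_integral_def
 using K(2) by (intro LINT_cong[OF refl]) (auto simp: H_def indicator_def)
 have close: "\<bar>(LINT x|leb_on S. H x * p x) - (LINT x|leb_on S. phi x * p x)\<bar> <= eps / 3"
 if p: "p : borel_measurable (leb_on S)" "AE x in leb_on S. \<bar>p x\<bar> <= C" for p
 proof -
 have pc: "AE x in leb_on S. \<bar>p x\<bar> <= c" using p(2) by eventually_elim (use c in simp)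
 note b = integrable_mult_bounded_AE[OF _ p(1) pc]
 have "(LINT x|leb_on S. H x * p x) - (LINT x|leb_on S. phi x * p x) = (LINT x|leb_on S. (H x - phi x) * p x)"
  using b(1)[OF on[OF H]] b(1)[OF on[OF phii]] by (simp add: left_diff_distrib)
 also have "\<bar>...\<bar> <= c * (LINT x|leb_on S. \<bar>H x - phi x\<bar>)"
  by (rule b(2)[OF on]) (use H phii in simp)
 also have "... <= c * (LINT x|leb. \<bar>H x - phi x\<bar>)"
 proof (rule mult_left_mono)
  show "(LINT x|leb_on S. \<bar>H x - phi x\<bar>) <= (LINT x|leb. \<bar>H x - phi x\<bar>)"
  unfolding lebesgue_on_integral(1)[OF Ss, symmetric] set_lebesgue_integral_def
  by (rule integral_mono') (use H phii in \<open>auto simp: indicator_def\<close>)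
 qed (use c in simp)
 also have "... <= c * (eps / (3 * c))"
  using n c by (intro mult_left_mono) (auto simp: phi_def abs_minus_commute)
 also have "... = eps / 3" using c by simp
 finally show ?thesis .
 qed
 have "(%k. LINT x|leb_on S. phi x * fk k x) \<leadsto> (LINT x|leb_on S. phi x * f x)"
 using lim[OF phic phis] by (simp add: lebesgue_on_integral(1)[OF Ss] mult.commute)
 from LIMSEQ_D[OF this, of "eps / 3"]
 obtain N where N: "!!k. k >= N ==> \<bar>(LINT x|leb_on S. phi x * fk k x) - (LINT x|leb_on S. phi x * f x)\<bar> < eps / 3"
 using eps by auto
 have "\<bar>(LINT x|leb_on K. h x * fk k x) - (LINT x|leb_on K. h x * f x)\<bar> < eps" if "k >= N" for k
 unfolding eq using close[OF fk, of k] close[OF fm fb] N[OF that] by linarith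
 then show "\<exists>N. \<forall>k\<ge>N. norm ((LINT x|leb_on K. h x * fk k x) - (LINT x|leb_on K. h x * f x)) < eps"
 by auto
qed

lemma dirichlet_tendsto:
 assumes "!!i. L2_tendsto (leb_on K) (%n. Hn n i) (H i)" "!!n i. L2 (leb_on K) (Hn n i)" "!!i. L2 (leb_on K) (H i)"
 shows "(%n. dirichlet K (Hn n)) \<leadsto> dirichlet K H"
 unfolding dirichlet_def by (intro tendsto_sum L2_tendsto_norm_square assms)

text \<open>Uniformly bounded coefficients make the lower order terms equicontinuous with respect to \<open>L\<^sup>2\<close>.\<close>

lemma lower_terms_diff_tendsto:
 fixes vn :: "nat => 'a::euclidean_space => real ^ 'm::finite"
 assumes K: "compact K"
 and c: "!!n i. fn n i : borel_measurable (leb_on K)" "!!n i. gn n i : borel_measurable (leb_on K)"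
  "!!n i. AE x in leb_on K. \<bar>fn n i x\<bar> <= C" "!!n i. AE x in leb_on K. \<bar>gn n i x\<bar> <= C"
 and v: "!!i. L2_tendsto (leb_on K) (%n x. vn n x $ i) (%x. v x $ i)"
  "!!n i. L2 (leb_on K) (%x. vn n x $ i)" "!!i. L2 (leb_on K) (%x. v x $ i)"
 shows "(%n. lower_terms K (fn n) (gn n) (vn n) - lower_terms K (fn n) (gn n) v) \<leadsto> 0"
proof -
 interpret finite_measure "leb_on K" by (rule finite_measure_compact[OF K])
 have a: "(%n. LINT x|leb_on K. \<bar>(vn n x $ i)^2 - (v x $ i)^2\<bar>) \<leadsto> 0" for i
 using L2_tendsto_square_L1[OF v(1)[of i] v(2)[of _ i] v(3)[of i]] by simp
 have b: "(%n. LINT x|leb_on K. \<bar>vn n x $ i - v x $ i\<bar>) \<leadsto> 0" for i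
 proof -
 define q where "q n = (LINT x|leb_on K. (norm (vn n x $ i - v x $ i))^2)" for n
 have q: "q \<leadsto> 0" using v(1)[of i] unfolding L2_tendsto_def q_def[abs_def] .
 define V where "V = measure (leb_on K) (space (leb_on K))"
 have V: "0 <= V" by (simp add: V_def)
 have le: "(LINT x|leb_on K. \<bar>vn n x $ i - v x $ i\<bar>) <= sqrt (q n) * V + sqrt (q n)" for n
 proof -
  have L: "L2 (leb_on K) (%x. vn n x $ i - v x $ i)" by (rule L2_diff[OF v(2,3)])
  have q0: "0 <= q n" unfolding q_def by (intro LINT_nonneg) simp
  show ?thesis
  proof (cases "q n = 0")
  case True
  have "AE x in leb_on K. (norm (vn n x $ i - v x $ i))^2 = 0"
   using True L2D(2)[OF L] by (subst integral_nonneg_eq_0_iff_AE[symmetric]) (auto simp: q_def)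
  then have "(LINT x|leb_on K. \<bar>vn n x $ i - v x $ i\<bar>) = (LINT x|leb_on K. 0)"
   using borel_measurable_integrable[OF L2_integrable[OF L]] by (intro integral_cong_AE) auto
  then show ?thesis using True by simp
  next
  case False
  define s where "s = sqrt (q n)"
  have s: "0 < s" "s^2 = q n" using q0 False by (auto simp: s_def)
  have "(LINT x|leb_on K. \<bar>vn n x $ i - v x $ i\<bar>) <= (LINT x|leb_on K. s + (1/s) * (norm (vn n x $ i - v x $ i))^2)"
  proof (rule integral_mono)
   show "integrable (leb_on K) (%x. \<bar>vn n x $ i - v x $ i\<bar>)" using L2_integrable[OF L] by (rule integrable_abs)
   show "integrable (leb_on K) (%x. s + (1/s) * (norm (vn n x $ i - v x $ i))^2)"
   by (intro intgb_add integrable_const integrable_mult_right L2D(2)[OF L])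
   fix x
   define t where "t = \<bar>vn n x $ i - v x $ i\<bar>"
   have "2 * (s * t) <= s * s + t^2" using zero_le_power2[of "s - t"] unfolding power2_diff power2_eq_square[of s, symmetric] by linarith
   moreover have "0 <= s * t" using s(1) by (simp add: t_def)
   ultimately have "s * t <= s * s + t^2" by linarith
   then have "t <= s + (1/s) * t^2" using s(1) by (simp add: field_simps)
   then show "\<bar>vn n x $ i - v x $ i\<bar> <= s + (1/s) * (norm (vn n x $ i - v x $ i))^2" by (simp add: t_def)
  qed
  also have "... = s * V + (1/s) * q n"
   unfolding q_def using L2D(2)[OF L] by (simp add: V_def mult.commute)
  also have "(1/s) * q n = s" using s by (simp add: power2_eq_square field_simps)
  finally show ?thesis by (simp add: s_def)
  qed
 qed
 have "(%n. sqrt (q n) * V + sqrt (q n)) \<leadsto> sqrt 0 * V + sqrt 0" by (intro tendsto_intros q)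
 then have lim: "(%n. sqrt (q n) * V + sqrt (q n)) \<leadsto> 0" by simp
 show ?thesis
 proof (rule tendsto_sandwich[OF _ _ tendsto_const lim])
  show "\<forall>\<^sub>F n in sequentially. 0 <= (LINT x|leb_on K. \<bar>vn n x $ i - v x $ i\<bar>)"
  by (intro always_eventually allI LINT_nonneg) simp
 qed (use le in simp)
 qed
 have "(%n. C * (\<Sum>i\<in>UNIV. (LINT x|leb_on K. \<bar>(vn n x $ i)^2 - (v x $ i)^2\<bar>) + (LINT x|leb_on K. \<bar>vn n x $ i - v x $ i\<bar>)))
  \<leadsto> C * (\<Sum>i\<in>(UNIV::'m set). 0 + 0)"
 by (intro tendsto_intros tendsto_sum a b)
 then have z: "(%n. C * (\<Sum>i\<in>UNIV. (LINT x|leb_on K. \<bar>(vn n x $ i)^2 - (v x $ i)^2\<bar>) + (LINT x|leb_on K. \<bar>vn n x $ i - v x $ i\<bar>))) \<leadsto> 0"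
 by simp
 show ?thesis
 by (rule Lim_null_comparison[OF _ z], rule always_eventually, rule allI)
  (unfold real_norm_def, rule lower_terms_diff_bound[OF K c v(2,3)])
qed

locale convergent_data = convergent_minimizers Om \<Omega>k fk gk Fk uk Gk Wk u G C0
 for Om :: "'a::euclidean_space set" and \<Omega>k
 and fk gk :: "nat => 'm::finite => 'a => real" and Fk uk Gk Wk u G C0 +
 fixes f g :: "'m => 'a => real"
 assumes coeff_integrable: "!!i. locally_integrable Om (f i)" "!!i. locally_integrable Om (g i)"
 and weak_limit:
  "!!i phi. continuous_on UNIV phi ==> supp_compact_in Om phi ==>
   (%k. LINT x:Om|leb. fk k i x * phi x) \<leadsto> (LINT x:Om|leb. f i x * phi x)"
  "!!i phi. continuous_on UNIV phi ==> supp_compact_in Om phi ==>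
   (%k. LINT x:Om|leb. gk k i x * phi x) \<leadsto> (LINT x:Om|leb. g i x * phi x)"
begin

lemma coeff_bound_on: "AE x in leb_on Om. \<bar>fk k i x\<bar> <= C0" "AE x in leb_on Om. \<bar>gk k i x\<bar> <= C0"
 unfolding AE_lebesgue_on_iff[OF Om_sets] by (rule coeff_bound)+

lemma limit_coeff_on:
 assumes K: "compact K" "K <= Om"
 shows "f i : borel_measurable (leb_on K)" "g i : borel_measurable (leb_on K)"
 "AE x in leb_on K. \<bar>f i x\<bar> <= C0" "AE x in leb_on K. \<bar>g i x\<bar> <= C0"
proof -
 note Ks = compact_sets_lebesgue[OF K(1)]
 have m: "p : borel_measurable (leb_on K)" if "locally_integrable Om p" for p :: "'a => real"
 using locally_integrable_set_integrable[OF that K] unfolding lebesgue_on_integral(2)[OF Ks] by (rule borel_measurable_integrable)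
 have b1: "AE x in leb. x : Om --> \<bar>f i x\<bar> <= C0"
 by (rule weak_limit_bounded[OF Om coeff_integrable(1) coeff_measurable(1) coeff_bound_on(1)]) (rule weak_limit(1))
 have b2: "AE x in leb. x : Om --> \<bar>g i x\<bar> <= C0"
 by (rule weak_limit_bounded[OF Om coeff_integrable(2) coeff_measurable(2) coeff_bound_on(2)]) (rule weak_limit(2))
 show "f i : borel_measurable (leb_on K)" "g i : borel_measurable (leb_on K)" by (intro m coeff_integrable)+
 show "AE x in leb_on K. \<bar>f i x\<bar> <= C0" unfolding AE_lebesgue_on_iff[OF Ks]
 using b1 by eventually_elim (use K in auto)
 show "AE x in leb_on K. \<bar>g i x\<bar> <= C0" unfolding AE_lebesgue_on_iff[OF Ks]
 using b2 by eventually_elim (use K in auto)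
qed

lemma lower_terms_fixed_tendsto:
 assumes K: "compact K" "K <= Om" and v: "!!i. L2 (leb_on K) (%x. v x $ i)"
 shows "(%k. lower_terms K (fk k) (gk k) v) \<leadsto> lower_terms K f g v"
proof -
 interpret finite_measure "leb_on K" by (rule finite_measure_compact[OF K(1)])
 have i2: "integrable (leb_on K) (%x. (v x $ i)^2)" for i using L2D(2)[OF v[of i]] by auto
 have i1: "integrable (leb_on K) (%x. v x $ i)" for i by (rule L2_integrable[OF v])
 have split: "lower_terms K p q v = (\<Sum>i\<in>UNIV. (LINT x|leb_on K. (v x $ i)^2 * p i x) - (LINT x|leb_on K. v x $ i * q i x))"
 if "!!i. p i : borel_measurable (leb_on K)" "!!i. q i : borel_measurable (leb_on K)"
  "!!i. AE x in leb_on K. \<bar>p i x\<bar> <= C0" "!!i. AE x in leb_on K. \<bar>q i x\<bar> <= C0" for p q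
 unfolding lower_terms_def
 by (intro sum.cong[OF refl] LINT_diff integrable_mult_bounded_AE(1)[OF i2 that(1,3)] integrable_mult_bounded_AE(1)[OF i1 that(2,4)])
 have l1: "(%k. LINT x|leb_on K. (v x $ i)^2 * fk k i x) \<leadsto> (LINT x|leb_on K. (v x $ i)^2 * f i x)" for i
 by (rule weak_limit_L1[OF Om coeff_integrable(1) coeff_measurable(1) coeff_bound_on(1) _ K i2]) (rule weak_limit(1))
 have l2: "(%k. LINT x|leb_on K. v x $ i * gk k i x) \<leadsto> (LINT x|leb_on K. v x $ i * g i x)" for i
 by (rule weak_limit_L1[OF Om coeff_integrable(2) coeff_measurable(2) coeff_bound_on(2) _ K i1]) (rule weak_limit(2))
 show ?thesis
 unfolding split[OF coeff_on[OF K]] split[OF limit_coeff_on[OF K]]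
 by (intro tendsto_sum tendsto_diff l1 l2)
qed

text \<open>Strong convergence of the functions is combined with weak convergence of the coefficients; the second
 statement is the case of constant coefficients.\<close>

lemma lower_terms_tendsto:
 assumes K: "compact K" "K <= Om"
 and v: "!!i. L2_tendsto (leb_on K) (%n x. vn n x $ i) (%x. v x $ i)"
  "!!n i. L2 (leb_on K) (%x. vn n x $ i)" "!!i. L2 (leb_on K) (%x. v x $ i)"
 shows "(%k. lower_terms K (fk k) (gk k) (vn k)) \<leadsto> lower_terms K f g v"
 "(%k. lower_terms K f g (vn k)) \<leadsto> lower_terms K f g v"
proof -
 show "(%k. lower_terms K (fk k) (gk k) (vn k)) \<leadsto> lower_terms K f g v"
 proof -
 have "(%k. lower_terms K (fk k) (gk k) (vn k) - lower_terms K (fk k) (gk k) v) \<leadsto> 0"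
  by (rule lower_terms_diff_tendsto[OF K(1) coeff_on[OF K] v])
 from tendsto_add[OF this lower_terms_fixed_tendsto[OF K v(3)]] show ?thesis by simp
 qed
 show "(%k. lower_terms K f g (vn k)) \<leadsto> lower_terms K f g v"
 by (rule LIM_zero_cancel) (rule lower_terms_diff_tendsto[OF K(1) limit_coeff_on[OF K] v])
qed

end



section \<open>Limit partitions with prescribed volumes\<close>

lemma bounded_rows_convergent_subsequence:
 fixes a :: "nat => nat => 'b::heine_borel"
 assumes "!!n. bounded (range (a n))"
 shows "\<exists>s l. strict_mono (s :: nat => nat) & (\<forall>n. (%k. a n (s k)) \<leadsto> l n)"
proof -
 interpret subseqs "%n s. convergent (%k. a n (s k))"
 proof
 fix n :: nat and s :: "nat => nat" assume "strict_mono s"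
 have "bounded (range (%k. a n (s k)))" by (rule bounded_subset[OF assms[of n]]) auto
 from bounded_imp_convergent_subsequence[OF this] obtain l r where "strict_mono (r :: nat => nat)" "((%k. a n (s k)) \<circ> r) \<leadsto> l"
  by blast
 then show "\<exists>r. strict_mono r & convergent (%k. a n ((s \<circ> r) k))" by (auto simp: o_def convergent_def)
 qed
 have "convergent (%k. a n (diagseq k))" for n
 proof -
 have "convergent (%k. a n ((diagseq \<circ> (+) (Suc n)) k))"
 proof (rule diagseq_holds)
  fix m and r s :: "nat => nat" assume r: "strict_mono r" and "convergent (%k. a m (s k))"
  then obtain l where "(%k. a m (s k)) \<leadsto> l" by (auto simp: convergent_def)
  then show "convergent (%k. a m ((s \<circ> r) k))"
  using LIMSEQ_subseq_LIMSEQ[OF _ r, of "%k. a m (s k)" l] by (auto simp: o_def convergent_def)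
 qed
 moreover have "(%k. a n ((diagseq \<circ> (+) (Suc n)) k)) = (%k. a n (diagseq (k + Suc n)))"
  by (simp add: add.commute)
 ultimately have "convergent (%k. a n (diagseq (k + Suc n)))" by (simp only:)
 then show ?thesis using convergent_ignore_initial_segment[of "%k. a n (diagseq k)" "Suc n"] by blast
 qed
 then have "\<forall>n. \<exists>l. (%k. a n (diagseq k)) \<leadsto> l" unfolding convergent_def by blast
 then obtain l where "!!n. (%k. a n (diagseq k)) \<leadsto> l n" using choice[of "%n l. (%k. a n (diagseq k)) \<leadsto> l"] by blast
 then show ?thesis using subseq_diagseq by blast
qed

text \<open>The measure of \<open>A \<inter> cball 0 t\<close> is continuous in \<open>t\<close>, since it varies less than the volume of the ball, so
 the intermediate value theorem applies.\<close>

lemma lebesgue_intermediate_measure: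
 fixes A :: "'a::euclidean_space set"
 assumes A: "A : lmeasurable" and v: "0 <= v" "v <= measure leb A"
 shows "\<exists>B\<in>sets leb. B <= A & measure leb B = v"
proof (cases "v = measure leb A")
 case True
 then show ?thesis using A by (auto intro: fmeasurableD)
next
 case False
 define phi where "phi t = measure leb (A \<inter> cball 0 t)" for t
 define V where "V = unit_ball_vol (real DIM('a))"
 have fm: "A \<inter> cball 0 t : lmeasurable" for t using A by (intro fmeasurable_Int_fmeasurable) auto
 have cb: "measure leb (cball (0::'a) t) = V * t ^ DIM('a)" if "0 <= t" for t
 using content_cball[OF that, of "0::'a"] by (simp add: V_def)
 have step: "\<bar>phi t - phi s\<bar> <= \<bar>V * t ^ DIM('a) - V * s ^ DIM('a)\<bar>" if st: "0 <= s" "s <= t" for s t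
 proof -
 have sub: "A \<inter> cball 0 s <= A \<inter> cball 0 t" "cball (0::'a) s <= cball 0 t" using st by auto
 have d1: "measure leb ((A \<inter> cball 0 t) - (A \<inter> cball 0 s)) = phi t - phi s"
  unfolding phi_def by (rule measurable_measure_Diff) (use fm sub in \<open>auto intro: fmeasurableD\<close>)
 have d2: "measure leb (cball (0::'a) t - cball 0 s) = V * t ^ DIM('a) - V * s ^ DIM('a)"
 proof -
  have "measure leb (cball (0::'a) t - cball 0 s) = measure leb (cball (0::'a) t) - measure leb (cball (0::'a) s)"
  by (rule measurable_measure_Diff) (use sub in auto)
  then show ?thesis using cb[of s] cb[of t] st by linarith
 qed
 have "measure leb ((A \<inter> cball 0 t) - (A \<inter> cball 0 s)) <= measure leb (cball (0::'a) t - cball 0 s)"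
  by (rule measure_mono_fmeasurable) (use fm in \<open>auto intro: fmeasurableD fmeasurable.Diff\<close>)
 then show ?thesis using d1 d2 measure_nonneg[of leb "(A \<inter> cball 0 t) - (A \<inter> cball 0 s)"] by linarith
 qed
 have step': "\<bar>phi t - phi s\<bar> <= \<bar>V * t ^ DIM('a) - V * s ^ DIM('a)\<bar>" if "0 <= s" "0 <= t" for s t
 using step[of s t] step[of t s] that by (cases "s <= t") (auto simp: abs_minus_commute)
 have cont: "continuous_on {0..T} phi" for T
 unfolding continuous_on_iff dist_real_def
 proof (intro ballI allI impI)
 fix s and e :: real assume s: "s : {0..T}" and e: "0 < e"
 have "continuous_on {0..T} (%t. V * t ^ DIM('a))" by (intro continuous_intros)
 then obtain d where d: "0 < d" "!!t. t : {0..T} ==> \<bar>t - s\<bar> < d ==> \<bar>V * t ^ DIM('a) - V * s ^ DIM('a)\<bar> < e"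
  unfolding continuous_on_iff dist_real_def using s e by meson
 show "\<exists>d>0. \<forall>t\<in>{0..T}. \<bar>t - s\<bar> < d --> \<bar>phi t - phi s\<bar> < e"
  using d step'[of s] s by (intro exI[of _ d]) force
 qed
 have lim: "(%n. phi (real n)) \<leadsto> measure leb (\<Union>n. A \<inter> cball 0 (real n))"
 unfolding phi_def
 proof (rule Lim_measure_incseq)
 show "range (%n. A \<inter> cball 0 (real n)) <= sets leb" using fm by (auto intro: fmeasurableD)
 show "incseq (%n. A \<inter> cball 0 (real n))" by (auto simp: incseq_def)
 have "(\<Union>n. A \<inter> cball 0 (real n)) <= A" by auto
 then have "emeasure leb (\<Union>n. A \<inter> cball 0 (real n)) <= emeasure leb A" using A by (intro emeasure_mono) auto
 then show "emeasure leb (\<Union>n. A \<inter> cball 0 (real n)) ~= \<infinity>" using A by (auto simp: fmeasurable_def top_unique less_top[symmetric])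
 qed
 have "(\<Union>n. A \<inter> cball 0 (real n)) = A" by (auto simp: real_arch_simple)
 with lim have "(%n. phi (real n)) \<leadsto> measure leb A" by simp
 moreover have "v < measure leb A" using v(2) False by simp
 ultimately have "\<forall>\<^sub>F n in sequentially. v < phi (real n)" by (rule order_tendstoD(1))
 from eventually_happens[OF this] obtain n where n: "v < phi (real n)" by auto
 have "phi 0 = 0"
 proof -
 have "phi 0 <= measure leb (cball (0::'a) 0)" unfolding phi_def
  by (rule measure_mono_fmeasurable[OF Int_lower2 fmeasurableD[OF fm] lmeasurable_cball])
 then have "phi 0 <= 0" using cb[of 0] by simp
 moreover have "0 <= phi 0" unfolding phi_def by (rule measure_nonneg)
 ultimately show ?thesis by linarith
 qed
 then obtain t where "phi t = v" using IVT'[of phi 0 v "real n"] n v(1) cont[of "real n"] by auto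
 then show ?thesis using fm[of t] by (intro bexI[of _ "A \<inter> cball 0 t"]) (auto simp: phi_def intro: fmeasurableD)
qed

text \<open>The limit sets are found by measure theory alone, from the Darboux property of a measure without atoms.\<close>

locale nonatomic_finite_measure = finite_measure +
 assumes intermediate_measure: "!!A v. A : sets M ==> 0 <= v ==> v <= measure M A ==> \<exists>B\<in>sets M. B <= A & measure M B = v"
begin

text \<open>The sets are enlarged one after another: as the prescribed volumes add up to at most the volume of \<open>D\<close>,
 enough room is left outside the given sets.\<close>

lemma disjoint_enlargements:
 assumes "finite I" "D : sets M" "!!i. i : I ==> P i : sets M" "!!i. i : I ==> P i <= D" "disjoint_family_on P I"
 "!!i. i : I ==> measure M (P i) <= l i" "(\<Sum>i\<in>I. l i) <= measure M D"
 shows "\<exists>W. (\<forall>i\<in>I. W i : sets M & P i <= W i & W i <= D & measure M (W i) = l i) & disjoint_family_on W I"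
 using assms
proof (induction I arbitrary: D rule: finite_induct)
 case empty
 then show ?case by (auto simp: disjoint_family_on_def)
next
 case (insert a I)
 define U where "U = (\<Union>i\<in>insert a I. P i)"
 have U: "U : sets M" "U <= D" using insert.hyps insert.prems by (auto simp: U_def)
 have mU: "measure M U = measure M (P a) + (\<Sum>i\<in>I. measure M (P i))"
 proof -
 have "measure M U = (\<Sum>i\<in>insert a I. measure M (P i))"
  unfolding U_def by (rule finite_measure_finite_Union) (use insert.hyps insert.prems in auto)
 then show ?thesis using insert.hyps by simp
 qed
 have "(\<Sum>i\<in>I. measure M (P i)) <= (\<Sum>i\<in>I. l i)" using insert.hyps insert.prems by (intro sum_mono) auto
 then have le: "l a - measure M (P a) <= measure M (D - U)"
 using insert.hyps insert.prems mU U by (simp add: finite_measure_Diff)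
 have ge: "0 <= l a - measure M (P a)" using insert.prems by simp
 have "D - U : sets M" using insert.prems(1) U by auto
 from intermediate_measure[OF this ge le]
 obtain B where B: "B : sets M" "B <= D - U" "measure M B = l a - measure M (P a)" by blast
 define Wa where "Wa = P a \<union> B"
 have Pa: "P a : sets M" "P a <= U" using insert.hyps insert.prems by (auto simp: U_def)
 have Wa: "Wa : sets M" "P a <= Wa" "Wa <= D" "measure M Wa = l a"
 proof -
 show "measure M Wa = l a" unfolding Wa_def using B Pa by (subst finite_measure_Union) auto
 qed (use B Pa U in \<open>auto simp: Wa_def\<close>)
 have "\<exists>W. (\<forall>i\<in>I. W i : sets M & P i <= W i & W i <= D - Wa & measure M (W i) = l i) & disjoint_family_on W I"
 proof (rule insert.IH)
 show "D - Wa : sets M" using insert.hyps insert.prems Wa by auto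
 show "P i <= D - Wa" if "i : I" for i
 proof -
  have "P i \<inter> P a = {}" using insert.prems(4) insert.hyps(2) that by (auto simp: disjoint_family_on_def)
  moreover have "P i <= U" "P i <= D" using that insert.hyps insert.prems by (auto simp: U_def)
  ultimately show ?thesis using B(2) by (auto simp: Wa_def)
 qed
 show "disjoint_family_on P I" using insert.prems(4) by (rule disjoint_family_on_mono[rotated]) auto
 show "(\<Sum>i\<in>I. l i) <= measure M (D - Wa)" using insert.hyps insert.prems Wa by (simp add: finite_measure_Diff)
 qed (use insert.hyps insert.prems in auto)
 then obtain W where W: "!!i. i : I ==> W i : sets M & P i <= W i & W i <= D - Wa & measure M (W i) = l i" "disjoint_family_on W I"
 by blast
 have "disjoint_family_on (W(a := Wa)) (insert a I)"
 unfolding disjoint_family_on_def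
 proof (intro ballI impI)
 fix m n assume mn: "m : insert a I" "n : insert a I" "m ~= n"
 show "(W(a := Wa)) m \<inter> (W(a := Wa)) n = {}"
 proof (cases "m = a \<or> n = a")
  case True
  then show ?thesis using mn W(1)[of m] W(1)[of n] by auto
 next
  case False
  then show ?thesis using mn W(2) by (auto simp: disjoint_family_on_def)
 qed
 qed
 moreover have "(W(a := Wa)) i : sets M & P i <= (W(a := Wa)) i & (W(a := Wa)) i <= D & measure M ((W(a := Wa)) i) = l i"
 if "i : insert a I" for i
 proof (cases "i = a")
 case True then show ?thesis using Wa by simp
 next
 case False
 then show ?thesis using W(1)[of i] that by auto
 qed
 ultimately show ?case by blast
qed

text \<open>The indicators of the sets \<open>Wk k i\<close> need not converge, but along a subsequence their volumes in each
 shell of the exhaustion \<open>C\<close> do. By Fatou's lemma the set \<open>P i\<close>, whose points lie in almost all \<open>Wk k i\<close>,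
 has at most the limit volume in each shell, and it can be enlarged within \<open>\<Omega>\<close> to have exactly that volume.
 Prescribing the volumes shell by shell, not just in total, is what later allows a competitor to agree with
 \<open>Wk k\<close> outside \<open>C j\<close> and still have convergent volumes. The finite total measure controls the
 tails.\<close>

lemma limit_partition:
 fixes Wk :: "nat => 'm::finite => 'a set"
 assumes C: "!!j. C j : sets M" "incseq C" "(\<Union>j. C j) = space M"
 and \<Omega>: "\<Omega> : sets M" "!!k. \<Omega>k k : sets M" "(%k. measure M (\<Omega>k k - \<Omega>)) \<leadsto> 0"
 and Wk: "!!k i. Wk k i : sets M" "!!k i. Wk k i <= \<Omega>k k" "!!k. disjoint_family (Wk k)"
 and P: "!!i. P i : sets M" "!!i x. x : P i ==> \<forall>\<^sub>F k in sequentially. x : Wk k i"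
 shows "\<exists>s W. strict_mono (s :: nat => nat) & (\<forall>i. W i : sets M & W i <= \<Omega>) & disjoint_family W &
 (\<forall>i. measure M (P i - W i) = 0) &
 (\<forall>i j. (%k. measure M (Wk (s k) i \<inter> C j)) \<leadsto> measure M (W i \<inter> C j)) &
 (\<forall>i. (%k. measure M (Wk (s k) i)) \<leadsto> measure M (W i))"
proof -
 define S where "S = disjointed C"
 have S: "S j : sets M" for j unfolding S_def using sets.range_disjointed_sets[of C M] C(1) by auto
 have Sd: "disjoint_family S" unfolding S_def by (rule disjoint_family_disjointed)
 have CS: "C j = (\<Union>n\<le>j. S n)" for j
 proof -
 have "C j = (\<Union>n\<le>j. C n)" using C(2) by (auto simp: incseq_def)
 also have "... = (\<Union>n<Suc j. C n)" by (simp add: lessThan_Suc_atMost)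
 also have "... = (\<Union>n<Suc j. S n)" unfolding S_def using finite_UN_disjointed_eq[of C "Suc j"] by (simp add: atLeast0LessThan)
 finally show ?thesis by (simp add: lessThan_Suc_atMost)
 qed
 have SU: "(\<Union>n. S n) = space M" unfolding S_def UN_disjointed_eq using C(3) .
 define a where "a j k = (\<chi> i. measure M (Wk k i \<inter> S j))" for j k
 have "bounded (range (a j))" for j
 proof (rule bounded_subset[OF bounded_cbox])
 show "range (a j) <= cbox 0 (\<chi> i. measure M (space M))"
  by (auto simp: mem_box_cart a_def intro: bounded_measure)
 qed
 from bounded_rows_convergent_subsequence[of a, OF this]
 obtain s l where s: "strict_mono (s :: nat => nat)" and l: "!!j. (%k. a j (s k)) \<leadsto> l j" by blast
 have lim: "(%k. measure M (Wk (s k) i \<inter> S j)) \<leadsto> l j $ i" for i j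
 using tendsto_vec_nth[OF l[of j], of i] by (simp add: a_def)
 have delta: "(%k. measure M (\<Omega>k (s k) - \<Omega>)) \<leadsto> 0"
 using LIMSEQ_subseq_LIMSEQ[OF \<Omega>(3) s] by (simp add: o_def)
 \<comment> \<open>A set whose points lie in almost all \<open>Wk k i\<close> has measure at most the limit of their measures.\<close>
 have fatou: "measure M Q <= c"
 if Q: "Q : sets M" "!!x. x : Q ==> \<forall>\<^sub>F k in sequentially. x : T k" "!!k. T k : sets M" and c: "(%k. measure M (T (s k))) \<leadsto> c" for Q T c
 proof -
 define E where "E m = Q \<inter> (\<Inter>k\<in>{m..}. T k)" for m
 have E: "E m : sets M" for m unfolding E_def using Q by (intro sets.Int sets.countable_INT') auto
 have "incseq E" by (auto simp: incseq_def E_def)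
 moreover have "(\<Union>m. E m) = Q"
 proof
  show "Q <= (\<Union>m. E m)"
  proof
  fix x assume x: "x : Q"
  obtain N where "!!k. N <= k ==> x : T k" using Q(2)[OF x] unfolding eventually_sequentially by blast
  then have "x : E N" using x by (auto simp: E_def)
  then show "x : (\<Union>m. E m)" by blast
  qed
 qed (auto simp: E_def)
 ultimately have lim: "(%m. measure M (E m)) \<leadsto> measure M Q" using finite_Lim_measure_incseq[of E] E by (auto simp: image_subset_iff)
 have "measure M (E m) <= c" for m
 proof (rule LIMSEQ_le_const[OF c], intro exI allI impI)
  fix k assume "m <= k"
  then have "m <= s k" using seq_suble[OF s, of k] by linarith
  then show "measure M (E m) <= measure M (T (s k))" using Q by (intro finite_measure_mono) (auto simp: E_def)
 qed
 then show ?thesis by (intro LIMSEQ_le_const2[OF lim]) auto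
 qed
 have P\<Omega>: "measure M (P i - \<Omega>) = 0" for i
 proof -
 have "measure M (P i - \<Omega>) <= 0"
 proof (rule fatou[OF _ _ _ delta])
  show "\<forall>\<^sub>F k in sequentially. x : \<Omega>k k - \<Omega>" if "x : P i - \<Omega>" for x
  using P(2)[of x i] that by (auto elim!: eventually_mono dest: subsetD[OF Wk(2)])
 qed (use P \<Omega> in auto)
 then show ?thesis using measure_nonneg[of M "P i - \<Omega>"] by linarith
 qed
 have Pdis: "P i \<inter> P j = {}" if "i ~= j" for i j
 proof (rule ccontr)
 assume "P i \<inter> P j ~= {}"
 then obtain x where x: "x : P i" "x : P j" by blast
 have "\<forall>\<^sub>F k in sequentially. x : Wk k i \<inter> Wk k j" using P(2)[OF x(1)] P(2)[OF x(2)] by eventually_elim simp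
 moreover have "Wk k i \<inter> Wk k j = {}" for k using Wk(3)[of k] that by (auto simp: disjoint_family_on_def)
 ultimately show False by simp
 qed
 have ex: "\<exists>W. (\<forall>i\<in>(UNIV::'m set). W i : sets M & P i \<inter> \<Omega> \<inter> S j <= W i & W i <= \<Omega> \<inter> S j & measure M (W i) = l j $ i) & disjoint_family_on W UNIV" for j
 proof (rule disjoint_enlargements)
 show "measure M (P i \<inter> \<Omega> \<inter> S j) <= l j $ i" for i
 proof (rule fatou[OF _ _ _ lim])
  show "\<forall>\<^sub>F k in sequentially. x : Wk k i \<inter> S j" if "x : P i \<inter> \<Omega> \<inter> S j" for x
  using P(2)[of x i] that by (auto elim!: eventually_mono)
 qed (use P \<Omega> S Wk in auto)
 show "disjoint_family_on (%i. P i \<inter> \<Omega> \<inter> S j) UNIV" using Pdis by (auto simp: disjoint_family_on_def)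
 have "(%k. \<Sum>i\<in>(UNIV::'m set). measure M (Wk (s k) i \<inter> S j)) \<leadsto> (\<Sum>i\<in>UNIV. l j $ i)" by (intro tendsto_sum lim)
 moreover have "(%k. measure M (\<Omega> \<inter> S j) + measure M (\<Omega>k (s k) - \<Omega>)) \<leadsto> measure M (\<Omega> \<inter> S j) + 0" by (intro tendsto_intros delta)
 moreover have "(\<Sum>i\<in>(UNIV::'m set). measure M (Wk k i \<inter> S j)) <= measure M (\<Omega> \<inter> S j) + measure M (\<Omega>k k - \<Omega>)" for k
 proof -
  have "(\<Sum>i\<in>(UNIV::'m set). measure M (Wk k i \<inter> S j)) = measure M (\<Union>i. Wk k i \<inter> S j)"
  proof (rule finite_measure_finite_Union[symmetric])
  show "disjoint_family_on (%i. Wk k i \<inter> S j) UNIV" using Wk(3)[of k] by (auto simp: disjoint_family_on_def)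
  qed (use Wk S in auto)
  also have "... <= measure M ((\<Omega> \<inter> S j) \<union> (\<Omega>k k - \<Omega>))"
  using Wk(2)[of k] \<Omega> S by (intro finite_measure_mono) auto
  also have "... <= measure M (\<Omega> \<inter> S j) + measure M (\<Omega>k k - \<Omega>)" using \<Omega> S by (intro measure_Un_le) auto
  finally show ?thesis .
 qed
 ultimately show "(\<Sum>i\<in>UNIV. l j $ i) <= measure M (\<Omega> \<inter> S j)" by (intro LIMSEQ_le) auto
 qed (use \<Omega> S P in auto)
 have "\<exists>V. \<forall>j i. V j i : sets M & P i \<inter> \<Omega> \<inter> S j <= V j i & V j i <= \<Omega> \<inter> S j & measure M (V j i) = l j $ i & (\<forall>i'. i ~= i' --> V j i \<inter> V j i' = {})"
 using ex unfolding disjoint_family_on_def by (intro choice allI) (metis UNIV_I)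
 then obtain V where V: "!!j i. V j i : sets M" "!!j i. P i \<inter> \<Omega> \<inter> S j <= V j i" "!!j i. V j i <= \<Omega> \<inter> S j"
  "!!j i. measure M (V j i) = l j $ i" "!!j i i'. i ~= i' ==> V j i \<inter> V j i' = {}" by metis
 define W where "W i = (\<Union>j. V j i)" for i
 have WS: "W i \<inter> S j = V j i" for i j
 proof
 show "W i \<inter> S j <= V j i"
 proof
  fix x assume "x : W i \<inter> S j"
  then obtain n where n: "x : V n i" "x : S j" by (auto simp: W_def)
  have "n = j"
  proof (rule ccontr)
  assume "n ~= j"
  then have "S n \<inter> S j = {}" using Sd by (simp add: disjoint_family_on_def)
  then show False using n V(3)[of n i] by blast
  qed
  then show "x : V j i" using n by simp
 qed
 show "V j i <= W i \<inter> S j" using V(3)[of j i] by (auto simp: W_def)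
 qed
 have W: "W i : sets M" "W i <= \<Omega>" for i
 proof -
 show "W i : sets M" unfolding W_def using V(1) by auto
 show "W i <= \<Omega>" unfolding W_def by (rule UN_least) (use V(3) in blast)
 qed
 have Wd: "disjoint_family W"
 unfolding disjoint_family_on_def
 proof (intro ballI impI)
 fix m n :: 'm assume "m ~= n"
 show "W m \<inter> W n = {}"
 proof (rule ccontr)
  assume "W m \<inter> W n ~= {}"
  then obtain x where x: "x : W m" "x : W n" by blast
  then obtain j where "x : V j m" by (auto simp: W_def)
  then have "x : S j" using V(3) by blast
  then have "x : V j m" "x : V j n" using x WS by blast+
  then show False using V(5)[OF \<open>m ~= n\<close>] by blast
 qed
 qed
 have PW: "measure M (P i - W i) = 0" for i
 proof -
 have "P i - W i <= P i - \<Omega>"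
 proof
  fix x assume x: "x : P i - W i"
  then have "x : (\<Union>n. S n)" unfolding SU using sets.sets_into_space[OF P(1)[of i]] by blast
  then obtain j where "x : S j" by blast
  then show "x : P i - \<Omega>" using x V(2)[of i j] by (auto simp: W_def)
 qed
 then have "measure M (P i - W i) <= measure M (P i - \<Omega>)" using P \<Omega> by (intro finite_measure_mono) auto
 then show ?thesis using P\<Omega>[of i] measure_nonneg[of M "P i - W i"] by linarith
 qed
 have sumC: "measure M (A \<inter> C j) = (\<Sum>n\<le>j. measure M (A \<inter> S n))" if "A : sets M" for A j
 proof -
 have "A \<inter> C j = (\<Union>n\<le>j. A \<inter> S n)" unfolding CS by auto
 moreover have "measure M (\<Union>n\<le>j. A \<inter> S n) = (\<Sum>n\<le>j. measure M (A \<inter> S n))"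
 proof (rule finite_measure_finite_Union)
  show "disjoint_family_on (%n. A \<inter> S n) {..j}" using Sd by (auto simp: disjoint_family_on_def)
 qed (use that S in auto)
 ultimately show ?thesis by simp
 qed
 have CL: "(%k. measure M (Wk (s k) i \<inter> C j)) \<leadsto> measure M (W i \<inter> C j)" for i j
 unfolding sumC[OF Wk(1)] sumC[OF W(1)] WS V(4) by (intro tendsto_sum lim)
 have TL: "(%k. measure M (Wk (s k) i)) \<leadsto> measure M (W i)" for i
 proof (rule LIMSEQ_I)
 fix e :: real assume e: "0 < e"
 have "(%j. measure M (C j)) \<leadsto> measure M (space M)"
  using finite_Lim_measure_incseq[of C] C by (auto simp: image_subset_iff)
 from LIMSEQ_D[OF this, of "e/3"] obtain j where j: "\<bar>measure M (C j) - measure M (space M)\<bar> < e/3"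
  using e by auto
 have tail: "\<bar>measure M A - measure M (A \<inter> C j)\<bar> < e/3" if A: "A : sets M" for A
 proof -
  have "measure M A - measure M (A \<inter> C j) = measure M (A - A \<inter> C j)" using A C by (subst finite_measure_Diff) auto
  also have "... <= measure M (space M - C j)" using A C sets.sets_into_space[OF A] by (intro finite_measure_mono) auto
  also have "... = measure M (space M) - measure M (C j)" using C(1)[of j] sets.sets_into_space[OF C(1)] by (intro finite_measure_Diff) auto
  finally have "measure M A - measure M (A \<inter> C j) < e/3" using j by linarith
  moreover have "measure M (A \<inter> C j) <= measure M A" using A by (intro finite_measure_mono) auto
  ultimately show ?thesis by linarith
 qed
 obtain N where N: "!!k. k >= N ==> \<bar>measure M (Wk (s k) i \<inter> C j) - measure M (W i \<inter> C j)\<bar> < e/3"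
  using LIMSEQ_D[OF CL[of i j], of "e/3"] e by auto
 have "\<bar>measure M (Wk (s k) i) - measure M (W i)\<bar> < e" if "k >= N" for k
  using N[OF that] tail[OF Wk(1)[of "s k" i]] tail[OF W(1)[of i]] by linarith
 then show "\<exists>N. \<forall>k\<ge>N. norm (measure M (Wk (s k) i) - measure M (W i)) < e" by auto
 qed
 show ?thesis using s W Wd PW CL TL by blast
qed

end

lemma nonatomic_lebesgue_on:
 fixes S :: "'a::euclidean_space set"
 assumes S: "S : sets leb" "emeasure leb S < \<infinity>"
 shows "nonatomic_finite_measure (leb_on S)"
proof (rule nonatomic_finite_measure.intro)
 show "finite_measure (leb_on S)"
 using S by (intro finite_measureI) (simp add: emeasure_restrict_space less_top[symmetric])
 show "nonatomic_finite_measure_axioms (leb_on S)"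
 proof
 fix A v assume A: "A : sets (leb_on S)" and v: "0 <= v" "v <= measure (leb_on S) A"
 have A': "A : sets leb" "A <= S" using A S sets_restrict_space_iff[of S leb A] by simp_all
 have "A : lmeasurable" by (rule fmeasurableI2[OF fmeasurableI[OF S] A'(2,1)])
 moreover have "measure (leb_on S) A = measure leb A" by (rule measure_restrict_space) (use S A' in simp_all)
 ultimately obtain B where B: "B : sets leb" "B <= A" "measure leb B = v" using lebesgue_intermediate_measure[of A v] v by auto
 have "B <= S" using B(2) A'(2) by blast
 then have "B : sets (leb_on S)" "measure (leb_on S) B = v"
  using S B by (simp_all add: sets_restrict_space_iff measure_restrict_space)
 then show "\<exists>B\<in>sets (leb_on S). B <= A & measure (leb_on S) B = v" using B(2) by blast
 qed
qed



section \<open>Cutting off near the complement of the limit domain\<close>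

definition thickening :: "real => 'a::metric_space set => 'a set" where
 "thickening d A = (\<Union>y\<in>A. ball y d)"

lemma in_thickening: "x : thickening d A \<longleftrightarrow> (\<exists>y\<in>A. dist x y < d)"
 by (auto simp: thickening_def dist_commute)

lemma open_thickening: "open (thickening d A)"
 by (auto simp: thickening_def)

lemma thickening_mono: "d <= e ==> thickening d A <= thickening e A"
 by (force simp: in_thickening)

lemma thickening_ball: "y : thickening e A ==> dist x y < d ==> x : thickening (d + e) A"
 unfolding in_thickening by (meson add_strict_mono dist_triangle le_less_trans)

lemma thickening_AE_sets: "thickening d A : sets leb"
 by (simp add: open_thickening)

lemma ball_volume: "0 <= r ==> measure leb (ball (c::'a::euclidean_space) r) = unit_ball_vol (real DIM('a)) * r ^ DIM('a)"
 using content_ball[of r c] by simp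

text \<open>Lower density of the complement at frontier points, locally uniform.\<close>

definition porous_complement :: "'a::euclidean_space set => 'a set => bool" where
 "porous_complement S \<Omega> \<longleftrightarrow> (\<forall>K. compact K --> K <= S -->
  (\<exists>r>0. \<exists>c>0. \<forall>x\<in>K \<inter> frontier \<Omega>. \<forall>rho. 0 < rho & rho <= r --> c * rho ^ DIM('a) <= measure leb (ball x rho - \<Omega>)))"

text \<open>A point of \<open>\<Omega>\<close> at distance less than \<open>delta\<close> from the complement has a frontier point within \<open>delta\<close>, because
 the connecting segment crosses the frontier. So the ball of radius \<open>2 delta\<close> around it contains a fixed
 fraction of the complement, where \<open>w = 0\<close>, and the Poincare inequality applies. The constants do not depend
 on \<open>w\<close>.\<close>

lemma Hardy_near_complement:
 fixes S \<Omega> :: "'a::euclidean_space set"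
 assumes S: "open S" and \<Omega>: "\<Omega> : sets leb" and por: "porous_complement S \<Omega>"
 and K: "compact K" "K <= S"
 shows "\<exists>delta0>0. \<exists>C K1. compact K1 & K1 <= S & (\<forall>x\<in>K. cball x delta0 <= K1) &
 (\<forall>w H. loc_sobolev S w H --> (AE x in leb. x : S - \<Omega> --> w x = 0) -->
  (\<forall>delta. 0 < delta --> delta <= delta0 -->
  (LINT x|leb_on K. indicator (thickening delta (S - \<Omega>)) x * (w x)^2)
   <= C * delta^2 * (LINT x|leb_on K1. indicator (thickening (3 * delta) (S - \<Omega>)) x * (norm (H x))^2)))"
proof -
 define Z where "Z = S - \<Omega>"
 have Zs: "Z : sets leb" using S \<Omega> by (auto simp: Z_def)
 obtain rho K1 where K1: "0 < rho" "compact K1" "K1 <= S" "!!x. x : K ==> cball x rho <= K1" "K1 = (\<Union>x\<in>K. cball x rho)"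
 by (rule compact_neighbourhood[OF K S]) blast
 obtain zeta K2 where zeta: "smooth zeta" "!!x. 0 <= zeta x" "!!x. zeta x <= 1" "!!x. x : K1 ==> zeta x = 1"
 "compact K2" "K2 <= S" "K1 <= K2" "!!x. x \<notin> K2 ==> zeta x = 0"
 by (rule cutoff_compact[OF K1(2,3) S]) blast
 obtain r c where rc: "0 < r" "0 < c" "!!x t. x : K1 \<inter> frontier \<Omega> ==> 0 < t ==> t <= r ==> c * t ^ DIM('a) <= measure leb (ball x t - \<Omega>)"
 using por K1(2,3) unfolding porous_complement_def by meson
 \<comment> \<open>Half of \<open>rho\<close>, so that balls of radius \<open>2 delta\<close> stay in \<open>K1\<close>.\<close>
 define delta0 where "delta0 = min r (rho / 2)"
 have delta0: "0 < delta0" "delta0 <= r" "2 * delta0 <= rho" using rc(1) K1(1) by (auto simp: delta0_def)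
 define V where "V = unit_ball_vol (real DIM('a))"
 \<comment> \<open>The volume of a ball of radius \<open>2 delta\<close> divided by \<open>c delta^n\<close>, times the Poincare factor \<open>2 (2 delta)^2 / delta^2\<close>.\<close>
 define C where "C = V * 2 ^ DIM('a) * 8 / c"
 define O1 where "O1 = (\<Union>x\<in>K. ball x rho)"
 have O1: "open O1" "O1 <= K1"
 proof -
 show "open O1" by (auto simp: O1_def)
 show "O1 <= K1" unfolding O1_def
 proof (rule UN_least)
  fix x assume "x : K"
  from K1(4)[OF this] ball_subset_cball[of x rho] show "ball x rho <= K1" by blast
 qed
 qed
 note Ks = compact_sets_lebesgue[OF K(1)] and K1s = compact_sets_lebesgue[OF K1(2)] and K2s = compact_sets_lebesgue[OF zeta(5)]
 have main: "(LINT x|leb_on K. indicator (thickening delta Z) x * (w x)^2)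
   <= C * delta^2 * (LINT x|leb_on K1. indicator (thickening (3 * delta) Z) x * (norm (H x))^2)"
 if w: "loc_sobolev S w H" and w0: "AE x in leb. x : Z --> w x = 0" and delta: "0 < delta" "delta <= delta0" for w H delta
 proof -
 define v where "v = (%x. if x : S then zeta x * w x else 0)"
 define J where "J = (%x. if x : S then zeta x *\<^sub>R H x + w x *\<^sub>R grad zeta x else 0)"
 note ext = has_weak_gradient_cutoff_extension[OF loc_sobolevD(1)[OF w] zeta(1,5,6,8), folded v_def J_def]
 have J2: "integrable leb (%x. (norm (J x))^2)"
 proof -
  have "integrable leb (%x. indicator K2 x *\<^sub>R (norm (zeta x *\<^sub>R H x + w x *\<^sub>R grad zeta x))^2)"
  using L2D(2)[OF loc_sobolevD(3)[OF loc_sobolev_mult_smooth[OF w zeta(1)] zeta(5,6)]]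
  unfolding lebesgue_on_integral(2)[OF K2s, symmetric] set_integrable_def .
  also have "(%x. indicator K2 x *\<^sub>R (norm (zeta x *\<^sub>R H x + w x *\<^sub>R grad zeta x))^2) = (%x. (norm (J x))^2)"
  proof
  fix x
  show "indicator K2 x *\<^sub>R (norm (zeta x *\<^sub>R H x + w x *\<^sub>R grad zeta x))^2 = (norm (J x))^2"
   using zeta(6) zeta(8)[of x] grad_eq_0_outside[where x = x, OF compact_imp_closed[OF zeta(5)] zeta(8)] by (cases "x : K2") (auto simp: J_def)
  qed
  finally show ?thesis .
 qed
 define A where "A = K \<inter> thickening delta Z"
 define B where "B = O1 \<inter> thickening (3 * delta) Z"
 have Ab: "A : sets borel" unfolding A_def using K(1) by (intro sets.Int borel_compact borel_open open_thickening)
 have Bb: "B : sets borel" unfolding B_def using O1 by (intro sets.Int borel_open open_thickening)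
 have AB: "x + h : B" if "x : A" "norm h < 2 * delta" for x h
 proof -
  have "x + h : thickening (2 * delta + delta) Z" by (rule thickening_ball[of x]) (use that in \<open>auto simp: A_def dist_norm\<close>)
  moreover have "x + h : ball x rho" using that delta delta0 by (simp add: dist_norm)
  ultimately show ?thesis using that by (auto simp: A_def B_def O1_def)
 qed
 have v0: "AE x in leb. x : Z --> v x = 0" using w0 by eventually_elim (auto simp: v_def)
 have portion: "AE x in leb. x : A --> v x = 0 \<or> c * delta ^ DIM('a) <= measure leb (ball x (2 * delta) \<inter> Z)"
  using v0
 proof eventually_elim
  case (elim x)
  show ?case
  proof
  assume x: "x : A"
  have xK1: "ball x (2 * delta) <= K1"
  proof -
   have "ball x (2 * delta) <= cball x rho" using delta delta0 by auto
   then show ?thesis using K1(4)[of x] x by (auto simp: A_def)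
  qed
  show "v x = 0 \<or> c * delta ^ DIM('a) <= measure leb (ball x (2 * delta) \<inter> Z)"
  proof (cases "x : Z")
   case True then show ?thesis using elim by blast
  next
   case False
   then have x\<Omega>: "x : \<Omega>" using x K(2) by (auto simp: A_def Z_def)
   obtain y where y: "y : Z" "dist x y < delta" using x by (auto simp: A_def in_thickening)
   have "closed_segment x y \<inter> frontier \<Omega> ~= {}"
   by (rule connected_Int_frontier) (use x\<Omega> y in \<open>auto simp: Z_def\<close>)
   then obtain p where p: "p : closed_segment x y" "p : frontier \<Omega>" by blast
   have px: "dist x p < delta" using segment_bound(1)[OF p(1)] y(2) by (simp add: dist_norm norm_minus_commute)
   have sub: "ball p delta <= ball x (2 * delta)"
   proof
   fix z assume "z : ball p delta"
   then show "z : ball x (2 * delta)" using px dist_triangle[of x z p] by simp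
   qed
   have "p : K1" using xK1 px delta by (auto simp: subset_eq)
   then have "c * delta ^ DIM('a) <= measure leb (ball p delta - \<Omega>)" using rc(3)[of p delta] p delta delta0 by auto
   also have "... <= measure leb (ball x (2 * delta) \<inter> Z)"
   proof (rule measure_mono_fmeasurable)
   show "ball p delta - \<Omega> <= ball x (2 * delta) \<inter> Z" using sub xK1 K1(3) by (auto simp: Z_def)
   show "ball p delta - \<Omega> : sets leb" using \<Omega> by auto
   show "ball x (2 * delta) \<inter> Z : lmeasurable" using Zs by (intro fmeasurable_Int_fmeasurable) auto
   qed
   finally show ?thesis ..
  qed
  qed
 qed
 have P: "c * delta ^ DIM('a) * (LINT x:A|leb. (v x)^2)
  <= measure leb (ball (0::'a) (2 * delta)) * (2 * (2 * delta)^2 * (LINT x:B|leb. (norm (J x))^2))"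
  by (rule Poincare_zero_portion[OF ext(1-3) J2 Ab Bb _ AB Zs v0 _ portion]) (use delta rc in auto)
 have dn: "0 < delta ^ DIM('a)" using delta by simp
 have bv: "measure leb (ball (0::'a) (2 * delta)) = V * (2 * delta) ^ DIM('a)"
  unfolding V_def by (rule ball_volume) (use delta in simp)
 define a where "a = (LINT x:A|leb. (v x)^2)"
 define b where "b = (LINT x:B|leb. (norm (J x))^2)"
 have e1: "c * delta ^ DIM('a) * a = delta ^ DIM('a) * (c * a)" by (simp add: mult_ac)
 have e2: "V * (2 * delta) ^ DIM('a) * (2 * (2 * delta)^2 * b) = delta ^ DIM('a) * (c * (C * delta^2 * b))"
  using rc(2) by (simp add: C_def power_mult_distrib)
 have "delta ^ DIM('a) * (c * a) <= delta ^ DIM('a) * (c * (C * delta^2 * b))"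
  using P unfolding bv a_def[symmetric] b_def[symmetric] e1 e2 .
 then have "c * a <= c * (C * delta^2 * b)" by (rule mult_le_cancel_left_pos[OF dn, THEN iffD1])
 then have P': "(LINT x:A|leb. (v x)^2) <= C * delta^2 * (LINT x:B|leb. (norm (J x))^2)"
  unfolding a_def[symmetric] b_def[symmetric] by (rule mult_le_cancel_left_pos[OF rc(2), THEN iffD1])
 have left: "(LINT x:A|leb. (v x)^2) = (LINT x|leb_on K. indicator (thickening delta Z) x * (w x)^2)"
  unfolding lebesgue_on_integral(1)[OF Ks, symmetric] set_lebesgue_integral_def
 proof (rule LINT_cong[OF refl])
  fix x
  show "indicator A x *\<^sub>R (v x)^2 = indicator K x *\<^sub>R (indicator (thickening delta Z) x * (w x)^2)"
  proof (cases "x : K")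
  case True
  then have "x : K1" "x : S" using K1(1) K1(4)[of x] K(2) by force+
  then show ?thesis using True zeta(4)[of x] by (auto simp: A_def v_def indicator_def)
  qed (simp add: A_def)
 qed
 have J_eq: "J x = H x" if x: "x : O1" for x
 proof -
  have "grad zeta x = 0" by (rule grad_const_on_open[OF O1(1) zeta(4) x]) (use O1 in auto)
  then show ?thesis using x O1 zeta(4)[of x] K1(3) by (auto simp: J_def)
 qed
 have HK1: "integrable leb (%x. indicator K1 x *\<^sub>R (norm (H x))^2)"
  using L2D(2)[OF loc_sobolevD(3)[OF w K1(2,3)]] unfolding lebesgue_on_integral(2)[OF K1s, symmetric] set_integrable_def .
 have right: "(LINT x:B|leb. (norm (J x))^2) <= (LINT x|leb_on K1. indicator (thickening (3 * delta) Z) x * (norm (H x))^2)"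
  unfolding lebesgue_on_integral(1)[OF K1s, symmetric] set_lebesgue_integral_def
 proof (rule integral_mono')
  have "(%x. indicator K1 x *\<^sub>R (indicator (thickening (3 * delta) Z) x * (norm (H x))^2))
   = (%x. indicator (thickening (3 * delta) Z) x *\<^sub>R (indicator K1 x *\<^sub>R (norm (H x))^2))" by (auto simp: indicator_def)
  then show "integrable leb (%x. indicator K1 x *\<^sub>R (indicator (thickening (3 * delta) Z) x * (norm (H x))^2))"
  using integrable_mult_indicator[OF thickening_AE_sets HK1] by simp
  show "indicator B x *\<^sub>R (norm (J x))^2 <= indicator K1 x *\<^sub>R (indicator (thickening (3 * delta) Z) x * (norm (H x))^2)" for x
  using O1(2) J_eq[of x] by (auto simp: B_def indicator_def)
 qed simp
 have "0 <= C" using rc(2) unit_ball_vol_nonneg[of "real DIM('a)"] by (simp add: C_def V_def)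
 then have "C * delta^2 * (LINT x:B|leb. (norm (J x))^2) <= C * delta^2 * (LINT x|leb_on K1. indicator (thickening (3 * delta) Z) x * (norm (H x))^2)"
  by (intro mult_left_mono right) simp
 with P' left show ?thesis by simp
 qed
 have cb: "cball x delta0 <= K1" if "x : K" for x
 proof -
 have "cball x delta0 <= cball x rho" using delta0 by auto
 then show ?thesis using K1(4)[OF that] by blast
 qed
 show ?thesis
 unfolding Z_def[symmetric]
 by (rule exI[of _ delta0], intro conjI exI[of _ C] exI[of _ K1] ballI allI impI)
  (rule delta0(1) K1(2,3) | rule cb, assumption | rule main, assumption, assumption, assumption, assumption)+
qed

lemma integrable_on_indicator_mult:
 fixes f :: "'a::euclidean_space => real"
 assumes "integrable (leb_on K) f" "T : sets leb" "K : sets leb"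
 shows "integrable (leb_on K) (%x. indicator T x * f x)"
proof -
 have "T \<inter> K : sets (leb_on K)" using assms(2,3) by (auto simp: sets_restrict_space_iff)
 from integrable_mult_indicator[OF this assms(1)]
 have "integrable (leb_on K) (%x. indicator (T \<inter> K) x *\<^sub>R f x)" .
 then show ?thesis by (rule intgb_cong[THEN iffD1, rotated -1]) (auto simp: indicator_def)
qed

text \<open>Letting \<open>delta\<close> tend to zero in the Hardy inequality: points of \<open>\<Omega>\<close> that are not at a positive distance
 from the complement cannot carry \<open>w\<close>.\<close>

lemma vanishes_on_thin_part:
 fixes S \<Omega> :: "'a::euclidean_space set"
 assumes S: "open S" and \<Omega>: "\<Omega> : sets leb" and por: "porous_complement S \<Omega>"
 and K: "compact K" "K <= S" and w: "loc_sobolev S w H" and w0: "AE x in leb. x : S - \<Omega> --> w x = 0"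
 shows "AE x in leb_on K. (\<forall>delta>0. x : thickening delta (S - \<Omega>)) --> w x = 0 & H x = 0"
proof -
 note Ks = compact_sets_lebesgue[OF K(1)]
 from Hardy_near_complement[OF S \<Omega> por K] obtain delta0 C K1 where H0: "0 < delta0" "compact K1" "K1 <= S" "\<forall>x\<in>K. cball x delta0 <= K1"
 "\<forall>w H. loc_sobolev S w H --> (AE x in leb. x : S - \<Omega> --> w x = 0) -->
  (\<forall>delta. 0 < delta --> delta <= delta0 -->
  (LINT x|leb_on K. indicator (thickening delta (S - \<Omega>)) x * (w x)^2)
   <= C * delta^2 * (LINT x|leb_on K1. indicator (thickening (3 * delta) (S - \<Omega>)) x * (norm (H x))^2))"
 by (elim exE conjE) (rule that)
 note delta0 = H0(1-3) H0(5)[THEN spec, THEN spec, THEN mp, THEN mp, THEN spec, THEN mp, THEN mp, OF w w0]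
 define D where "D = (LINT x|leb_on K1. (norm (H x))^2)"
 define d where "d n = delta0 / real (Suc n)" for n
 have d: "0 < d n" "d n <= delta0" for n using delta0(1) by (auto simp: d_def field_simps)
 have d0: "d \<leadsto> 0" unfolding d_def[abs_def] by (rule LIMSEQ_Suc[OF lim_const_over_n])
 define T where "T = (\<Inter>n. thickening (d n) (S - \<Omega>))"
 have Ts: "T : sets leb" unfolding T_def using thickening_AE_sets by (intro sets.countable_INT') auto
 have i2: "integrable (leb_on K) (%x. (w x)^2)" using L2D(2)[OF loc_sobolevD(2)[OF w K]] by simp
 have iH: "integrable (leb_on K1) (%x. (norm (H x))^2)" by (rule L2D(2)[OF loc_sobolevD(3)[OF w delta0(2,3)]])
 have le: "(LINT x|leb_on K. indicator T x * (w x)^2) <= \<bar>C\<bar> * (d n)^2 * D" for n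
 proof -
 have "(LINT x|leb_on K. indicator T x * (w x)^2) <= (LINT x|leb_on K. indicator (thickening (d n) (S - \<Omega>)) x * (w x)^2)"
  by (rule integral_mono[OF integrable_on_indicator_mult[OF i2 Ts Ks] integrable_on_indicator_mult[OF i2 thickening_AE_sets Ks]])
  (auto simp: T_def indicator_def)
 also have "... <= C * (d n)^2 * (LINT x|leb_on K1. indicator (thickening (3 * d n) (S - \<Omega>)) x * (norm (H x))^2)"
  by (rule delta0(4)[OF d])
 also have "... <= \<bar>C\<bar> * (d n)^2 * (LINT x|leb_on K1. indicator (thickening (3 * d n) (S - \<Omega>)) x * (norm (H x))^2)"
  by (intro mult_right_mono LINT_nonneg) auto
 also have "... <= \<bar>C\<bar> * (d n)^2 * D"
  unfolding D_def by (intro mult_left_mono integral_mono integrable_on_indicator_mult[OF iH] iH thickening_AE_sets compact_sets_lebesgue delta0)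
  (auto simp: indicator_def)
 finally show ?thesis .
 qed
 have "(%n. \<bar>C\<bar> * (d n)^2 * D) \<leadsto> \<bar>C\<bar> * 0^2 * D" by (intro tendsto_intros d0)
 then have "(LINT x|leb_on K. indicator T x * (w x)^2) <= \<bar>C\<bar> * 0^2 * D"
 by (rule LIMSEQ_le_const) (use le in auto)
 moreover have "0 <= (LINT x|leb_on K. indicator T x * (w x)^2)" by (intro LINT_nonneg) auto
 ultimately have "(LINT x|leb_on K. indicator T x * (w x)^2) = 0" by simp
 then have "AE x in leb_on K. indicator T x * (w x)^2 = 0"
 by (subst integral_nonneg_eq_0_iff_AE[symmetric]) (auto intro: integrable_on_indicator_mult[OF i2 Ts Ks])
 moreover have "AE x in leb_on K. w x = 0 --> H x = 0"
 unfolding AE_lebesgue_on_iff[OF Ks]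
 using weak_gradient_eq_0_on_zero_set[OF S loc_sobolevD(1)[OF w]] by eventually_elim (use K in auto)
 ultimately show ?thesis
 proof eventually_elim
 case (elim x)
 then show ?case using d(1) by (auto simp: T_def)
 qed
qed

lemma lborel_distr_reflect: "distr lborel borel (%y. x - y) = (lborel :: 'a::euclidean_space measure)"
 using lborel_affine[of "-1" x] by (simp add: density_1 scaleR_minus1_left)

lemma mollify_indicator_gradient_bound:
 fixes T :: "'a::euclidean_space set"
 assumes r: "0 < r" and T: "bounded T" "T : sets leb"
 shows "norm (grad (mollify r (indicat_real T)) x) <= real DIM('a) * (4 * exp 2 * 2 ^ DIM('a)) / r"
proof -
 have iT: "integrable leb (indicat_real T)"
 using bounded_set_imp_lmeasurable[OF T] by (simp add: lmeasurable_iff_integrable)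
 have part: "\<bar>frechet_derivative (mollify r (indicat_real T)) (at x) b\<bar> <= 4 * exp 2 * 2 ^ DIM('a) / r" if b: "b : Basis" for b
 proof -
 define k where "k z = frechet_derivative (kernel r) (at z) b" for z :: 'a
 have kc: "continuous_on UNIV k"
  using C_k_kernel[of "Suc 0" r, where 'a='a] b unfolding k_def[abs_def] by simp
 have k0: "k z = 0" if "z \<notin> cball 0 r" for z
  unfolding k_def using frechet_derivative_eq_0_outside[of "cball 0 r" "kernel r" z, OF closed_cball kernel_eq_0_cball[OF r] that] by simp
 have ki: "integrable lborel (%z. \<bar>k z\<bar>)" using integrable_abs[OF integrable_continuous_compact_support(1)[OF kc compact_cball k0]] .
 have km: "(%z. \<bar>k z\<bar>) : borel_measurable borel" using borel_measurable_continuous_onI[OF kc] by measurable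
 have refl: "(LINT y|lborel. \<bar>k (x - y)\<bar>) = (LINT z|lborel. \<bar>k z\<bar>)"
  using integral_distr[of "%y. x - y" lborel borel "%z. \<bar>k z\<bar>"] km by (simp add: lborel_distr_reflect)
 have refli: "integrable lborel (%y. \<bar>k (x - y)\<bar>)"
  using integrable_distr_eq[of "%y. x - y" lborel borel "%z. \<bar>k z\<bar>"] km ki by (simp add: lborel_distr_reflect)
 have kxm: "(%y. \<bar>k (x - y)\<bar>) : borel_measurable lborel" using refli by (rule borel_measurable_integrable)
 have "\<bar>frechet_derivative (mollify r (indicat_real T)) (at x) b\<bar> = \<bar>LINT y|leb. k (x - y) * indicat_real T y\<bar>"
  unfolding mollify_frechet_derivative[OF r iT b] convol_def k_def ..
 also have "... <= (LINT y|leb. norm (k (x - y) * indicat_real T y))" using integral_norm_bound[of leb "%y. k (x - y) * indicat_real T y"] by simp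
 also have "... <= (LINT y|leb. \<bar>k (x - y)\<bar>)"
 proof (rule integral_mono')
  show "integrable leb (%y. \<bar>k (x - y)\<bar>)" using integrable_completion[OF kxm] refli by simp
 qed (auto simp: indicator_def)
 also have "... = (LINT y|lborel. \<bar>k (x - y)\<bar>)" using integral_completion[OF kxm] by simp
 also have "... = (LINT z|leb. \<bar>k z\<bar>)" unfolding refl using integral_completion[of "%z. \<bar>k z\<bar>" lborel] km by simp
 also have "... <= 4 * exp 2 * 2 ^ DIM('a) / r" unfolding k_def by (rule kernel_gradient_L1[OF r b])
 finally show ?thesis .
 qed
 have "norm (grad (mollify r (indicat_real T)) x) <= (\<Sum>b\<in>Basis. \<bar>frechet_derivative (mollify r (indicat_real T)) (at x) b\<bar>)"
 unfolding grad_def by (rule order_trans[OF norm_sum]) (simp add: sum_mono)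
 also have "... <= (\<Sum>b\<in>(Basis::'a set). 4 * exp 2 * 2 ^ DIM('a) / r)" by (intro sum_mono part)
 finally show ?thesis by simp
qed

lemma grad_one_minus: "smooth m ==> grad (%x. 1 - m x) x = - grad m x"
proof -
 assume "smooth m"
 then have "(m has_derivative frechet_derivative m (at x)) (at x)"
 using smooth_differentiable frechet_derivative_works by blast
 then have "((%x. 1 - m x) has_derivative (%h. - frechet_derivative m (at x) h)) (at x)"
 by (auto intro!: derivative_eq_intros)
 then have "frechet_derivative (%x. 1 - m x) (at x) = (%h. - frechet_derivative m (at x) h)"
 by (rule frechet_derivative_at[symmetric])
 then show ?thesis by (simp add: grad_def sum_negf)
qed

text \<open>The gradient of the cutoff is of order \<open>1/delta\<close> on the layer of width \<open>4 delta\<close>, where the Hardy inequality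
 bounds \<open>w^2\<close> by \<open>delta^2\<close> times the integral of \<open>|H|^2\<close> over a slightly larger layer. The product is bounded by
 the latter integral, which tends to zero since \<open>H\<close> vanishes on the intersection of the layers. The same cutoffs
 serve all functions \<open>w\<close>.\<close>

lemma cutoff_near_complement:
 fixes S \<Omega> :: "'a::euclidean_space set" and K :: "'a set"
 assumes S: "open S" and \<Omega>: "\<Omega> : sets leb" and por: "porous_complement S \<Omega>"
 and K: "compact K" "K <= S"
 shows "\<exists>eta d. (\<forall>n. smooth (eta n)) & (\<forall>n. 0 < d n) & (\<forall>n x. 0 <= eta n x & eta n x <= 1) &
 (\<forall>n. \<forall>x\<in>K. x : thickening (d n) (S - \<Omega>) --> eta n x = 0) &
 (\<forall>w H. loc_sobolev S w H --> (AE x in leb. x : S - \<Omega> --> w x = 0) -->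
  L2_tendsto (leb_on K) (%n x. eta n x * w x) w &
  L2_tendsto (leb_on K) (%n x. eta n x *\<^sub>R H x + w x *\<^sub>R grad (eta n) x) H)"
proof -
 define Z where "Z = S - \<Omega>"
 note Ks = compact_sets_lebesgue[OF K(1)]
 from Hardy_near_complement[OF S \<Omega> por K, folded Z_def] obtain delta0 C K1 where H0: "0 < delta0" "compact K1" "K1 <= S" "\<forall>x\<in>K. cball x delta0 <= K1"
 "\<forall>w H. loc_sobolev S w H --> (AE x in leb. x : Z --> w x = 0) -->
  (\<forall>delta. 0 < delta --> delta <= delta0 -->
  (LINT x|leb_on K. indicator (thickening delta Z) x * (w x)^2)
   <= C * delta^2 * (LINT x|leb_on K1. indicator (thickening (3 * delta) Z) x * (norm (H x))^2))"
 by (elim exE conjE) (rule that)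
 note delta0 = H0(1-3) bspec[OF H0(4)] H0(5)[THEN spec, THEN spec, THEN mp, THEN mp, THEN spec, THEN mp, THEN mp]
 note K1s = compact_sets_lebesgue[OF delta0(2)]
 define d where "d n = delta0 / 4 / real (Suc n)" for n
 have d: "0 < d n" "4 * d n <= delta0" "d n <= delta0" for n
 using delta0(1) by (auto simp: d_def field_simps)
 have d0: "d \<leadsto> 0" unfolding d_def[abs_def] by (rule LIMSEQ_Suc[OF lim_const_over_n])
 define T where "T n = thickening (2 * d n) Z \<inter> K1" for n
 have T: "bounded (T n)" "T n : sets leb" for n
 unfolding T_def by (rule bounded_subset[OF compact_imp_bounded[OF delta0(2)] Int_lower2]) (rule sets.Int[OF thickening_AE_sets K1s])
 define m where "m n = mollify (d n) (indicat_real (T n))" for n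
 have mo: "smooth (m n)" "0 <= m n x" "m n x <= 1" "ball x (d n) <= T n ==> m n x = 1" "ball x (d n) \<inter> T n = {} ==> m n x = 0" for n x
 unfolding m_def by (fact cutoff_exists[OF T[of n] d(1)[of n]])+
 define eta where "eta n x = 1 - m n x" for n x
 have eta: "smooth (eta n)" "0 <= eta n x" "eta n x <= 1" for n x
 using mo(1,2,3) unfolding eta_def[abs_def] by (auto intro: smooth_diff smooth_const)
 have eta0: "eta n x = 0" if x: "x : K" "x : thickening (d n) Z" for n x
 proof -
 have "ball x (d n) <= T n"
 proof
  fix y assume y: "y : ball x (d n)"
  have "y : thickening (d n + d n) Z" by (rule thickening_ball[OF x(2)]) (use y in \<open>simp add: dist_commute\<close>)
  moreover have "y : K1" using delta0(4)[OF x(1)] y d(3)[of n] by (auto simp: subset_eq)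
  ultimately show "y : T n" by (simp add: T_def)
 qed
 then show ?thesis using mo(4)[where n = n and x = x] by (simp add: eta_def)
 qed
 have eta1: "eta n x = 1" if x: "x \<notin> thickening (3 * d n) Z" for n x
 proof -
 have "ball x (d n) \<inter> T n = {}"
 proof (rule ccontr)
  assume "ball x (d n) \<inter> T n ~= {}"
  then obtain y where y: "dist x y < d n" "y : thickening (2 * d n) Z" by (auto simp: T_def)
  have "x : thickening (d n + 2 * d n) Z" by (rule thickening_ball[OF y(2,1)])
  then show False using x by simp
 qed
 then show ?thesis using mo(5)[where n = n and x = x] by (simp add: eta_def)
 qed
 have grad0: "grad (eta n) x = 0" if x: "x \<notin> thickening (4 * d n) Z" for n x
 proof (rule grad_const_on_open[of "ball x (d n)" _ 1])
 fix y assume y: "y : ball x (d n)"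
 show "eta n y = 1"
 proof (rule eta1, rule notI)
  assume "y : thickening (3 * d n) Z"
  then have "x : thickening (d n + 3 * d n) Z" by (rule thickening_ball) (use y in simp)
  then show False using x by simp
 qed
 qed (use d in auto)
 define L where "L = real DIM('a) * (4 * exp 2 * 2 ^ DIM('a))"
 have gradL: "norm (grad (eta n) x) <= L / d n" for n x
 proof -
 have "grad (eta n) x = - grad (m n) x" unfolding eta_def[abs_def] by (rule grad_one_minus[OF mo(1)])
 then have "norm (grad (eta n) x) = norm (grad (mollify (d n) (indicat_real (T n))) x)" by (simp add: m_def)
 then show ?thesis using mollify_indicator_gradient_bound[OF d(1)[of n] T[of n], of x] unfolding L_def by linarith
 qed
 have lim: "\<forall>\<^sub>F n in sequentially. x \<notin> thickening (c * d n) Z" if "\<not> (\<forall>delta>0. x : thickening delta Z)" "0 < c" for x and c :: real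
 proof -
 from that(1) obtain delta where delta: "0 < delta" "x \<notin> thickening delta Z" by auto
 have "(%n. c * d n) \<leadsto> c * 0" by (intro tendsto_mult tendsto_const d0)
 from order_tendstoD(2)[OF this, of delta] have "\<forall>\<^sub>F n in sequentially. c * d n < delta" using delta(1) by simp
 then show ?thesis
 proof eventually_elim
  case (elim n)
  have "thickening (c * d n) Z <= thickening delta Z" by (rule thickening_mono) (use elim in simp)
  then show ?case using delta(2) by blast
 qed
 qed
 have conv: "L2_tendsto (leb_on K) (%n x. eta n x * w x) w &
  L2_tendsto (leb_on K) (%n x. eta n x *\<^sub>R H x + w x *\<^sub>R grad (eta n) x) H"
 if w: "loc_sobolev S w H" and w0: "AE x in leb. x : Z --> w x = 0" for w H
 proof -
 note Lw = loc_sobolevD(2)[OF w K] and LH = loc_sobolevD(3)[OF w K] and LH1 = loc_sobolevD(3)[OF w delta0(2,3)]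
 have etam: "eta n : borel_measurable (leb_on K)" for n
  by (rule continuous_measurable_lebesgue_on[OF smooth_continuous[OF eta(1)]])
 have etaa: "\<bar>eta n x\<bar> <= 1" for n x using eta(2,3)[of n x] by simp
 have etalim: "(%n. eta n x) \<leadsto> 1" if "\<not> (\<forall>delta>0. x : thickening delta Z)" for x
 proof (rule tendsto_eventually)
  show "\<forall>\<^sub>F n in sequentially. eta n x = 1" using lim[OF that, of 3] by (auto elim!: eventually_mono simp: eta1)
 qed
 note van = vanishes_on_thin_part[OF S \<Omega> por _ _ w w0[unfolded Z_def], folded Z_def]
 have a: "L2_tendsto (leb_on K) (%n x. eta n x * w x) w"
 proof (rule L2_tendsto_dominated[OF _ _ _ Lw])
  show "(%x. eta n x * w x) : borel_measurable (leb_on K)" for n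
  by (intro borel_measurable_times etam L2D(1)[OF Lw])
  show "w : borel_measurable (leb_on K)" by (rule L2D(1)[OF Lw])
  show "AE x in leb_on K. (%n. eta n x * w x) \<leadsto> w x"
  using van[OF K]
  proof eventually_elim
  case (elim x)
  show ?case
  proof (cases "\<forall>delta>0. x : thickening delta Z")
   case False
   then show ?thesis using tendsto_mult_right[OF etalim[OF False], of "w x"] by simp
  qed (use elim in simp)
  qed
  show "norm (eta n x * w x - w x) <= norm (w x)" for n x
  proof -
  have "eta n x * w x - w x = - (m n x * w x)" by (simp add: eta_def algebra_simps)
  then show ?thesis using mo(2,3)[where n = n and x = x] by (simp add: abs_mult mult_left_le_one_le)
  qed
 qed
 have b: "L2_tendsto (leb_on K) (%n x. eta n x *\<^sub>R H x) H"
 proof (rule L2_tendsto_dominated[OF _ _ _ LH])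
  show "(%x. eta n x *\<^sub>R H x) : borel_measurable (leb_on K)" for n
  by (intro borel_measurable_scaleR etam L2D(1)[OF LH])
  show "H : borel_measurable (leb_on K)" by (rule L2D(1)[OF LH])
  show "AE x in leb_on K. (%n. eta n x *\<^sub>R H x) \<leadsto> H x"
  using van[OF K]
  proof eventually_elim
  case (elim x)
  show ?case
  proof (cases "\<forall>delta>0. x : thickening delta Z")
   case False
   then show ?thesis using tendsto_scaleR[OF etalim[OF False] tendsto_const, of "H x"] by simp
  qed (use elim in simp)
  qed
  show "norm (eta n x *\<^sub>R H x - H x) <= norm (H x)" for n x
  proof -
  have "eta n x *\<^sub>R H x - H x = - (m n x *\<^sub>R H x)" by (simp add: eta_def algebra_simps)
  then show ?thesis using mo(2,3)[where n = n and x = x] by (simp add: mult_left_le_one_le)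
  qed
 qed
 have i1: "integrable (leb_on K) (%x. (w x)^2)" using L2D(2)[OF Lw] by simp
 define E where "E n = (LINT x|leb_on K1. indicator (thickening (12 * d n) Z) x * (norm (H x))^2)" for n
 have E: "E \<leadsto> 0"
 proof -
  have "(%n. LINT x|leb_on K1. indicator (thickening (12 * d n) Z) x * (norm (H x))^2) \<leadsto> (LINT x|leb_on K1. 0)"
  proof (rule integral_dominated_convergence[OF _ _ L2D(2)[OF LH1]])
  show "(%x. indicator (thickening (12 * d n) Z) x * (norm (H x))^2) : borel_measurable (leb_on K1)" for n
   by (rule borel_measurable_integrable[OF integrable_on_indicator_mult[OF L2D(2)[OF LH1] thickening_AE_sets K1s]])
  show "AE x in leb_on K1. (%n. indicator (thickening (12 * d n) Z) x * (norm (H x))^2) \<leadsto> 0"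
   using van[OF delta0(2,3)]
  proof eventually_elim
   case (elim x)
   show ?case
   proof (cases "\<forall>delta>0. x : thickening delta Z")
   case False
   show ?thesis
    by (rule tendsto_eventually, rule eventually_mono[OF lim[OF False, of 12]]) auto
   qed (use elim in simp)
  qed
  show "AE x in leb_on K1. norm (indicator (thickening (12 * d n) Z) x * (norm (H x))^2) <= (norm (H x))^2" for n
   by (auto simp: indicator_def)
  qed simp
  then show ?thesis by (simp add: E_def[abs_def])
 qed
 have c: "L2_tendsto (leb_on K) (%n x. w x *\<^sub>R grad (eta n) x) (%x. 0)"
 proof (rule L2_tendsto_bound)
  show "(LINT x|leb_on K. (norm (w x *\<^sub>R grad (eta n) x - 0))^2) <= 16 * C * L^2 * E n" for n
  proof -
  have "(LINT x|leb_on K. (norm (w x *\<^sub>R grad (eta n) x - 0))^2)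
   <= (LINT x|leb_on K. (L / d n)^2 * (indicator (thickening (4 * d n) Z) x * (w x)^2))"
  proof (rule integral_mono')
   show "integrable (leb_on K) (%x. (L / d n)^2 * (indicator (thickening (4 * d n) Z) x * (w x)^2))"
   by (intro integrable_mult_right integrable_on_indicator_mult[OF i1 thickening_AE_sets Ks])
   show "(norm (w x *\<^sub>R grad (eta n) x - 0))^2 <= (L / d n)^2 * (indicator (thickening (4 * d n) Z) x * (w x)^2)" for x
   proof (cases "x : thickening (4 * d n) Z")
   case True
   have "(norm (grad (eta n) x))^2 <= (L / d n)^2" by (intro power_mono gradL) auto
   then have "(norm (grad (eta n) x))^2 * (w x)^2 <= (L / d n)^2 * (w x)^2" by (intro mult_right_mono) auto
   then show ?thesis using True by (simp add: power_mult_distrib mult.commute)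
   qed (simp add: grad0)
  qed auto
  also have "... = (L / d n)^2 * (LINT x|leb_on K. indicator (thickening (4 * d n) Z) x * (w x)^2)" by simp
  also have "... <= (L / d n)^2 * (C * (4 * d n)^2 * E n)"
   using delta0(5)[OF w w0, of "4 * d n"] d[of n] by (intro mult_left_mono) (auto simp: E_def)
  also have "... = 16 * C * L^2 * E n" using d(1)[of n] by (simp add: power_mult_distrib power_divide)
  finally show ?thesis .
  qed
  have "(%n. 16 * C * L^2 * E n) \<leadsto> 16 * C * L^2 * 0" by (intro tendsto_intros E)
  then show "(%n. 16 * C * L^2 * E n) \<leadsto> 0" by simp
 qed
 have L1: "L2 (leb_on K) (%x. eta n x *\<^sub>R H x)" for n by (rule L2_mult_bounded[OF LH etam etaa])
 have L2': "L2 (leb_on K) (%x. w x *\<^sub>R grad (eta n) x)" for n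
 proof (rule L2_scaleR_bounded[OF Lw _ gradL])
  show "grad (eta n) : borel_measurable (leb_on K)"
  by (rule continuous_measurable_lebesgue_on[OF smooth_grad_continuous[OF eta(1)]])
 qed
 have L0: "L2 (leb_on K) (%x. 0 :: 'a)" by (simp add: L2_def)
 have "L2_tendsto (leb_on K) (%n x. eta n x *\<^sub>R H x + w x *\<^sub>R grad (eta n) x) (%x. H x + 0)"
  by (rule L2_tendsto_add[OF b c L1 LH L2' L0])
 then show ?thesis using a by simp
 qed
 show ?thesis
 unfolding Z_def[symmetric]
 by (intro exI[of _ eta] exI[of _ d] conjI allI impI ballI)
  (rule eta d(1) | rule eta0, assumption, assumption | rule conjunct1[OF conv], assumption, assumption
  | rule conjunct2[OF conv], assumption, assumption)+
qed



section \<open>Passing to the limit in the comparison\<close>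

text \<open>A competitor is glued to a given function: it is \<open>w\<close> where \<open>eta = 1\<close> and \<open>u\<close> where \<open>eta = 0\<close>.\<close>

definition interp :: "('a => real) => ('a => real ^ 'm::finite) => ('a => real ^ 'm) => 'a => real ^ 'm" where
 "interp eta u w x = u x + eta x *\<^sub>R (w x - u x)"

text \<open>The gradient of \<open>interp\<close> by the product rule.\<close>

definition interp_grad :: "('a::euclidean_space => real) => ('a => real ^ 'm::finite) => ('m => 'a => 'a) =>
 ('a => real ^ 'm) => ('m => 'a => 'a) => 'm => 'a => 'a" where
 "interp_grad eta u G w H i x = G i x + (eta x *\<^sub>R (H i x - G i x) + (w x $ i - u x $ i) *\<^sub>R grad eta x)"

lemma loc_sobolev_interp:
 assumes "smooth eta" "loc_sobolev S (%x. u x $ i) (G i)" "loc_sobolev S (%x. w x $ i) (H i)"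
 shows "loc_sobolev S (%x. interp eta u w x $ i) (interp_grad eta u G w H i)"
 using loc_sobolev_add[OF assms(2) loc_sobolev_mult_smooth[OF loc_sobolev_diff[OF assms(3,2)] assms(1)]]
 by (simp add: interp_def interp_grad_def[abs_def])

lemma L2_tendsto_diff:
 assumes f: "L2_tendsto M f f'" "L2_tendsto M g g'" and L: "!!n. L2 M (f n)" "L2 M f'" "!!n. L2 M (g n)" "L2 M g'"
 shows "L2_tendsto M (%n x. f n x - g n x) (%x. f' x - g' x)"
proof -
 have m: "L2_tendsto M (%n x. (-1) *\<^sub>R g n x) (%x. (-1) *\<^sub>R g' x)"
 proof (rule L2_tendsto_pointwise_bound[OF f(2) L(3,4), where C = 1])
 fix n x
 have "(-1) *\<^sub>R g n x - (-1) *\<^sub>R g' x = - (g n x - g' x)" by simp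
 then show "norm ((-1) *\<^sub>R g n x - (-1) *\<^sub>R g' x) <= 1 * norm (g n x - g' x)" by (simp only: norm_minus_cancel mult_1)
 qed
 from L2_tendsto_add[OF f(1) m L(1,2) L2_scale[OF L(3)] L2_scale[OF L(4)]] show ?thesis by simp
qed

lemma L2_tendsto_contraction:
 assumes etaa: "!!x. \<bar>eta x\<bar> <= (1::real)" and f: "L2_tendsto M f f'" "!!n. L2 M (f n)" "L2 M f'"
 shows "L2_tendsto M (%n x. eta x *\<^sub>R f n x) (%x. eta x *\<^sub>R f' x)"
proof (rule L2_tendsto_pointwise_bound[OF f, where C = 1])
 fix n x
 have "eta x *\<^sub>R f n x - eta x *\<^sub>R f' x = eta x *\<^sub>R (f n x - f' x)" by (simp add: scaleR_diff_right)
 then show "norm (eta x *\<^sub>R f n x - eta x *\<^sub>R f' x) <= 1 * norm (f n x - f' x)"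
 using etaa[of x] by (simp add: mult_left_le_one_le)
qed

lemma interp_tendsto:
 fixes un wn :: "nat => 'a::euclidean_space => real ^ 'm::finite"
 assumes K: "compact K" and eta: "smooth eta" "!!x. 0 <= eta x" "!!x. eta x <= 1"
 and u: "L2_tendsto (leb_on K) (%n x. un n x $ i) (%x. u x $ i)" "!!n. L2 (leb_on K) (%x. un n x $ i)" "L2 (leb_on K) (%x. u x $ i)"
 and w: "L2_tendsto (leb_on K) (%n x. wn n x $ i) (%x. w x $ i)" "!!n. L2 (leb_on K) (%x. wn n x $ i)" "L2 (leb_on K) (%x. w x $ i)"
 and G: "L2_tendsto (leb_on K) (%n. Gn n i) (G i)" "!!n. L2 (leb_on K) (Gn n i)" "L2 (leb_on K) (G i)"
 and H: "L2_tendsto (leb_on K) (%n. Hn n i) (H i)" "!!n. L2 (leb_on K) (Hn n i)" "L2 (leb_on K) (H i)"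
 shows "L2_tendsto (leb_on K) (%n x. interp eta (un n) (wn n) x $ i) (%x. interp eta u w x $ i)"
 "!!n. L2 (leb_on K) (%x. interp eta (un n) (wn n) x $ i)" "L2 (leb_on K) (%x. interp eta u w x $ i)"
 "L2_tendsto (leb_on K) (%n. interp_grad eta (un n) (Gn n) (wn n) (Hn n) i) (interp_grad eta u G w H i)"
 "!!n. L2 (leb_on K) (interp_grad eta (un n) (Gn n) (wn n) (Hn n) i)" "L2 (leb_on K) (interp_grad eta u G w H i)"
proof -
 have etam: "eta : borel_measurable (leb_on K)" by (rule continuous_measurable_lebesgue_on[OF smooth_continuous[OF eta(1)]])
 have etaa: "\<bar>eta x\<bar> <= 1" for x using eta(2,3)[of x] by simp
 have gm: "grad eta : borel_measurable (leb_on K)" by (rule continuous_measurable_lebesgue_on[OF smooth_grad_continuous[OF eta(1)]])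
 obtain L where L: "!!x. x : K ==> norm (grad eta x) <= L"
 by (rule continuous_on_compact_bounded[OF K smooth_grad_continuous[OF eta(1)]]) blast
 have L': "norm (grad eta x) <= L" if "x : space (leb_on K)" for x using L that by simp
 note m1 = L2_tendsto_contraction[OF etaa]
 note wu = L2_tendsto_diff[OF w(1) u(1) w(2,3) u(2,3)] L2_diff[OF w(2) u(2)] L2_diff[OF w(3) u(3)]
 note HG = L2_tendsto_diff[OF H(1) G(1) H(2,3) G(2,3)] L2_diff[OF H(2) G(2)] L2_diff[OF H(3) G(3)]
 have m2: "L2_tendsto (leb_on K) (%n x. (wn n x $ i - un n x $ i) *\<^sub>R grad eta x) (%x. (w x $ i - u x $ i) *\<^sub>R grad eta x)"
 proof (rule L2_tendsto_pointwise_bound[OF wu, where C = L])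
 fix n x assume x: "x : space (leb_on K)"
 have "norm ((wn n x $ i - un n x $ i) *\<^sub>R grad eta x - (w x $ i - u x $ i) *\<^sub>R grad eta x)
  = norm (grad eta x) * norm ((wn n x $ i - un n x $ i) - (w x $ i - u x $ i))"
  by (simp add: scaleR_diff_left[symmetric])
 also have "... <= L * norm ((wn n x $ i - un n x $ i) - (w x $ i - u x $ i))" by (rule mult_right_mono[OF L'[OF x]]) simp
 finally show "norm ((wn n x $ i - un n x $ i) *\<^sub>R grad eta x - (w x $ i - u x $ i) *\<^sub>R grad eta x)
  <= L * norm ((wn n x $ i - un n x $ i) - (w x $ i - u x $ i))" .
 qed
 note b = L2_mult_bounded[OF wu(2) etam etaa] L2_mult_bounded[OF wu(3) etam etaa] L2_mult_bounded[OF HG(2) etam etaa] L2_mult_bounded[OF HG(3) etam etaa]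
 L2_scaleR_bounded[OF wu(2) gm L'] L2_scaleR_bounded[OF wu(3) gm L']
 have e1: "(%x. interp eta a c x $ i) = (%x. a x $ i + eta x *\<^sub>R (c x $ i - a x $ i))" for a c
 by (simp add: interp_def fun_eq_iff)
 have e2: "interp_grad eta a A c D i = (%x. A i x + (eta x *\<^sub>R (D i x - A i x) + (c x $ i - a x $ i) *\<^sub>R grad eta x))" for a A c D
 by (simp add: interp_grad_def fun_eq_iff)
 show "L2_tendsto (leb_on K) (%n x. interp eta (un n) (wn n) x $ i) (%x. interp eta u w x $ i)"
 unfolding e1 by (rule L2_tendsto_add[OF u(1) m1[OF wu] u(2,3) b(1,2)])
 show "L2 (leb_on K) (%x. interp eta (un n) (wn n) x $ i)" for n unfolding e1 by (rule L2_add[OF u(2) b(1)])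
 show "L2 (leb_on K) (%x. interp eta u w x $ i)" unfolding e1 by (rule L2_add[OF u(3) b(2)])
 show "L2_tendsto (leb_on K) (%n. interp_grad eta (un n) (Gn n) (wn n) (Hn n) i) (interp_grad eta u G w H i)"
 unfolding e2 by (rule L2_tendsto_add[OF G(1) L2_tendsto_add[OF m1[OF HG] m2 b(3,4,5,6)] G(2,3) L2_add[OF b(3,5)] L2_add[OF b(4,6)]])
 show "L2 (leb_on K) (interp_grad eta (un n) (Gn n) (wn n) (Hn n) i)" for n unfolding e2 by (rule L2_add[OF G(2) L2_add[OF b(3,5)]])
 show "L2 (leb_on K) (interp_grad eta u G w H i)" unfolding e2 by (rule L2_add[OF G(3) L2_add[OF b(4,6)]])
qed

lemma uniform_limit_tendsto_diagonal:
 fixes f :: "nat => 'a::topological_space => real"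
 assumes c: "!!k. continuous_on D (f k)" and u: "uniform_limit D f g sequentially"
 and x: "!!k. x k : D" "y : D" "x \<leadsto> y" and s: "strict_mono (s :: nat => nat)"
 shows "(%k. f (s k) (x k)) \<leadsto> g y"
proof -
 have "continuous_on D g" by (rule uniform_limit_theorem[OF always_eventually[OF allI[OF c]] u]) simp
 from continuous_on_tendsto_compose[OF this x(3,2) always_eventually[OF allI[OF x(1)]]] have g: "(%k. g (x k)) \<leadsto> g y" .
 have "(%k. f (s k) (x k) - g (x k)) \<leadsto> 0"
 proof (rule tendstoI)
 fix e :: real assume "0 < e"
 from eventually_subseq[OF s uniform_limitD[OF u this]]
 show "\<forall>\<^sub>F k in sequentially. dist (f (s k) (x k) - g (x k)) 0 < e"
  by eventually_elim (use x(1) in \<open>simp add: dist_real_def\<close>)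
 qed
 from tendsto_add[OF this g] show ?thesis by simp
qed

text \<open>The hypotheses on the domains and on the volume terms, in the form in which the proof uses them.\<close>

locale convergent_problems = convergent_data Om \<Omega>k fk gk Fk uk Gk Wk u G C0 f g
 for Om :: "'a::euclidean_space set" and \<Omega>k
 and fk gk :: "nat => 'm::finite => 'a => real" and Fk uk Gk Wk u G C0 f g +
 fixes \<Omega> :: "'a set" and F :: "('m => 'a set) => real" and Ft :: "real ^ 'm => real" and Ftk :: "nat => real ^ 'm => real"
 assumes finite_volume: "emeasure leb Om < \<infinity>"
 and \<Omega>: "\<Omega> : sets leb" "\<Omega> <= Om"
 and \<Omega>k: "!!k. \<Omega>k k : sets leb" "!!k. \<Omega>k k <= Om"
 and \<Omega>k_tendsto: "(%k. measure leb (\<Omega>k k - \<Omega>)) \<leadsto> 0" "(%k. measure leb (\<Omega> - \<Omega>k k)) \<leadsto> 0"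
 and porous: "porous_complement Om \<Omega>"
 and excess: "!!K d. compact K ==> K <= Om ==> 0 < d ==> \<forall>\<^sub>F k in sequentially. K - \<Omega>k k <= thickening d (Om - \<Omega>)"
 and Fk_volumes: "!!k W. W : set_tuples (\<Omega>k k) ==> Fk k W = Ftk k (volumes W)"
 and Ftk_continuous: "!!k. continuous_on (cbox 0 (\<chi> i. measure leb Om)) (Ftk k)"
 and Ftk_uniform: "uniform_limit (cbox 0 (\<chi> i. measure leb Om)) Ftk Ft sequentially"
 and F_volumes: "!!W. W : set_tuples \<Omega> ==> F W = Ft (volumes W)"
begin

lemma finite_volume_subset: "A : sets leb ==> A <= Om ==> A : lmeasurable"
 by (rule fmeasurableI2[OF fmeasurableI[OF Om_sets finite_volume]])

lemma volumes_box:
 assumes "X : set_tuples S" "S <= Om"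
 shows "volumes X : cbox 0 (\<chi> i. measure leb Om)"
proof -
 have "measure leb (X i) <= measure leb Om" for i
 by (rule measure_mono_fmeasurable) (use assms finite_volume_subset[OF Om_sets] in \<open>auto simp: set_tuples_def\<close>)
 then show ?thesis by (simp add: mem_box_cart volumes_def)
qed

text \<open>Uniform convergence of the volume functions and continuity of their limit.\<close>

lemma F_tendsto:
 assumes s: "strict_mono s" and X: "!!k. X k : set_tuples (\<Omega>k (s k))" "Y : set_tuples \<Omega>"
 and lim: "!!i. (%k. measure leb (X k i)) \<leadsto> measure leb (Y i)"
 shows "(%k. Fk (s k) (X k)) \<leadsto> F Y"
 unfolding Fk_volumes[OF X(1)] F_volumes[OF X(2)]
proof (rule uniform_limit_tendsto_diagonal[OF Ftk_continuous Ftk_uniform _ _ _ s])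
 show "volumes (X k) : cbox 0 (\<chi> i. measure leb Om)" for k by (rule volumes_box[OF X(1) \<Omega>k(2)])
 show "volumes Y : cbox 0 (\<chi> i. measure leb Om)" by (rule volumes_box[OF X(2) \<Omega>(2)])
 show "(%k. volumes (X k)) \<leadsto> volumes Y" unfolding volumes_def by (rule tendsto_vec_lambda[OF lim])
qed

text \<open>The partition lemma is applied to the sets where \<open>u\<close> does not vanish. As \<open>uk\<close> converges pointwise, a point
 where component \<open>i\<close> of \<open>u\<close> is not zero lies in \<open>Wk k i\<close> for all large \<open>k\<close>, apart from the null set where
 some \<open>uk k\<close> fails to vanish outside its set.\<close>

lemma limit_set_tuple:
 assumes C: "!!j. compact (C j)" "incseq C" "(\<Union>j. C j) = Om"
 shows "\<exists>s W. strict_mono (s :: nat => nat) & W : set_tuples \<Omega> & (\<forall>i. AE x in leb. x : Om - W i --> u x $ i = 0) &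
 (\<forall>i j. (%k. measure leb (Wk (s k) i \<inter> C j)) \<leadsto> measure leb (W i \<inter> C j)) &
 (\<forall>i. (%k. measure leb (Wk (s k) i)) \<leadsto> measure leb (W i))"
proof -
 interpret M: nonatomic_finite_measure "leb_on Om" by (rule nonatomic_lebesgue_on[OF Om_sets finite_volume])
 have sets: "A : sets (leb_on Om) \<longleftrightarrow> A <= Om & A : sets leb" for A
 using sets_restrict_space_iff[of Om leb A] Om_sets by simp
 have meas: "measure (leb_on Om) A = measure leb A" if "A <= Om" for A
 by (rule measure_restrict_space) (use Om_sets that in simp_all)
 have "AE x in leb. \<forall>k. \<forall>i\<in>UNIV. x : Om - Wk k i --> uk k x $ i = 0"
 unfolding AE_all_countable by (intro allI AE_finite_allI finite uk_vanishes)
 then obtain N where N: "N : null_sets leb" "{x\<in>space leb. \<not> (\<forall>k. \<forall>i\<in>UNIV. x : Om - Wk k i --> uk k x $ i = 0)} <= N"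
 unfolding eventually_ae_filter by blast
 have N': "uk k x $ i = 0" if "x \<notin> N" "x : Om" "x \<notin> Wk k i" for x k i using N(2) that by auto
 \<comment> \<open>The positivity sets, minus the null set where some \<open>uk k\<close> violates its sets.\<close>
 define P where "P i = {x\<in>Om. u x $ i ~= 0} - N" for i
 have Ps: "P i : sets leb" for i
 proof -
 have m: "(%x. indicator Om x *\<^sub>R u x $ i) : borel_measurable leb"
  by (rule locally_integrable_measurable[OF Om has_weak_gradientD(1)[OF loc_sobolevD(1)[OF G]]])
 have "(%x. indicator Om x *\<^sub>R u x $ i) -` (- {0}) \<inter> space leb : sets leb"
  by (rule measurable_sets[OF m]) auto
 moreover have "(%x. indicator Om x *\<^sub>R u x $ i) -` (- {0}) \<inter> space leb = {x\<in>Om. u x $ i ~= 0}"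
  by (auto simp: indicator_def)
 ultimately show ?thesis unfolding P_def using N(1) by auto
 qed
 have POm: "P i <= Om" for i by (auto simp: P_def)
 have Pev: "\<forall>\<^sub>F k in sequentially. x : Wk k i" if x: "x : P i" for i x
 proof -
 have x': "x : Om" "u x $ i ~= 0" "x \<notin> N" using x by (auto simp: P_def)
 have "\<forall>\<^sub>F k in sequentially. \<forall>y\<in>{x}. norm (uk k y - u y) <= \<bar>u x $ i\<bar> / 2" by (rule unif) (use x' in auto)
 then show ?thesis
 proof eventually_elim
  case (elim k)
  have "\<bar>uk k x $ i - u x $ i\<bar> <= \<bar>u x $ i\<bar> / 2" using component_le_norm_cart[of "uk k x - u x" i] elim by simp
  then have "uk k x $ i ~= 0" using x'(2) by auto
  then show ?case using N'[OF x'(3,1)] by blast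
 qed
 qed
 have Wks: "Wk k i : sets leb" "Wk k i <= \<Omega>k k" "disjoint_family (Wk k)" for k i
 using Wk_tuple[of k] by (auto simp: set_tuples_def)
 have WkOm: "Wk k i <= Om" for k i using Wks(2) \<Omega>k(2) by blast
 have COm: "C j <= Om" for j using C(3) by blast
 have "\<exists>s W. strict_mono (s :: nat => nat) & (\<forall>i. W i : sets (leb_on Om) & W i <= \<Omega>) & disjoint_family W &
 (\<forall>i. measure (leb_on Om) (P i - W i) = 0) &
 (\<forall>i j. (%k. measure (leb_on Om) (Wk (s k) i \<inter> C j)) \<leadsto> measure (leb_on Om) (W i \<inter> C j)) &
 (\<forall>i. (%k. measure (leb_on Om) (Wk (s k) i)) \<leadsto> measure (leb_on Om) (W i))"
 proof (rule M.limit_partition[OF _ C(2) _ _ _ _ _ _ Wks(3) _ Pev])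
 show "C j : sets (leb_on Om)" for j unfolding sets using COm compact_sets_lebesgue[OF C(1)] by blast
 show "(\<Union>j. C j) = space (leb_on Om)" using C(3) by simp
 show "\<Omega> : sets (leb_on Om)" "\<Omega>k k : sets (leb_on Om)" for k unfolding sets using \<Omega> \<Omega>k by auto
 show "(%k. measure (leb_on Om) (\<Omega>k k - \<Omega>)) \<leadsto> 0"
 proof -
  have "measure (leb_on Om) (\<Omega>k k - \<Omega>) = measure leb (\<Omega>k k - \<Omega>)" for k by (rule meas) (use \<Omega>k(2) in blast)
  then show ?thesis using \<Omega>k_tendsto(1) by simp
 qed
 show "Wk k i : sets (leb_on Om)" for k i unfolding sets using Wks(1) WkOm by blast
 show "Wk k i <= \<Omega>k k" for k i by (rule Wks(2))
 show "P i : sets (leb_on Om)" for i unfolding sets using Ps POm by blast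
 qed
 then obtain s W where sW0: "strict_mono (s :: nat => nat)" "\<forall>i. W i : sets (leb_on Om) & W i <= \<Omega>" "disjoint_family W"
 "\<forall>i. measure (leb_on Om) (P i - W i) = 0"
 "\<forall>i j. (%k. measure (leb_on Om) (Wk (s k) i \<inter> C j)) \<leadsto> measure (leb_on Om) (W i \<inter> C j)"
 "\<forall>i. (%k. measure (leb_on Om) (Wk (s k) i)) \<leadsto> measure (leb_on Om) (W i)"
 by (elim exE conjE) (rule that)
 note sW = sW0(1) spec[OF sW0(2), THEN conjunct1] spec[OF sW0(2), THEN conjunct2] sW0(3) spec[OF sW0(4)] spec[OF spec[OF sW0(5)]] spec[OF sW0(6)]
 have Ws: "W i : sets leb" "W i <= Om" for i using sW(2)[of i] unfolding sets by auto
 have "AE x in leb. x : Om - W i --> u x $ i = 0" for i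
 proof -
 have PW: "P i - W i <= Om" "P i - W i : sets leb" using POm Ps Ws by auto
 have "measure leb (P i - W i) = 0" using sW(5)[of i] unfolding meas[OF PW(1)] .
 then have "emeasure leb (P i - W i) = 0" using emeasure_eq_measure2[OF finite_volume_subset[OF PW(2,1)]] by simp
 then have "P i - W i : null_sets leb" using PW(2) by (rule null_setsI)
 from AE_not_in[OF this] AE_not_in[OF N(1)] show ?thesis
  by eventually_elim (auto simp: P_def)
 qed
 moreover have "W : set_tuples \<Omega>" using Ws(1) sW(3,4) by (auto simp: set_tuples_def)
 moreover have "(%k. measure leb (Wk (s k) i \<inter> C j)) \<leadsto> measure leb (W i \<inter> C j)" for i j
 using sW(6)[of i j] meas[OF le_infI1[OF WkOm]] meas[OF le_infI1[OF Ws(2)]] by simp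
 moreover have "(%k. measure leb (Wk (s k) i)) \<leadsto> measure leb (W i)" for i
 using sW(7)[of i] meas[OF WkOm] meas[OF Ws(2)] by simp
 ultimately show ?thesis using sW(1) by blast
qed

text \<open>The pair \<open>(w, W')\<close> is transplanted to problem \<open>k\<close>. In \<open>C\<close> the sets are \<open>W'\<close> cut down to \<open>\<Omega>k k\<close>; this loses
 only points near the complement of \<open>\<Omega>\<close>, where \<open>w\<close> is assumed to vanish. Outside \<open>C\<close> the sets remain \<open>Wk k\<close>,
 and \<open>w\<close> is interpolated with \<open>uk k\<close>. This is admissible because \<open>w\<close> differs from zero only where \<open>u\<close> exceeds
 \<open>eps\<close>, and there \<open>uk k\<close> does not vanish. All terms of the inequality converge.\<close>

lemma limit_comparison:
 assumes s: "strict_mono (s :: nat => nat)" and W: "W : set_tuples \<Omega>" and W': "W' : set_tuples \<Omega>"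
 and C: "compact C" "C <= Om"
 and limC: "!!i. (%k. measure leb (Wk (s k) i \<inter> C)) \<leadsto> measure leb (W i \<inter> C)"
 and lim: "!!i. (%k. measure leb (Wk (s k) i)) \<leadsto> measure leb (W i)"
 and off: "!!i. W' i \<inter> (Om - C) = W i \<inter> (Om - C)"
 and eta: "smooth eta" "!!x. 0 <= eta x" "!!x. eta x <= 1" "!!x. x : C ==> eta x = 1"
 and K: "compact K" "K <= Om" "C <= K" "!!x. x \<notin> K ==> eta x = 0"
 and w: "!!i. loc_sobolev Om (%x. w x $ i) (H i)" and w0: "!!i. AE x in leb. x : Om - W' i --> w x $ i = 0"
 and d: "0 < d" "!!x. x : C ==> x : thickening d (Om - \<Omega>) ==> w x = 0"
 and eps: "0 < eps" "!!i. AE x in leb. x : Om - C --> w x $ i ~= 0 --> eps < \<bar>u x $ i\<bar>"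
 shows "dirichlet K G + lower_terms K f g u + F W
 <= dirichlet K (interp_grad eta u G w H) + lower_terms K f g (interp eta u w) + F W'"
proof -
 have Wks: "Wk k i : sets leb" "Wk k i <= \<Omega>k k" "disjoint_family (Wk k)" for k i
 using Wk_tuple[of k] by (auto simp: set_tuples_def)
 have W's: "W' i : sets leb" "W' i <= \<Omega>" "disjoint_family W'" for i using W' by (auto simp: set_tuples_def)
 have Ws: "W i : sets leb" "W i <= \<Omega>" for i using W by (auto simp: set_tuples_def)
 note Cs = compact_sets_lebesgue[OF C(1)]
 \<comment> \<open>The sets of the transplanted competitor.\<close>
 define X where "X k i = (Wk k i - C) \<union> (W' i \<inter> \<Omega>k k \<inter> C)" for k i
 have X: "X k : set_tuples (\<Omega>k k)" for k
 proof -
 have "X k i : sets leb" "X k i <= \<Omega>k k" for i using Wks(1,2)[of k i] W's(1)[of i] \<Omega>k(1)[of k] Cs by (auto simp: X_def)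
 moreover have "X k m \<inter> X k n = {}" if "m ~= n" for m n
 proof -
  have "Wk k m \<inter> Wk k n = {}" "W' m \<inter> W' n = {}" using Wks(3)[of k] W's(3) that by (auto simp: disjoint_family_on_def)
  then show ?thesis by (auto simp: X_def)
 qed
 ultimately show ?thesis by (simp add: set_tuples_def disjoint_family_on_def)
 qed
 have Xlim: "(%k. measure leb (X (s k) i)) \<leadsto> measure leb (W' i)" for i
 proof -
 have fm: "Wk k i : lmeasurable" "W' i : lmeasurable" "W i : lmeasurable" "\<Omega> - \<Omega>k k : lmeasurable" for k
  using Wks(1,2)[of k i] W's(1,2)[of i] Ws[of i] \<Omega> \<Omega>k[of k] by (auto intro!: finite_volume_subset)
 have dc: "measure leb (A - C) = measure leb A - measure leb (A \<inter> C)" if "A : lmeasurable" for A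
 proof -
  have "A - C = A - A \<inter> C" by blast
  moreover have "measure leb (A - A \<inter> C) = measure leb A - measure leb (A \<inter> C)"
  by (rule measurable_measure_Diff[OF that]) (use that Cs in \<open>auto intro: fmeasurableD\<close>)
  ultimately show ?thesis by simp
 qed
 have m: "measure leb (X k i) = measure leb (Wk k i) - measure leb (Wk k i \<inter> C) + measure leb (W' i \<inter> \<Omega>k k \<inter> C)" for k
 proof -
  have "measure leb (X k i) = measure leb (Wk k i - C) + measure leb (W' i \<inter> \<Omega>k k \<inter> C)"
  unfolding X_def
  proof (rule measure_Un_AE)
  show "AE x in leb. x \<notin> Wk k i - C \<or> x \<notin> W' i \<inter> \<Omega>k k \<inter> C" by auto
  show "Wk k i - C : lmeasurable" by (rule fmeasurable.Diff[OF fm(1) finite_volume_subset[OF Cs C(2)]])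
  show "W' i \<inter> \<Omega>k k \<inter> C : lmeasurable"
   by (rule finite_volume_subset) (use W's(1) \<Omega>k(1) Cs C(2) in auto)
  qed
  then show ?thesis unfolding dc[OF fm(1)] .
 qed
 have "(%k. measure leb (W' i \<inter> \<Omega>k (s k) \<inter> C)) \<leadsto> measure leb (W' i \<inter> C)"
 proof (rule Lim_transform2[OF tendsto_const])
  show "(%k. measure leb (W' i \<inter> C) - measure leb (W' i \<inter> \<Omega>k (s k) \<inter> C)) \<leadsto> 0"
  proof (rule Lim_null_comparison)
  show "(%k. measure leb (\<Omega> - \<Omega>k (s k))) \<leadsto> 0"
   using LIMSEQ_subseq_LIMSEQ[OF \<Omega>k_tendsto(2) s] by (simp add: o_def)
  have "norm (measure leb (W' i \<inter> C) - measure leb (W' i \<inter> \<Omega>k k \<inter> C)) <= measure leb (\<Omega> - \<Omega>k k)" for k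
  proof -
   have a: "W' i \<inter> C : lmeasurable" "W' i \<inter> \<Omega>k k \<inter> C : sets leb"
   using W's(1)[of i] \<Omega>k(1)[of k] Cs C(2) by (auto intro!: finite_volume_subset)
   have "measure leb (W' i \<inter> C) - measure leb (W' i \<inter> \<Omega>k k \<inter> C) = measure leb (W' i \<inter> C - W' i \<inter> \<Omega>k k \<inter> C)"
   by (rule measurable_measure_Diff[OF a, symmetric]) auto
   moreover have "... <= measure leb (\<Omega> - \<Omega>k k)"
   by (rule measure_mono_fmeasurable[OF _ _ fm(4)]) (use W's(2)[of i] a in \<open>auto intro!: sets.Diff fmeasurableD\<close>)
   ultimately show ?thesis using measure_nonneg[of leb "W' i \<inter> C - W' i \<inter> \<Omega>k k \<inter> C"] by simp
  qed
  then show "\<forall>\<^sub>F k in sequentially. norm (measure leb (W' i \<inter> C) - measure leb (W' i \<inter> \<Omega>k (s k) \<inter> C)) <= measure leb (\<Omega> - \<Omega>k (s k))"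
   by (intro always_eventually allI)
  qed
 qed
 from tendsto_add[OF tendsto_diff[OF lim[of i] limC[of i]] this]
 have "(%k. measure leb (X (s k) i)) \<leadsto> measure leb (W i) - measure leb (W i \<inter> C) + measure leb (W' i \<inter> C)" unfolding m .
 moreover have "measure leb (W i) - measure leb (W i \<inter> C) = measure leb (W' i) - measure leb (W' i \<inter> C)"
 proof -
  have "W i - C = W' i - C" using off[of i] Ws(2)[of i] W's(2)[of i] \<Omega>(2) by blast
  then show ?thesis using dc[OF fm(2)] dc[OF fm(3)] by simp
 qed
 ultimately show ?thesis by simp
 qed
 note LK = loc_sobolevD(2,3)[OF Gk K(1,2)] loc_sobolevD(2,3)[OF G K(1,2)] loc_sobolevD(2,3)[OF w K(1,2)]
 note it = interp_tendsto[OF K(1) eta(1,2,3) uk_L2_tendsto[OF K(1,2)] LK(1,3) L2_tendsto_const LK(5,5) gradients_L2_tendsto[OF K(1,2)] LK(2,4) L2_tendsto_const LK(6,6)]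
 define a where "a k = dirichlet K (Gk k) + lower_terms K (fk k) (gk k) (uk k)" for k
 define b where "b k = dirichlet K (interp_grad eta (uk k) (Gk k) w H) + lower_terms K (fk k) (gk k) (interp eta (uk k) w)" for k
 have alim: "a \<leadsto> dirichlet K G + lower_terms K f g u"
 unfolding a_def[abs_def]
 by (intro tendsto_add dirichlet_tendsto[OF gradients_L2_tendsto[OF K(1,2)] LK(2,4)] lower_terms_tendsto(1)[OF K(1,2) uk_L2_tendsto[OF K(1,2)] LK(1,3)])
 have blim: "b \<leadsto> dirichlet K (interp_grad eta u G w H) + lower_terms K f g (interp eta u w)"
 unfolding b_def[abs_def]
 by (intro tendsto_add dirichlet_tendsto[OF it(4-6)] lower_terms_tendsto(1)[OF K(1,2) it(1-3)])
 have "\<forall>\<^sub>F k in sequentially. a k + Fk k (Wk k) <= b k + Fk k (X k)"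
 using excess[OF C d(1)] unif[OF K(1,2) eps(1)]
 proof eventually_elim
 case (elim k)
 show ?case unfolding a_def b_def
 proof (rule minimality[where v = "interp eta (uk k) w" and H = "interp_grad eta (uk k) (Gk k) w H" and W = "X k" and k = k and K = K, OF _ X _ K(1,2)])
  fix i
  show "loc_sobolev Om (%x. interp eta (uk k) w x $ i) (interp_grad eta (uk k) (Gk k) w H i)"
  by (rule loc_sobolev_interp[OF eta(1) Gk w])
  show "AE x in leb. x : Om - X k i --> interp eta (uk k) w x $ i = 0"
  using w0[of i] uk_vanishes[of k i] eps(2)[of i]
  proof eventually_elim
  case e: (elim x)
  show ?case
  proof
   assume x: "x : Om - X k i"
   show "interp eta (uk k) w x $ i = 0"
   proof (cases "x : C")
   case True
   then have v: "interp eta (uk k) w x $ i = w x $ i" by (simp add: interp_def eta(4))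
   have "x \<notin> W' i \<or> x \<notin> \<Omega>k k" using x True by (auto simp: X_def)
   then show ?thesis
   proof
    assume "x \<notin> W' i" then show ?thesis using v e(1) x by simp
   next
    assume "x \<notin> \<Omega>k k"
    then have "x : thickening d (Om - \<Omega>)" using elim(1) True by blast
    then show ?thesis using v d(2)[OF True] by simp
   qed
   next
   case False
   then have u0: "uk k x $ i = 0" using x e(2) by (auto simp: X_def)
   show ?thesis
   proof (cases "x : K & w x $ i ~= 0")
    case True
    then have "eps < \<bar>u x $ i\<bar>" using e(3) x False by blast
    moreover have "\<bar>uk k x $ i - u x $ i\<bar> <= eps"
    using component_le_norm_cart[of "uk k x - u x" i] elim(2) True by fastforce
    ultimately show ?thesis using u0 by simp
   next
    case False
    then show ?thesis using u0 K(4)[of x] by (auto simp: interp_def)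
   qed
   qed
  qed
  qed
  show "X k i \<inter> (Om - K) = Wk k i \<inter> (Om - K)" using K(3) by (auto simp: X_def)
 next
  show "AE x in leb. x : Om - K --> interp eta (uk k) w x = uk k x"
  by (rule AE_I2) (simp add: interp_def K(4))
 qed
 qed
 then have le: "\<forall>\<^sub>F k in sequentially. a (s k) + Fk (s k) (Wk (s k)) <= b (s k) + Fk (s k) (X (s k))" by (rule eventually_subseq[OF s])
 have "(%k. a (s k) + Fk (s k) (Wk (s k))) \<leadsto> dirichlet K G + lower_terms K f g u + F W"
 by (rule tendsto_add[OF LIMSEQ_subseq_LIMSEQ[OF alim s, unfolded o_def] F_tendsto[OF s Wk_tuple W lim]])
 moreover have "(%k. b (s k) + Fk (s k) (X (s k))) \<leadsto> dirichlet K (interp_grad eta u G w H) + lower_terms K f g (interp eta u w) + F W'"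
 by (rule tendsto_add[OF LIMSEQ_subseq_LIMSEQ[OF blim s, unfolded o_def] F_tendsto[OF s X W' Xlim]])
 ultimately show ?thesis by (rule tendsto_le[OF sequentially_bot _ _ le, rotated])
qed

end



lemma integral_difference_localized:
 fixes p q :: "'a::euclidean_space => real"
 assumes K: "K : sets leb" and L: "L : sets leb" "L <= K" and i: "integrable (leb_on K) p" "integrable (leb_on K) q"
 and eq: "AE x in leb. x : K - L --> p x = q x"
 shows "(LINT x|leb_on K. p x) - (LINT x|leb_on K. q x) = (LINT x|leb_on L. p x) - (LINT x|leb_on L. q x)"
proof -
 have ip: "integrable leb (%x. indicator K x *\<^sub>R p x)" "integrable leb (%x. indicator K x *\<^sub>R q x)"
 using i unfolding lebesgue_on_integral(2)[OF K, symmetric] set_integrable_def by blast+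
 have il: "integrable leb (%x. indicator L x *\<^sub>R p x)" "integrable leb (%x. indicator L x *\<^sub>R q x)"
 proof -
 have e: "indicator L x *\<^sub>R r x = indicator L x *\<^sub>R (indicator K x *\<^sub>R r x)" for r :: "'a => real" and x using L(2) by (auto simp: indicator_def)
 show "integrable leb (%x. indicator L x *\<^sub>R p x)" unfolding e[of _ p] by (rule integrable_mult_indicator[OF L(1) ip(1)])
 show "integrable leb (%x. indicator L x *\<^sub>R q x)" unfolding e[of _ q] by (rule integrable_mult_indicator[OF L(1) ip(2)])
 qed
 note d = intgb_diff[OF ip] and dl = intgb_diff[OF il]
 have "(LINT x|leb. indicator K x *\<^sub>R p x - indicator K x *\<^sub>R q x) = (LINT x|leb. indicator L x *\<^sub>R p x - indicator L x *\<^sub>R q x)"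
 proof (rule integral_cong_AE[OF borel_measurable_integrable[OF d] borel_measurable_integrable[OF dl]])
 show "AE x in leb. indicator K x *\<^sub>R p x - indicator K x *\<^sub>R q x = indicator L x *\<^sub>R p x - indicator L x *\<^sub>R q x"
  using eq by eventually_elim (use L(2) in \<open>auto simp: indicator_def\<close>)
 qed
 then show ?thesis
 unfolding lebesgue_on_integral(1)[OF K, symmetric] lebesgue_on_integral(1)[OF L(1), symmetric] set_lebesgue_integral_def
  LINT_diff[OF ip] LINT_diff[OF il] .
qed

lemma soft_tendsto_L2:
 fixes v :: "'a::euclidean_space => real"
 assumes S: "open S" and v: "loc_sobolev S v D" and K: "compact K" "K <= S"
 shows "L2_tendsto (leb_on K) (%m x. soft (1 / real (Suc m)) (v x)) v"
 "L2_tendsto (leb_on K) (%m x. soft' (1 / real (Suc m)) (v x) *\<^sub>R D x) D"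
proof -
 interpret finite_measure "leb_on K" by (rule finite_measure_compact[OF K(1)])
 have pos: "0 < 1 / real (Suc m)" for m by simp
 note LD = loc_sobolevD(3)[OF v K]
 show "L2_tendsto (leb_on K) (%m x. soft (1 / real (Suc m)) (v x)) v"
 proof (rule L2_tendsto_uniform)
 fix e :: real assume "0 < e"
 then have "0 < e / 2" by simp
 from order_tendstoD(2)[OF LIMSEQ_Suc[OF lim_const_over_n[of "1::real"]] this]
 show "\<forall>\<^sub>F n in sequentially. \<forall>x\<in>space (leb_on K). norm (soft (1 / real (Suc n)) (v x) - v x) <= e"
 proof eventually_elim
  case (elim n)
  show ?case
  proof
  fix x
  show "norm (soft (1 / real (Suc n)) (v x) - v x) <= e" using soft_close[OF pos[of n], of "v x"] elim by simp
  qed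
 qed
 qed
 show "L2_tendsto (leb_on K) (%m x. soft' (1 / real (Suc m)) (v x) *\<^sub>R D x) D"
 proof (rule L2_tendsto_dominated[OF _ L2D(1)[OF LD] _ LD])
 show "(%x. soft' (1 / real (Suc m)) (v x) *\<^sub>R D x) : borel_measurable (leb_on K)" for m
  by (rule L2D(1)[OF loc_sobolevD(3)[OF loc_sobolev_soft[OF S v pos] K]])
 show "AE x in leb_on K. (%m. soft' (1 / real (Suc m)) (v x) *\<^sub>R D x) \<leadsto> D x"
  unfolding AE_lebesgue_on_iff[OF compact_sets_lebesgue[OF K(1)]]
  using weak_gradient_eq_0_on_zero_set[OF S loc_sobolevD(1)[OF v]]
 proof eventually_elim
  case (elim x)
  show ?case
  proof
  assume "x : K"
  show "(%m. soft' (1 / real (Suc m)) (v x) *\<^sub>R D x) \<leadsto> D x"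
  proof (cases "v x = 0")
   case True
   then have "D x = 0" using elim \<open>x : K\<close> K(2) by blast
   then show ?thesis by simp
  next
   case False
   then have "(%m. soft' (1 / real (Suc m)) (v x)) \<leadsto> 1" using soft'_tendsto[of "v x"] by simp
   from tendsto_scaleR[OF this tendsto_const[of "D x"]] show ?thesis by simp
  qed
  qed
 qed
 show "norm (soft' (1 / real (Suc m)) (v x) *\<^sub>R D x - D x) <= norm (D x)" for m x
 proof -
  have "soft' (1 / real (Suc m)) (v x) *\<^sub>R D x - D x = - ((1 - soft' (1 / real (Suc m)) (v x)) *\<^sub>R D x)" by (simp add: scaleR_diff_left)
  then show ?thesis using soft'_bounds[OF pos[of m], of "v x"] by (simp add: mult_left_le_one_le)
 qed
 qed
qed

context convergent_problems
begin

text \<open>A competitor \<open>w\<close> is made to satisfy the two extra conditions of \<open>limit_comparison\<close>: first it is multiplied by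
 a cutoff near the complement of \<open>\<Omega>\<close>, then small values are removed by soft thresholding. Both modifications
 tend to \<open>w\<close> strongly, so they disappear in the limit.\<close>

lemma comparison_on_large_compact:
 assumes s: "strict_mono (s :: nat => nat)" and W: "W : set_tuples \<Omega>" and W': "W' : set_tuples \<Omega>"
 and C: "compact C" "C <= Om"
 and limC: "!!i. (%k. measure leb (Wk (s k) i \<inter> C)) \<leadsto> measure leb (W i \<inter> C)"
 and lim: "!!i. (%k. measure leb (Wk (s k) i)) \<leadsto> measure leb (W i)"
 and off: "!!i. W' i \<inter> (Om - C) = W i \<inter> (Om - C)"
 and w: "!!i. loc_sobolev Om (%x. w x $ i) (H i)" and w0: "!!i. AE x in leb. x : Om - W' i --> w x $ i = 0"
 and wu: "AE x in leb. x : Om - C --> w x = u x"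
 shows "\<exists>K. compact K & K <= Om & C <= K &
 dirichlet K G + lower_terms K f g u + F W <= dirichlet K H + lower_terms K f g w + F W'"
proof -
 obtain eta K where eta: "smooth eta" "!!x. 0 <= eta x" "!!x. eta x <= 1" "!!x. x : C ==> eta x = 1"
 and K: "compact K" "K <= Om" "C <= K" "!!x. x \<notin> K ==> eta x = 0"
 by (rule cutoff_compact[OF C Om]) blast
 from cutoff_near_complement[OF Om \<Omega>(1) porous K(1,2)] obtain theta d where theta0: "\<forall>n. smooth (theta n)" "\<forall>n. 0 < (d n :: real)" "\<forall>n x. 0 <= theta n x & theta n x <= 1"
 "\<forall>n. \<forall>x\<in>K. x : thickening (d n) (Om - \<Omega>) --> theta n x = 0"
 "\<forall>w H. loc_sobolev Om w H --> (AE x in leb. x : Om - \<Omega> --> w x = 0) -->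
  L2_tendsto (leb_on K) (%n x. theta n x * w x) w &
  L2_tendsto (leb_on K) (%n x. theta n x *\<^sub>R H x + w x *\<^sub>R grad (theta n) x) H"
 by (elim exE conjE) (rule that)
 note thetasmooth = spec[OF theta0(1)] and thetabounds = spec[OF spec[OF theta0(3)]]
 have w\<Omega>: "AE x in leb. x : Om - \<Omega> --> w x $ i = 0" for i
 using w0[of i] by eventually_elim (use W' in \<open>auto simp: set_tuples_def\<close>)
 have conv: "L2_tendsto (leb_on K) (%n x. theta n x * w x $ i) (%x. w x $ i) &
 L2_tendsto (leb_on K) (%n x. theta n x *\<^sub>R H i x + w x $ i *\<^sub>R grad (theta n) x) (H i)" for i
 by (rule theta0(5)[THEN spec, THEN spec, THEN mp, THEN mp, OF w w\<Omega>])
 \<comment> \<open>First modification: \<open>wn n\<close> vanishes near the complement of \<open>\<Omega>\<close>.\<close>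
 define wn where "wn n x = theta n x *\<^sub>R w x" for n x
 define Hn where "Hn n i x = theta n x *\<^sub>R H i x + w x $ i *\<^sub>R grad (theta n) x" for n i x
 have wn: "loc_sobolev Om (%x. wn n x $ i) (Hn n i)" for n i
 using loc_sobolev_mult_smooth[OF w[of i] thetasmooth[of n]] by (simp add: wn_def Hn_def[abs_def])
 define e where "e m = 1 / real (Suc m)" for m
 have e: "0 < e m" for m by (simp add: e_def)
 \<comment> \<open>Second modification: \<open>wnm n m\<close> is zero wherever \<open>wn n\<close> is at most \<open>e m\<close>.\<close>
 define wnm where "wnm n m x = (\<chi> i. soft (e m) (wn n x $ i))" for n m x
 define Hnm where "Hnm n m i x = soft' (e m) (wn n x $ i) *\<^sub>R Hn n i x" for n m i x
 have wnm: "loc_sobolev Om (%x. wnm n m x $ i) (Hnm n m i)" for n m i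
 using loc_sobolev_soft[OF Om wn[of n i] e[of m]] by (simp add: wnm_def Hnm_def[abs_def])
 define E where "E v D = dirichlet K (interp_grad eta u G v D) + lower_terms K f g (interp eta u v) + F W'" for v D
 define E0 where "E0 = dirichlet K G + lower_terms K f g u + F W"
 note Lu = loc_sobolevD(2)[OF G K(1,2)] and LG = loc_sobolevD(3)[OF G K(1,2)]
 have E_tendsto: "(%n. E (vn n) (Dn n)) \<leadsto> E v D"
 if v: "!!n i. loc_sobolev Om (%x. vn n x $ i) (Dn n i)" "!!i. loc_sobolev Om (%x. v x $ i) (D i)"
  and c: "!!i. L2_tendsto (leb_on K) (%n x. vn n x $ i) (%x. v x $ i)" "!!i. L2_tendsto (leb_on K) (%n. Dn n i) (D i)"
 for vn Dn v D
 proof -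
 note it = interp_tendsto[OF K(1) eta(1,2,3) L2_tendsto_const Lu Lu c(1) loc_sobolevD(2)[OF v(1) K(1,2)] loc_sobolevD(2)[OF v(2) K(1,2)]
  L2_tendsto_const LG LG c(2) loc_sobolevD(3)[OF v(1) K(1,2)] loc_sobolevD(3)[OF v(2) K(1,2)]]
 show ?thesis unfolding E_def
  by (intro tendsto_add tendsto_const dirichlet_tendsto[OF it(4-6)] lower_terms_tendsto(2)[OF K(1,2) it(1-3)])
 qed
 have base: "E0 <= E (wnm n m) (Hnm n m)" for n m
 unfolding E0_def E_def
 proof (rule limit_comparison[OF s W W' C limC lim off eta K wnm _ spec[OF theta0(2), of n] _ e[of m]])
 fix i
 show "AE x in leb. x : Om - W' i --> wnm n m x $ i = 0"
  using w0[of i] by eventually_elim (use less_imp_le[OF e[of m]] in \<open>simp add: wnm_def wn_def soft_eq_0\<close>)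
 show "AE x in leb. x : Om - C --> wnm n m x $ i ~= 0 --> e m < \<bar>u x $ i\<bar>"
  using wu
 proof eventually_elim
  case (elim x)
  show ?case
  proof (intro impI)
  assume x: "x : Om - C" "wnm n m x $ i ~= 0"
  then have "e m < \<bar>wn n x $ i\<bar>" using soft_eq_0[of "wn n x $ i" "e m"] by (force simp: wnm_def)
  also have "\<bar>wn n x $ i\<bar> <= \<bar>w x $ i\<bar>" using thetabounds[of n x] by (simp add: wn_def abs_mult mult_left_le_one_le)
  also have "w x = u x" using elim x(1) by blast
  finally show "e m < \<bar>u x $ i\<bar>" .
  qed
 qed
 next
 fix x assume "x : C" "x : thickening (d n) (Om - \<Omega>)"
 then have "theta n x = 0" using theta0(4) K(3) by blast
 then show "wnm n m x = 0" using less_imp_le[OF e[of m]] by (simp add: wnm_def wn_def soft_eq_0 vec_eq_iff)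
 qed
 have limm: "(%m. E (wnm n m) (Hnm n m)) \<leadsto> E (wn n) (Hn n)" for n
 proof (rule E_tendsto[OF wnm wn])
 fix i
 show "L2_tendsto (leb_on K) (%m x. wnm n m x $ i) (%x. wn n x $ i)"
  using soft_tendsto_L2(1)[OF Om wn K(1,2), of n i] by (simp add: wnm_def e_def)
 show "L2_tendsto (leb_on K) (%m. Hnm n m i) (Hn n i)"
  using soft_tendsto_L2(2)[OF Om wn K(1,2), of n i] by (simp add: Hnm_def[abs_def] e_def)
 qed
 have le: "E0 <= E (wn n) (Hn n)" for n by (rule LIMSEQ_le_const[OF limm]) (use base in blast)
 have "(%n. E (wn n) (Hn n)) \<leadsto> E w H"
 proof (rule E_tendsto[OF wn w])
 fix i
 show "L2_tendsto (leb_on K) (%n x. wn n x $ i) (%x. w x $ i)" using conjunct1[OF conv[of i]] by (simp add: wn_def)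
 show "L2_tendsto (leb_on K) (%n. Hn n i) (H i)" using conjunct2[OF conv[of i]] by (simp add: Hn_def[abs_def])
 qed
 then have E0: "E0 <= E w H" by (rule LIMSEQ_le_const) (use le in auto)
 note Ks = compact_sets_lebesgue[OF K(1)]
 have iw: "AE x in leb. x : Om --> interp eta u w x = w x"
 using wu by eventually_elim (use eta(4) in \<open>auto simp: interp_def\<close>)
 note li = loc_sobolev_interp[OF eta(1) G w]
 have ig: "AE x in leb. x : Om --> interp_grad eta u G w H i x = H i x" for i
 proof (rule weak_gradient_unique[OF Om _ loc_sobolevD(1)[OF w]])
 show "has_weak_gradient Om (%x. w x $ i) (interp_grad eta u G w H i)"
  by (rule has_weak_gradient_cong_AE[OF loc_sobolevD(1)[OF li]]) (use iw in \<open>auto elim!: eventually_mono\<close>)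
 qed
 have "dirichlet K (interp_grad eta u G w H) = dirichlet K H"
 unfolding dirichlet_def
 proof (rule sum.cong[OF refl], rule integral_cong_AE)
 fix i
 show "(%x. (norm (interp_grad eta u G w H i x))^2) : borel_measurable (leb_on K)"
  by (rule borel_measurable_integrable[OF L2D(2)[OF loc_sobolevD(3)[OF li K(1,2)]]])
 show "(%x. (norm (H i x))^2) : borel_measurable (leb_on K)"
  by (rule borel_measurable_integrable[OF L2D(2)[OF loc_sobolevD(3)[OF w K(1,2)]]])
 show "AE x in leb_on K. (norm (interp_grad eta u G w H i x))^2 = (norm (H i x))^2"
  unfolding AE_lebesgue_on_iff[OF Ks] using ig[of i] by eventually_elim (use K(2) in auto)
 qed
 moreover have "lower_terms K f g (interp eta u w) = lower_terms K f g w"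
 proof -
 have iwK: "AE x in leb_on K. interp eta u w x = w x"
  unfolding AE_lebesgue_on_iff[OF Ks] using iw by eventually_elim (use K(2) in auto)
 have z: "(LINT x|leb_on K. \<bar>(interp eta u w x $ i)^2 - (w x $ i)^2\<bar>) = 0" "(LINT x|leb_on K. \<bar>interp eta u w x $ i - w x $ i\<bar>) = 0" for i
  by (rule integral_eq_zero_AE, use iwK in eventually_elim, simp)+
 have "\<bar>lower_terms K f g (interp eta u w) - lower_terms K f g w\<bar>
  <= C0 * (\<Sum>i\<in>UNIV. (LINT x|leb_on K. \<bar>(interp eta u w x $ i)^2 - (w x $ i)^2\<bar>) + (LINT x|leb_on K. \<bar>interp eta u w x $ i - w x $ i\<bar>))"
  by (rule lower_terms_diff_bound[OF K(1) limit_coeff_on[OF K(1,2)]])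
  (rule loc_sobolevD(2)[OF li K(1,2)], rule loc_sobolevD(2)[OF w K(1,2)])
 then show ?thesis unfolding z by simp
 qed
 ultimately have "E w H = dirichlet K H + lower_terms K f g w + F W'" by (simp add: E_def)
 then show ?thesis using E0 K(1-3) unfolding E0_def by auto
qed

text \<open>The energies are compared on a compact set larger than the one on which the pairs differ; the
 contributions of the remainder are equal and cancel.\<close>

lemma energy_difference_localized:
 assumes K: "compact K" "K <= Om" and L: "compact L" "L <= K"
 and w: "!!i. loc_sobolev Om (%x. w x $ i) (H i)" and wu: "AE x in leb. x : Om - L --> w x = u x"
 shows "dirichlet K H - dirichlet K G = dirichlet L H - dirichlet L G"
 "lower_terms K f g w - lower_terms K f g u = lower_terms L f g w - lower_terms L f g u"
proof -
 interpret finite_measure "leb_on K" by (rule finite_measure_compact[OF K(1)])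
 note Ks = compact_sets_lebesgue[OF K(1)] and Ls = compact_sets_lebesgue[OF L(1)]
 have op: "open (Om - L)" using Om L(1) by (simp add: open_Diff compact_imp_closed)
 have HG: "AE x in leb. x : Om - L --> H i x = G i x" for i
 proof (rule weak_gradient_unique[OF op])
 show "has_weak_gradient (Om - L) (%x. u x $ i) (G i)" by (rule has_weak_gradient_mono[OF loc_sobolevD(1)[OF G] Diff_subset])
 show "has_weak_gradient (Om - L) (%x. u x $ i) (H i)"
  by (rule has_weak_gradient_cong_AE[OF has_weak_gradient_mono[OF loc_sobolevD(1)[OF w] Diff_subset]]) (use wu in \<open>auto elim!: eventually_mono\<close>)
 qed
 show "dirichlet K H - dirichlet K G = dirichlet L H - dirichlet L G"
 unfolding dirichlet_def sum_subtractf[symmetric]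
 proof (rule sum.cong[OF refl], rule integral_difference_localized[OF Ks Ls L(2) L2D(2)[OF loc_sobolevD(3)[OF w K]] L2D(2)[OF loc_sobolevD(3)[OF G K]]])
 fix i
 show "AE x in leb. x : K - L --> (norm (H i x))^2 = (norm (G i x))^2"
  using HG[of i] by eventually_elim (use K(2) in auto)
 qed
 have int: "integrable (leb_on K) (%x. (v x $ i)^2 * f i x - v x $ i * g i x)" if v: "!!i. loc_sobolev Om (%x. v x $ i) (D i)" for v :: "'a => real ^ 'm" and D i
 proof -
 note Lv = loc_sobolevD(2)[OF v K, of i]
 have "integrable (leb_on K) (%x. (v x $ i)^2)" using L2D(2)[OF Lv] by simp
 then show ?thesis
  by (intro intgb_diff integrable_mult_bounded_AE(1)[OF _ limit_coeff_on(1,3)[OF K]]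
   integrable_mult_bounded_AE(1)[OF L2_integrable[OF Lv] limit_coeff_on(2,4)[OF K]])
 qed
 show "lower_terms K f g w - lower_terms K f g u = lower_terms L f g w - lower_terms L f g u"
 unfolding lower_terms_def sum_subtractf[symmetric]
 proof (rule sum.cong[OF refl], rule integral_difference_localized[OF Ks Ls L(2) int[OF w] int[OF G]])
 fix i
 show "AE x in leb. x : K - L --> (w x $ i)^2 * f i x - w x $ i * g i x = (u x $ i)^2 * f i x - u x $ i * g i x"
  using wu by eventually_elim (use K(2) in auto)
 qed
qed

lemma limit_local_minimizer:
 "\<exists>W\<in>set_tuples \<Omega>. (u, W) : admissible Om \<Omega> & local_minimizer Om \<Omega> f g F (u, W)"
proof -
 from compact_exhaustion[OF Om] obtain C where C0: "\<forall>n. compact (C n)" "\<forall>n. C n <= Om" "\<forall>n. C n <= C (Suc n)"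
 "\<forall>K. compact K --> K <= Om --> (\<exists>N. \<forall>n\<ge>N. K <= C n)"
 by (elim exE conjE) (rule that)
 note C = spec[OF C0(1)] spec[OF C0(2)]
 have inc: "incseq C" by (rule incseq_SucI) (use C0(3) in blast)
 have UC: "(\<Union>j. C j) = Om"
 proof
 show "Om <= (\<Union>j. C j)"
 proof
  fix x assume "x : Om"
  then have "\<exists>N. \<forall>n\<ge>N. {x} <= C n" using C0(4)[THEN spec, of "{x}"] by simp
  then show "x : (\<Union>j. C j)" by blast
 qed
 qed (use C(2) in blast)
 from limit_set_tuple[OF C(1) inc UC] obtain s W where sW: "strict_mono (s :: nat => nat)" "W : set_tuples \<Omega>" "\<forall>i. AE x in leb. x : Om - W i --> u x $ i = 0"
 "\<forall>i j. (%k. measure leb (Wk (s k) i \<inter> C j)) \<leadsto> measure leb (W i \<inter> C j)"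
 "\<forall>i. (%k. measure leb (Wk (s k) i)) \<leadsto> measure leb (W i)"
 by (elim exE conjE) (rule that)
 have adm: "(u, W) : admissible Om \<Omega>"
 using sW(2,3) loc_sobolev_imp_W12_loc[OF G] by (simp add: admissible_def)
 have min: "energy Om f g F K0 (u, W) <= energy Om f g F K0 p"
 if comp: "competitor Om \<Omega> p (u, W)" and K0: "compact K0" "K0 <= Om" and co: "coincide_off Om K0 p (u, W)" for p K0
 proof -
 obtain w W' where p: "p = (w, W')" by (cases p)
 have wadm: "\<forall>i. W12_loc Om (%x. w x $ i)" "W' : set_tuples \<Omega>" "\<forall>i. AE x in leb. x : Om - W' i --> w x $ i = 0"
  using comp unfolding competitor_def p admissible_def by auto
 have "\<forall>i. \<exists>H. loc_sobolev Om (%x. w x $ i) H" using W12_loc_imp_loc_sobolev[OF Om spec[OF wadm(1)]] by blast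
 from choice[OF this] obtain H where H: "\<forall>i. loc_sobolev Om (%x. w x $ i) (H i)" by blast
 note H = spec[OF H]
 have off: "AE x in leb. x : Om - K0 --> w x = u x" "!!i. W' i \<inter> (Om - K0) = W i \<inter> (Om - K0)"
  using co by (auto simp: coincide_off_def p)
 from C0(4)[THEN spec, THEN mp, THEN mp, OF K0] obtain j where "\<forall>n\<ge>j. K0 <= C n"
  by (elim exE) (rule that)
 then have j: "K0 <= C j" by simp
 have offC: "W' i \<inter> (Om - C j) = W i \<inter> (Om - C j)" for i using off(2)[of i] j by blast
 have offCu: "AE x in leb. x : Om - C j --> w x = u x" using off(1) by eventually_elim (use j in blast)
 from comparison_on_large_compact[OF sW(1,2) wadm(2) C(1)[of j] C(2)[of j] spec[OF spec[OF sW(4)]] spec[OF sW(5)] offC H spec[OF wadm(3)] offCu]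
 obtain K where K: "compact K" "K <= Om" "C j <= K"
  "dirichlet K G + lower_terms K f g u + F W <= dirichlet K H + lower_terms K f g w + F W'"
  by (elim exE conjE) (rule that)
 have "K0 <= K" using j K(3) by blast
 note d = energy_difference_localized[OF K(1,2) K0(1) this H off(1)]
 show ?thesis unfolding p energy_eq[OF Om G K0] energy_eq[OF Om H K0] using K(4) d by linarith
 qed
 have "local_minimizer Om \<Omega> f g F (u, W)"
 unfolding local_minimizer_def by (intro conjI allI impI adm) (rule min)
 then show ?thesis using adm sW(2) by blast
qed

end



section \<open>Stability of local minimizers\<close>

theorem theorem17p1:
  fixes Om \<Omega> :: "(real ^ 'n::finite) set"
    and \<Omega>k :: "nat \<Rightarrow> (real ^ 'n) set"
    and f g :: "'m::finite \<Rightarrow> real ^ 'n \<Rightarrow> real"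
    and fk gk :: "nat \<Rightarrow> 'm \<Rightarrow> real ^ 'n \<Rightarrow> real"
    and F :: "('m \<Rightarrow> (real ^ 'n) set) \<Rightarrow> real"
    and Fk :: "nat \<Rightarrow> ('m \<Rightarrow> (real ^ 'n) set) \<Rightarrow> real"
    and Ft :: "real ^ 'm \<Rightarrow> real"
    and Ftk :: "nat \<Rightarrow> real ^ 'm \<Rightarrow> real"
    and u :: "real ^ 'n \<Rightarrow> real ^ 'm"
    and uk :: "nat \<Rightarrow> real ^ 'n \<Rightarrow> real ^ 'm"
    and Wk :: "nat \<Rightarrow> 'm \<Rightarrow> (real ^ 'n) set"
  assumes dim: "CARD('n) \<ge> 2"
    and Om: "open Om" "emeasure lebesgue Om < \<infinity>"
    and Omega: "\<Omega> \<in> sets lebesgue" "\<Omega> \<subseteq> Om"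
    and Omega_k: "\<And>k. \<Omega>k k \<in> sets lebesgue" "\<And>k. \<Omega>k k \<subseteq> Om"
    and data_k: "\<And>k i. bounded_measurable Om (fk k i)"
      "\<And>k i. AE x in lebesgue_on Om. 0 \<le> fk k i x"
      "\<And>k i. bounded_measurable Om (gk k i)"
    and uniform_bound: "\<exists>C0. \<forall>k i. (AE x in lebesgue_on Om. \<bar>fk k i x\<bar> \<le> C0) \<and>
                                   (AE x in lebesgue_on Om. \<bar>gk k i x\<bar> \<le> C0)"
    and data_limit: "\<And>i. locally_integrable Om (f i)" "\<And>i. locally_integrable Om (g i)"
    and weak_limit:
      "\<And>i \<phi>. continuous_on UNIV \<phi> \<Longrightarrow> supp_compact_in Om \<phi> \<Longrightarrow>
         (\<lambda>k. LINT x:Om|lebesgue. fk k i x * \<phi> x) \<longlonglongrightarrow> (LINT x:Om|lebesgue. f i x * \<phi> x)"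
      "\<And>i \<phi>. continuous_on UNIV \<phi> \<Longrightarrow> supp_compact_in Om \<phi> \<Longrightarrow>
         (\<lambda>k. LINT x:Om|lebesgue. gk k i x * \<phi> x) \<longlonglongrightarrow> (LINT x:Om|lebesgue. g i x * \<phi> x)"
    and F_k: "\<And>k W. W \<in> set_tuples (\<Omega>k k) \<Longrightarrow> Fk k W = Ftk k (volumes W)"
    and F_cont: "\<And>k. continuous_on (cbox 0 (\<chi> i. measure lebesgue Om)) (Ftk k)"
    and F_unif: "uniform_limit (cbox 0 (\<chi> i. measure lebesgue Om)) Ftk Ft sequentially"
    and F: "\<And>W. W \<in> set_tuples \<Omega> \<Longrightarrow> F W = Ft (volumes W)"
    and L1_conv:
      "(\<lambda>k. LINT x:Om|lebesgue. \<bar>indicat_real (\<Omega>k k) x - indicat_real \<Omega> x\<bar>) \<longlonglongrightarrow> 0"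
    and density:
      "\<And>K. compact K \<Longrightarrow> K \<subseteq> Om \<Longrightarrow>
         \<exists>r>0. \<exists>c>0. \<forall>x\<in>K \<inter> frontier \<Omega>. \<forall>\<rho>. 0 < \<rho> \<and> \<rho> \<le> r \<longrightarrow>
           measure lebesgue (ball x \<rho> - \<Omega>) \<ge> c * \<rho> ^ CARD('n)"
    and excess:
      "\<And>K. compact K \<Longrightarrow> K \<subseteq> Om \<Longrightarrow> (\<lambda>k. excess_dist Om \<Omega> (\<Omega>k k) K) \<longlonglongrightarrow> 0"
    and minimizers: "\<And>k. local_minimizer Om (\<Omega>k k) (fk k) (gk k) (Fk k) (uk k, Wk k)"
    and lipschitz:
      "\<And>x r. 0 < r \<Longrightarrow> cball x r \<subseteq> Om \<Longrightarrow> \<exists>C. \<forall>k. C-lipschitz_on (cball x r) (uk k)"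
    and u_W12: "\<And>i. W12 Om (\<lambda>x. u x $ i)"
    and u_limit: "\<And>x. x \<in> Om \<Longrightarrow> (\<lambda>k. uk k x) \<longlonglongrightarrow> u x"
  shows "(\<exists>W \<in> set_tuples \<Omega>. (u, W) \<in> admissible Om \<Omega> \<and> local_minimizer Om \<Omega> f g F (u, W)) \<and>
    (\<forall>x r. 0 < r \<longrightarrow> cball x r \<subseteq> Om \<longrightarrow>
       (\<forall>i. W12_tendsto (ball x r) (\<lambda>k y. uk k y $ i) (\<lambda>y. u y $ i)))"
proof -
 have Oms: "Om : sets leb" using Om(1) by simp
 have adm: "(uk k, Wk k) : admissible Om (\<Omega>k k)" for k using minimizers[of k] by (simp add: local_minimizer_def)
 have "\<exists>G. loc_sobolev Om (%x. uk k x $ i) G" for k i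
 by (rule W12_loc_imp_loc_sobolev[OF Om(1)]) (use adm[of k] in \<open>simp add: admissible_def\<close>)
 then have "\<forall>p. \<exists>G. loc_sobolev Om (%x. uk (fst p) x $ snd p) G" by blast
 from choice[OF this] obtain G0 where "\<forall>p. loc_sobolev Om (%x. uk (fst p) x $ snd p) (G0 p)" by blast
 then have Gk: "loc_sobolev Om (%x. uk k x $ i) (G0 (k, i))" for k i by (metis fst_conv snd_conv)
 have "\<forall>i. \<exists>G. loc_sobolev Om (%x. u x $ i) G" using W12_imp_loc_sobolev[OF Om(1) u_W12] by blast
 from choice[OF this] obtain G where "\<forall>i. loc_sobolev Om (%x. u x $ i) (G i)" by blast
 then have G: "loc_sobolev Om (%x. u x $ i) (G i)" for i by blast
 obtain C0 where C0: "\<forall>k i. (AE x in leb_on Om. \<bar>fk k i x\<bar> <= C0) & (AE x in leb_on Om. \<bar>gk k i x\<bar> <= C0)"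
 using uniform_bound by blast
 have bounds: "AE x in leb. x : Om --> \<bar>fk k i x\<bar> <= C0" "AE x in leb. x : Om --> \<bar>gk k i x\<bar> <= C0" for k i
 using C0[THEN spec, THEN spec, of k i] unfolding AE_lebesgue_on_iff[OF Oms] by blast+
 have meas: "fk k i : borel_measurable (leb_on Om)" "gk k i : borel_measurable (leb_on Om)" for k i
 using data_k(1,3)[of k i] by (simp_all add: bounded_measurable_def)
 have fm: "A : lmeasurable" if "A : sets leb" "A <= Om" for A
 by (rule fmeasurableI2[OF fmeasurableI[OF Oms Om(2)] that(2,1)])
 have small: "(%k. measure leb (\<Omega>k k - \<Omega>)) \<leadsto> 0" "(%k. measure leb (\<Omega> - \<Omega>k k)) \<leadsto> 0"
 proof -
 define D where "D k = (\<Omega>k k - \<Omega>) \<union> (\<Omega> - \<Omega>k k)" for k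
 have Ds: "D k : lmeasurable" for k by (rule fm) (use Omega Omega_k in \<open>auto simp: D_def\<close>)
 have eq: "(LINT x:Om|leb. \<bar>indicat_real (\<Omega>k k) x - indicat_real \<Omega> x\<bar>) = measure leb (D k)" for k
 proof -
  have "(LINT x:Om|leb. \<bar>indicat_real (\<Omega>k k) x - indicat_real \<Omega> x\<bar>) = (LINT x|leb. indicat_real (D k) x)"
  unfolding set_lebesgue_integral_def
  by (rule LINT_cong[OF refl]) (use Omega(2) Omega_k(2)[of k] in \<open>auto simp: indicator_def D_def\<close>)
  then show ?thesis by simp
 qed
 have lim: "(%k. measure leb (D k)) \<leadsto> 0" using L1_conv unfolding eq .
 have le: "norm (measure leb (\<Omega>k k - \<Omega>)) <= measure leb (D k)" "norm (measure leb (\<Omega> - \<Omega>k k)) <= measure leb (D k)" for k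
 proof -
  have sub: "\<Omega>k k - \<Omega> <= D k" "\<Omega> - \<Omega>k k <= D k" by (auto simp: D_def)
  have sets: "\<Omega>k k - \<Omega> : sets leb" "\<Omega> - \<Omega>k k : sets leb" by (rule sets.Diff[OF Omega_k(1) Omega(1)], rule sets.Diff[OF Omega(1) Omega_k(1)])
  have "measure leb (\<Omega>k k - \<Omega>) <= measure leb (D k)" by (rule measure_mono_fmeasurable[OF sub(1) sets(1) Ds])
  moreover have "measure leb (\<Omega> - \<Omega>k k) <= measure leb (D k)" by (rule measure_mono_fmeasurable[OF sub(2) sets(2) Ds])
  ultimately show "norm (measure leb (\<Omega>k k - \<Omega>)) <= measure leb (D k)" "norm (measure leb (\<Omega> - \<Omega>k k)) <= measure leb (D k)" by simp_all
 qed
 show "(%k. measure leb (\<Omega>k k - \<Omega>)) \<leadsto> 0" by (rule Lim_null_comparison[OF always_eventually[OF allI[OF le(1)]] lim])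
 show "(%k. measure leb (\<Omega> - \<Omega>k k)) \<leadsto> 0" by (rule Lim_null_comparison[OF always_eventually[OF allI[OF le(2)]] lim])
 qed
 have near: "\<forall>\<^sub>F k in sequentially. K - \<Omega>k k <= thickening d (Om - \<Omega>)" if K: "compact K" "K <= Om" and d: "0 < d" for K d
 proof -
 have "0 < ennreal d" using d by simp
 from order_tendstoD(2)[OF excess[OF K] this] show ?thesis
 proof eventually_elim
  case (elim k)
  show ?case
  proof
  fix x assume x: "x : K - \<Omega>k k"
  have "(INF y\<in>Om - \<Omega>. ennreal (dist x y)) < ennreal d"
   using SUP_lessD[OF elim[unfolded excess_dist_def] x] .
  then obtain y where "y : Om - \<Omega>" "ennreal (dist x y) < ennreal d" unfolding INF_less_iff by blast
  then show "x : thickening d (Om - \<Omega>)" unfolding in_thickening by (auto simp: ennreal_less_iff)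
  qed
 qed
 qed
 have porous: "porous_complement Om \<Omega>"
 unfolding porous_complement_def using density by simp
 have unif: "\<forall>\<^sub>F k in sequentially. \<forall>x\<in>K. norm (uk k x - u x) <= e" if "compact K" "K <= Om" "0 < e" for K e
 by (rule locally_equi_Lipschitz_uniform[OF Om(1) lipschitz u_limit that])
 interpret convergent_problems Om \<Omega>k fk gk Fk uk "%k i. G0 (k, i)" Wk u G C0 f g \<Omega> F Ft Ftk
 by unfold_locales (fact Om(1) Gk G unif meas bounds minimizers data_limit weak_limit Om(2) Omega Omega_k small porous near F_k F_cont F_unif F)+
 show ?thesis
 proof (intro conjI allI impI)
 show "\<exists>W\<in>set_tuples \<Omega>. (u, W) : admissible Om \<Omega> & local_minimizer Om \<Omega> f g F (u, W)" by (rule limit_local_minimizer)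
 show "W12_tendsto (ball x r) (%k y. uk k y $ i) (%y. u y $ i)" if "0 < r" "cball x r <= Om" for x r i
  by (rule W12_tendsto_balls[OF that(2)])
 qed
qed

end
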